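(* Let $k$ be a number field containing a primitive $s$-th root of unity and $r\geq2$. Let $\mathbf{a}_n\in\mathcal{U}_{r,n}(k)$, i.e. $\alpha_0,\dots,\alpha_n\in k$ with $\alpha_i^r$ pairwise distinct. (1) If $s=2$, $n=2$, then $\mathcal{X}_{\mathbf{a}_2}$ is a conic over $k$ containing a rational point, and thus has infinitely many $k$-rational points. (2) If $s=2$, $n=3$, then $\mathcal{X}_{\mathbf{a}_3}$ is a curve of genus one, and there exist infinitely many choices of $\mathbf{a}_3\in\mathcal{U}_{r,3}(k)$ for which $\mathcal{X}_{\mathbf{a}_3}$ is an elliptic curve over $k$ of rank $\geq1$. (3) If $s=3$, $n=2$, then $\mathcal{X}_{\mathbf{a}_2}$ is a curve of genus one, and there exist infinitely many choices of $\mathbf{a}_2\in\mathcal{U}_{r,2}(k)$ for which $\mathcal{X}_{\mathbf{a}_2}$ is an elliptic curve over $k$ of rank $\geq1$.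
   Context: For $\alpha_0,\dots,\alpha_n\in k$, $\mathcal{X}_{\mathbf{a}_n}$ denotes the curve in $\mathbb{P}^n_{[Y_0:\dots:Y_n]}$ defined by the equations $(\alpha_i^r-\alpha_1^r)Y_0^s+(\alpha_0^r-\alpha_i^r)Y_1^s+(\alpha_1^r-\alpha_0^r)Y_i^s=0$ for $i=2,\dots,n$. $\mathcal{U}_{r,n}(k)$ denotes the set of tuples $(\alpha_0,\dots,\alpha_n)$ of elements of $k$ (viewed as points $([1:\alpha_i])_i$ of $\mathrm{Sym}^{n+1}(\mathbb{P}^1)$) with $\prod_{i<j}(\alpha_i^r-\alpha_j^r)\neq0$. *)

theory Defs
  imports
    "HOL-Algebra.Algebraic_Closure_Type"
    "HOL-Library.Poly_Mapping"
    "HOL-Library.Multiset"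
    "HOL-Library.Extended_Nat"
begin

section \<open>Fields\<close>

definition number_field :: "'k::field_char_0 itself \<Rightarrow> bool" where
  "number_field _ \<longleftrightarrow>
     (\<exists>B :: 'k set. finite B \<and> module.span (\<lambda>(q::rat) (x::'k). of_rat q * x) B = UNIV)"

definition primitive_root_of_unity :: "nat \<Rightarrow> 'a::field \<Rightarrow> bool" where
  "primitive_root_of_unity s z \<longleftrightarrow> 0 < s \<and> z ^ s = 1 \<and> (\<forall>j. 0 < j \<and> j < s \<longrightarrow> z ^ j \<noteq> 1)"

section \<open>Polynomials in the homogeneous coordinates\<close>

text \<open>A polynomial in the variables $Y_0, Y_1, \dots$ is a finitely supported map from exponent
  vectors to coefficients; the ring structure is the convolution product of Poly\_Mapping.\<close>

type_synonym 'a mpol = "(nat \<Rightarrow>\<^sub>0 nat) \<Rightarrow>\<^sub>0 'a"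

definition mpol_eval :: "(nat \<Rightarrow> 'a) \<Rightarrow> 'a::field mpol \<Rightarrow> 'a" where
  "mpol_eval v p = (\<Sum>m\<in>Poly_Mapping.keys p.
     Poly_Mapping.lookup p m * (\<Prod>i\<in>Poly_Mapping.keys m. v i ^ Poly_Mapping.lookup m i))"

definition mpol_deriv :: "nat \<Rightarrow> 'a::field mpol \<Rightarrow> 'a mpol" where
  "mpol_deriv i p = (\<Sum>m\<in>Poly_Mapping.keys p. Poly_Mapping.single (m - Poly_Mapping.single i 1)
     (of_nat (Poly_Mapping.lookup m i) * Poly_Mapping.lookup p m))"

definition mpol_ring :: "nat \<Rightarrow> 'a::field mpol set" where
  "mpol_ring n = {p. \<forall>m\<in>Poly_Mapping.keys p. Poly_Mapping.keys m \<subseteq> {..n}}"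

definition forms :: "nat \<Rightarrow> nat \<Rightarrow> 'a::field mpol set" where
  "forms n d = {p \<in> mpol_ring n. \<forall>m\<in>Poly_Mapping.keys p.
     (\<Sum>i\<in>Poly_Mapping.keys m. Poly_Mapping.lookup m i) = d}"

definition ideal_gen :: "nat \<Rightarrow> 'a::field mpol set \<Rightarrow> 'a mpol set" where
  "ideal_gen n E = {(\<Sum>f\<in>T. q f * f) | T q. finite T \<and> T \<subseteq> E \<and> q ` T \<subseteq> mpol_ring n}"

definition ideal_power :: "nat \<Rightarrow> 'a::field mpol set \<Rightarrow> nat \<Rightarrow> 'a mpol set" where
  "ideal_power n M m = ideal_gen n {prod_list fs | fs. length fs = m \<and> set fs \<subseteq> M}"

definition base_change :: "'k::field mpol \<Rightarrow> 'k alg_closure mpol" where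
  "base_change = Poly_Mapping.map to_ac"

section \<open>Projective space and its closed subsets\<close>

type_synonym 'a ppoint = "(nat \<Rightarrow> 'a) set"

definition coord_vectors :: "nat \<Rightarrow> (nat \<Rightarrow> 'a::field) set" where
  "coord_vectors n = {v. (\<forall>i>n. v i = 0) \<and> (\<exists>i. v i \<noteq> 0)}"

definition scaling_rel :: "nat \<Rightarrow> ((nat \<Rightarrow> 'a::field) \<times> (nat \<Rightarrow> 'a)) set" where
  "scaling_rel n = {(v, w). v \<in> coord_vectors n \<and> w \<in> coord_vectors n \<and>
     (\<exists>c. c \<noteq> 0 \<and> w = (\<lambda>i. c * v i))}"

definition proj_space :: "nat \<Rightarrow> 'a::field ppoint set" where
  "proj_space n = coord_vectors n // scaling_rel n"

definition zero_locus :: "nat \<Rightarrow> 'a::field mpol set \<Rightarrow> 'a ppoint set" where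
  "zero_locus n E = {P \<in> proj_space n. \<forall>f\<in>E. \<forall>v\<in>P. mpol_eval v f = 0}"

definition proj_closed :: "nat \<Rightarrow> 'a::field ppoint set \<Rightarrow> bool" where
  "proj_closed n Z \<longleftrightarrow> (\<exists>E \<subseteq> (\<Union>d. forms n d). Z = zero_locus n E)"

definition proj_irreducible :: "nat \<Rightarrow> 'a::field ppoint set \<Rightarrow> bool" where
  "proj_irreducible n Z \<longleftrightarrow> Z \<noteq> {} \<and>
     (\<forall>A B. proj_closed n A \<and> proj_closed n B \<and> Z \<subseteq> A \<union> B \<longrightarrow> Z \<subseteq> A \<or> Z \<subseteq> B)"

section \<open>Projective schemes given by equations\<close>

text \<open>A finite or infinite set E of forms over the field k in the variables
  $Y_0, \dots, Y_n$ describes the closed subscheme of $\mathbb{P}^n_k$ that it cuts out.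
  Its k-rational points are the zero locus over k; its geometric points are the zero locus over the
  algebraic closure.\<close>

definition rational_points :: "nat \<Rightarrow> 'k::field mpol set \<Rightarrow> 'k ppoint set" where
  "rational_points n E = zero_locus n E"

definition geometric_points :: "nat \<Rightarrow> 'k::field mpol set \<Rightarrow> 'k alg_closure ppoint set" where
  "geometric_points n E = zero_locus n (base_change ` E)"

definition geometric_point :: "'k::field ppoint \<Rightarrow> 'k alg_closure ppoint" where
  "geometric_point P = {w. \<exists>v\<in>P. \<exists>c. c \<noteq> 0 \<and> w = (\<lambda>i. c * to_ac (v i))}"

definition mpol_dim :: "'a::field mpol set \<Rightarrow> nat" where
  "mpol_dim V = vector_space.dim (\<lambda>c p. Poly_Mapping.single 0 c * p) V"

text \<open>The dimension of the degree d part of the homogeneous coordinate ring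
  $k[Y_0, \dots, Y_n]/(E)$.\<close>

definition hilbert_function :: "nat \<Rightarrow> 'a::field mpol set \<Rightarrow> nat \<Rightarrow> int" where
  "hilbert_function n E d =
     int (mpol_dim (forms n d :: 'a mpol set)) - int (mpol_dim (ideal_gen n E \<inter> forms n d))"

definition hilbert_polynomial :: "nat \<Rightarrow> 'a::field mpol set \<Rightarrow> rat poly" where
  "hilbert_polynomial n E =
     (THE p. \<forall>\<^sub>F d in sequentially. poly p (of_nat d) = of_int (hilbert_function n E d))"

definition proj_dimension :: "nat \<Rightarrow> 'a::field mpol set \<Rightarrow> nat" where
  "proj_dimension n E = Polynomial.degree (hilbert_polynomial n E)"

text \<open>The arithmetic genus $(-1)^{\dim X} (P_X(0) - 1)$; for the smooth, geometrically
  irreducible curves to which it is applied below this is the genus $h^1(X, \mathcal{O}_X)$.\<close>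

definition genus :: "nat \<Rightarrow> 'a::field mpol set \<Rightarrow> rat" where
  "genus n E = (- 1) ^ proj_dimension n E * (poly (hilbert_polynomial n E) 0 - 1)"

text \<open>The rank of the Jacobian matrix at v. Its rows are encoded as the linear forms
  $\sum_{j \le n} (\partial f / \partial Y_j)(v) \, Y_j$.\<close>

definition jacobian_rank :: "nat \<Rightarrow> 'a::field mpol set \<Rightarrow> (nat \<Rightarrow> 'a) \<Rightarrow> nat" where
  "jacobian_rank n E v = mpol_dim
     ((\<lambda>f. \<Sum>j\<le>n. Poly_Mapping.single (Poly_Mapping.single j 1) (mpol_eval v (mpol_deriv j f))) ` E)"

text \<open>Smooth, geometrically irreducible projective curves. Smoothness is the Jacobian criterion
  at the geometric points.\<close>

definition smooth_curve :: "nat \<Rightarrow> 'k::field mpol set \<Rightarrow> bool" where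
  "smooth_curve n E \<longleftrightarrow>
     E \<subseteq> (\<Union>d. forms n d) \<and>
     proj_irreducible n (geometric_points n E) \<and>
     proj_dimension n E = 1 \<and>
     (\<forall>P\<in>geometric_points n E. \<forall>v\<in>P. jacobian_rank n (base_change ` E) v + 1 = n)"

definition genus_one_curve :: "nat \<Rightarrow> 'k::field mpol set \<Rightarrow> bool" where
  "genus_one_curve n E \<longleftrightarrow> smooth_curve n E \<and> genus n E = 1"

definition smooth_conic :: "nat \<Rightarrow> 'k::field mpol set \<Rightarrow> bool" where
  "smooth_conic n E \<longleftrightarrow> n = 2 \<and> (\<exists>f \<in> forms 2 2. f \<noteq> 0 \<and> E = {f}) \<and> smooth_curve 2 E"

section \<open>Linear equivalence and the group law\<close>

definition point_ideal :: "nat \<Rightarrow> 'a::field ppoint \<Rightarrow> 'a mpol set" where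
  "point_ideal n P = {f \<in> mpol_ring n. \<forall>v\<in>P. mpol_eval v f = 0}"

text \<open>The order of vanishing at P of a form F on the curve E: the largest m such that F lies, in the
  homogeneous localisation at P, in the m-th power of the maximal ideal modulo the equations. The
  form H is the denominator coming from the localisation.\<close>

definition vanishing_order ::
    "nat \<Rightarrow> 'a::field mpol set \<Rightarrow> 'a mpol \<Rightarrow> 'a ppoint \<Rightarrow> nat" where
  "vanishing_order n E F P = (GREATEST m.
     \<exists>H \<in> (\<Union>e. forms n e) - point_ideal n P.
       \<exists>g \<in> ideal_power n (point_ideal n P) m. \<exists>h \<in> ideal_gen n E. H * F = g + h)"

text \<open>Divisors are integer valued functions on the geometric points. They are linearly
  equivalent when they differ by the divisor of a rational function F/G, where F and G are forms of
  the same degree over the algebraic closure, neither vanishing identically on the curve.\<close>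

definition point_divisor :: "'a ppoint \<Rightarrow> 'a ppoint \<Rightarrow> int" where
  "point_divisor P = (\<lambda>Q. if Q = P then 1 else 0)"

definition lin_equiv :: "nat \<Rightarrow> 'k::field mpol set \<Rightarrow>
    ('k alg_closure ppoint \<Rightarrow> int) \<Rightarrow> ('k alg_closure ppoint \<Rightarrow> int) \<Rightarrow> bool" where
  "lin_equiv n E D D' \<longleftrightarrow> (\<exists>d. \<exists>F\<in>forms n d. \<exists>G\<in>forms n d.
     \<not> geometric_points n E \<subseteq> zero_locus n {F} \<and>
     \<not> geometric_points n E \<subseteq> zero_locus n {G} \<and>
     (\<forall>P\<in>geometric_points n E. D P - D' P =
        int (vanishing_order n (base_change ` E) F P) -
        int (vanishing_order n (base_change ` E) G P)))"

text \<open>The group of k-rational points of a genus one curve with origin B0, where the sum of P and Q is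
  the point R with $(P) + (Q) \sim (R) + (B_0)$; R exists and is unique by Riemann-Roch.\<close>

definition mordell_weil_group ::
    "nat \<Rightarrow> 'k::field mpol set \<Rightarrow> 'k ppoint \<Rightarrow> 'k ppoint monoid" where
  "mordell_weil_group n E B0 =
     \<lparr> carrier = rational_points n E,
       monoid.mult = (\<lambda>P Q. THE R. R \<in> rational_points n E \<and>
         lin_equiv n E
           (\<lambda>Z. point_divisor (geometric_point P) Z + point_divisor (geometric_point Q) Z)
           (\<lambda>Z. point_divisor (geometric_point R) Z + point_divisor (geometric_point B0) Z)),
       one = B0 \<rparr>"

definition int_independent :: "('g, 'm) monoid_scheme \<Rightarrow> 'g set \<Rightarrow> bool" where
  "int_independent G S \<longleftrightarrow> (\<forall>c :: 'g \<Rightarrow> int.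
     finprod G (\<lambda>x. x [^]\<^bsub>G\<^esub> c x) S = \<one>\<^bsub>G\<^esub> \<longrightarrow> (\<forall>x\<in>S. c x = 0))"

definition abelian_rank :: "('g, 'm) monoid_scheme \<Rightarrow> enat" where
  "abelian_rank G =
     (SUP S \<in> {S. finite S \<and> S \<subseteq> carrier G \<and> int_independent G S}. enat (card S))"

definition elliptic_curve :: "nat \<Rightarrow> 'k::field mpol set \<Rightarrow> 'k ppoint \<Rightarrow> bool" where
  "elliptic_curve n E B0 \<longleftrightarrow> genus_one_curve n E \<and> B0 \<in> rational_points n E"

definition mordell_weil_rank :: "nat \<Rightarrow> 'k::field mpol set \<Rightarrow> 'k ppoint \<Rightarrow> enat" where
  "mordell_weil_rank n E B0 = abelian_rank (mordell_weil_group n E B0)"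

section \<open>The curves\<close>

text \<open>Tuples $(\alpha_0, \dots, \alpha_n)$ are extensional functions on $\{0, \dots, n\}$.\<close>

definition U_set :: "nat \<Rightarrow> nat \<Rightarrow> (nat \<Rightarrow> 'k::field) set" where
  "U_set r n = {\<alpha> \<in> {..n} \<rightarrow>\<^sub>E UNIV. (\<Prod>j\<le>n. \<Prod>i<j. \<alpha> i ^ r - \<alpha> j ^ r) \<noteq> 0}"

text \<open>The point $([1:\alpha_i])_i$ of $\mathrm{Sym}^{n+1}(\mathbb{P}^1)$.\<close>

definition sym_point :: "nat \<Rightarrow> (nat \<Rightarrow> 'k::field) \<Rightarrow> 'k ppoint multiset" where
  "sym_point n \<alpha> = image_mset
     (\<lambda>i. scaling_rel 1 `` {\<lambda>j. if j = 0 then 1 else if j = 1 then \<alpha> i else 0})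
     (mset_set {..n})"

definition X_equation :: "nat \<Rightarrow> nat \<Rightarrow> (nat \<Rightarrow> 'k::field) \<Rightarrow> nat \<Rightarrow> 'k mpol" where
  "X_equation r s \<alpha> i =
     Poly_Mapping.single (Poly_Mapping.single 0 s) (\<alpha> i ^ r - \<alpha> 1 ^ r) +
     Poly_Mapping.single (Poly_Mapping.single 1 s) (\<alpha> 0 ^ r - \<alpha> i ^ r) +
     Poly_Mapping.single (Poly_Mapping.single i s) (\<alpha> 1 ^ r - \<alpha> 0 ^ r)"

definition X_curve :: "nat \<Rightarrow> nat \<Rightarrow> nat \<Rightarrow> (nat \<Rightarrow> 'k::field) \<Rightarrow> 'k mpol set" where
  "X_curve r s n \<alpha> = X_equation r s \<alpha> ` {2..n}"

end

theory Submission
  imports Defs "HOL-Computational_Algebra.Formal_Power_Series"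
begin

text \<open>Over the algebraic closure the curve carries, at every point v, an arc, that is, a solution of its equations
  in power series whose parameter is a uniformiser at v, and the vanishing order of a form at v is the
  order of its pullback along that arc. The group of s-th roots of unity acts on $Y_2, \dots, Y_n$ with
  quotient the line with coordinates $Y_0, Y_1$; norms along this action and the decomposition into its
  characters reduce irreducibility, the degree of a hyperplane section and the statement that a
  function with a single simple pole is constant to factorisations of binary forms. The Hilbert
  polynomial is read off the monomials with exponents of $Y_2, \dots, Y_n$ below s.

  For positive rank take $\alpha = \lambda (0, 1, 8)$ if s = 3 and $\alpha = \lambda (0, 1, 9, 25)$ if s = 2. The
  point with $Y_0 = 0$, $Y_1^s : \dots : Y_n^s = \alpha_1^r : \dots : \alpha_n^r$ is a hyperflex and serves as
  origin $B_0$, so the residual point of the tangent at Q (for n = 3, of the plane spanned by the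
  tangent and $B_0$) is -2Q. Starting at $(1 : \dots : 1)$ and iterating, the 2-adic valuation of one coordinate ratio grows by one in each step. Hence the points
  $(-2)^k Q$ are pairwise distinct, which is impossible if Q is torsion.\<close>

text \<open>The constants serve two needs. The hyperflex has to be k-rational, which holds if the
  \<alpha>_i^r / \<alpha>_1^r are s-th powers; for every r, 8^r = (2^r)^3, 9^r = (3^r)^2 and 25^r =
  (5^r)^2. Parity has to drive the valuation: 2^r is even, 3^r and 5^r are odd. Scaling by \<lambda>
  multiplies the equations by \<lambda>^r, so the curve stays while its point in the symmetric
  product moves.

  Order and group law are given by a maximum over powers of an ideal and by a choice up to linear
  equivalence. Arcs turn the order into the subdegree of a power series, and facts about the group
  are obtained by adding principal divisors. Rationality of residual points uses no Galois descent:
  the norm of a k-rational linear form takes values in k at k-rational points of the line, which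
  yields the first two coordinates, and the equation of the hyperplane yields the others.

  In both genus one cases the group of roots of unity acting on \<open>Y_2\<close>, ...,
  \<open>Y_n\<close> has order n + 1, the number of coefficients of a linear form. This makes the
  count of conditions exact.\<close>

abbreviation "mkeys \<equiv> Poly_Mapping.keys"
abbreviation "mlookup \<equiv> Poly_Mapping.lookup"
abbreviation "msingle \<equiv> Poly_Mapping.single"

section \<open>Evaluation of polynomials\<close>

definition mdeg :: "(nat \<Rightarrow>\<^sub>0 nat) \<Rightarrow> nat" where
  "mdeg m = (\<Sum>i\<in>mkeys m. mlookup m i)"

lemma mdeg_superset: "finite S \<Longrightarrow> mkeys m \<subseteq> S \<Longrightarrow> mdeg m = (\<Sum>i\<in>S. mlookup m i)"
  unfolding mdeg_def by (rule sum.mono_neutral_left) (auto simp: in_keys_iff)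

lemma keys_add_nat: "mkeys (m + m' :: nat \<Rightarrow>\<^sub>0 nat) = mkeys m \<union> mkeys m'"
  by (auto simp: in_keys_iff lookup_add)

lemma mdeg_add [simp]: "mdeg (m + m') = mdeg m + mdeg m'"
proof -
  let ?S = "mkeys m \<union> mkeys m'"
  have "mdeg (m + m') = (\<Sum>i\<in>?S. mlookup m i + mlookup m' i)"
    by (subst mdeg_superset[of ?S]) (auto simp: keys_add_nat lookup_add)
  also have "\<dots> = mdeg m + mdeg m'"
    by (simp add: sum.distrib mdeg_superset[of ?S m] mdeg_superset[of ?S m'])
  finally show ?thesis .
qed

lemma mdeg_0 [simp]: "mdeg 0 = 0"
  by (simp add: mdeg_def)

lemma mdeg_single [simp]: "mdeg (msingle i k) = k"
  by (simp add: mdeg_def)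

definition mon_eval :: "(nat \<Rightarrow> 'b::comm_ring_1) \<Rightarrow> (nat \<Rightarrow>\<^sub>0 nat) \<Rightarrow> 'b" where
  "mon_eval y m = (\<Prod>i\<in>mkeys m. y i ^ mlookup m i)"

lemma mon_eval_superset:
  "finite S \<Longrightarrow> mkeys m \<subseteq> S \<Longrightarrow> mon_eval y m = (\<Prod>i\<in>S. y i ^ mlookup m i)"
  unfolding mon_eval_def by (rule prod.mono_neutral_left) (auto simp: in_keys_iff)

lemma mon_eval_0 [simp]: "mon_eval y 0 = 1"
  by (simp add: mon_eval_def)

lemma mon_eval_single [simp]: "mon_eval y (msingle i k) = y i ^ k"
  by (simp add: mon_eval_def)

lemma mon_eval_add [simp]: "mon_eval y (m + m') = mon_eval y m * mon_eval y m'"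
proof -
  let ?S = "mkeys m \<union> mkeys m'"
  have "mon_eval y (m + m') = (\<Prod>i\<in>?S. y i ^ mlookup m i * y i ^ mlookup m' i)"
    by (subst mon_eval_superset[of ?S]) (auto simp: keys_add_nat lookup_add power_add)
  also have "\<dots> = mon_eval y m * mon_eval y m'"
    by (simp add: prod.distrib mon_eval_superset[of ?S m] mon_eval_superset[of ?S m'])
  finally show ?thesis .
qed

lemma mon_eval_cong: "(\<And>i. i \<in> mkeys m \<Longrightarrow> y i = y' i) \<Longrightarrow> mon_eval y m = mon_eval y' m"
  unfolding mon_eval_def by (rule prod.cong) auto

lemma mon_eval_mult: "mon_eval (\<lambda>i. t i * y i) m = mon_eval t m * mon_eval y m"
  by (simp add: mon_eval_def power_mult_distrib prod.distrib)

lemma mon_eval_const: "mon_eval (\<lambda>i. t) m = t ^ mdeg m"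
  by (simp add: mon_eval_def mdeg_def power_sum)

section \<open>Ring homomorphisms acting on coefficients\<close>

locale coeff_hom =
  fixes c :: "'a::comm_ring_1 \<Rightarrow> 'b::comm_ring_1"
  assumes c_1 [simp]: "c 1 = 1"
    and c_add [simp]: "c (a + b) = c a + c b"
    and c_mult [simp]: "c (a * b) = c a * c b"
begin

lemma c_0 [simp]: "c 0 = 0"
  using c_add[of 0 0] by simp

lemma c_minus [simp]: "c (- a) = - c a"
  using c_add[of a "- a"] by (simp add: eq_neg_iff_add_eq_0 add.commute)

lemma c_diff [simp]: "c (a - b) = c a - c b"
  using c_add[of a "- b"] by simp

lemma c_sum: "c (sum f S) = (\<Sum>x\<in>S. c (f x))"
  by (induction S rule: infinite_finite_induct) auto

lemma c_prod: "c (prod f S) = (\<Prod>x\<in>S. c (f x))"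
  by (induction S rule: infinite_finite_induct) auto

lemma c_power [simp]: "c (a ^ k) = c a ^ k"
  by (induction k) auto

lemma c_of_nat [simp]: "c (of_nat k) = of_nat k"
  by (induction k) auto

lemma c_mon_eval: "c (mon_eval v m) = mon_eval (\<lambda>i. c (v i)) m"
  by (simp add: mon_eval_def c_prod)

end

text \<open>Substitution of y after moving the coefficients along c. The identity gives values at
  points, \<open>fps_const\<close> gives the pullback of a form along an arc; \<open>gev_hom\<close>
  lets constant terms, twists and field extensions pass through the substitution.\<close>

definition gev ::
  "('a::comm_ring_1 \<Rightarrow> 'b::comm_ring_1) \<Rightarrow> (nat \<Rightarrow> 'b) \<Rightarrow> ((nat \<Rightarrow>\<^sub>0 nat) \<Rightarrow>\<^sub>0 'a) \<Rightarrow> 'b" where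
  "gev c y p = (\<Sum>m\<in>mkeys p. c (mlookup p m) * mon_eval y m)"

lemma mpol_eval_gev: "mpol_eval v p = gev (\<lambda>x. x) v p"
  by (simp add: mpol_eval_def gev_def mon_eval_def)

lemma mpol_expand:
  fixes p :: "'m \<Rightarrow>\<^sub>0 'a::comm_monoid_add"
  shows "p = (\<Sum>m\<in>mkeys p. msingle m (mlookup p m))"
proof (rule poly_mapping_eqI)
  fix k
  have "(\<Sum>m\<in>mkeys p. mlookup (msingle m (mlookup p m)) k)
      = (\<Sum>m\<in>mkeys p. if m = k then mlookup p k else 0)"
    by (rule sum.cong[OF refl]) (simp add: lookup_single when_def)
  also have "\<dots> = mlookup p k"
    by (subst sum.delta) (auto simp: not_in_keys_iff_lookup_eq_zero)
  finally show "mlookup p k = mlookup (\<Sum>m\<in>mkeys p. msingle m (mlookup p m)) k"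
    unfolding lookup_sum by (rule sym)
qed

lemma mpol_induct [case_names zero add]:
  fixes p :: "'m \<Rightarrow>\<^sub>0 'a::comm_monoid_add"
  assumes "P 0" "\<And>m a p. a \<noteq> 0 \<Longrightarrow> m \<notin> mkeys p \<Longrightarrow> P p \<Longrightarrow> P (msingle m a + p)"
  shows "P p"
proof -
  have "finite S \<Longrightarrow> S \<subseteq> mkeys p \<Longrightarrow> P (\<Sum>m\<in>S. msingle m (mlookup p m))" for S
  proof (induction S rule: finite_induct)
    case (insert m S)
    let ?q = "\<Sum>m\<in>S. msingle m (mlookup p m)"
    have "mlookup ?q m = (\<Sum>m'\<in>S. 0)"
      unfolding lookup_sum by (rule sum.cong) (use insert.hyps in \<open>auto simp: lookup_single when_def\<close>)
    then have "m \<notin> mkeys ?q" by (simp add: in_keys_iff)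
    then have "P (msingle m (mlookup p m) + ?q)"
      using insert.prems by (intro assms(2) insert.IH) (auto simp: in_keys_iff)
    then show ?case using insert.hyps by simp
  qed (simp add: assms)
  from this[of "mkeys p"] show ?thesis
    by (simp add: mpol_expand[symmetric])
qed

context coeff_hom
begin

lemma gev_superset:
  "finite S \<Longrightarrow> mkeys p \<subseteq> S \<Longrightarrow> gev c y p = (\<Sum>m\<in>S. c (mlookup p m) * mon_eval y m)"
  unfolding gev_def by (rule sum.mono_neutral_left) (auto simp: in_keys_iff)

lemma gev_0 [simp]: "gev c y 0 = 0"
  by (simp add: gev_def)

lemma gev_single [simp]: "gev c y (msingle m a) = c a * mon_eval y m"
  by (simp add: gev_def)

lemma gev_1 [simp]: "gev c y 1 = 1"
  by (simp add: single_one[symmetric] del: single_one)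

lemma gev_add [simp]: "gev c y (p + q) = gev c y p + gev c y q"
proof -
  let ?S = "mkeys p \<union> mkeys q"
  have "gev c y (p + q) = (\<Sum>m\<in>?S. c (mlookup (p + q) m) * mon_eval y m)"
    by (rule gev_superset) (use keys_add[of p q] in auto)
  also have "\<dots> = gev c y p + gev c y q"
    by (simp add: lookup_add algebra_simps sum.distrib gev_superset[of ?S p] gev_superset[of ?S q])
  finally show ?thesis .
qed

lemma gev_sum [simp]: "gev c y (sum f S) = (\<Sum>x\<in>S. gev c y (f x))"
  by (induction S rule: infinite_finite_induct) auto

lemma gev_mult_single: "gev c y (msingle m a * q) = c a * mon_eval y m * gev c y q"
  by (induction q rule: mpol_induct) (simp_all add: distrib_left mult_single)

lemma gev_mult [simp]: "gev c y (p * q) = gev c y p * gev c y q"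
  by (induction p rule: mpol_induct) (simp_all add: distrib_right gev_mult_single)

lemma gev_uminus [simp]: "gev c y (- p) = - gev c y p"
  using gev_add[of y p "- p"] by (simp add: eq_neg_iff_add_eq_0 add.commute)

lemma gev_diff [simp]: "gev c y (p - q) = gev c y p - gev c y q"
  using gev_add[of y p "- q"] by simp

lemma gev_prod [simp]: "gev c y (prod f S) = (\<Prod>x\<in>S. gev c y (f x))"
  by (induction S rule: infinite_finite_induct) auto

lemma gev_power [simp]: "gev c y (p ^ k) = gev c y p ^ k"
  by (induction k) auto

lemma gev_prod_list [simp]: "gev c y (prod_list fs) = prod_list (map (gev c y) fs)"
  by (induction fs) auto

lemma c_gev: "c (gev (\<lambda>x. x) v p) = gev c (\<lambda>i. c (v i)) p"
  by (simp add: gev_def c_sum c_mon_eval)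

end

lemma gev_hom:
  assumes "coeff_hom f"
  shows "f (gev c y p) = gev (\<lambda>a. f (c a)) (\<lambda>i. f (y i)) p"
proof -
  interpret coeff_hom f by fact
  show ?thesis by (simp add: gev_def c_sum c_mon_eval)
qed

lemma coeff_hom_id: "coeff_hom (\<lambda>x::'a::comm_ring_1. x)"
  by unfold_locales auto

lemmas id_gev_simps [simp] =
  coeff_hom.gev_0[OF coeff_hom_id] coeff_hom.gev_1[OF coeff_hom_id]
  coeff_hom.gev_single[OF coeff_hom_id] coeff_hom.gev_add[OF coeff_hom_id]
  coeff_hom.gev_diff[OF coeff_hom_id] coeff_hom.gev_uminus[OF coeff_hom_id]
  coeff_hom.gev_mult[OF coeff_hom_id] coeff_hom.gev_power[OF coeff_hom_id]
  coeff_hom.gev_sum[OF coeff_hom_id] coeff_hom.gev_prod[OF coeff_hom_id]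

interpretation fps_const_hom: coeff_hom "fps_const :: 'a::comm_ring_1 \<Rightarrow> 'a fps"
  by unfold_locales auto

declare fps_const_hom.c_add [simp del] fps_const_hom.c_mult [simp del] fps_const_hom.c_minus [simp del]
  fps_const_hom.c_diff [simp del] fps_const_hom.c_power [simp del] fps_const_hom.c_of_nat [simp del]

interpretation to_ac_hom: coeff_hom "to_ac :: 'a::field \<Rightarrow> 'a alg_closure"
  by unfold_locales auto

lemma coeff_hom_nth_0: "coeff_hom (\<lambda>f::'a::comm_ring_1 fps. f $ 0)"
  by unfold_locales auto

section \<open>Forms and ideals\<close>

lemma forms_iff: "p \<in> forms n d \<longleftrightarrow> (\<forall>m\<in>mkeys p. mkeys m \<subseteq> {..n} \<and> mdeg m = d)"
  by (auto simp: forms_def mpol_ring_def mdeg_def)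

lemma forms_mpol_ring: "p \<in> forms n d \<Longrightarrow> p \<in> mpol_ring n"
  by (simp add: forms_def)

lemma mpol_ring_0 [simp]: "0 \<in> mpol_ring n" and forms_0 [simp]: "0 \<in> forms n d"
  by (auto simp: mpol_ring_def forms_iff)

lemma mpol_ring_single: "mkeys m \<subseteq> {..n} \<Longrightarrow> msingle m a \<in> mpol_ring n"
  by (simp add: mpol_ring_def)

lemma forms_single: "mkeys m \<subseteq> {..n} \<Longrightarrow> mdeg m = d \<Longrightarrow> msingle m a \<in> forms n d"
  by (simp add: forms_iff)

lemma mpol_ring_1 [simp]: "1 \<in> mpol_ring n" and forms_1: "1 \<in> forms n 0"
  by (auto simp: mpol_ring_def forms_iff)

lemma mpol_ring_add: "p \<in> mpol_ring n \<Longrightarrow> q \<in> mpol_ring n \<Longrightarrow> p + q \<in> mpol_ring n"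
  using keys_add[of p q] unfolding mpol_ring_def by blast

lemma forms_add: "p \<in> forms n d \<Longrightarrow> q \<in> forms n d \<Longrightarrow> p + q \<in> forms n d"
  using keys_add[of p q] unfolding forms_iff by blast

lemma mpol_ring_uminus: "p \<in> mpol_ring n \<Longrightarrow> - p \<in> mpol_ring n"
  unfolding mpol_ring_def by (auto simp: in_keys_iff)

lemma forms_uminus: "p \<in> forms n d \<Longrightarrow> - p \<in> forms n d"
  unfolding forms_iff by (auto simp: in_keys_iff)

lemma forms_diff: "p \<in> forms n d \<Longrightarrow> q \<in> forms n d \<Longrightarrow> p - q \<in> forms n d"
  using forms_add[of p n d "- q"] forms_uminus[of q] by simp

lemma mpol_ring_mult: "p \<in> mpol_ring n \<Longrightarrow> q \<in> mpol_ring n \<Longrightarrow> p * q \<in> mpol_ring n"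
  using keys_mult[of p q] keys_add_nat unfolding mpol_ring_def by blast

lemma forms_mult:
  assumes "p \<in> forms n d" "q \<in> forms n e"
  shows "p * q \<in> forms n (d + e)"
  unfolding forms_iff
proof
  fix m assume "m \<in> mkeys (p * q)"
  then obtain a b where "m = a + b" "a \<in> mkeys p" "b \<in> mkeys q"
    using keys_mult[of p q] by blast
  then show "mkeys m \<subseteq> {..n} \<and> mdeg m = d + e"
    using assms by (auto simp: forms_iff keys_add_nat)
qed

lemma forms_sum: "(\<And>x. x \<in> S \<Longrightarrow> f x \<in> forms n d) \<Longrightarrow> sum f S \<in> forms n d"
  by (induction S rule: infinite_finite_induct) (auto intro: forms_add)

lemma forms_power: "p \<in> forms n d \<Longrightarrow> p ^ k \<in> forms n (k * d)"
  by (induction k) (auto intro: forms_1 forms_mult)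

lemma forms_prod: "(\<And>x. x \<in> S \<Longrightarrow> f x \<in> forms n (d x)) \<Longrightarrow> prod f S \<in> forms n (sum d S)"
  by (induction S rule: infinite_finite_induct) (auto intro: forms_1 forms_mult)

lemma forms_scale: "p \<in> forms n d \<Longrightarrow> msingle 0 a * p \<in> forms n d"
  using forms_mult[of "msingle 0 a" n 0 p d] by (simp add: forms_single)

lemma forms_mono: "p \<in> forms n d \<Longrightarrow> n \<le> n' \<Longrightarrow> p \<in> forms n' d"
  unfolding forms_iff by fastforce

lemma forms_induct [consumes 1, case_names zero add]:
  assumes "p \<in> forms n d" "P 0"
    "\<And>m a p. mkeys m \<subseteq> {..n} \<Longrightarrow> mdeg m = d \<Longrightarrow> p \<in> forms n d \<Longrightarrow> P p \<Longrightarrow> P (msingle m a + p)"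
  shows "P p"
  using assms(1)
proof (induction p rule: mpol_induct)
  case (add m a p)
  have k: "mkeys (msingle m a + p) = insert m (mkeys p)"
    using add.hyps by (auto simp: in_keys_iff lookup_add lookup_single when_def split: if_splits)
  show ?case
    by (rule assms(3)) (use add k in \<open>auto simp: forms_iff\<close>)
qed (rule assms(2))

lemma gev_cong_ring:
  "p \<in> mpol_ring n \<Longrightarrow> (\<And>i. i \<le> n \<Longrightarrow> y i = y' i) \<Longrightarrow> gev c y p = gev c y' p"
  unfolding gev_def mpol_ring_def by (intro sum.cong refl arg_cong2[of _ _ _ _ "(*)"] mon_eval_cong) auto

lemma gev_scale:
  assumes "p \<in> forms n d"
  shows "gev c (\<lambda>i. t * y i) p = t ^ d * gev c y p"
  using assms unfolding gev_def forms_iff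
  by (auto simp: mon_eval_mult mon_eval_const sum_distrib_left intro!: sum.cong)

section \<open>Ideals generated by a set of polynomials\<close>

lemma ideal_gen_0 [simp]: "0 \<in> ideal_gen n E"
  unfolding ideal_gen_def by (intro CollectI exI[of _ "{}"] exI[of _ "\<lambda>_. 0"]) auto

lemma ideal_gen_generator: "f \<in> E \<Longrightarrow> q \<in> mpol_ring n \<Longrightarrow> q * f \<in> ideal_gen n E"
  unfolding ideal_gen_def by (intro CollectI exI[of _ "{f}"] exI[of _ "\<lambda>_. q"]) auto

lemma ideal_gen_add:
  assumes "h \<in> ideal_gen n E" "h' \<in> ideal_gen n E"
  shows "h + h' \<in> ideal_gen n E"
proof -
  obtain T q where 1: "h = (\<Sum>f\<in>T. q f * f)" "finite T" "T \<subseteq> E" "q ` T \<subseteq> mpol_ring n"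
    using assms(1) unfolding ideal_gen_def by auto
  obtain T' q' where 2: "h' = (\<Sum>f\<in>T'. q' f * f)" "finite T'" "T' \<subseteq> E" "q' ` T' \<subseteq> mpol_ring n"
    using assms(2) unfolding ideal_gen_def by auto
  \<comment> \<open>\<open>ideal_gen\<close> allows one coefficient per generator, so on generators
    common to both sums the two coefficients are added.\<close>
  define r where "r f = (if f \<in> T then q f else 0) + (if f \<in> T' then q' f else 0)" for f
  have e1: "(\<Sum>f\<in>T \<union> T'. (if f \<in> T then q f else 0) * f) = h"
    unfolding 1(1) by (rule sum.mono_neutral_cong_right) (use 1 2 in auto)
  have e2: "(\<Sum>f\<in>T \<union> T'. (if f \<in> T' then q' f else 0) * f) = h'"
    unfolding 2(1) by (rule sum.mono_neutral_cong_right) (use 1 2 in auto)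
  have "h + h' = (\<Sum>f\<in>T \<union> T'. r f * f)"
    by (simp add: r_def distrib_right sum.distrib e1 e2)
  moreover have "r ` (T \<union> T') \<subseteq> mpol_ring n"
    using 1(4) 2(4) by (auto simp: r_def image_subset_iff intro!: mpol_ring_add)
  ultimately show ?thesis
    unfolding ideal_gen_def using 1 2 by (intro CollectI exI[of _ "T \<union> T'"] exI[of _ r]) auto
qed

lemma ideal_gen_sum: "(\<And>x. x \<in> S \<Longrightarrow> f x \<in> ideal_gen n E) \<Longrightarrow> sum f S \<in> ideal_gen n E"
  by (induction S rule: infinite_finite_induct) (auto intro: ideal_gen_add)

lemma ideal_gen_mult:
  assumes "h \<in> ideal_gen n E" "p \<in> mpol_ring n"
  shows "p * h \<in> ideal_gen n E"
proof -
  obtain T q where 1: "h = (\<Sum>f\<in>T. q f * f)" "finite T" "T \<subseteq> E" "q ` T \<subseteq> mpol_ring n"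
    using assms(1) unfolding ideal_gen_def by auto
  have "p * h = (\<Sum>f\<in>T. (p * q f) * f)"
    by (simp add: 1(1) sum_distrib_left mult.assoc)
  also have "\<dots> \<in> ideal_gen n E"
    using 1 assms(2) by (intro ideal_gen_sum ideal_gen_generator) (auto intro!: mpol_ring_mult)
  finally show ?thesis .
qed

lemma ideal_gen_induct [consumes 1, case_names zero add]:
  assumes "h \<in> ideal_gen n E" "P 0"
    "\<And>q f h. f \<in> E \<Longrightarrow> q \<in> mpol_ring n \<Longrightarrow> P h \<Longrightarrow> P (q * f + h)"
  shows "P h"
proof -
  obtain T q where 1: "h = (\<Sum>f\<in>T. q f * f)" "finite T" "T \<subseteq> E" "q ` T \<subseteq> mpol_ring n"
    using assms(1) unfolding ideal_gen_def by auto
  from 1(2-4) have "P (\<Sum>f\<in>T. q f * f)"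
    by (induction T rule: finite_induct) (auto intro: assms)
  then show ?thesis by (simp add: 1)
qed

lemma gev_ideal_gen:
  assumes "coeff_hom c" "h \<in> ideal_gen n E" "\<And>f. f \<in> E \<Longrightarrow> gev c y f = 0"
  shows "gev c y h = 0"
proof -
  interpret coeff_hom c by fact
  show ?thesis
    using assms(2) by (induction rule: ideal_gen_induct) (auto simp: assms(3))
qed

section \<open>Base change to the algebraic closure, and linear forms\<close>

lemma lookup_base_change: "mlookup (base_change p) m = to_ac (mlookup p m)"
  unfolding base_change_def by transfer (auto simp: when_def)

lemma base_change_single: "base_change (msingle m a) = msingle m (to_ac a)"
  by (rule poly_mapping_eqI) (simp add: lookup_base_change lookup_single when_def)

lemma base_change_add: "base_change (p + q) = base_change p + base_change q"
  by (rule poly_mapping_eqI) (simp add: lookup_base_change lookup_add)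

definition linform :: "nat \<Rightarrow> (nat \<Rightarrow> 'a::comm_ring_1) \<Rightarrow> (nat \<Rightarrow>\<^sub>0 nat) \<Rightarrow>\<^sub>0 'a" where
  "linform n l = (\<Sum>i\<le>n. msingle (msingle i 1) (l i))"

lemma linform_forms: "linform n l \<in> forms n 1"
  unfolding linform_def by (intro forms_sum forms_single) auto

lemma (in coeff_hom) gev_linform [simp]: "gev c y (linform n l) = (\<Sum>i\<le>n. c (l i) * y i)"
  by (simp add: linform_def)

lemma mdeg_eq_1D:
  assumes "mdeg m = 1"
  shows "\<exists>i. m = msingle i 1"
proof -
  have "mkeys m \<noteq> {}"
    using assms by (auto simp: mdeg_def)
  then obtain i where i: "i \<in> mkeys m" by blast
  have "mdeg m = mlookup m i + (\<Sum>j\<in>mkeys m - {i}. mlookup m j)"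
    unfolding mdeg_def by (rule sum.remove) (use i in auto)
  moreover have "mlookup m i \<noteq> 0" using i by (simp add: in_keys_iff)
  ultimately have l: "mlookup m i = 1" "(\<Sum>j\<in>mkeys m - {i}. mlookup m j) = 0"
    using assms by linarith+
  then have "mlookup m j = 0" if "j \<noteq> i" for j
    using that by (metis DiffI finite_Diff finite_keys in_keys_iff singletonD sum_eq_0_iff)
  then have "m = msingle i 1"
    using l by (intro poly_mapping_eqI) (auto simp: lookup_single when_def)
  then show ?thesis ..
qed

lemma forms_1_linform:
  assumes "F \<in> forms n 1"
  obtains l where "F = linform n l"
proof -
  have "F = linform n (\<lambda>i. mlookup F (msingle i 1))"
  proof (rule poly_mapping_eqI)
    fix m
    show "mlookup F m = mlookup (linform n (\<lambda>i. mlookup F (msingle i 1))) m"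
    proof (cases "\<exists>i\<le>n. m = msingle i 1")
      case True
      then obtain i where i: "i \<le> n" "m = msingle i 1" by auto
      have "msingle j (1::nat) = msingle i 1 \<longleftrightarrow> j = i" for j
        by (metis keys_single one_neq_zero singleton_inject)
      then show ?thesis using i
        by (simp add: linform_def lookup_sum lookup_single when_def)
    next
      case False
      have "m \<notin> mkeys F"
      proof
        assume "m \<in> mkeys F"
        then have "mkeys m \<subseteq> {..n}" "mdeg m = 1" using assms by (auto simp: forms_iff)
        then show False using mdeg_eq_1D[of m] False by auto
      qed
      then show ?thesis using False
        by (auto simp: linform_def lookup_sum lookup_single when_def in_keys_iff intro!: sum.neutral)
    qed
  qed
  then show ?thesis using that by blast
qed

section \<open>The equations of the curve and the Hilbert polynomial\<close>

definition eqn :: "nat \<Rightarrow> (nat \<Rightarrow> 'a::field) \<Rightarrow> nat \<Rightarrow> 'a mpol" where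
  "eqn s B i = msingle (msingle 0 s) (B i - B 1) + msingle (msingle 1 s) (B 0 - B i)
     + msingle (msingle i s) (B 1 - B 0)"

definition crv :: "nat \<Rightarrow> nat \<Rightarrow> (nat \<Rightarrow> 'a::field) \<Rightarrow> 'a mpol set" where
  "crv n s B = eqn s B ` {2..n}"

lemma X_curve_crv: "X_curve r s n \<alpha> = crv n s (\<lambda>i. \<alpha> i ^ r)"
  by (simp add: X_curve_def crv_def X_equation_def[abs_def] eqn_def[abs_def])

lemma base_change_crv: "base_change ` crv n s B = crv n s (\<lambda>i. to_ac (B i))"
  by (simp add: crv_def image_image eqn_def base_change_add base_change_single)

lemma eqn_forms: "2 \<le> i \<Longrightarrow> i \<le> n \<Longrightarrow> eqn s B i \<in> forms n s"
  unfolding eqn_def by (intro forms_add forms_single) auto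

lemma crv_forms: "crv n s B \<subseteq> forms n s"
  by (auto simp: crv_def intro: eqn_forms)

lemma gev_eqn:
  assumes "coeff_hom c"
  shows "gev c y (eqn s B i) =
    c (B i - B 1) * y 0 ^ s + c (B 0 - B i) * y 1 ^ s + c (B 1 - B 0) * y i ^ s"
proof -
  interpret coeff_hom c by fact
  show ?thesis by (simp add: eqn_def)
qed

text \<open>The binary form that equals \<open>Y_i^s\<close> on the curve. For
  \<open>B 1 \<noteq> B 0\<close> its coefficients are the weights that write \<open>B i\<close> as
  an affine combination of \<open>B 0\<close> and \<open>B 1\<close>.\<close>

definition qf :: "nat \<Rightarrow> (nat \<Rightarrow> 'a::field) \<Rightarrow> nat \<Rightarrow> 'a mpol" where
  "qf s B i = msingle (msingle 0 s) ((B 1 - B i) / (B 1 - B 0))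
     + msingle (msingle 1 s) ((B i - B 0) / (B 1 - B 0))"

lemma qf_forms: "qf s B i \<in> forms 1 s"
  unfolding qf_def by (intro forms_add forms_single) auto

lemma scale_qf:
  assumes "B 1 \<noteq> B 0"
  shows "msingle 0 (B 1 - B 0) * qf s B i =
    msingle (msingle 0 s) (B 1 - B i) + msingle (msingle 1 s) (B i - B 0)"
  using assms by (simp add: qf_def distrib_left mult_single)

lemma eqn_qf:
  assumes "B 1 \<noteq> B 0"
  shows "eqn s B i = msingle 0 (B 1 - B 0) * (msingle (msingle i s) 1 - qf s B i)"
  unfolding right_diff_distrib scale_qf[where i = i, OF assms] eqn_def mult_single
  by (simp add: single_diff)

section \<open>Normal forms modulo the equations\<close>

definition redm :: "nat \<Rightarrow> nat \<Rightarrow> (nat \<Rightarrow>\<^sub>0 nat) \<Rightarrow> (nat \<Rightarrow>\<^sub>0 nat)" where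
  "redm n s m = Poly_Mapping.mapp (\<lambda>i k. if 2 \<le> i \<and> i \<le> n then k mod s else k) m"

lemma lookup_redm:
  "mlookup (redm n s m) i = (if 2 \<le> i \<and> i \<le> n then mlookup m i mod s else mlookup m i)"
  by (simp add: redm_def lookup_mapp when_def in_keys_iff)

lemma keys_redm: "mkeys (redm n s m) \<subseteq> mkeys m"
proof
  fix i assume "i \<in> mkeys (redm n s m)"
  then show "i \<in> mkeys m"
    by (cases "mlookup m i = 0") (auto simp: in_keys_iff lookup_redm split: if_splits)
qed

lemma monom_redm: "m = redm n s m + (\<Sum>i\<in>{2..n}. msingle i (s * (mlookup m i div s)))"
  by (rule poly_mapping_eqI)
     (auto simp: lookup_add lookup_sum lookup_redm lookup_single when_def)

definition nfm :: "nat \<Rightarrow> nat \<Rightarrow> (nat \<Rightarrow> 'a::field) \<Rightarrow> (nat \<Rightarrow>\<^sub>0 nat) \<Rightarrow> 'a mpol" where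
  "nfm n s B m = msingle (redm n s m) 1 * (\<Prod>i\<in>{2..n}. qf s B i ^ (mlookup m i div s))"

text \<open>Replacing $Y_i^s$ by the binary form it equals on the curve ($i \ge 2$) is a linear projection
  whose kernel is the ideal of the curve.\<close>

definition nf :: "nat \<Rightarrow> nat \<Rightarrow> (nat \<Rightarrow> 'a::field) \<Rightarrow> 'a mpol \<Rightarrow> 'a mpol" where
  "nf n s B p = (\<Sum>m\<in>mkeys p. msingle 0 (mlookup p m) * nfm n s B m)"

lemma nf_0 [simp]: "nf n s B 0 = 0"
  by (simp add: nf_def)

lemma nf_add: "nf n s B (p + q) = nf n s B p + nf n s B q"
  unfolding nf_def by (rule setsum_keys_plus_distrib) (auto simp: single_add distrib_right)

lemma nf_single: "nf n s B (msingle m a) = msingle 0 a * nfm n s B m"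
  by (simp add: nf_def)

lemma prod_power_update:
  fixes g :: "nat \<Rightarrow> 'b::comm_ring_1"
  assumes "finite S" "i \<in> S" "e i = Suc (e' i)" "\<And>j. j \<in> S \<Longrightarrow> j \<noteq> i \<Longrightarrow> e j = e' j"
  shows "(\<Prod>j\<in>S. g j ^ e j) = g i * (\<Prod>j\<in>S. g j ^ e' j)"
proof -
  have "(\<Prod>j\<in>S - {i}. g j ^ e j) = (\<Prod>j\<in>S - {i}. g j ^ e' j)"
    by (rule prod.cong) (use assms in auto)
  then show ?thesis
    using assms by (simp add: prod.remove[of S i])
qed

lemma nfm_add_high:
  assumes "2 \<le> i" "i \<le> n" "0 < s"
  shows "nfm n s B (m + msingle i s) = qf s B i * nfm n s B m"
proof -
  have 1: "redm n s (m + msingle i s) = redm n s m"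
    using assms by (intro poly_mapping_eqI) (auto simp: lookup_redm lookup_add lookup_single when_def)
  have "(\<Prod>j\<in>{2..n}. qf s B j ^ (mlookup (m + msingle i s) j div s))
      = qf s B i * (\<Prod>j\<in>{2..n}. qf s B j ^ (mlookup m j div s))"
    by (rule prod_power_update) (use assms in \<open>auto simp: lookup_add lookup_single when_def\<close>)
  then show ?thesis
    by (simp add: nfm_def 1 mult_ac)
qed

lemma nfm_add_low:
  assumes "j < 2"
  shows "nfm n s B (m + msingle j s) = msingle (msingle j s) 1 * nfm n s B m"
proof -
  have 1: "redm n s (m + msingle j s) = msingle j s + redm n s m"
    using assms by (intro poly_mapping_eqI) (auto simp: lookup_redm lookup_add lookup_single when_def)
  have "(\<Prod>i\<in>{2..n}. qf s B i ^ (mlookup (m + msingle j s) i div s))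
      = (\<Prod>i\<in>{2..n}. qf s B i ^ (mlookup m i div s))"
    by (rule prod.cong) (use assms in \<open>auto simp: lookup_add lookup_single when_def\<close>)
  then show ?thesis
    unfolding nfm_def 1 by (simp add: mult_single mult.assoc[symmetric])
qed

text \<open>On normal forms, multiplication of a monomial by \<open>Y_j^s\<close> is multiplication
  by \<open>Y_j^s\<close> for j < 2 and by \<open>qf s B i\<close> for i \<ge> 2. The normal form of
  a monomial times an equation is therefore \<open>nfm\<close> times the equation with
  \<open>Y_i^s\<close> replaced by \<open>qf s B i\<close>, which is zero.\<close>

lemma nf_mult_eqn:
  assumes "2 \<le> i" "i \<le> n" "0 < s" "B 1 \<noteq> B 0"
  shows "nf n s B (q * eqn s B i) = 0"
proof (induction q rule: mpol_induct)
  case (add m a q)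
  have "msingle m a * eqn s B i = msingle (m + msingle 0 s) (a * (B i - B 1))
     + msingle (m + msingle 1 s) (a * (B 0 - B i)) + msingle (m + msingle i s) (a * (B 1 - B 0))"
    by (simp add: eqn_def distrib_left mult_single)
  then have "nf n s B (msingle m a * eqn s B i) =
     msingle 0 (a * (B i - B 1)) * (msingle (msingle 0 s) 1 * nfm n s B m) +
     msingle 0 (a * (B 0 - B i)) * (msingle (msingle 1 s) 1 * nfm n s B m) +
     msingle 0 (a * (B 1 - B 0)) * (qf s B i * nfm n s B m)"
    using nfm_add_low[of 1 n s B m] nfm_add_low[of 0 n s B m] assms
    by (simp add: nf_add nf_single nfm_add_high)
  also have "\<dots> = msingle 0 a * nfm n s B m *
      (msingle 0 (B i - B 1) * msingle (msingle 0 s) 1 + msingle 0 (B 0 - B i) * msingle (msingle 1 s) 1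
       + msingle 0 (B 1 - B 0) * qf s B i)"
  proof -
    have e: "msingle 0 (a * b) = msingle 0 a * msingle 0 b" for b by (simp add: mult_single)
    show ?thesis
      unfolding e[of "B i - B 1"] e[of "B 0 - B i"] e[of "B 1 - B 0"] by (simp only: distrib_left mult_ac)
  qed
  also have "msingle 0 (B i - B 1) * msingle (msingle 0 s) 1 + msingle 0 (B 0 - B i) * msingle (msingle 1 s) 1
       + msingle 0 (B 1 - B 0) * qf s B i =
       msingle (msingle 0 s) ((B i - B 1) + (B 1 - B i)) + msingle (msingle 1 s) ((B 0 - B i) + (B i - B 0))"
    unfolding scale_qf[OF assms(4)] single_add by (simp add: mult_single)
  also have "\<dots> = 0" by simp
  finally have "nf n s B (msingle m a * eqn s B i) = 0" by simp
  then show ?case using add.IH by (simp add: distrib_right nf_add)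
qed simp

lemma nf_ideal:
  assumes "h \<in> ideal_gen n (crv n s B)" "0 < s" "B 1 \<noteq> B 0"
  shows "nf n s B h = 0"
  using assms(1)
  by (induction rule: ideal_gen_induct) (use assms in \<open>auto simp: nf_add crv_def intro!: nf_mult_eqn\<close>)

lemma ideal_diff_mult:
  assumes "p - q \<in> ideal_gen n E" "p' - q' \<in> ideal_gen n E" "p \<in> mpol_ring n" "q' \<in> mpol_ring n"
  shows "p * p' - q * q' \<in> ideal_gen n E"
proof -
  have "p * p' - q * q' = p * (p' - q') + q' * (p - q)" by (simp add: algebra_simps)
  then show ?thesis using assms by (auto intro!: ideal_gen_add ideal_gen_mult)
qed

lemma mpol_ring_power: "p \<in> mpol_ring n \<Longrightarrow> p ^ k \<in> mpol_ring n"
  by (induction k) (auto intro: mpol_ring_mult)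

lemma mpol_ring_prod: "(\<And>x. x \<in> S \<Longrightarrow> f x \<in> mpol_ring n) \<Longrightarrow> prod f S \<in> mpol_ring n"
  by (induction S rule: infinite_finite_induct) (auto intro: mpol_ring_mult)

lemma ideal_diff_power:
  assumes "p - q \<in> ideal_gen n E" "p \<in> mpol_ring n" "q \<in> mpol_ring n"
  shows "p ^ k - q ^ k \<in> ideal_gen n E"
  by (induction k) (auto intro!: ideal_diff_mult assms mpol_ring_power)

lemma ideal_diff_prod:
  assumes "finite S" "\<And>x. x \<in> S \<Longrightarrow> f x - g x \<in> ideal_gen n E"
    "\<And>x. x \<in> S \<Longrightarrow> f x \<in> mpol_ring n" "\<And>x. x \<in> S \<Longrightarrow> g x \<in> mpol_ring n"
  shows "prod f S - prod g S \<in> ideal_gen n E"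
  using assms by (induction S rule: finite_induct) (auto intro!: ideal_diff_mult mpol_ring_prod)

lemma qf_mpol_ring: "1 \<le> n \<Longrightarrow> qf s B i \<in> mpol_ring n"
  using forms_mpol_ring[OF forms_mono[OF qf_forms]] by blast

lemma single_power: "msingle m (1::'a::comm_ring_1) ^ k = msingle (\<Sum>j<k. m) 1"
  by (induction k) (auto simp: mult_single add.commute simp del: sum_constant)

lemma single_prod: "(\<Prod>i\<in>S. msingle (f i) (1::'a::comm_ring_1)) = msingle (\<Sum>i\<in>S. f i) 1"
  by (induction S rule: infinite_finite_induct) (auto simp: mult_single)

lemma single_multiple: "(\<Sum>j<k. msingle i a :: nat \<Rightarrow>\<^sub>0 nat) = msingle i (a * k)"
  by (induction k) (auto simp: single_add[symmetric] add.commute simp del: sum_constant)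

text \<open>The congruence of \<open>Y_i^s\<close> and \<open>qf s B i\<close> modulo the ideal is
  carried through powers and products; the reduced part of the monomial is common to both
  sides.\<close>

lemma single_minus_nfm:
  assumes "mkeys m \<subseteq> {..n}" "1 \<le> n" "B 1 \<noteq> B 0"
  shows "msingle m 1 - nfm n s B m \<in> ideal_gen n (crv n s B)"
proof -
  have k: "msingle (msingle i s) 1 - qf s B i \<in> ideal_gen n (crv n s B)" if "i \<in> {2..n}" for i
  proof -
    have "msingle (msingle i s) 1 - qf s B i = msingle 0 (1 / (B 1 - B 0)) * eqn s B i"
      using assms by (simp add: eqn_qf mult_single flip: mult.assoc)
    also have "\<dots> \<in> ideal_gen n (crv n s B)"
      using that by (intro ideal_gen_generator) (auto simp: crv_def intro: mpol_ring_single)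
    finally show ?thesis .
  qed
  have r: "mkeys (redm n s m) \<subseteq> {..n}"
    using assms(1) keys_redm[of n s m] by auto
  have "msingle m (1::'a) = msingle (redm n s m + (\<Sum>i\<in>{2..n}. msingle i (s * (mlookup m i div s)))) 1"
    using monom_redm[of m n s] by simp
  also have "\<dots> = msingle (redm n s m) 1 *
      (\<Prod>i\<in>{2..n}. msingle (msingle i s) 1 ^ (mlookup m i div s))"
    by (simp add: single_power single_multiple single_prod mult_single del: sum_constant)
  finally have e: "msingle m (1::'a) = \<dots>" .
  show ?thesis
    unfolding e nfm_def using r assms(2)
    by (intro ideal_diff_mult ideal_diff_prod ideal_diff_power k mpol_ring_single mpol_ring_power
          mpol_ring_prod qf_mpol_ring) auto
qed

lemma mdeg_sum: "finite S \<Longrightarrow> mdeg (sum f S) = (\<Sum>i\<in>S. mdeg (f i))"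
  by (induction S rule: finite_induct) auto

lemma nfm_forms:
  assumes "mkeys m \<subseteq> {..n}" "1 \<le> n"
  shows "nfm n s B m \<in> forms n (mdeg m)"
proof -
  have r: "mkeys (redm n s m) \<subseteq> {..n}"
    using assms(1) keys_redm[of n s m] by auto
  have "mdeg m = mdeg (redm n s m) + (\<Sum>i\<in>{2..n}. (mlookup m i div s) * s)"
    by (subst monom_redm[of m n s]) (simp add: mdeg_sum mult.commute)
  then show ?thesis
    unfolding nfm_def using r assms(2)
    by (auto intro!: forms_mult forms_prod forms_power forms_single intro: forms_mono[OF qf_forms])
qed

section \<open>Counting reduced monomials\<close>

definition Mon :: "nat \<Rightarrow> nat \<Rightarrow> (nat \<Rightarrow>\<^sub>0 nat) set" where
  "Mon n d = {m. mkeys m \<subseteq> {..n} \<and> mdeg m = d}"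

definition Red :: "nat \<Rightarrow> nat \<Rightarrow> nat \<Rightarrow> (nat \<Rightarrow>\<^sub>0 nat) set" where
  "Red n s d = {m \<in> Mon n d. \<forall>i\<in>{2..n}. mlookup m i < s}"

lemma finite_Mon: "finite (Mon n d)"
proof -
  have "mlookup m i \<le> d" if "m \<in> Mon n d" for m i
  proof (cases "i \<in> mkeys m")
    case True
    then have "mlookup m i \<le> mdeg m"
      unfolding mdeg_def by (intro member_le_sum) auto
    then show ?thesis using that by (auto simp: Mon_def)
  qed (simp add: in_keys_iff)
  then have "mlookup ` Mon n d \<subseteq> {f. \<forall>i. (i \<in> {..n} \<longrightarrow> f i \<in> {..d}) \<and> (i \<notin> {..n} \<longrightarrow> f i = 0)}"
    by (auto simp: Mon_def in_keys_iff)
  then have "finite (mlookup ` Mon n d)"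
    by (rule finite_subset) (rule finite_set_of_finite_funs; simp)
  then show ?thesis
    by (rule finite_imageD) (auto intro: inj_onI poly_mapping_eqI)
qed

text \<open>The factors \<open>qf\<close> involve only \<open>Y_0\<close> and \<open>Y_1\<close>, so
  the exponents of the other variables come from \<open>redm\<close> alone.\<close>

lemma nfm_keys_Red:
  assumes "k \<in> mkeys (nfm n s B m)" "i \<in> {2..n}" "0 < s"
  shows "mlookup k i < s"
proof -
  have "(\<Prod>i\<in>{2..n}. qf s B i ^ (mlookup m i div s)) \<in> forms 1 (\<Sum>i\<in>{2..n}. mlookup m i div s * s)"
    by (intro forms_prod forms_power qf_forms)
  moreover obtain b where "k = redm n s m + b"
      "b \<in> mkeys (\<Prod>i\<in>{2..n}. qf s B i ^ (mlookup m i div s))"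
    using keys_mult assms(1) unfolding nfm_def by (fastforce split: if_splits)
  ultimately have "mkeys b \<subseteq> {..1}" "k = redm n s m + b"
    by (auto simp: forms_iff)
  moreover from this have "i \<notin> mkeys b" using assms(2) by auto
  ultimately have "mlookup b i = 0" "k = redm n s m + b"
    by (auto simp: in_keys_iff)
  then show ?thesis using assms by (simp add: lookup_add lookup_redm)
qed

lemma nfm_Red:
  assumes "m \<in> Red n s d"
  shows "nfm n s B m = msingle m 1"
proof -
  have "redm n s m = m"
    using assms by (intro poly_mapping_eqI) (auto simp: lookup_redm Red_def)
  moreover have "(\<Prod>i\<in>{2..n}. qf s B i ^ (mlookup m i div s)) = 1"
    by (rule prod.neutral) (use assms in \<open>auto simp: Red_def\<close>)
  ultimately show ?thesis by (simp add: nfm_def)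
qed

interpretation mpol_vs: vector_space "\<lambda>(c::'a::field) (p::'a mpol). msingle 0 c * p"
proof unfold_locales
  show "msingle 0 (a + b) * x = msingle 0 a * x + msingle 0 b * x" for a b :: 'a and x :: "'a mpol"
    by (simp add: single_add distrib_right)
  show "msingle 0 a * (msingle 0 b * x) = msingle 0 (a * b) * x" for a b :: 'a and x :: "'a mpol"
    by (simp add: mult_single flip: mult.assoc)
qed (auto simp: distrib_left)

lemma lookup_scale: "mlookup (msingle 0 c * p) m = (c::'a::field) * mlookup p m"
proof (induction p rule: mpol_induct)
  case (add k a p)
  then show ?case by (simp add: distrib_left mult_single lookup_add lookup_single when_def)
qed simp

text \<open>The coefficients of the \<open>g m\<close> at the monomials of S form an identity
  matrix, which gives independence. It is applied to the monomials themselves and to the relations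
  that reduce a monomial to its normal form.\<close>

lemma mpol_dim_triangular:
  fixes g :: "(nat \<Rightarrow>\<^sub>0 nat) \<Rightarrow> 'a::field mpol"
  assumes fin: "finite S"
    and g: "\<And>m m'. m \<in> S \<Longrightarrow> m' \<in> S \<Longrightarrow> mlookup (g m) m' = (if m = m' then 1 else 0)"
    and sub: "g ` S \<subseteq> V" and span: "V \<subseteq> mpol_vs.span (g ` S)"
  shows "mpol_dim V = card S"
proof -
  have inj: "inj_on g S"
  proof (rule inj_onI)
    fix m m' assume "m \<in> S" "m' \<in> S" "g m = g m'"
    then show "m = m'" using g[of m m'] g[of m' m'] by (auto split: if_splits)
  qed
  have "mpol_vs.independent (g ` S)"
  proof
    assume "mpol_vs.dependent (g ` S)"
    then obtain u v where v: "v \<in> g ` S" "u v \<noteq> 0" "(\<Sum>v\<in>g ` S. msingle 0 (u v) * v) = 0"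
      using mpol_vs.dependent_finite[of "g ` S"] fin by auto
    then obtain m where m: "m \<in> S" "v = g m" by auto
    have "0 = mlookup (\<Sum>v\<in>g ` S. msingle 0 (u v) * v) m" using v by simp
    also have "\<dots> = (\<Sum>m'\<in>S. u (g m') * mlookup (g m') m)"
      by (simp add: sum.reindex[OF inj] lookup_sum lookup_scale)
    also have "\<dots> = (\<Sum>m'\<in>S. if m' = m then u (g m) else 0)"
      by (rule sum.cong) (use m in \<open>auto simp: g\<close>)
    also have "\<dots> = u v" using m fin by simp
    finally show False using v by simp
  qed
  moreover have "mpol_vs.span (g ` S) = mpol_vs.span V"
    using sub span by (auto simp: mpol_vs.span_eq intro: mpol_vs.span_base)
  ultimately have "mpol_vs.dim V = card (g ` S)"
    by (rule mpol_vs.dim_eq_card[rotated])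
  then show ?thesis by (simp add: mpol_dim_def card_image[OF inj])
qed

lemma dim_forms: "mpol_dim (forms n d :: 'a::field mpol set) = card (Mon n d)"
proof (rule mpol_dim_triangular[where g = "\<lambda>m. msingle m 1"])
  show "forms n d \<subseteq> mpol_vs.span ((\<lambda>m. msingle m (1::'a)) ` Mon n d)"
  proof
    fix p :: "'a mpol" assume p: "p \<in> forms n d"
    have "p = (\<Sum>m\<in>mkeys p. msingle 0 (mlookup p m) * msingle m 1)"
      using mpol_expand[of p] by (simp add: mult_single)
    also have "\<dots> \<in> mpol_vs.span ((\<lambda>m. msingle m (1::'a)) ` Mon n d)"
      by (intro mpol_vs.span_sum mpol_vs.span_scale mpol_vs.span_base)
         (use p in \<open>auto simp: forms_iff Mon_def\<close>)
    finally show "p \<in> mpol_vs.span ((\<lambda>m. msingle m (1::'a)) ` Mon n d)" .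
  qed
next
  show "(\<lambda>m. msingle m 1) ` Mon n d \<subseteq> forms n d"
    by (auto simp: Mon_def intro: forms_single)
qed (auto simp: finite_Mon lookup_single when_def)

text \<open>The relations \<open>msingle m 1 - nfm n s B m\<close> with m not reduced form a basis.
  Since \<open>nfm\<close> has reduced monomials only, m occurs in its own relation and in no other.
  An element p of the ideal has \<open>nf n s B p = 0\<close>, so p = p - \<open>nf n s B p\<close>
  is a combination of relations, and those of reduced m are zero.\<close>

lemma dim_ideal:
  fixes B :: "nat \<Rightarrow> 'a::field"
  assumes "0 < s" "B 1 \<noteq> B 0" "1 \<le> n"
  shows "mpol_dim (ideal_gen n (crv n s B) \<inter> forms n d) = card (Mon n d - Red n s d)"
proof (rule mpol_dim_triangular[where g = "\<lambda>m. msingle m 1 - nfm n s B m"])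
  fix m m' assume m: "m \<in> Mon n d - Red n s d" "m' \<in> Mon n d - Red n s d"
  then obtain i where "i \<in> {2..n}" "\<not> mlookup m' i < s"
    by (auto simp: Red_def)
  then have "m' \<notin> mkeys (nfm n s B m)" using nfm_keys_Red assms(1) by blast
  then show "mlookup (msingle m 1 - nfm n s B m) m' = (if m = m' then 1 else 0)"
    by (simp add: lookup_minus lookup_single when_def in_keys_iff)
next
  show "(\<lambda>m. msingle m 1 - nfm n s B m) ` (Mon n d - Red n s d) \<subseteq> ideal_gen n (crv n s B) \<inter> forms n d"
    using assms nfm_forms[of _ n s B]
    by (auto simp: Mon_def intro!: single_minus_nfm forms_diff forms_single)
next
  show "ideal_gen n (crv n s B) \<inter> forms n d
      \<subseteq> mpol_vs.span ((\<lambda>m. msingle m 1 - nfm n s B m) ` (Mon n d - Red n s d))" (is "_ \<subseteq> ?S")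
  proof
    fix p assume p: "p \<in> ideal_gen n (crv n s B) \<inter> forms n d"
    have "p = p - nf n s B p" using p assms by (simp add: nf_ideal)
    also have "\<dots> = (\<Sum>m\<in>mkeys p. msingle 0 (mlookup p m) * (msingle m 1 - nfm n s B m))"
      unfolding nf_def right_diff_distrib sum_subtractf
      using mpol_expand[of p] by (simp add: mult_single)
    also have "\<dots> \<in> ?S"
    proof (rule mpol_vs.span_sum)
      fix m assume "m \<in> mkeys p"
      then have m: "m \<in> Mon n d" using p by (auto simp: forms_iff Mon_def)
      show "msingle 0 (mlookup p m) * (msingle m 1 - nfm n s B m) \<in> ?S"
      proof (cases "m \<in> Red n s d")
        case True then show ?thesis by (simp add: nfm_Red mpol_vs.span_zero)
      next
        case False then show ?thesis
          using m by (intro mpol_vs.span_scale mpol_vs.span_base) auto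
      qed
    qed
    finally show "p \<in> ?S" .
  qed
qed (simp add: finite_Mon)

lemma hilbert_function_crv:
  fixes B :: "nat \<Rightarrow> 'a::field"
  assumes "0 < s" "B 1 \<noteq> B 0" "1 \<le> n"
  shows "hilbert_function n (crv n s B) d = int (card (Red n s d))"
proof -
  have "card (Mon n d - Red n s d) = card (Mon n d) - card (Red n s d)"
    by (rule card_Diff_subset) (auto simp: Red_def intro: finite_subset[OF _ finite_Mon])
  moreover have "card (Red n s d) \<le> card (Mon n d)"
    by (rule card_mono) (auto simp: Red_def finite_Mon)
  ultimately show ?thesis
    using dim_ideal[OF assms, of d] by (simp add: hilbert_function_def dim_forms)
qed

text \<open>A reduced monomial is fixed by its exponent j < s of \<open>Y_2\<close> and its exponent
  of \<open>Y_0\<close>; the rest of the degree goes to \<open>Y_1\<close>. The bound s \<le> d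
  keeps d - j a true difference.\<close>

lemma card_Red_2:
  assumes "s \<le> d"
  shows "card (Red 2 s d) = (\<Sum>j<s. d - j + 1)"
proof -
  let ?f = "\<lambda>(j, i). msingle 0 i + msingle 1 (d - j - i) + msingle 2 j :: nat \<Rightarrow>\<^sub>0 nat"
  have "bij_betw ?f (Sigma {..<s} (\<lambda>j. {..d - j})) (Red 2 s d)"
  proof (rule bij_betw_imageI)
    show "inj_on ?f (Sigma {..<s} (\<lambda>j. {..d - j}))"
    proof (rule inj_onI, safe)
      fix j i j' i' assume e: "msingle 0 i + msingle 1 (d - j - i) + msingle 2 j
        = (msingle 0 i' + msingle 1 (d - j' - i') + msingle 2 j' :: nat \<Rightarrow>\<^sub>0 nat)"
      show "j = j'" using arg_cong[OF e, of "\<lambda>m. mlookup m 2"] by (simp add: lookup_add lookup_single)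
      show "i = i'" using arg_cong[OF e, of "\<lambda>m. mlookup m 0"] by (simp add: lookup_add lookup_single)
    qed
    show "?f ` Sigma {..<s} (\<lambda>j. {..d - j}) = Red 2 s d"
    proof safe
      fix j i assume "j < s" "i \<le> d - j"
      then show "msingle 0 i + msingle 1 (d - j - i) + msingle 2 j \<in> Red 2 s d"
        using assms by (auto simp: Red_def Mon_def keys_add_nat lookup_add lookup_single split: if_splits)
    next
      fix m assume m: "m \<in> Red 2 s d"
      have m': "m = msingle 0 (mlookup m 0) + msingle 1 (mlookup m 1) + msingle 2 (mlookup m 2)"
      proof (rule poly_mapping_eqI)
        fix k :: nat
        consider "k = 0" | "k = 1" | "k = 2" | "k > 2" by linarith
        then show "mlookup m k = mlookup (msingle 0 (mlookup m 0) + msingle 1 (mlookup m 1) + msingle 2 (mlookup m 2)) k"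
          using m by cases (auto simp: Red_def Mon_def lookup_add lookup_single in_keys_iff subset_iff when_def)
      qed
      have "d = mdeg m" using m by (simp add: Red_def Mon_def)
      also have "\<dots> = mlookup m 0 + mlookup m 1 + mlookup m 2"
        by (subst m') simp
      finally have d: "d - mlookup m 2 - mlookup m 0 = mlookup m 1" "mlookup m 0 \<le> d - mlookup m 2" by auto
      show "m \<in> ?f ` Sigma {..<s} (\<lambda>j. {..d - j})"
        by (rule image_eqI[of _ _ "(mlookup m 2, mlookup m 0)"])
           (use m m' d in \<open>auto simp: Red_def\<close>)
    qed
  qed
  from bij_betw_same_card[OF this, symmetric] show ?thesis
    by (simp add: card_SigmaI)
qed

text \<open>The four choices for the exponents of \<open>Y_2\<close> and \<open>Y_3\<close> leave d
  + 1, d, d and d - 1 choices for the exponent of \<open>Y_0\<close>.\<close>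

lemma card_Red_3:
  assumes "2 \<le> d"
  shows "card (Red 3 2 d) = 4 * d"
proof -
  let ?f = "\<lambda>((j, k), i). msingle 0 i + msingle 1 (d - j - k - i) + msingle 2 j + msingle 3 k :: nat \<Rightarrow>\<^sub>0 nat"
  let ?S = "Sigma ({..<2::nat} \<times> {..<2::nat}) (\<lambda>(j, k). {..d - j - k})"
  have "bij_betw ?f ?S (Red 3 2 d)"
  proof (rule bij_betw_imageI)
    show "inj_on ?f ?S"
    proof (rule inj_onI, safe)
      fix j k i j' k' i' assume e: "msingle 0 i + msingle 1 (d - j - k - i) + msingle 2 j + msingle 3 k
        = (msingle 0 i' + msingle 1 (d - j' - k' - i') + msingle 2 j' + msingle 3 k' :: nat \<Rightarrow>\<^sub>0 nat)"
      show "j = j'" using arg_cong[OF e, of "\<lambda>m. mlookup m 2"] by (simp add: lookup_add lookup_single)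
      show "k = k'" using arg_cong[OF e, of "\<lambda>m. mlookup m 3"] by (simp add: lookup_add lookup_single)
      show "i = i'" using arg_cong[OF e, of "\<lambda>m. mlookup m 0"] by (simp add: lookup_add lookup_single)
    qed
    show "?f ` ?S = Red 3 2 d"
    proof safe
      fix j k i :: nat assume "j < 2" "k < 2" "i \<le> d - j - k"
      then show "msingle 0 i + msingle 1 (d - j - k - i) + msingle 2 j + msingle 3 k \<in> Red 3 2 d"
        using assms by (auto simp: Red_def Mon_def keys_add_nat lookup_add lookup_single when_def split: if_splits)
    next
      fix m assume m: "m \<in> Red 3 2 d"
      have m': "m = msingle 0 (mlookup m 0) + msingle 1 (mlookup m 1) + msingle 2 (mlookup m 2) + msingle 3 (mlookup m 3)"
      proof (rule poly_mapping_eqI)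
        fix k :: nat
        consider "k = 0" | "k = 1" | "k = 2" | "k = 3" | "k > 3" by linarith
        then show "mlookup m k = mlookup (msingle 0 (mlookup m 0) + msingle 1 (mlookup m 1) + msingle 2 (mlookup m 2) + msingle 3 (mlookup m 3)) k"
          using m by cases (auto simp: Red_def Mon_def lookup_add lookup_single in_keys_iff subset_iff when_def)
      qed
      have "d = mdeg m" using m by (simp add: Red_def Mon_def)
      also have "\<dots> = mlookup m 0 + mlookup m 1 + mlookup m 2 + mlookup m 3"
        by (subst m') simp
      finally have d: "d - mlookup m 2 - mlookup m 3 - mlookup m 0 = mlookup m 1"
        "mlookup m 0 \<le> d - mlookup m 2 - mlookup m 3" by auto
      show "m \<in> ?f ` ?S"
        by (rule image_eqI[of _ _ "((mlookup m 2, mlookup m 3), mlookup m 0)"])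
           (use m m' d in \<open>auto simp: Red_def\<close>)
    qed
  qed
  from bij_betw_same_card[OF this, symmetric]
  have "card (Red 3 2 d) = (\<Sum>j<2. \<Sum>k<2. Suc (d - j - k))"
    by (simp add: card_SigmaI sum.cartesian_product split_beta)
  then show ?thesis using assms by (simp add: numeral_2_eq_2)
qed

lemma hilbert_polynomialI:
  assumes "\<And>d. N \<le> d \<Longrightarrow> of_int (hilbert_function n E d) = poly p (of_nat d)"
  shows "hilbert_polynomial n E = p"
  unfolding hilbert_polynomial_def
proof (rule the_equality)
  show "\<forall>\<^sub>F d in sequentially. poly p (of_nat d) = of_int (hilbert_function n E d)"
    using assms unfolding eventually_sequentially by metis
next
  fix q :: "rat poly" assume "\<forall>\<^sub>F d in sequentially. poly q (of_nat d) = of_int (hilbert_function n E d)"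
  then obtain M where M: "\<And>d. M \<le> d \<Longrightarrow> poly q (of_nat d) = of_int (hilbert_function n E d)"
    unfolding eventually_sequentially by auto
  have "of_nat ` {max M N..} \<subseteq> {x. poly (q - p) x = 0}"
    using M assms by auto
  moreover have "infinite (of_nat ` {max M N..} :: rat set)"
    by (subst finite_image_iff) (auto intro: inj_onI simp: infinite_Ici)
  ultimately have "infinite {x. poly (q - p) x = 0}"
    using infinite_super by blast
  then show "q = p" using poly_roots_finite[of "q - p"] by auto
qed

lemma hilbert_polynomial_2_2:
  assumes "B 1 \<noteq> B 0"
  shows "hilbert_polynomial 2 (crv 2 2 B) = [:1, 2:]"
proof (rule hilbert_polynomialI)
  fix d :: nat assume d: "2 \<le> d"
  have "card (Red 2 2 d) = 2 * d + 1"
    using d unfolding card_Red_2[OF d] by (simp add: lessThan_nat_numeral lessThan_Suc)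
  then show "of_int (hilbert_function 2 (crv 2 2 B) d) = poly [:1, 2 :: rat:] (of_nat d)"
    using assms by (simp add: hilbert_function_crv)
qed

lemma hilbert_polynomial_2_3:
  assumes "B 1 \<noteq> B 0"
  shows "hilbert_polynomial 2 (crv 2 3 B) = [:0, 3:]"
proof (rule hilbert_polynomialI)
  fix d :: nat assume d: "3 \<le> d"
  have "card (Red 2 3 d) = 3 * d"
    using d unfolding card_Red_2[OF d] by (simp add: lessThan_nat_numeral lessThan_Suc)
  then show "of_int (hilbert_function 2 (crv 2 3 B) d) = poly [:0, 3 :: rat:] (of_nat d)"
    using assms by (simp add: hilbert_function_crv)
qed

lemma hilbert_polynomial_3_2:
  assumes "B 1 \<noteq> B 0"
  shows "hilbert_polynomial 3 (crv 3 2 B) = [:0, 4:]"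
  by (rule hilbert_polynomialI[of 2]) (use assms in \<open>simp_all add: hilbert_function_crv card_Red_3\<close>)

section \<open>Points and arcs of the curve\<close>

text \<open>Stated over an arbitrary commutative ring because it serves both points, with values in
  a field, and arcs, with values in power series over it.\<close>

definition sol :: "nat \<Rightarrow> nat \<Rightarrow> (nat \<Rightarrow> 'b::comm_ring_1) \<Rightarrow> (nat \<Rightarrow> 'b) \<Rightarrow> bool" where
  "sol n s B y \<longleftrightarrow>
    (\<forall>i\<in>{2..n}. (B i - B 1) * y 0 ^ s + (B 0 - B i) * y 1 ^ s + (B 1 - B 0) * y i ^ s = 0)"

lemma gev_crv_zero_iff:
  assumes "coeff_hom c"
  shows "(\<forall>f\<in>crv n s B. gev c y f = 0) \<longleftrightarrow> sol n s (\<lambda>i. c (B i)) y"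
proof -
  interpret coeff_hom c by fact
  show ?thesis by (simp add: crv_def gev_eqn[OF assms] sol_def)
qed

lemma sol_hom:
  assumes "coeff_hom f" "sol n s B y"
  shows "sol n s (\<lambda>i. f (B i)) (\<lambda>i. f (y i))"
proof -
  interpret coeff_hom f by fact
  show ?thesis
    unfolding sol_def
  proof
    fix i assume "i \<in> {2..n}"
    then have "f ((B i - B 1) * y 0 ^ s + (B 0 - B i) * y 1 ^ s + (B 1 - B 0) * y i ^ s) = 0"
      using assms(2) by (simp add: sol_def)
    then show "(f (B i) - f (B 1)) * f (y 0) ^ s + (f (B 0) - f (B i)) * f (y 1) ^ s
        + (f (B 1) - f (B 0)) * f (y i) ^ s = 0"
      by simp
  qed
qed

text \<open>The equations say that the points (\<open>B i\<close>, \<open>v i ^ s\<close>) of the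
  affine plane lie on one line that is not vertical; u and w are its intercept and slope.\<close>

lemma sol_iff_affine:
  fixes v :: "nat \<Rightarrow> 'a::field"
  assumes "B 1 \<noteq> B 0"
  shows "sol n s B v \<longleftrightarrow> (\<exists>u w. \<forall>i\<in>{0, 1} \<union> {2..n}. v i ^ s = u + w * B i)"
proof
  assume sol: "sol n s B v"
  define w where "w = (v 1 ^ s - v 0 ^ s) / (B 1 - B 0)"
  have w: "w * (B 1 - B 0) = v 1 ^ s - v 0 ^ s" using assms by (simp add: w_def)
  have "v i ^ s = (v 0 ^ s - w * B 0) + w * B i" if "i \<in> {0, 1} \<union> {2..n}" for i
  proof (cases "i \<in> {2..n}")
    case True
    then have "(B 1 - B 0) * v i ^ s = (B 1 - B i) * v 0 ^ s + (B i - B 0) * v 1 ^ s"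
      using sol by (auto simp: sol_def algebra_simps eq_neg_iff_add_eq_0)
    also have "v 1 ^ s = v 0 ^ s + w * (B 1 - B 0)" using w by simp
    finally have "(B 1 - B 0) * v i ^ s = (B 1 - B 0) * ((v 0 ^ s - w * B 0) + w * B i)"
      by (simp add: algebra_simps)
    then show ?thesis using assms by simp
  next
    case False
    then have "i = 0 \<or> i = 1" using that by auto
    then show ?thesis using w by (auto simp: algebra_simps)
  qed
  then show "\<exists>u w. \<forall>i\<in>{0, 1} \<union> {2..n}. v i ^ s = u + w * B i" by blast
next
  assume "\<exists>u w. \<forall>i\<in>{0, 1} \<union> {2..n}. v i ^ s = u + w * B i"
  then obtain u w where uw: "\<And>i. i \<in> {0, 1} \<union> {2..n} \<Longrightarrow> v i ^ s = u + w * B i" by blast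
  show "sol n s B v"
    unfolding sol_def
  proof
    fix i assume "i \<in> {2..n}"
    then show "(B i - B 1) * v 0 ^ s + (B 0 - B i) * v 1 ^ s + (B 1 - B 0) * v i ^ s = 0"
      using uw[of i] uw[of 0] uw[of 1] by (simp add: algebra_simps)
  qed
qed

text \<open>By \<open>sol_iff_affine\<close> the s-th powers are an affine function of
  \<open>B i\<close>; an affine function with two distinct zeros vanishes. Hence at a point of the
  curve at most one coordinate is zero.\<close>

lemma sol_two_zeros:
  fixes v :: "nat \<Rightarrow> 'a::field"
  assumes sol: "sol n s B v" and inj: "inj_on B {..n}" and n: "1 \<le> n" and s: "0 < s"
    and ij: "i \<le> n" "j \<le> n" "i \<noteq> j" "v i = 0" "v j = 0" and k: "k \<le> n"
  shows "v k = 0"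
proof -
  have "B 1 \<noteq> B 0" using inj n by (auto dest: inj_onD)
  then obtain u w where uw: "\<And>i. i \<in> {0, 1} \<union> {2..n} \<Longrightarrow> v i ^ s = u + w * B i"
    using iffD1[OF sol_iff_affine[OF \<open>B 1 \<noteq> B 0\<close>] sol] by blast
  have uw: "v i ^ s = u + w * B i" if "i \<le> n" for i
    by (rule uw) (use that in auto)
  have "u + w * B i = 0" "u + w * B j = 0"
    using uw[OF ij(1)] uw[OF ij(2)] ij s by (simp_all add: zero_power)
  moreover have "w * (B i - B j) = (u + w * B i) - (u + w * B j)" by (simp add: algebra_simps)
  ultimately have "w * (B i - B j) = 0" by simp
  moreover have "B i \<noteq> B j" using inj ij by (auto dest: inj_onD)
  ultimately have "w = 0" by simp
  with \<open>u + w * B i = 0\<close> have "u = 0" by simp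
  then have "v k ^ s = 0" using uw[OF k] \<open>w = 0\<close> by simp
  then show ?thesis by simp
qed

section \<open>Roots of power series and the substitution of zX for X\<close>

lemma fps_root_exists:
  fixes f :: "'a::field_char_0 fps"
  assumes "f $ 0 = r ^ s" "r \<noteq> 0" "0 < s"
  shows "\<exists>g. g ^ s = f \<and> g $ 0 = r"
proof -
  obtain k where k: "s = Suc k" using assms(3) by (cases s) auto
  have "fps_radical (\<lambda>_ _. r) (Suc k) f ^ Suc k = f"
    by (subst power_radical[symmetric]) (use assms k in auto)
  moreover have "fps_radical (\<lambda>_ _. r) (Suc k) f $ 0 = r" by simp
  ultimately show ?thesis unfolding k by blast
qed

text \<open>The constant term of the cofactor is s times \<open>(f $ 0) ^ (s - 1)\<close>, nonzero
  in characteristic 0. So \<open>f ^ s - g ^ s\<close> and \<open>f - g\<close> have the same order,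
  which gives uniqueness of roots and, later, orders of contact.\<close>

lemma fps_power_diff_factor:
  fixes f g :: "'a::field_char_0 fps"
  assumes "f $ 0 = g $ 0" "f $ 0 \<noteq> 0" "0 < s"
  obtains h where "f ^ s - g ^ s = (f - g) * h" "h $ 0 \<noteq> 0"
proof -
  obtain k where k: "s = Suc k" using assms(3) by (cases s) auto
  let ?h = "\<Sum>i<Suc k. g ^ (Suc k - Suc i) * f ^ i"
  have "?h $ 0 = (\<Sum>i<Suc k. (f $ 0) ^ k)"
    unfolding fps_sum_nth
  proof (rule sum.cong[OF refl])
    fix i assume "i \<in> {..<Suc k}"
    then have "(f $ 0) ^ (k - i) * (f $ 0) ^ i = (f $ 0) ^ k" by (simp flip: power_add)
    then show "(g ^ (Suc k - Suc i) * f ^ i) $ 0 = (f $ 0) ^ k"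
      using assms(1) by (simp add: fps_power_zeroth)
  qed
  then have "?h $ 0 = of_nat (Suc k) * (f $ 0) ^ k" by simp
  then have "?h $ 0 \<noteq> 0" using assms(2) by (simp del: of_nat_Suc)
  moreover have "f ^ s - g ^ s = (f - g) * ?h" unfolding k by (rule power_diff_sumr2)
  ultimately show ?thesis using that by blast
qed

lemma fps_root_unique:
  fixes f g :: "'a::field_char_0 fps"
  assumes "f ^ s = g ^ s" "f $ 0 = g $ 0" "f $ 0 \<noteq> 0" "0 < s"
  shows "f = g"
proof -
  obtain h where "f ^ s - g ^ s = (f - g) * h" "h $ 0 \<noteq> 0"
    using fps_power_diff_factor[OF assms(2-4)] .
  then show ?thesis using assms(1) by auto
qed

text \<open>The substitution of zX for X. For z an s-th root of unity it realises, on the arc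
  through a ramified point, the action of the group on the vanishing coordinate.\<close>

definition twist :: "'a::comm_ring_1 \<Rightarrow> 'a fps \<Rightarrow> 'a fps" where
  "twist z f = Abs_fps (\<lambda>k. z ^ k * f $ k)"

lemma twist_nth [simp]: "twist z f $ k = z ^ k * f $ k"
  by (simp add: twist_def)

lemma coeff_hom_twist: "coeff_hom (twist z)"
proof
  show "twist z 1 = 1" by (rule fps_ext) auto
  show "twist z (a + b) = twist z a + twist z b" for a b by (rule fps_ext) (simp add: distrib_left)
  show "twist z (a * b) = twist z a * twist z b" for a b
  proof (rule fps_ext)
    fix k
    have "z ^ k * (\<Sum>i=0..k. a $ i * b $ (k - i)) = (\<Sum>i=0..k. (z ^ i * a $ i) * (z ^ (k - i) * b $ (k - i)))"
      unfolding sum_distrib_left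
    proof (rule sum.cong[OF refl])
      fix i assume "i \<in> {0..k}"
      then have "z ^ k = z ^ i * z ^ (k - i)" by (simp flip: power_add)
      then show "z ^ k * (a $ i * b $ (k - i)) = (z ^ i * a $ i) * (z ^ (k - i) * b $ (k - i))"
        by (simp add: mult_ac)
    qed
    then show "twist z (a * b) $ k = (twist z a * twist z b) $ k"
      by (simp add: fps_mult_nth)
  qed
qed

interpretation twist: coeff_hom "twist z" by (rule coeff_hom_twist)

lemma twist_const [simp]: "twist z (fps_const a) = fps_const a"
  by (rule fps_ext) simp

lemma twist_X [simp]: "twist z fps_X = fps_const z * fps_X"
  by (rule fps_ext) (auto simp: le_Suc_eq)

text \<open>The second clause says that the ratio of \<open>y 0\<close> and \<open>y 1\<close> is
  not constant, so no nonzero binary linear form vanishes along the arc. This rules out constant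
  solutions.\<close>

definition arc :: "nat \<Rightarrow> nat \<Rightarrow> (nat \<Rightarrow> 'a::field) \<Rightarrow> (nat \<Rightarrow> 'a fps) \<Rightarrow> bool" where
  "arc n s B y \<longleftrightarrow> sol n s (\<lambda>i. fps_const (B i)) y \<and>
    (\<forall>a b. (a, b) \<noteq> (0, 0) \<longrightarrow> fps_const b * y 0 \<noteq> fps_const a * y 1)"

text \<open>A good arc parametrises a branch of the curve at v with a uniformiser as parameter. At a point
  where some $Y_i$ with $i \ge 2$ vanishes, $(Y_0 : Y_1)$ is ramified of order s.\<close>

definition good :: "nat \<Rightarrow> nat \<Rightarrow> (nat \<Rightarrow> 'a::field) \<Rightarrow> (nat \<Rightarrow> 'a) \<Rightarrow> (nat \<Rightarrow> 'a fps) \<Rightarrow> bool" where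
  "good n s B v y \<longleftrightarrow> arc n s B y \<and> (\<forall>i\<le>n. y i $ 0 = v i) \<and>
    ((\<forall>i\<in>{2..n}. v i \<noteq> 0) \<longrightarrow> subdegree (fps_const (v 1) * y 0 - fps_const (v 0) * y 1) = 1) \<and>
    (\<forall>i\<in>{2..n}. v i = 0 \<longrightarrow> (\<exists>c. c \<noteq> 0 \<and> y i = fps_const c * fps_X) \<and>
       subdegree (fps_const (v 1) * y 0 - fps_const (v 0) * y 1) = s)"

lemma subdegree_const_X: "c \<noteq> 0 \<Longrightarrow> subdegree (fps_const c * fps_X :: 'a::field fps) = 1"
  by (subst subdegree_mult) auto

lemma subdegree_const_mult: "c \<noteq> 0 \<Longrightarrow> subdegree (fps_const c * f :: 'a::field fps) = subdegree f"
  by (cases "f = 0") auto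

text \<open>Where \<open>v i\<close> is nonzero, \<open>Y_i\<close> is an s-th root of a power
  series with constant term \<open>v i ^ s\<close>, hence is determined by \<open>Y_0\<close>,
  \<open>Y_1\<close> and its starting value.\<close>

lemma sol_extend:
  fixes B :: "nat \<Rightarrow> 'a::field_char_0"
  assumes sol: "sol n s B v" and B: "B 1 \<noteq> B 0" and s: "0 < s"
    and y: "y0 $ 0 = v 0" "y1 $ 0 = v 1" and S: "S \<subseteq> {2..n}" "\<And>i. i \<in> S \<Longrightarrow> v i \<noteq> 0"
  obtains g where "\<And>i. i \<in> S \<Longrightarrow> g i $ 0 = v i"
    "\<And>i. i \<in> S \<Longrightarrow> fps_const (B i - B 1) * y0 ^ s + fps_const (B 0 - B i) * y1 ^ s
      + fps_const (B 1 - B 0) * g i ^ s = 0"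
proof -
  have "\<exists>g. g $ 0 = v i \<and> fps_const (B i - B 1) * y0 ^ s + fps_const (B 0 - B i) * y1 ^ s
      + fps_const (B 1 - B 0) * g ^ s = 0" if i: "i \<in> S" for i
  proof -
    define f where "f = fps_const (1 / (B 1 - B 0)) *
      - (fps_const (B i - B 1) * y0 ^ s + fps_const (B 0 - B i) * y1 ^ s)"
    have "(B i - B 1) * v 0 ^ s + (B 0 - B i) * v 1 ^ s + (B 1 - B 0) * v i ^ s = 0"
      using sol i S unfolding sol_def by blast
    then have "(B 1 - B 0) * v i ^ s = - ((B i - B 1) * v 0 ^ s + (B 0 - B i) * v 1 ^ s)"
      by (simp only: eq_neg_iff_add_eq_0) (simp add: add.commute)
    then have "1 / (B 1 - B 0) * - ((B i - B 1) * v 0 ^ s + (B 0 - B i) * v 1 ^ s)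
      = 1 / (B 1 - B 0) * ((B 1 - B 0) * v i ^ s)" by simp
    also have "\<dots> = v i ^ s" using B by simp
    also have "1 / (B 1 - B 0) * - ((B i - B 1) * v 0 ^ s + (B 0 - B i) * v 1 ^ s) = f $ 0"
      using y by (simp add: f_def fps_power_zeroth)
    finally have f0: "f $ 0 = v i ^ s" .
    obtain g where g: "g ^ s = f" "g $ 0 = v i"
      using fps_root_exists[OF f0 S(2)[OF i] s] by auto
    have "fps_const (B 1 - B 0) * f = fps_const ((B 1 - B 0) * (1 / (B 1 - B 0))) *
      - (fps_const (B i - B 1) * y0 ^ s + fps_const (B 0 - B i) * y1 ^ s)"
      unfolding f_def fps_const_mult[symmetric] mult.assoc ..
    then have "fps_const (B 1 - B 0) * f = - (fps_const (B i - B 1) * y0 ^ s + fps_const (B 0 - B i) * y1 ^ s)"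
      using B by simp
    then show ?thesis using g by (intro exI[of _ g]) simp
  qed
  then obtain g where "\<forall>i\<in>S. g i $ 0 = v i \<and> fps_const (B i - B 1) * y0 ^ s
      + fps_const (B 0 - B i) * y1 ^ s + fps_const (B 1 - B 0) * g i ^ s = 0"
    by metis
  then show ?thesis using that by blast
qed

lemma good_exists_unramified:
  fixes B :: "nat \<Rightarrow> 'a::field_char_0"
  assumes sol: "sol n s B v" and B: "B 1 \<noteq> B 0" and s: "0 < s" and n: "1 \<le> n"
    and v: "v 0 \<noteq> 0 \<or> v 1 \<noteq> 0" "\<And>i. i \<in> {2..n} \<Longrightarrow> v i \<noteq> 0"
  shows "\<exists>y. good n s B v y"
proof -
  \<comment> \<open>A direction not proportional to (\<open>v 0\<close>, \<open>v 1\<close>); moving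
    along it gives the binary linear form through v order exactly one.\<close>
  obtain w0 w1 where w: "v 1 * w0 - v 0 * w1 \<noteq> 0"
    using v(1) by (metis diff_0_right diff_zero mult_1_right mult_zero_right neg_equal_0_iff_equal diff_0)
  define y0 where "y0 = fps_const (v 0) + fps_const w0 * fps_X"
  define y1 where "y1 = fps_const (v 1) + fps_const w1 * fps_X"
  have y01: "y0 $ 0 = v 0" "y1 $ 0 = v 1" by (simp_all add: y0_def y1_def)
  obtain g where g: "\<And>i. i \<in> {2..n} \<Longrightarrow> g i $ 0 = v i"
    "\<And>i. i \<in> {2..n} \<Longrightarrow> fps_const (B i - B 1) * y0 ^ s + fps_const (B 0 - B i) * y1 ^ s
      + fps_const (B 1 - B 0) * g i ^ s = 0"
    using sol_extend[OF sol B s y01 subset_refl v(2)] by metis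
  define y where "y i = (if i = 0 then y0 else if i = 1 then y1 else g i)" for i
  have [simp]: "y 0 = y0" "y 1 = y1" "y (Suc 0) = y1" by (auto simp: y_def)
  have yi: "y i = g i" if "2 \<le> i" for i using that by (auto simp: y_def)
  have "sol n s (\<lambda>i. fps_const (B i)) y"
    unfolding sol_def
  proof
    fix i assume i: "i \<in> {2..n}"
    then show "(fps_const (B i) - fps_const (B 1)) * y 0 ^ s + (fps_const (B 0) - fps_const (B i)) * y 1 ^ s
      + (fps_const (B 1) - fps_const (B 0)) * y i ^ s = 0"
      using g(2)[OF i] yi[of i] by simp
  qed
  moreover have "fps_const b * y 0 \<noteq> fps_const a * y 1" if ab: "(a, b) \<noteq> (0, 0)" for a b
  proof
    assume e: "fps_const b * y 0 = fps_const a * y 1"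
    have 1: "b * v 0 = a * v 1" using arg_cong[OF e, of "\<lambda>f. f $ 0"] by (simp add: y0_def y1_def)
    have 2: "b * w0 = a * w1" using arg_cong[OF e, of "\<lambda>f. f $ 1"] by (simp add: y0_def y1_def)
    have "b * (v 1 * w0 - v 0 * w1) = v 1 * (b * w0) - w1 * (b * v 0)"
      "a * (v 1 * w0 - v 0 * w1) = w0 * (a * v 1) - v 0 * (a * w1)"
      by (simp_all add: algebra_simps)
    moreover have "v 1 * (b * w0) - w1 * (b * v 0) = 0"
      unfolding 1 2 by (simp add: mult_ac)
    moreover have "w0 * (a * v 1) - v 0 * (a * w1) = 0"
      unfolding 1[symmetric] 2[symmetric] by (simp add: mult_ac)
    ultimately have "b * (v 1 * w0 - v 0 * w1) = 0" "a * (v 1 * w0 - v 0 * w1) = 0" by simp_all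
    then show False using w ab by auto
  qed
  ultimately have arc: "arc n s B y" by (simp add: arc_def)
  have ring: "a * (b + c * x) - b * (a + d * x) = (a * c - b * d) * x" for a b c d x :: "'a fps"
    by (simp add: algebra_simps)
  have "fps_const (v 1) * y 0 - fps_const (v 0) * y 1 = fps_const (v 1 * w0 - v 0 * w1) * fps_X"
    unfolding \<open>y 0 = y0\<close> \<open>y 1 = y1\<close> y0_def y1_def ring
    by (simp only: fps_const_mult fps_const_sub)
  then have "subdegree (fps_const (v 1) * y 0 - fps_const (v 0) * y 1) = 1"
    using subdegree_const_X[OF w] by (simp only:)
  moreover have "\<forall>i\<le>n. y i $ 0 = v i"
    using g(1) by (auto simp: y_def y0_def y1_def)
  ultimately have "good n s B v y" using arc v(2) by (auto simp: good_def)
  then show ?thesis by blast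
qed

text \<open>With \<open>Y_k\<close> itself as the parameter X and \<open>Y_0\<close> constant, all
  other s-th powers are series in X^s with nonzero constant term, and so are their roots. Hence X ->
  zX with z^s = 1 moves \<open>Y_k\<close> only; \<open>arc_vanishing\<close> rests on this
  invariance.\<close>

lemma good_exists_ramified:
  fixes B :: "nat \<Rightarrow> 'a::field_char_0"
  assumes sol: "sol n s B v" and inj: "inj_on B {..n}" and s: "0 < s"
    and v: "v 0 \<noteq> 0 \<or> v 1 \<noteq> 0" and k: "k \<in> {2..n}" "v k = 0"
  shows "\<exists>y. good n s B v y \<and> y k = fps_X \<and>
    (\<forall>z. z ^ s = 1 \<longrightarrow> (\<forall>i\<le>n. i \<noteq> k \<longrightarrow> twist z (y i) = y i))"
proof -
  have n: "1 \<le> n" using k by auto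
  have B: "B i \<noteq> B j" if "i \<le> n" "j \<le> n" "i \<noteq> j" for i j
    using inj that by (auto dest: inj_onD)
  have B10: "B 1 \<noteq> B 0" using B[of 1 0] n by auto
  have nz: "v i \<noteq> 0" if "i \<le> n" "i \<noteq> k" for i
    using sol_two_zeros[OF sol inj n s that(1) _ that(2) _ k(2), of 0]
      sol_two_zeros[OF sol inj n s that(1) _ that(2) _ k(2), of 1] k v n by auto
  have v0: "v 0 \<noteq> 0" and v1: "v 1 \<noteq> 0" using nz[of 0] nz[of 1] k by auto
  have eqk: "(B k - B 1) * v 0 ^ s + (B 0 - B k) * v 1 ^ s = 0"
    using sol k s unfolding sol_def by (auto simp: zero_power dest!: bspec[of _ _ k])
  \<comment> \<open>The k-th equation solved for \<open>Y_1^s\<close>, with \<open>Y_0 = v 0\<close>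
    and \<open>Y_k = X\<close>.\<close>
  define f1 where "f1 = fps_const (1 / (B 0 - B k)) *
    - (fps_const (B k - B 1) * fps_const (v 0) ^ s + fps_const (B 1 - B 0) * fps_X ^ s)"
  have B0k: "B 0 - B k \<noteq> 0" using B[of 0 k] k by auto
  have "(B 0 - B k) * v 1 ^ s = - ((B k - B 1) * v 0 ^ s)"
    using eqk by (simp only: eq_neg_iff_add_eq_0) (simp add: add.commute)
  moreover have "f1 $ 0 = 1 / (B 0 - B k) * - ((B k - B 1) * v 0 ^ s)"
    using s by (simp add: f1_def fps_power_zeroth zero_power)
  ultimately have "f1 $ 0 = 1 / (B 0 - B k) * ((B 0 - B k) * v 1 ^ s)" by simp
  then have f10: "f1 $ 0 = v 1 ^ s"
    using B0k by simp
  obtain y1 where y1: "y1 ^ s = f1" "y1 $ 0 = v 1"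
    using fps_root_exists[OF f10 v1 s] by auto
  have "fps_const (B 0 - B k) * f1 = fps_const ((B 0 - B k) * (1 / (B 0 - B k))) *
    - (fps_const (B k - B 1) * fps_const (v 0) ^ s + fps_const (B 1 - B 0) * fps_X ^ s)"
    unfolding f1_def fps_const_mult[symmetric] mult.assoc ..
  then have f1: "fps_const (B 0 - B k) * f1 = - (fps_const (B k - B 1) * fps_const (v 0) ^ s + fps_const (B 1 - B 0) * fps_X ^ s)"
    using B0k by simp
  define y0 where "y0 = fps_const (v 0)"
  have y00: "y0 $ 0 = v 0" by (simp add: y0_def)
  have nz': "v i \<noteq> 0" if "i \<in> {2..n} - {k}" for i using nz that by auto
  obtain g where g: "\<And>i. i \<in> {2..n} - {k} \<Longrightarrow> g i $ 0 = v i"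
    "\<And>i. i \<in> {2..n} - {k} \<Longrightarrow> fps_const (B i - B 1) * y0 ^ s + fps_const (B 0 - B i) * y1 ^ s
      + fps_const (B 1 - B 0) * g i ^ s = 0"
    using sol_extend[OF sol B10 s y00 y1(2) Diff_subset nz'] by metis
  define y where "y i = (if i = 0 then y0 else if i = 1 then y1 else if i = k then fps_X else g i)" for i
  have [simp]: "y 0 = y0" "y 1 = y1" "y (Suc 0) = y1" "y k = fps_X" using k by (auto simp: y_def)
  have yi: "y i = g i" if "2 \<le> i" "i \<noteq> k" for i using that by (auto simp: y_def)
  have sy: "sol n s (\<lambda>i. fps_const (B i)) y"
    unfolding sol_def
  proof
    fix i assume i: "i \<in> {2..n}"
    show "(fps_const (B i) - fps_const (B 1)) * y 0 ^ s + (fps_const (B 0) - fps_const (B i)) * y 1 ^ s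
      + (fps_const (B 1) - fps_const (B 0)) * y i ^ s = 0"
    proof (cases "i = k")
      case True
      then show ?thesis using f1 y1 by (simp add: y0_def)
    next
      case False
      then show ?thesis using g(2)[of i] yi[of i] i by simp
    qed
  qed
  obtain h where h: "y1 ^ s - fps_const (v 1) ^ s = (y1 - fps_const (v 1)) * h" "h $ 0 \<noteq> 0"
    using fps_power_diff_factor[of y1 "fps_const (v 1)" s] y1 v1 s by auto
  \<comment> \<open>Subtracting the k-th equation at v itself leaves a multiple of X^s, so
    \<open>y1\<close> differs from its constant term to order exactly s.\<close>
  have "fps_const (B 0 - B k) * (f1 - fps_const (v 1) ^ s) =
     - (fps_const ((B k - B 1) * v 0 ^ s + (B 0 - B k) * v 1 ^ s) + fps_const (B 1 - B 0) * fps_X ^ s)"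
    unfolding right_diff_distrib f1 by (simp add: fps_const_power algebra_simps)
  then have "fps_const (B 0 - B k) * ((y1 - fps_const (v 1)) * h) = fps_const (- (B 1 - B 0)) * fps_X ^ s"
    unfolding eqk h(1)[symmetric] y1(1) fps_const_neg[symmetric] fps_const_0_eq_0 by (simp only: add_0 mult_minus_left)
  then have "subdegree (fps_const (B 0 - B k) * ((y1 - fps_const (v 1)) * h))
     = subdegree (fps_const (- (B 1 - B 0)) * fps_X ^ s :: 'a fps)" by simp
  also have "\<dots> = s" using B10 by (subst subdegree_const_mult) auto
  finally have sd0: "subdegree ((y1 - fps_const (v 1)) * h) = s"
    unfolding subdegree_const_mult[OF B0k] .
  have nz1: "y1 - fps_const (v 1) \<noteq> 0" using sd0 s by auto
  then have sd: "subdegree (y1 - fps_const (v 1)) = s"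
    using sd0 h(2) by (subst (asm) subdegree_mult) auto
  have ring: "a * b - b * c = - b * (c - a)" for a b c :: "'a fps" by (simp add: algebra_simps)
  have "fps_const (v 1) * y 0 - fps_const (v 0) * y 1 = fps_const (- v 0) * (y1 - fps_const (v 1))"
    unfolding \<open>y 0 = y0\<close> \<open>y 1 = y1\<close> y0_def ring fps_const_neg[symmetric] ..
  then have sd1: "subdegree (fps_const (v 1) * y 0 - fps_const (v 0) * y 1) = s"
    using subdegree_const_mult[of "- v 0" "y1 - fps_const (v 1)"] v0 sd by (simp only: neg_equal_0_iff_equal not_False_eq_True)
  have "fps_const b * y 0 \<noteq> fps_const a * y 1" if ab: "(a, b) \<noteq> (0, 0)" for a b
  proof
    assume e: "fps_const b * y 0 = fps_const a * y 1"
    have "fps_const a * (y1 - fps_const (v 1)) = fps_const b * y 0 - fps_const a * fps_const (v 1)"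
      unfolding e right_diff_distrib \<open>y 1 = y1\<close> ..
    then have "fps_const a * (y1 - fps_const (v 1)) = fps_const (b * v 0 - a * v 1)"
      by (simp only: \<open>y 0 = y0\<close> y0_def fps_const_mult fps_const_sub)
    moreover from arg_cong[OF this, of "\<lambda>f. f $ 0"] have "b * v 0 - a * v 1 = 0"
      using y1(2) by (simp only: fps_mult_nth_0 fps_sub_nth) simp
    ultimately have "a = 0" using nz1 by auto
    then show False using e v0 ab by (auto simp: y0_def)
  qed
  then have arc: "arc n s B y" using sy by (simp add: arc_def)
  have const: "\<forall>i\<le>n. y i $ 0 = v i"
    using g(1) y1 k by (auto simp: y_def y0_def)
  have "(\<exists>c. c \<noteq> 0 \<and> y i = fps_const c * fps_X)" if "i \<in> {2..n}" "v i = 0" for i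
    using nz[of i] that by (intro exI[of _ 1]) (cases "i = k"; auto)
  then have "good n s B v y"
    using arc const sd1 k by (auto simp: good_def)
  moreover have "twist z (y i) = y i" if z: "z ^ s = 1" and i: "i \<le> n" "i \<noteq> k" for z i
  proof (cases "i = 0")
    case True then show ?thesis by (simp add: y0_def)
  next
    case False
    \<comment> \<open>The twist of \<open>y1\<close> is again a root of \<open>f1\<close>, since
      \<open>f1\<close> contains X only through X^s, and it has the same nonzero constant
      term.\<close>
    have t1: "twist z y1 = y1"
    proof (rule fps_root_unique)
      have "twist z (fps_X ^ s) = fps_X ^ s"
        using z by (simp add: power_mult_distrib fps_const_power)
      then have "twist z f1 = f1" by (simp add: f1_def)
      then show "twist z y1 ^ s = y1 ^ s" using y1 by (simp flip: twist.c_power)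
    qed (use y1 v1 s in auto)
    show ?thesis
    proof (cases "i = 1")
      case True then show ?thesis using t1 by simp
    next
      case False
      then have i2: "i \<in> {2..n} - {k}" using i \<open>i \<noteq> 0\<close> by auto
      have "twist z (fps_const (B i - B 1) * y0 ^ s + fps_const (B 0 - B i) * y1 ^ s
          + fps_const (B 1 - B 0) * g i ^ s) = 0"
        unfolding g(2)[OF i2] by simp
      then have "fps_const (B i - B 1) * y0 ^ s + fps_const (B 0 - B i) * y1 ^ s
          + fps_const (B 1 - B 0) * twist z (g i) ^ s = 0"
        using t1 by (simp add: y0_def del: fps_const_sub)
      with g(2)[OF i2] have "fps_const (B 1 - B 0) * twist z (g i) ^ s = fps_const (B 1 - B 0) * g i ^ s"
        by (metis add_left_imp_eq)
      then have "twist z (g i) ^ s = g i ^ s" using B10 by (simp del: fps_const_sub)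
      then have "twist z (g i) = g i"
        by (rule fps_root_unique) (use g(1)[OF i2] nz[of i] i s in auto)
      then show ?thesis using i2 yi by auto
    qed
  qed
  ultimately show ?thesis by (intro exI[of _ y]) auto
qed

lemma good_exists:
  fixes B :: "nat \<Rightarrow> 'a::field_char_0"
  assumes "sol n s B v" "inj_on B {..n}" "0 < s" "1 \<le> n" "v 0 \<noteq> 0 \<or> v 1 \<noteq> 0"
  shows "\<exists>y. good n s B v y"
proof (cases "\<exists>k\<in>{2..n}. v k = 0")
  case True
  then show ?thesis using good_exists_ramified assms by blast
next
  case False
  have "B 1 \<noteq> B 0" using assms(2,4) by (auto dest: inj_onD)
  then show ?thesis using good_exists_unramified assms False by blast
qed

section \<open>Binary forms\<close>

text \<open>The homogenisation of p to degree d, evaluated at (x, z) with coefficients moved along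
  c. Choosing d above the degree of p adds zeros at infinity, see
  \<open>hev_infinity\<close>.\<close>

definition hev :: "('a::comm_ring_1 \<Rightarrow> 'b::comm_ring_1) \<Rightarrow> 'b \<Rightarrow> 'b \<Rightarrow> nat \<Rightarrow> 'a poly \<Rightarrow> 'b" where
  "hev c x z d p = (\<Sum>i\<le>d. c (coeff p i) * x ^ i * z ^ (d - i))"

context coeff_hom
begin

lemma hev_infinity:
  assumes "degree p \<le> d"
  shows "hev c x z (Suc d) p = z * hev c x z d p"
proof -
  have "hev c x z (Suc d) p = (\<Sum>i\<le>d. c (coeff p i) * x ^ i * z ^ (Suc d - i))"
    using assms by (simp add: hev_def coeff_eq_0)
  also have "\<dots> = (\<Sum>i\<le>d. z * (c (coeff p i) * x ^ i * z ^ (d - i)))"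
    by (rule sum.cong) (auto simp: Suc_diff_le)
  finally show ?thesis by (simp add: hev_def sum_distrib_left)
qed

lemma hev_add: "hev c x z d (p + q) = hev c x z d p + hev c x z d q"
  by (simp add: hev_def distrib_right sum.distrib)

lemma hev_smult: "hev c x z d (smult a p) = c a * hev c x z d p"
  by (simp add: hev_def sum_distrib_left mult.assoc)

lemma hev_linear:
  assumes "degree p \<le> d"
  shows "hev c x z (Suc d) ([:- a, 1:] * p) = (x - c a * z) * hev c x z d p"
proof -
  have "[:- a, 1:] * p = pCons 0 p + smult (- a) p" by simp
  then have "hev c x z (Suc d) ([:- a, 1:] * p) = hev c x z (Suc d) (pCons 0 p) - c a * hev c x z (Suc d) p"
    by (simp only: hev_add hev_smult) simp
  also have "hev c x z (Suc d) (pCons 0 p) = x * hev c x z d p"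
    unfolding hev_def sum.atMost_Suc_shift by (simp add: sum_distrib_left mult_ac)
  also have "hev c x z (Suc d) p = z * hev c x z d p" using assms by (rule hev_infinity)
  finally show ?thesis by (simp add: algebra_simps)
qed

end

lemma coeff_hom_const: "coeff_hom (msingle 0 :: 'a::comm_ring_1 \<Rightarrow> 'm::comm_monoid_add \<Rightarrow>\<^sub>0 'a)"
  by unfold_locales (auto simp: single_add mult_single)

text \<open>The linear form b \<open>Y_0\<close> - a \<open>Y_1\<close> that vanishes at the point
  (a : b) of the line.\<close>

definition lam :: "'a::comm_ring_1 \<times> 'a \<Rightarrow> (nat \<Rightarrow>\<^sub>0 nat) \<Rightarrow>\<^sub>0 'a" where
  "lam ab = msingle (msingle 0 1) (snd ab) - msingle (msingle 1 1) (fst ab)"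

lemma lam_forms: "1 \<le> n \<Longrightarrow> lam ab \<in> forms n 1"
  unfolding lam_def by (intro forms_diff forms_single) auto

lemma (in coeff_hom) gev_lam: "gev c y (lam ab) = c (snd ab) * y 0 - c (fst ab) * y 1"
  by (simp add: lam_def)

text \<open>One representative for each point of the projective line, so that points of the line can
  be compared and counted as pairs.\<close>

definition P1N :: "('a::field \<times> 'a) set" where
  "P1N = insert (1, 0) {(a, 1) | a. True}"

definition hmp :: "nat \<Rightarrow> 'a::field poly \<Rightarrow> 'a mpol" where
  "hmp = hev (msingle 0) (msingle (msingle 0 1) 1) (msingle (msingle 1 1) 1)"

lemma hmp_eq: "hmp d p = (\<Sum>i\<le>d. msingle (msingle 0 i + msingle 1 (d - i)) (coeff p i))"
  unfolding hmp_def hev_def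
  by (rule sum.cong) (simp_all add: single_power single_multiple mult_single del: sum_constant)

lemma hmp_forms: "hmp d p \<in> forms 1 d"
  unfolding hmp_eq by (intro forms_sum forms_single) (auto simp: keys_add_nat)

lemma hmp_add: "hmp d (p + q) = hmp d p + hmp d q"
  by (simp add: hmp_eq single_add sum.distrib)

lemma hmp_monom: "i \<le> d \<Longrightarrow> hmp d (monom a i) = msingle (msingle 0 i + msingle 1 (d - i)) a"
proof -
  assume i: "i \<le> d"
  have "hmp d (monom a i) = (\<Sum>j\<le>d. if j = i then msingle (msingle 0 i + msingle 1 (d - i)) a else 0)"
    unfolding hmp_eq by (rule sum.cong) auto
  then show ?thesis using i by simp
qed

lemma forms_1_hmp:
  assumes "H \<in> forms 1 d"
  shows "\<exists>p. degree p \<le> d \<and> H = hmp d p"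
  using assms
proof (induction rule: forms_induct)
  case zero
  show ?case by (intro exI[of _ 0]) (simp add: hmp_eq)
next
  case (add m a H)
  then obtain p where p: "degree p \<le> d" "H = hmp d p" by auto
  have "m = msingle 0 (mlookup m 0) + msingle 1 (mlookup m 1)"
  proof (rule poly_mapping_eqI)
    fix k :: nat
    consider "k = 0" | "k = 1" | "k > 1" by linarith
    then show "mlookup m k = mlookup (msingle 0 (mlookup m 0) + msingle 1 (mlookup m 1)) k"
      using add.hyps by cases (auto simp: lookup_add lookup_single in_keys_iff subset_iff when_def)
  qed
  moreover from arg_cong[OF this, of mdeg] have "d = mlookup m 0 + mlookup m 1"
    using add.hyps by simp
  ultimately have "mlookup m 0 \<le> d" "m = msingle 0 (mlookup m 0) + msingle 1 (d - mlookup m 0)" by auto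
  then have "msingle m a + H = hmp d (monom a (mlookup m 0) + p)" "degree (monom a (mlookup m 0)) \<le> d"
    using p by (auto simp: hmp_add hmp_monom intro: order.trans[OF degree_monom_le])
  then show ?case using p(1) degree_add_le by blast
qed

lemma gev_hmp:
  assumes "coeff_hom c"
  shows "gev c y (hmp d p) = (\<Sum>i\<le>d. c (coeff p i) * y 0 ^ i * y 1 ^ (d - i))"
proof -
  interpret coeff_hom c by fact
  show ?thesis by (simp add: hmp_eq mult_ac)
qed

lemma lam_dvd_form:
  fixes H :: "'a::field mpol"
  assumes H: "H \<in> forms 1 (Suc d)" and ab: "ab \<in> P1N"
    and root: "gev (\<lambda>x. x) v H = 0" "v 0 = fst ab" "v 1 = snd ab"
  shows "\<exists>H'\<in>forms 1 d. H = lam ab * H'"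
proof -
  interpret C: coeff_hom "msingle 0 :: 'a \<Rightarrow> 'a mpol" by (rule coeff_hom_const)
  obtain p where p: "degree p \<le> Suc d" "H = hmp (Suc d) p" using forms_1_hmp[OF H] by auto
  have ev: "(\<Sum>i\<le>Suc d. coeff p i * fst ab ^ i * snd ab ^ (Suc d - i)) = 0"
    using root unfolding p(2) gev_hmp[OF coeff_hom_id] by simp
  consider a where "ab = (a, 1)" | "ab = (1, 0)" using ab by (auto simp: P1N_def)
  then show ?thesis
  proof cases
    case (1 a)
    have "(\<Sum>i\<le>Suc d. coeff p i * a ^ i) = 0" using ev 1 by simp
    moreover have "poly p a = (\<Sum>i\<le>Suc d. coeff p i * a ^ i)"
      unfolding poly_altdef by (rule sum.mono_neutral_left) (use p(1) in \<open>auto simp: coeff_eq_0\<close>)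
    ultimately have "[:- a, 1:] dvd p" by (simp add: poly_eq_0_iff_dvd)
    then obtain q where q: "p = [:- a, 1:] * q" by auto
    have "degree q \<le> d"
    proof (cases "q = 0")
      case False
      then have "degree p = Suc (degree q)" unfolding q by (subst degree_mult_eq) auto
      then show ?thesis using p(1) by simp
    qed simp
    then have "H = lam ab * hmp d q"
      unfolding p(2) hmp_def q by (subst C.hev_linear) (auto simp: lam_def 1 mult_single)
    then show ?thesis using hmp_forms by blast
  next
    case 2
    \<comment> \<open>At (1 : 0) the value of H is the top coefficient of p. If it vanishes, the
      degree of p drops and \<open>Y_1\<close>, which is \<open>lam\<close> of this point up to
      sign, splits off.\<close>
    have "(\<Sum>i\<le>d. coeff p i * 1 ^ i * 0 ^ (Suc d - i)) = 0" by (rule sum.neutral) (auto simp: power_0_left)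
    then have "coeff p (Suc d) = 0" using ev 2 by simp
    then have "degree p \<le> d" using p(1) by (metis le_Suc_eq leading_coeff_0_iff degree_0 le0)
    then have "H = msingle (msingle 1 1) 1 * hmp d p"
      unfolding p(2) hmp_def by (rule C.hev_infinity)
    also have "\<dots> = lam ab * hmp d (- p)"
    proof -
      have "hmp d (- p) = - hmp d p" using hmp_add[of d p "- p"] by (simp add: hmp_eq eq_neg_iff_add_eq_0 add.commute)
      moreover have "lam ab = - msingle (msingle 1 1) 1" by (simp add: lam_def 2)
      ultimately show ?thesis by simp
    qed
    finally show ?thesis using hmp_forms by blast
  qed
qed

lemma binary_root_exists:
  fixes H :: "'a::alg_closed_field mpol"
  assumes H: "H \<in> forms 1 (Suc d)"
  shows "\<exists>ab\<in>P1N. \<forall>v. v 0 = fst ab \<longrightarrow> v 1 = snd ab \<longrightarrow> gev (\<lambda>x. x) v H = 0"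
proof -
  obtain p where p: "degree p \<le> Suc d" "H = hmp (Suc d) p" using forms_1_hmp[OF H] by auto
  show ?thesis
  proof (cases "coeff p (Suc d) = 0")
    case True
    have "(\<Sum>i\<le>d. coeff p i * 1 ^ i * 0 ^ (Suc d - i)) = 0" by (rule sum.neutral) (auto simp: power_0_left)
    then show ?thesis
      using True unfolding p(2) gev_hmp[OF coeff_hom_id] by (intro bexI[of _ "(1, 0)"]) (auto simp: P1N_def)
  next
    case False
    then have "0 < degree p" using le_degree[of p "Suc d"] by auto
    then obtain a where a: "poly p a = 0" using alg_closed_imp_poly_has_root by blast
    moreover have "poly p a = (\<Sum>i\<le>Suc d. coeff p i * a ^ i)"
      unfolding poly_altdef by (rule sum.mono_neutral_left) (use p(1) in \<open>auto simp: coeff_eq_0\<close>)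
    ultimately show ?thesis
      unfolding p(2) gev_hmp[OF coeff_hom_id] by (intro bexI[of _ "(a, 1)"]) (auto simp: P1N_def)
  qed
qed

text \<open>The list \<open>ps\<close> is the zero divisor of H on the line. Through norms its
  length, the degree of H, later becomes the degree of a hyperplane section.\<close>

lemma binary_factor:
  fixes H :: "'a::alg_closed_field mpol"
  assumes "H \<in> forms 1 d" "H \<noteq> 0"
  shows "\<exists>c ps. c \<noteq> 0 \<and> length ps = d \<and> set ps \<subseteq> P1N \<and> H = msingle 0 c * prod_list (map lam ps)"
  using assms
proof (induction d arbitrary: H)
  case 0
  obtain p where "H = hmp 0 p" using forms_1_hmp[OF 0(1)] by auto
  then have "H = msingle 0 (coeff p 0)" by (simp add: hmp_eq)
  then show ?case using 0 by (intro exI[of _ "coeff p 0"] exI[of _ "[]"]) auto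
next
  case (Suc d)
  obtain ab where ab: "ab \<in> P1N" "\<forall>v. v 0 = fst ab \<longrightarrow> v 1 = snd ab \<longrightarrow> gev (\<lambda>x. x) v H = 0"
    using binary_root_exists[OF Suc.prems(1)] by auto
  obtain H' where H': "H' \<in> forms 1 d" "H = lam ab * H'"
    using lam_dvd_form[OF Suc.prems(1) ab(1), of "\<lambda>i. if i = 0 then fst ab else snd ab"] ab(2) by auto
  then have "H' \<noteq> 0" using Suc.prems by auto
  then obtain c ps where "c \<noteq> 0" "length ps = d" "set ps \<subseteq> P1N" "H' = msingle 0 c * prod_list (map lam ps)"
    using Suc.IH[OF H'(1)] by auto
  then show ?case using ab(1) H'(2) by (intro exI[of _ c] exI[of _ "ab # ps"]) (auto simp: mult_ac)
qed

section \<open>Isotypic decomposition and norms\<close>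

abbreviation "fev \<equiv> gev fps_const"

locale curve =
  fixes n s :: nat and B :: "nat \<Rightarrow> 'a::{alg_closed_field, field_char_0}" and \<zeta> :: 'a
  assumes n2: "2 \<le> n" and s2: "2 \<le> s" and inj_B: "inj_on B {..n}"
    and prim: "primitive_root_of_unity s \<zeta>"
begin

abbreviation "cB \<equiv> (\<lambda>i. fps_const (B i))"

lemma B10: "B 1 \<noteq> B 0"
  using inj_B n2 by (auto dest: inj_onD)

lemma s0: "0 < s" using s2 by simp

lemma sol_qf:
  assumes "sol m s cB y" "i \<in> {2..m}"
  shows "y i ^ s = fev y (qf s B i)"
proof -
  have "(\<forall>f\<in>crv m s B. fev y f = 0)"
    using assms(1) gev_crv_zero_iff[OF fps_const_hom.coeff_hom_axioms] by blast
  then have "fev y (eqn s B i) = 0" using assms(2) by (auto simp: crv_def)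
  then have "fps_const (B 1 - B 0) * (y i ^ s - fev y (qf s B i)) = 0"
    unfolding eqn_qf[where B = B, OF B10] by simp
  then show ?thesis using B10 by (simp del: fps_const_sub)
qed

lemma sol_mono: "sol m s B' y \<Longrightarrow> l \<le> m \<Longrightarrow> sol l s B' y"
  unfolding sol_def by auto

lemma arc_mono: "arc m s B y \<Longrightarrow> l \<le> m \<Longrightarrow> arc l s B y"
  unfolding arc_def using sol_mono by blast

text \<open>The characters of the group \<open>T l m\<close> below, as exponents modulo s on the
  coordinates above l; \<open>chm\<close> is the monomial on which the group acts by the character
  and \<open>wt\<close> its degree.\<close>

definition Ch :: "nat \<Rightarrow> nat \<Rightarrow> (nat \<Rightarrow> nat) set" where
  "Ch l m = {Suc l..m} \<rightarrow>\<^sub>E {..<s}"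

definition wt :: "nat \<Rightarrow> nat \<Rightarrow> (nat \<Rightarrow> nat) \<Rightarrow> nat" where
  "wt l m \<chi> = (\<Sum>i\<in>{Suc l..m}. \<chi> i)"

definition chm :: "nat \<Rightarrow> nat \<Rightarrow> (nat \<Rightarrow> nat) \<Rightarrow> (nat \<Rightarrow> 'b::comm_ring_1) \<Rightarrow> 'b" where
  "chm l m \<chi> y = (\<Prod>i\<in>{Suc l..m}. y i ^ \<chi> i)"

text \<open>Decomposition of F into isotypic components, valid along solutions, that is, modulo the
  equations. The degree \<open>d - wt l m \<chi>\<close> is cut off at 0, so components of negative
  degree are required to vanish separately.\<close>

definition decomp :: "nat \<Rightarrow> nat \<Rightarrow> nat \<Rightarrow> 'a mpol \<Rightarrow> ((nat \<Rightarrow> nat) \<Rightarrow> 'a mpol) \<Rightarrow> bool" where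
  "decomp l m d F H \<longleftrightarrow>
    (\<forall>\<chi>\<in>Ch l m. H \<chi> \<in> forms l (d - wt l m \<chi>) \<and> (d < wt l m \<chi> \<longrightarrow> H \<chi> = 0)) \<and>
    (\<forall>y. sol m s cB y \<longrightarrow> fev y F = (\<Sum>\<chi>\<in>Ch l m. chm l m \<chi> y * fev y (H \<chi>)))"

lemma finite_Ch: "finite (Ch l m)"
  by (simp add: Ch_def finite_PiE)

lemma decomp_exists:
  assumes "F \<in> forms m d" "1 \<le> l" "l \<le> m"
  shows "\<exists>H. decomp l m d F H"
  using assms(1)
proof (induction rule: forms_induct)
  case zero
  show ?case by (intro exI[of _ "\<lambda>_. 0"]) (auto simp: decomp_def)
next
  case (add \<mu> a F)
  then obtain H where H: "decomp l m d F H" by auto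
  define S where "S = {Suc l..m}"
  \<comment> \<open>The exponents above l modulo s give the character \<chi>, those up to l the
    monomial \<nu>, and the complete s-th powers above l turn into binary forms
    \<open>qf\<close>.\<close>
  define \<chi> where "\<chi> = restrict (\<lambda>i. mlookup \<mu> i mod s) S"
  define \<nu> where "\<nu> = Poly_Mapping.mapp (\<lambda>i k. if i \<le> l then k else 0) \<mu>"
  define G where "G = msingle \<nu> a * (\<Prod>i\<in>S. qf s B i ^ (mlookup \<mu> i div s))"
  have l\<nu>: "mlookup \<nu> i = (if i \<le> l then mlookup \<mu> i else 0)" for i
    by (simp add: \<nu>_def lookup_mapp when_def in_keys_iff)
  have \<mu>: "\<mu> = \<nu> + (\<Sum>i\<in>S. msingle i (mlookup \<mu> i))"
  proof (rule poly_mapping_eqI)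
    fix k
    consider "k \<le> l" | "k \<in> S" | "k > m"
      unfolding S_def by (cases "k \<le> l"; cases "k \<le> m") auto
    then show "mlookup \<mu> k = mlookup (\<nu> + (\<Sum>i\<in>S. msingle i (mlookup \<mu> i))) k"
      using add.hyps(1) assms(3)
      by cases (auto simp: lookup_add lookup_sum l\<nu> lookup_single when_def S_def in_keys_iff subset_iff)
  qed
  have \<chi>: "\<chi> \<in> Ch l m" using s0 by (auto simp: Ch_def \<chi>_def S_def)
  have "d = mdeg \<nu> + (\<Sum>i\<in>S. mlookup \<mu> i)"
    unfolding add.hyps(2)[symmetric] by (subst \<mu>) (simp add: mdeg_sum S_def)
  also have "(\<Sum>i\<in>S. mlookup \<mu> i) = (\<Sum>i\<in>S. (mlookup \<mu> i div s) * s) + wt l m \<chi>"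
    by (simp add: wt_def \<chi>_def S_def flip: sum.distrib)
  finally have d: "d = mdeg \<nu> + (\<Sum>i\<in>S. (mlookup \<mu> i div s) * s) + wt l m \<chi>" by simp
  have "G \<in> forms l (mdeg \<nu> + (\<Sum>i\<in>S. (mlookup \<mu> i div s) * s))"
    unfolding G_def
    by (intro forms_mult forms_prod forms_power forms_single forms_mono[OF qf_forms assms(2)])
       (auto simp: in_keys_iff l\<nu> split: if_splits)
  then have G: "G \<in> forms l (d - wt l m \<chi>)" and "wt l m \<chi> \<le> d" using d by auto
  have ev: "fev y (msingle \<mu> a) = chm l m \<chi> y * fev y G" if y: "sol m s cB y" for y
  proof -
    have "(\<Prod>i\<in>S. y i ^ mlookup \<mu> i) = (\<Prod>i\<in>S. y i ^ \<chi> i * (fev y (qf s B i)) ^ (mlookup \<mu> i div s))"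
    proof (rule prod.cong[OF refl])
      fix i assume i: "i \<in> S"
      then have "i \<in> {2..m}" using assms(2) by (auto simp: S_def)
      then have "y i ^ s = fev y (qf s B i)" by (rule sol_qf[OF y])
      then have "fev y (qf s B i) ^ (mlookup \<mu> i div s) = y i ^ (s * (mlookup \<mu> i div s))"
        by (simp add: power_mult)
      then show "y i ^ mlookup \<mu> i = y i ^ \<chi> i * fev y (qf s B i) ^ (mlookup \<mu> i div s)"
        using i by (simp add: \<chi>_def flip: power_add)
    qed
    also have "\<dots> = chm l m \<chi> y * (\<Prod>i\<in>S. fev y (qf s B i) ^ (mlookup \<mu> i div s))"
      by (simp add: prod.distrib chm_def S_def)
    finally have e: "(\<Prod>i\<in>S. y i ^ mlookup \<mu> i) = \<dots>" .
    have "mon_eval y (\<Sum>i\<in>S. msingle i (mlookup \<mu> i)) = (\<Prod>i\<in>S. y i ^ mlookup \<mu> i)" if "finite S" for S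
      using that by (induction S rule: finite_induct) auto
    then have "mon_eval y \<mu> = mon_eval y \<nu> * (\<Prod>i\<in>S. y i ^ mlookup \<mu> i)"
      by (subst \<mu>) (simp add: S_def)
    then show ?thesis by (simp add: G_def e mult_ac)
  qed
  define H' where "H' = H(\<chi> := G + H \<chi>)"
  have "decomp l m d (msingle \<mu> a + F) H'"
    unfolding decomp_def
  proof (intro conjI ballI allI impI)
    fix \<psi> assume "\<psi> \<in> Ch l m"
    then show "H' \<psi> \<in> forms l (d - wt l m \<psi>)"
      using H G by (auto simp: H'_def decomp_def intro: forms_add)
  next
    fix \<psi> assume "\<psi> \<in> Ch l m" "d < wt l m \<psi>"
    then show "H' \<psi> = 0"
      using H \<open>wt l m \<chi> \<le> d\<close> by (auto simp: H'_def decomp_def)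
  next
    fix y assume y: "sol m s cB y"
    have "(\<Sum>\<psi>\<in>Ch l m. chm l m \<psi> y * fev y (H' \<psi>)) = chm l m \<chi> y * fev y (H' \<chi>)
        + (\<Sum>\<psi>\<in>Ch l m - {\<chi>}. chm l m \<psi> y * fev y (H' \<psi>))"
      by (rule sum.remove[OF finite_Ch \<chi>])
    also have "(\<Sum>\<psi>\<in>Ch l m - {\<chi>}. chm l m \<psi> y * fev y (H' \<psi>)) = (\<Sum>\<psi>\<in>Ch l m - {\<chi>}. chm l m \<psi> y * fev y (H \<psi>))"
      by (rule sum.cong) (auto simp: H'_def)
    also have "chm l m \<chi> y * fev y (H' \<chi>) + \<dots> = chm l m \<chi> y * fev y G + (chm l m \<chi> y * fev y (H \<chi>) + \<dots>)"
      by (simp add: H'_def distrib_left)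
    also have "chm l m \<chi> y * fev y (H \<chi>) + (\<Sum>\<psi>\<in>Ch l m - {\<chi>}. chm l m \<psi> y * fev y (H \<psi>)) =
        (\<Sum>\<psi>\<in>Ch l m. chm l m \<psi> y * fev y (H \<psi>))"
      by (rule sum.remove[OF finite_Ch \<chi>, symmetric])
    also have "\<dots> = fev y F" using H y by (simp add: decomp_def)
    finally show "fev y (msingle \<mu> a + F) = (\<Sum>\<psi>\<in>Ch l m. chm l m \<psi> y * fev y (H' \<psi>))"
      unfolding fps_const_hom.gev_add using ev[OF y] by simp
  qed
  then show ?case by blast
qed

text \<open>The Galois group of the projection of the curve in $\mathbb{P}^m$ to the one in $\mathbb{P}^l$ that forgets
  the coordinates above l.\<close>

definition T :: "nat \<Rightarrow> nat \<Rightarrow> (nat \<Rightarrow> 'a) set" where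
  "T l m = {t. \<forall>i. if i \<in> {Suc l..m} then t i ^ s = 1 else t i = 1}"

definition act :: "(nat \<Rightarrow> 'a) \<Rightarrow> (nat \<Rightarrow> 'a fps) \<Rightarrow> (nat \<Rightarrow> 'a fps)" where
  "act t y = (\<lambda>i. fps_const (t i) * y i)"

lemma T_pow: "t \<in> T l m \<Longrightarrow> t i ^ s = 1"
  by (auto simp: T_def split: if_splits dest!: spec[of _ i])

lemma T_low: "t \<in> T l m \<Longrightarrow> i \<le> l \<Longrightarrow> t i = 1"
  by (auto simp: T_def split: if_splits dest!: spec[of _ i])

lemma T_high: "t \<in> T l m \<Longrightarrow> m < i \<Longrightarrow> t i = 1"
  by (auto simp: T_def split: if_splits dest!: spec[of _ i])

lemma T_nz: "t \<in> T l m \<Longrightarrow> t i \<noteq> 0"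
  using T_pow[of t l m i] s0 by (auto simp: power_0_left)

lemma T_1: "(\<lambda>_. 1) \<in> T l m"
  by (simp add: T_def)

lemma T_mult: "t \<in> T l m \<Longrightarrow> t' \<in> T l m \<Longrightarrow> (\<lambda>i. t i * t' i) \<in> T l m"
  by (auto simp: T_def power_mult_distrib)

section \<open>The order of the group and orthogonality of its characters\<close>

lemma roots_of_unity: "finite {z::'a. z ^ s = 1}"
proof -
  have "{z::'a. z ^ s = 1} = {z. poly (monom 1 s - 1) z = 0}"
    by (auto simp: poly_monom)
  moreover have "monom 1 s - 1 \<noteq> (0 :: 'a poly)"
    using s0 by (auto simp: poly_eq_iff split: if_splits intro!: exI[of _ s])
  ultimately show ?thesis using poly_roots_finite by metis
qed

lemma zeta_power_eq_1: "\<zeta> ^ e = 1 \<longleftrightarrow> s dvd e"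
proof
  assume e: "\<zeta> ^ e = 1"
  have "\<zeta> ^ s = 1" using prim by (simp add: primitive_root_of_unity_def)
  have "\<zeta> ^ e = (\<zeta> ^ s) ^ (e div s) * \<zeta> ^ (e mod s)"
    by (simp flip: power_mult power_add)
  then have "\<zeta> ^ (e mod s) = 1" using e \<open>\<zeta> ^ s = 1\<close> by simp
  then have "e mod s = 0"
    using prim s0 by (auto simp: primitive_root_of_unity_def dest: spec[of _ "e mod s"])
  then show "s dvd e" by auto
next
  assume "s dvd e"
  then show "\<zeta> ^ e = 1" using prim by (auto simp: primitive_root_of_unity_def power_mult)
qed

lemma zeta_nz: "\<zeta> \<noteq> 0"
  using zeta_power_eq_1[of s] s0 by (auto simp: power_0_left)

lemma card_roots_of_unity: "card {z::'a. z ^ s = 1} = s"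
proof (rule antisym)
  have "{z::'a. z ^ s = 1} = {z. poly (monom 1 s - 1) z = 0}"
    by (auto simp: poly_monom)
  moreover have "degree (monom 1 s - 1 :: 'a poly) \<le> s"
    by (rule degree_diff_le) (auto simp: degree_monom_eq)
  moreover have "monom 1 s - 1 \<noteq> (0 :: 'a poly)"
    using s0 by (auto simp: poly_eq_iff split: if_splits intro!: exI[of _ s])
  ultimately show "card {z::'a. z ^ s = 1} \<le> s"
    using card_poly_roots_bound[of "monom 1 s - 1 :: 'a poly"] by simp
next
  have "inj_on (\<lambda>k. \<zeta> ^ k) {..<s}"
  proof (rule linorder_inj_onI')
    fix i j assume ij: "i \<in> {..<s}" "j \<in> {..<s}" "i < j"
    show "\<zeta> ^ i \<noteq> \<zeta> ^ j"
    proof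
      assume "\<zeta> ^ i = \<zeta> ^ j"
      also have "\<zeta> ^ j = \<zeta> ^ i * \<zeta> ^ (j - i)" using ij by (simp flip: power_add)
      finally have "\<zeta> ^ (j - i) = 1" using zeta_nz by simp
      then have "s dvd j - i" by (simp add: zeta_power_eq_1)
      then show False using ij by (auto dest: dvd_imp_le)
    qed
  qed
  moreover have "(\<lambda>k. \<zeta> ^ k) ` {..<s} \<subseteq> {z. z ^ s = 1}"
    using zeta_power_eq_1 by (auto simp flip: power_mult)
  ultimately show "s \<le> card {z::'a. z ^ s = 1}"
    using card_inj_on_le[OF _ _ roots_of_unity, of "\<lambda>k. \<zeta> ^ k" "{..<s}"] by simp
qed

lemma bij_T_PiE: "bij_betw (\<lambda>t. restrict t {Suc l..m}) (T l m) ({Suc l..m} \<rightarrow>\<^sub>E {z. z ^ s = 1})"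
proof (rule bij_betw_byWitness[where f' = "\<lambda>f i. if i \<in> {Suc l..m} then f i else 1"])
  show "\<forall>t\<in>T l m. (\<lambda>i. if i \<in> {Suc l..m} then restrict t {Suc l..m} i else 1) = t"
    by (auto simp: T_def fun_eq_iff split: if_splits)
  show "\<forall>f\<in>{Suc l..m} \<rightarrow>\<^sub>E {z. z ^ s = 1}. restrict (\<lambda>i. if i \<in> {Suc l..m} then f i else 1) {Suc l..m} = f"
    by (auto simp: fun_eq_iff PiE_def extensional_def)
qed (auto simp: T_def PiE_def Pi_def split: if_splits)

lemma finite_T: "finite (T l m)"
  using bij_betw_finite[OF bij_T_PiE] roots_of_unity by (simp add: finite_PiE)

lemma card_T: "card (T l m) = s ^ (m - l)"
  using bij_betw_same_card[OF bij_T_PiE, of l m] by (simp add: card_PiE card_roots_of_unity)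

lemma T_reindex:
  assumes "t0 \<in> T l m"
  shows "bij_betw (\<lambda>t i. t i * t0 i) (T l m) (T l m)"
proof -
  have "inj_on (\<lambda>t i. t i * t0 i) (T l m)"
    using T_nz[OF assms] by (intro inj_onI) (auto simp: fun_eq_iff)
  moreover have "(\<lambda>t i. t i * t0 i) ` T l m \<subseteq> T l m"
    using T_mult assms by auto
  ultimately show ?thesis
    using endo_inj_surj[OF finite_T] by (simp add: bij_betw_def)
qed

text \<open>If some exponent \<open>e j\<close> is not divisible by s, translating the sum by the
  element with entry \<zeta> at j multiplies it by \<zeta>^(e j), which is not 1, so the sum is
  zero.\<close>

lemma T_orthogonality:
  fixes e :: "nat \<Rightarrow> nat"
  shows "(\<Sum>t\<in>T l m. \<Prod>i\<in>{Suc l..m}. t i ^ e i) =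
    (if \<forall>i\<in>{Suc l..m}. s dvd e i then of_nat (card (T l m)) else 0)"
proof (cases "\<forall>i\<in>{Suc l..m}. s dvd e i")
  case True
  have "(\<Prod>i\<in>{Suc l..m}. t i ^ e i) = 1" if "t \<in> T l m" for t
    using True T_pow[OF that] by (intro prod.neutral) (auto simp: power_mult elim!: dvdE)
  then show ?thesis using True by simp
next
  case False
  then obtain j where j: "j \<in> {Suc l..m}" "\<not> s dvd e j" by auto
  define t0 where "t0 = (\<lambda>i. if i = j then \<zeta> else 1)"
  have t0: "t0 \<in> T l m" using j prim by (auto simp: t0_def T_def primitive_root_of_unity_def)
  let ?f = "\<lambda>t::nat \<Rightarrow> 'a. \<Prod>i\<in>{Suc l..m}. t i ^ e i"
  have "?f t0 = (\<Prod>i\<in>{Suc l..m}. if i = j then \<zeta> ^ e j else 1)"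
    by (rule prod.cong) (auto simp: t0_def)
  also have "\<dots> = \<zeta> ^ e j" using j(1) by simp
  finally have f0: "?f t0 \<noteq> 1" using j(2) zeta_power_eq_1 by simp
  have "(\<Sum>t\<in>T l m. ?f t) = (\<Sum>t\<in>T l m. ?f (\<lambda>i. t i * t0 i))"
    by (rule sum.reindex_bij_betw[OF T_reindex[OF t0], symmetric])
  also have "\<dots> = ?f t0 * (\<Sum>t\<in>T l m. ?f t)"
    by (simp add: power_mult_distrib prod.distrib sum_distrib_left mult_ac)
  finally have "(\<Sum>t\<in>T l m. ?f t) * (?f t0 - 1) = 0" by (simp add: algebra_simps)
  then show ?thesis using f0 False by auto
qed

lemma act_sol:
  assumes "sol m s cB y" "t \<in> T l m'" "1 \<le> l"
  shows "sol m s cB (act t y)"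
proof -
  have "act t y i ^ s = y i ^ s" for i
    using T_pow[OF assms(2), of i] by (simp add: act_def power_mult_distrib fps_const_power)
  then show ?thesis using assms(1) by (simp add: sol_def)
qed

lemma act_low: "t \<in> T l m \<Longrightarrow> i \<le> l \<Longrightarrow> act t y i = y i"
  by (simp add: act_def T_low)

lemma act_arc:
  assumes "arc m s B y" "t \<in> T l m'" "1 \<le> l"
  shows "arc m s B (act t y)"
  using assms act_sol[of m y t l m'] act_low[OF assms(2), of 0 y] act_low[OF assms(2), of 1 y]
  by (simp add: arc_def)

lemma act_act: "act t (act t' y) = act (\<lambda>i. t i * t' i) y"
  by (simp add: act_def fun_eq_iff mult.assoc flip: fps_const_mult)

lemma chm_act: "chm l m \<chi> (act t y) = fps_const (\<Prod>i\<in>{Suc l..m}. t i ^ \<chi> i) * chm l m \<chi> y"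
  by (simp add: chm_def act_def power_mult_distrib prod.distrib fps_const_hom.c_prod fps_const_power)

lemma fev_act_low:
  assumes "H \<in> forms l d" "t \<in> T l m"
  shows "fev (act t y) H = fev y H"
  by (rule gev_cong_ring[OF forms_mpol_ring[OF assms(1)]]) (simp add: act_low[OF assms(2)])

text \<open>Averaging the conjugates of F against the inverse character projects to the component of
  \<chi>. The exponents \<open>s - \<chi> i\<close> stand for \<open>- \<chi> i\<close>, as s-th
  powers of the entries of t are 1.\<close>

lemma decomp_extract:
  assumes H: "decomp l m d F H" and \<chi>: "\<chi> \<in> Ch l m" and y: "sol m s cB y" and l: "1 \<le> l"
  shows "(\<Sum>t\<in>T l m. fps_const (\<Prod>i\<in>{Suc l..m}. t i ^ (s - \<chi> i)) * fev (act t y) F) =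
    fps_const (of_nat (card (T l m))) * (chm l m \<chi> y * fev y (H \<chi>))"
proof -
  have orth: "(\<Sum>t\<in>T l m. (\<Prod>i\<in>{Suc l..m}. t i ^ (s - \<chi> i)) * (\<Prod>i\<in>{Suc l..m}. t i ^ \<psi> i)) =
    (if \<psi> = \<chi> then of_nat (card (T l m)) else 0)" if \<psi>: "\<psi> \<in> Ch l m" for \<psi>
  proof -
    have "(\<Sum>t\<in>T l m. (\<Prod>i\<in>{Suc l..m}. t i ^ (s - \<chi> i)) * (\<Prod>i\<in>{Suc l..m}. t i ^ \<psi> i)) =
      (\<Sum>t\<in>T l m. \<Prod>i\<in>{Suc l..m}. t i ^ (s - \<chi> i + \<psi> i))"
      by (simp add: power_add prod.distrib)
    also have "\<dots> = (if \<forall>i\<in>{Suc l..m}. s dvd s - \<chi> i + \<psi> i then of_nat (card (T l m)) else 0)"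
      by (rule T_orthogonality)
    also have "(\<forall>i\<in>{Suc l..m}. s dvd s - \<chi> i + \<psi> i) \<longleftrightarrow> \<psi> = \<chi>"
    proof
      assume a: "\<forall>i\<in>{Suc l..m}. s dvd s - \<chi> i + \<psi> i"
      show "\<psi> = \<chi>"
      proof (rule PiE_ext[OF \<psi>[unfolded Ch_def] \<chi>[unfolded Ch_def]])
        fix i assume i: "i \<in> {Suc l..m}"
        then have lt: "\<psi> i < s" "\<chi> i < s" using \<psi> \<chi> by (auto simp: Ch_def)
        obtain k where k: "s - \<chi> i + \<psi> i = s * k" using bspec[OF a i] by (rule dvdE)
        have "0 < s * k" "s * k < s * 2" using lt unfolding k[symmetric] by auto
        then have "k = 1" by auto
        then show "\<psi> i = \<chi> i" using k lt by auto
      qed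
    next
      assume "\<psi> = \<chi>"
      then show "\<forall>i\<in>{Suc l..m}. s dvd s - \<chi> i + \<psi> i"
        using \<chi> by (auto simp: Ch_def PiE_def Pi_def less_imp_le)
    qed
    finally show ?thesis .
  qed
  have "(\<Sum>t\<in>T l m. fps_const (\<Prod>i\<in>{Suc l..m}. t i ^ (s - \<chi> i)) * fev (act t y) F) =
    (\<Sum>t\<in>T l m. \<Sum>\<psi>\<in>Ch l m. fps_const ((\<Prod>i\<in>{Suc l..m}. t i ^ (s - \<chi> i)) * (\<Prod>i\<in>{Suc l..m}. t i ^ \<psi> i))
       * (chm l m \<psi> y * fev y (H \<psi>)))"
  proof (rule sum.cong[OF refl])
    fix t assume t: "t \<in> T l m"
    have "fev (act t y) F = (\<Sum>\<psi>\<in>Ch l m. chm l m \<psi> (act t y) * fev (act t y) (H \<psi>))"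
      using H act_sol[OF y t l] by (simp add: decomp_def)
    also have "\<dots> = (\<Sum>\<psi>\<in>Ch l m. fps_const (\<Prod>i\<in>{Suc l..m}. t i ^ \<psi> i) * (chm l m \<psi> y * fev y (H \<psi>)))"
      using H by (intro sum.cong[OF refl]) (auto simp: chm_act fev_act_low[OF _ t] decomp_def mult.assoc)
    finally show "fps_const (\<Prod>i\<in>{Suc l..m}. t i ^ (s - \<chi> i)) * fev (act t y) F =
      (\<Sum>\<psi>\<in>Ch l m. fps_const ((\<Prod>i\<in>{Suc l..m}. t i ^ (s - \<chi> i)) * (\<Prod>i\<in>{Suc l..m}. t i ^ \<psi> i))
       * (chm l m \<psi> y * fev y (H \<psi>)))"
      by (simp add: sum_distrib_left mult.assoc flip: fps_const_mult)
  qed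
  also have "\<dots> = (\<Sum>\<psi>\<in>Ch l m. fps_const (\<Sum>t\<in>T l m. (\<Prod>i\<in>{Suc l..m}. t i ^ (s - \<chi> i)) * (\<Prod>i\<in>{Suc l..m}. t i ^ \<psi> i))
       * (chm l m \<psi> y * fev y (H \<psi>)))"
    by (subst sum.swap) (simp only: fps_const_hom.c_sum sum_distrib_right)
  also have "\<dots> = (\<Sum>\<psi>\<in>Ch l m. if \<psi> = \<chi> then fps_const (of_nat (card (T l m))) * (chm l m \<chi> y * fev y (H \<chi>)) else 0)"
    by (rule sum.cong[OF refl]) (simp only: orth, simp)
  also have "\<dots> = fps_const (of_nat (card (T l m))) * (chm l m \<chi> y * fev y (H \<chi>))"
    using \<chi> finite_Ch by simp
  finally show ?thesis .
qed

lemma card_T_nz: "fps_const (of_nat (card (T l m))) \<noteq> (0 :: 'a fps)"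
  using s0 by (simp add: card_T)

definition scal :: "(nat \<Rightarrow> 'a) \<Rightarrow> 'a mpol \<Rightarrow> 'a mpol" where
  "scal t F = (\<Sum>m\<in>mkeys F. msingle m (mlookup F m * mon_eval t m))"

lemma fev_scal: "fev y (scal t F) = fev (act t y) F"
proof -
  have "fev (act t y) F = (\<Sum>m\<in>mkeys F. fps_const (mlookup F m) * mon_eval (act t y) m)"
    by (rule gev_def)
  also have "\<dots> = fev y (scal t F)"
    unfolding scal_def fps_const_hom.gev_sum act_def
    by (rule sum.cong)
       (simp_all add: mon_eval_mult fps_const_hom.c_mon_eval[symmetric] mult_ac flip: fps_const_mult)
  finally show ?thesis by simp
qed

lemma scal_forms: "F \<in> forms m d \<Longrightarrow> scal t F \<in> forms m d"
  unfolding scal_def by (intro forms_sum forms_single) (auto simp: forms_iff)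

text \<open>The product of the conjugates is invariant under the group, so only its component for
  the trivial character survives, and that component is a form in the lower coordinates.\<close>

lemma norm_exists:
  assumes F: "F \<in> forms m d" and l: "1 \<le> l" "l \<le> m"
  shows "\<exists>N\<in>forms l (card (T l m) * d). \<forall>y. sol m s cB y \<longrightarrow> fev y N = (\<Prod>t\<in>T l m. fev (act t y) F)"
proof -
  define G where "G = (\<Prod>t\<in>T l m. scal t F)"
  have "G \<in> forms m (\<Sum>t\<in>T l m. d)"
    unfolding G_def by (intro forms_prod scal_forms F)
  then have G: "G \<in> forms m (card (T l m) * d)" by simp
  obtain H where H: "decomp l m (card (T l m) * d) G H" using decomp_exists[OF G l] by auto
  define \<chi> where "\<chi> = restrict (\<lambda>_. 0::nat) {Suc l..m}"
  have \<chi>: "\<chi> \<in> Ch l m" using s0 by (auto simp: Ch_def \<chi>_def)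
  have w: "wt l m \<chi> = 0" by (simp add: wt_def \<chi>_def)
  have "fev y (H \<chi>) = (\<Prod>t\<in>T l m. fev (act t y) F)" if y: "sol m s cB y" for y
  proof -
    have inv: "fev (act t0 y) G = (\<Prod>t\<in>T l m. fev (act t y) F)" if t0: "t0 \<in> T l m" for t0
      unfolding G_def fps_const_hom.gev_prod fev_scal act_act
      by (rule prod.reindex_bij_betw[OF T_reindex[OF t0]])
    have "(\<Sum>t\<in>T l m. fps_const (\<Prod>i\<in>{Suc l..m}. t i ^ (s - \<chi> i)) * fev (act t y) G) =
      (\<Sum>t\<in>T l m. (\<Prod>t\<in>T l m. fev (act t y) F))"
      by (rule sum.cong[OF refl]) (simp add: inv \<chi>_def T_pow)
    then have "fps_const (of_nat (card (T l m))) * (\<Prod>t\<in>T l m. fev (act t y) F) =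
      fps_const (of_nat (card (T l m))) * (chm l m \<chi> y * fev y (H \<chi>))"
      unfolding decomp_extract[OF H \<chi> y l(1)] by (auto simp: fps_of_nat)
    moreover have "chm l m \<chi> y = 1" by (simp add: chm_def \<chi>_def)
    ultimately show ?thesis using card_T_nz by (metis mult_1 mult_left_cancel)
  qed
  moreover have "H \<chi> \<in> forms l (card (T l m) * d)"
    using H \<chi> w by (auto simp: decomp_def)
  ultimately show ?thesis by blast
qed

section \<open>Vanishing along one arc implies vanishing along all\<close>

lemma P1N_nz: "ab \<in> P1N \<Longrightarrow> ab \<noteq> (0, 0)"
  by (auto simp: P1N_def)

lemma arc_lam_nz:
  assumes "arc m s B y" "ab \<noteq> (0, 0)"
  shows "fev y (lam ab) \<noteq> 0"
proof -
  have "fps_const (snd ab) * y 0 \<noteq> fps_const (fst ab) * y 1"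
    using assms unfolding arc_def by (metis prod.collapse)
  then show ?thesis by (simp add: fps_const_hom.gev_lam)
qed

lemma arc_binary_nz:
  assumes "arc m s B y" "H \<in> forms 1 d" "H \<noteq> 0"
  shows "fev y H \<noteq> 0"
proof -
  obtain c ps where c: "c \<noteq> 0" "set ps \<subseteq> P1N" "H = msingle 0 c * prod_list (map lam ps)"
    using binary_factor[OF assms(2,3)] by auto
  have "fev y (lam p) \<noteq> 0" if "p \<in> set ps" for p
    using arc_lam_nz[OF assms(1) P1N_nz] c(2) that by blast
  then have "prod_list (map (\<lambda>ab. fev y (lam ab)) ps) \<noteq> 0"
    by (auto simp: prod_list_zero_iff)
  then show ?thesis unfolding c(3) using c(1) by (simp add: o_def)
qed

lemma point_over:
  assumes "m \<le> n"
  shows "\<exists>v. sol m s B v \<and> v 0 = a \<and> v 1 = b"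
proof -
  have "\<exists>x. (B i - B 1) * a ^ s + (B 0 - B i) * b ^ s + (B 1 - B 0) * x ^ s = 0" for i
  proof -
    obtain x where x: "x ^ s = - ((B i - B 1) * a ^ s + (B 0 - B i) * b ^ s) / (B 1 - B 0)"
      using nth_root_exists[OF s0] by blast
    then show ?thesis using B10 by (intro exI[of _ x]) (simp add: x)
  qed
  then obtain x where x: "\<And>i. (B i - B 1) * a ^ s + (B 0 - B i) * b ^ s + (B 1 - B 0) * x i ^ s = 0"
    by metis
  define v where "v i = (if i = 0 then a else if i = 1 then b else x i)" for i :: nat
  have "sol m s B v" using x by (auto simp: sol_def v_def)
  then show ?thesis by (intro exI[of _ v]) (simp add: v_def)
qed

lemma branch_point_exists:
  assumes "2 \<le> k" "k \<le> n"
  shows "\<exists>v. sol k s B v \<and> v 0 = 1 \<and> v k = 0"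
proof -
  have B0k: "B 0 \<noteq> B k" using inj_B assms by (auto dest!: inj_onD)
  obtain b where b: "b ^ s = - (B k - B 1) / (B 0 - B k)"
    using nth_root_exists[OF s0] by blast
  obtain v where v: "sol k s B v" "v 0 = 1" "v 1 = b" using point_over[OF assms(2)] by blast
  have "(B k - B 1) * v 0 ^ s + (B 0 - B k) * v 1 ^ s + (B 1 - B 0) * v k ^ s = 0"
    using v(1) assms by (auto simp: sol_def)
  moreover have "(B 0 - B k) * v 1 ^ s = - (B k - B 1)" using B0k by (simp only: v b) simp
  ultimately have "(B 1 - B 0) * v k ^ s = 0" by (simp only: v(2)) simp
  then have "v k = 0" using B10 by simp
  then show ?thesis using v by auto
qed

text \<open>Induction along the tower of projections, one coordinate at a time. The norm of F
  vanishes along y, hence by induction along an arc z through a branch point of the new coordinate,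
  so some conjugate of F vanishes along z. There the conjugates of z are twists of one another, so
  all conjugates of F vanish along z. Then so does each isotypic component, and induction carries
  this to y'. Total ramification at one point of each step is what makes the curve
  irreducible.\<close>

lemma arc_vanishing:
  assumes "1 \<le> m" "m \<le> n" "F \<in> forms m d" "arc m s B y" "arc m s B y'" "fev y F = 0"
  shows "fev y' F = 0"
  using assms
proof (induction m arbitrary: F d y y' rule: dec_induct)
  case base
  then show ?case using arc_binary_nz by fastforce
next
  case (step m)
  have m: "1 \<le> m" "m \<le> Suc m" using step.hyps by auto
  obtain H where H: "decomp m (Suc m) d F H" using decomp_exists[OF step.prems(2) m] by auto
  obtain N where N: "N \<in> forms m (card (T m (Suc m)) * d)"
    "\<And>y. sol (Suc m) s cB y \<Longrightarrow> fev y N = (\<Prod>t\<in>T m (Suc m). fev (act t y) F)"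
    using norm_exists[OF step.prems(2) m] by auto
  obtain v where v: "sol (Suc m) s B v" "v 0 = 1" "v (Suc m) = 0"
    using branch_point_exists[of "Suc m"] step by auto
  have inj: "inj_on B {..Suc m}" using inj_B step.prems(1) by (auto intro: inj_on_subset)
  obtain z where z: "good (Suc m) s B v z" "z (Suc m) = fps_X"
    "\<And>w i. w ^ s = 1 \<Longrightarrow> i \<le> Suc m \<Longrightarrow> i \<noteq> Suc m \<Longrightarrow> twist w (z i) = z i"
    using good_exists_ramified[OF v(1) inj s0, of "Suc m"] v step.hyps by auto
  have arcz: "arc (Suc m) s B z" using z(1) by (simp add: good_def)
  then have solz: "sol (Suc m) s cB z" by (simp add: arc_def)
  have "act (\<lambda>_. 1) y = y" by (simp add: act_def)
  then have "(\<Prod>t\<in>T m (Suc m). fev (act t y) F) = 0"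
    using step.prems(5) T_1 finite_T by (intro prod_zero) (auto intro!: bexI[of _ "\<lambda>_. 1"])
  then have "fev y N = 0" using N(2) step.prems(3) by (simp add: arc_def)
  then have "fev z N = 0"
    using step.IH[OF _ N(1), of y z] arc_mono[of "Suc m" _ m] arcz step.prems by auto
  then have "(\<Prod>t\<in>T m (Suc m). fev (act t z) F) = 0" using N(2) solz by simp
  then obtain t where t: "t \<in> T m (Suc m)" "fev (act t z) F = 0"
    using finite_T by (auto simp: prod_zero_iff)
  \<comment> \<open>Since \<open>z (Suc m)\<close> is X and the other coordinates are invariant,
    passing from t to t' is the substitution of wX for X.\<close>
  have all: "fev (act t' z) F = 0" if t': "t' \<in> T m (Suc m)" for t'
  proof -
    define w where "w = t' (Suc m) / t (Suc m)"
    have w: "w ^ s = 1" using T_pow[OF t(1)] T_pow[OF t'] by (simp add: w_def power_divide)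
    have "fev (act t' z) F = fev (\<lambda>i. twist w (act t z i)) F"
    proof (rule gev_cong_ring[OF forms_mpol_ring[OF step.prems(2)]])
      fix i assume i: "i \<le> Suc m"
      show "act t' z i = twist w (act t z i)"
      proof (cases "i = Suc m")
        case True
        have "fps_const (t (Suc m)) * fps_const w = fps_const (t' (Suc m))"
          using T_nz[OF t(1)] by (simp add: w_def)
        then show ?thesis using True z(2) by (simp add: act_def mult.assoc[symmetric])
      next
        case False
        then show ?thesis using i z(3)[OF w] T_low[OF t(1), of i] T_low[OF t', of i] by (simp add: act_def)
      qed
    qed
    also have "\<dots> = twist w (fev (act t z) F)"
      by (subst gev_hom[OF coeff_hom_twist]) simp
    finally show ?thesis using t(2) by simp
  qed
  have "fev z (H \<chi>) = 0" if \<chi>: "\<chi> \<in> Ch m (Suc m)" for \<chi>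
  proof -
    have "fps_const (of_nat (card (T m (Suc m)))) * (chm m (Suc m) \<chi> z * fev z (H \<chi>)) = 0"
      unfolding decomp_extract[OF H \<chi> solz m(1), symmetric] using all by simp
    moreover have "chm m (Suc m) \<chi> z \<noteq> 0" by (simp add: chm_def z(2))
    ultimately show ?thesis using card_T_nz by (metis mult_eq_0_iff)
  qed
  then have "fev y' (H \<chi>) = 0" if \<chi>: "\<chi> \<in> Ch m (Suc m)" for \<chi>
    using step.IH[of "H \<chi>" _ z y'] \<chi> H arc_mono[of "Suc m" _ m] arcz step.prems
    by (auto simp: decomp_def)
  then show ?case using H step.prems(4) by (simp add: decomp_def arc_def)
qed

lemma binary_nonroot_exists:
  fixes H :: "'a mpol"
  assumes "H \<in> forms 1 d" "H \<noteq> 0"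
  shows "\<exists>a. \<forall>v. v 0 = a \<longrightarrow> v 1 = 1 \<longrightarrow> gev (\<lambda>x. x) v H \<noteq> 0"
proof -
  obtain c ps where c: "c \<noteq> 0" "set ps \<subseteq> P1N" "H = msingle 0 c * prod_list (map lam ps)"
    using binary_factor[OF assms] by auto
  obtain a where a: "a \<notin> fst ` set ps"
    using ex_new_if_finite[OF infinite_UNIV_char_0, of "fst ` set ps"] by auto
  have "gev (\<lambda>x. x) v H \<noteq> 0" if v: "v 0 = a" "v 1 = 1" for v
  proof -
    have "gev (\<lambda>x. x) v (lam p) \<noteq> 0" if p: "p \<in> set ps" for p
    proof -
      have "fst p \<noteq> a" using p a by auto
      moreover have "p = (1, 0) \<or> snd p = 1" using p c(2) by (auto simp: P1N_def)
      ultimately show ?thesis using v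
        by (auto simp: coeff_hom.gev_lam[OF coeff_hom_id])
    qed
    then show ?thesis
      unfolding c(3) using c(1) by (auto simp: coeff_hom.gev_prod_list[OF coeff_hom_id] prod_list_zero_iff)
  qed
  then show ?thesis by blast
qed

text \<open>No conjugate of F vanishes along y, so its norm is a nonzero binary form. Any point of
  the curve above a point of the line where the norm is nonzero is a point where F is
  nonzero.\<close>

lemma nonvanishing_point:
  assumes F: "F \<in> forms n d" and y: "arc n s B y" "fev y F \<noteq> 0"
  shows "\<exists>v. sol n s B v \<and> v 1 = 1 \<and> gev (\<lambda>x. x) v F \<noteq> 0"
proof -
  have n1: "1 \<le> n" using n2 by simp
  obtain N where N: "N \<in> forms 1 (card (T 1 n) * d)"
    "\<And>y. sol n s cB y \<Longrightarrow> fev y N = (\<Prod>t\<in>T 1 n. fev (act t y) F)"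
    using norm_exists[OF F order_refl n1] by auto
  have "fev (act t y) F \<noteq> 0" if "t \<in> T 1 n" for t
    using arc_vanishing[OF n1 order_refl F act_arc[OF y(1) that] y(1)] y(2) by auto
  then have "fev y N \<noteq> 0" using N(2) y finite_T by (simp add: arc_def)
  then have "N \<noteq> 0" by auto
  then obtain a where a: "\<And>v. v 0 = a \<Longrightarrow> v 1 = 1 \<Longrightarrow> gev (\<lambda>x. x) v N \<noteq> 0"
    using binary_nonroot_exists[OF N(1)] by auto
  obtain v where v: "sol n s B v" "v 0 = a" "v 1 = 1" using point_over[OF order_refl] by blast
  let ?v = "\<lambda>i. fps_const (v i)"
  have "sol n s cB ?v" using sol_hom[OF fps_const_hom.coeff_hom_axioms v(1)] by simp
  then have "fev ?v N = (\<Prod>t\<in>T 1 n. fev (act t ?v) F)" by (rule N(2))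
  moreover have "fev ?v N \<noteq> 0"
    using a[OF v(2,3)] by (simp add: fps_const_hom.c_gev[symmetric])
  ultimately have "fev (act (\<lambda>_. 1) ?v) F \<noteq> 0"
    using T_1[of 1 n] finite_T by (auto simp: prod_zero_iff)
  then have "gev (\<lambda>x. x) v F \<noteq> 0"
    by (auto simp: act_def fps_const_hom.c_gev[symmetric])
  then show ?thesis using v by blast
qed

end

section \<open>Points of projective space\<close>

abbreviation "ev \<equiv> gev (\<lambda>x. x)"

definition pclass :: "nat \<Rightarrow> (nat \<Rightarrow> 'a::field) \<Rightarrow> 'a ppoint" where
  "pclass n v = scaling_rel n `` {v}"

lemma pclass_iff:
  assumes "v \<in> coord_vectors n"
  shows "w \<in> pclass n v \<longleftrightarrow> (\<exists>c. c \<noteq> 0 \<and> w = (\<lambda>i. c * v i))"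
  using assms by (auto simp: pclass_def scaling_rel_def coord_vectors_def)

lemma pclass_self: "v \<in> coord_vectors n \<Longrightarrow> v \<in> pclass n v"
  by (auto simp: pclass_iff intro!: exI[of _ 1])

lemma pclass_subset: "pclass n v \<subseteq> coord_vectors n"
  by (auto simp: pclass_def scaling_rel_def)

lemma proj_space_iff: "P \<in> proj_space n \<longleftrightarrow> (\<exists>v\<in>coord_vectors n. P = pclass n v)"
  by (auto simp: proj_space_def quotient_def pclass_def)

lemma equiv_scaling: "equiv (coord_vectors n) (scaling_rel n)"
proof (rule equivI)
  show "refl_on (coord_vectors n) (scaling_rel n)"
    by (auto simp: refl_on_def scaling_rel_def intro!: exI[of _ 1])
  show "sym (scaling_rel n)"
  proof (rule symI)
    fix v w assume "(v, w) \<in> scaling_rel n"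
    then obtain c where c: "v \<in> coord_vectors n" "w \<in> coord_vectors n" "c \<noteq> 0" "w = (\<lambda>i. c * v i)"
      unfolding scaling_rel_def by blast
    then have "inverse c \<noteq> 0" "v = (\<lambda>i. inverse c * w i)" by (simp_all add: fun_eq_iff)
    then show "(w, v) \<in> scaling_rel n" using c(1,2) unfolding scaling_rel_def by blast
  qed
  show "trans (scaling_rel n)"
  proof (rule transI)
    fix u v w assume uv: "(u, v) \<in> scaling_rel n" and vw: "(v, w) \<in> scaling_rel n"
    obtain c where c: "u \<in> coord_vectors n" "c \<noteq> 0" "v = (\<lambda>i. c * u i)"
      using uv unfolding scaling_rel_def by blast
    obtain d where d: "w \<in> coord_vectors n" "d \<noteq> 0" "w = (\<lambda>i. d * v i)"
      using vw unfolding scaling_rel_def by blast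
    have "d * c \<noteq> 0" "w = (\<lambda>i. (d * c) * u i)" using c d by (simp_all add: fun_eq_iff)
    then show "(u, w) \<in> scaling_rel n" using c(1) d(1) unfolding scaling_rel_def by blast
  qed
qed (auto simp: scaling_rel_def)

lemma pclass_eq_iff:
  assumes "v \<in> coord_vectors n" "w \<in> coord_vectors n"
  shows "pclass n v = pclass n w \<longleftrightarrow> (\<exists>c. c \<noteq> 0 \<and> w = (\<lambda>i. c * v i))"
proof -
  have "pclass n v = pclass n w \<longleftrightarrow> (v, w) \<in> scaling_rel n"
    unfolding pclass_def using eq_equiv_class_iff[OF equiv_scaling assms] .
  then show ?thesis using assms by (simp add: scaling_rel_def)
qed

lemma pclass_scale:
  assumes "v \<in> coord_vectors n" "c \<noteq> 0"
  shows "pclass n (\<lambda>i. c * v i) = pclass n v" "(\<lambda>i. c * v i) \<in> coord_vectors n"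
proof -
  show "(\<lambda>i. c * v i) \<in> coord_vectors n" using assms by (auto simp: coord_vectors_def)
  from pclass_eq_iff[OF assms(1) this] show "pclass n (\<lambda>i. c * v i) = pclass n v"
    using assms(2) by metis
qed

lemma form_zero_on_class:
  assumes "F \<in> forms n d" "v \<in> coord_vectors n"
  shows "(\<forall>w\<in>pclass n v. mpol_eval w F = 0) \<longleftrightarrow> ev v F = 0"
proof
  assume "\<forall>w\<in>pclass n v. mpol_eval w F = 0"
  then show "ev v F = 0" using pclass_self[OF assms(2)] by (simp add: mpol_eval_gev)
next
  assume "ev v F = 0"
  then show "\<forall>w\<in>pclass n v. mpol_eval w F = 0"
    using gev_scale[OF assms(1), of "\<lambda>x. x"] by (auto simp: pclass_iff[OF assms(2)] mpol_eval_gev)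
qed

lemma zero_locus_iff:
  assumes "E \<subseteq> (\<Union>d. forms n d)" "v \<in> coord_vectors n"
  shows "pclass n v \<in> zero_locus n E \<longleftrightarrow> (\<forall>f\<in>E. ev v f = 0)"
proof -
  have "(\<forall>w\<in>pclass n v. mpol_eval w f = 0) \<longleftrightarrow> ev v f = 0" if "f \<in> E" for f
    using assms that form_zero_on_class by blast
  moreover have "pclass n v \<in> proj_space n" using assms(2) by (auto simp: proj_space_iff)
  ultimately show ?thesis by (auto simp: zero_locus_def)
qed

lemma zero_locus_crv_iff:
  assumes "v \<in> coord_vectors n"
  shows "pclass n v \<in> zero_locus n (crv n s B) \<longleftrightarrow> sol n s B v"
proof -
  have "crv n s B \<subseteq> (\<Union>d. forms n d)" using crv_forms by blast
  then have "pclass n v \<in> zero_locus n (crv n s B) \<longleftrightarrow> (\<forall>f\<in>crv n s B. ev v f = 0)"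
    using assms by (rule zero_locus_iff)
  then show ?thesis by (simp add: gev_crv_zero_iff[OF coeff_hom_id])
qed

lemma zero_locus_crvE:
  assumes "P \<in> zero_locus n (crv n s B)"
  obtains v where "v \<in> coord_vectors n" "sol n s B v" "P = pclass n v"
proof -
  have "P \<in> proj_space n" using assms by (simp add: zero_locus_def)
  then obtain v where "v \<in> coord_vectors n" "P = pclass n v" by (auto simp: proj_space_iff)
  then show ?thesis using that assms zero_locus_crv_iff[of v n s B] by auto
qed

lemma point_ideal_form:
  assumes "F \<in> forms n d" "v \<in> coord_vectors n"
  shows "F \<in> point_ideal n (pclass n v) \<longleftrightarrow> ev v F = 0"
  using form_zero_on_class[OF assms] forms_mpol_ring[OF assms(1)] by (simp add: point_ideal_def)

lemma point_ideal_eval: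
  assumes "F \<in> point_ideal n (pclass n v)" "v \<in> coord_vectors n"
  shows "ev v F = 0"
proof -
  have "\<forall>w\<in>pclass n v. mpol_eval w F = 0" using assms(1) by (simp add: point_ideal_def)
  then have "mpol_eval v F = 0" using pclass_self[OF assms(2)] by blast
  then show ?thesis by (simp add: mpol_eval_gev)
qed

section \<open>The order of vanishing along a good arc\<close>

lemma fev_nth_0:
  assumes "F \<in> mpol_ring n" "\<And>i. i \<le> n \<Longrightarrow> y i $ 0 = v i"
  shows "fev y F $ 0 = ev v F"
proof -
  have "fev y F $ 0 = gev (\<lambda>a. fps_const a $ 0) (\<lambda>i. y i $ 0) F"
    by (rule gev_hom[OF coeff_hom_nth_0])
  also have "\<dots> = ev (\<lambda>i. y i $ 0) F" by simp
  also have "\<dots> = ev v F" by (rule gev_cong_ring[OF assms(1)]) (simp add: assms(2))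
  finally show ?thesis .
qed

context curve
begin

abbreviation "pts \<equiv> zero_locus n (crv n s B)"

lemma pt_nz:
  assumes "v \<in> coord_vectors n" "sol n s B v"
  shows "v 0 \<noteq> 0 \<or> v 1 \<noteq> 0"
proof (rule ccontr)
  assume a: "\<not> ?thesis"
  have "v k = 0" for k
  proof (cases "k \<le> n")
    case True
    then show ?thesis
      using sol_two_zeros[OF assms(2) inj_B _ s0, of 0 1 k] a n2 by auto
  next
    case False then show ?thesis using assms(1) by (auto simp: coord_vectors_def)
  qed
  then show False using assms(1) by (auto simp: coord_vectors_def)
qed

lemma good_at_point:
  assumes "v \<in> coord_vectors n" "sol n s B v"
  shows "\<exists>y. good n s B v y"
  using good_exists[OF assms(2) inj_B s0] pt_nz[OF assms] n2 by auto

lemma fev_ideal: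
  assumes "sol n s cB y" "h \<in> ideal_gen n (crv n s B)"
  shows "fev y h = 0"
proof -
  have "\<forall>f\<in>crv n s B. fev y f = 0"
    using assms(1) gev_crv_zero_iff[OF fps_const_hom.coeff_hom_axioms] by blast
  then show ?thesis by (intro gev_ideal_gen[OF fps_const_hom.coeff_hom_axioms assms(2)]) auto
qed

section \<open>A uniformiser at each point\<close>

definition Lf :: "(nat \<Rightarrow> 'a) \<Rightarrow> nat \<Rightarrow> nat \<Rightarrow> 'a mpol" where
  "Lf v j i = msingle (msingle i 1) (v j) - msingle (msingle j 1) (v i)"

definition Mf :: "(nat \<Rightarrow> 'a) \<Rightarrow> nat \<Rightarrow> nat \<Rightarrow> 'a mpol" where
  "Mf v j i = (\<Sum>k<s. msingle (msingle j 1) (v i) ^ (s - Suc k) * msingle (msingle i 1) (v j) ^ k)"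

text \<open>The analogue of \<open>Lf\<close> in s-th powers. These forms satisfy linear relations
  modulo the equations, and \<open>Ef = Lf * Mf\<close> transfers them to \<open>Lf\<close> wherever
  \<open>Mf\<close> is a local unit, that is, where \<open>v i\<close> and \<open>v j\<close> are
  nonzero.\<close>

definition Ef :: "(nat \<Rightarrow> 'a) \<Rightarrow> nat \<Rightarrow> nat \<Rightarrow> 'a mpol" where
  "Ef v j i = msingle (msingle i s) (v j ^ s) - msingle (msingle j s) (v i ^ s)"

lemma single_pow: "msingle m a ^ k = msingle (\<Sum>j<k. m) (a ^ k :: 'a)"
  by (induction k) (auto simp: mult_single add.commute simp del: sum_constant)

lemma Ef_factor: "Ef v j i = Lf v j i * Mf v j i"
proof -
  obtain k where k: "s = Suc k" using s0 by (cases s) auto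
  have factor: "x ^ s - y ^ s = (x - y) * (\<Sum>i<s. y ^ (s - Suc i) * x ^ i)" for x y :: "'a mpol"
    unfolding k by (rule power_diff_sumr2)
  have "Ef v j i = msingle (msingle i 1) (v j) ^ s - msingle (msingle j 1) (v i) ^ s"
    by (simp add: Ef_def single_pow single_multiple del: sum_constant)
  also have "\<dots> = Lf v j i * Mf v j i"
    unfolding Lf_def Mf_def by (rule factor)
  finally show ?thesis .
qed

lemma Lf_forms: "i \<le> n \<Longrightarrow> j \<le> n \<Longrightarrow> Lf v j i \<in> forms n 1"
  unfolding Lf_def by (intro forms_diff forms_single) auto

lemma Mf_forms:
  assumes "i \<le> n" "j \<le> n"
  shows "Mf v j i \<in> forms n (s - 1)"
  unfolding Mf_def
proof (rule forms_sum)
  fix k assume "k \<in> {..<s}"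
  then have e: "s - 1 = (s - Suc k) * 1 + k * 1" by simp
  show "msingle (msingle j 1) (v i) ^ (s - Suc k) * msingle (msingle i 1) (v j) ^ k \<in> forms n (s - 1)"
    unfolding e by (intro forms_mult forms_power forms_single) (use assms in auto)
qed

lemma Mf_eval: "ev v (Mf v j i) = of_nat s * (v i * v j) ^ (s - 1)"
proof -
  have "ev v (Mf v j i) = (\<Sum>k<s. (v i * v j) ^ (s - 1))"
    unfolding Mf_def coeff_hom.gev_sum[OF coeff_hom_id]
  proof (rule sum.cong[OF refl])
    fix k assume "k \<in> {..<s}"
    then have "(v i * v j) ^ (s - 1) = (v i * v j) ^ (s - Suc k) * (v i * v j) ^ k"
      by (simp flip: power_add)
    then show "ev v (msingle (msingle j 1) (v i) ^ (s - Suc k) * msingle (msingle i 1) (v j) ^ k) = (v i * v j) ^ (s - 1)"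
      by (simp add: mult.commute)
  qed
  then show ?thesis by simp
qed

text \<open>The relation of the curve is linear in s-th powers and holds for the variables modulo
  the ideal and for v exactly, hence for the combination of the two in \<open>Ef\<close>.\<close>

lemma Ef_relation:
  assumes v: "sol n s B v" and i: "i \<in> {2..n}" and j: "j \<le> n"
  shows "msingle 0 (B i - B 1) * Ef v j 0 + msingle 0 (B 0 - B i) * Ef v j 1
    + msingle 0 (B 1 - B 0) * Ef v j i \<in> ideal_gen n (crv n s B)"
proof -
  have e: "(B i - B 1) * v 0 ^ s + (B 0 - B i) * v 1 ^ s + (B 1 - B 0) * v i ^ s = 0"
    using v i by (simp add: sol_def)
  have "msingle 0 (B i - B 1) * Ef v j 0 + msingle 0 (B 0 - B i) * Ef v j 1
    + msingle 0 (B 1 - B 0) * Ef v j i = msingle 0 (v j ^ s) * eqn s B i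
    - msingle (msingle j s) ((B i - B 1) * v 0 ^ s + (B 0 - B i) * v 1 ^ s + (B 1 - B 0) * v i ^ s)"
    unfolding Ef_def eqn_def by (simp add: right_diff_distrib distrib_left mult_single single_add mult.commute)
  then have "msingle 0 (B i - B 1) * Ef v j 0 + msingle 0 (B 0 - B i) * Ef v j 1
    + msingle 0 (B 1 - B 0) * Ef v j i = msingle 0 (v j ^ s) * eqn s B i"
    unfolding e by simp
  also have "\<dots> \<in> ideal_gen n (crv n s B)"
    using i by (intro ideal_gen_generator) (auto simp: crv_def intro: mpol_ring_single)
  finally show ?thesis .
qed

text \<open>Locally at v the form F of degree e + 1 is a multiple of the linear form u.\<close>

definition locdiv :: "(nat \<Rightarrow> 'a) \<Rightarrow> 'a mpol \<Rightarrow> nat \<Rightarrow> 'a mpol \<Rightarrow> bool" where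
  "locdiv v u e F \<longleftrightarrow> (\<exists>a. \<exists>H\<in>forms n a. ev v H \<noteq> 0 \<and>
     (\<exists>A\<in>forms n (a + e). H * F - u * A \<in> ideal_gen n (crv n s B)))"

lemma locdivI:
  assumes "H \<in> forms n a" "ev v H \<noteq> 0" "A \<in> forms n (a + e)"
    "H * F - u * A \<in> ideal_gen n (crv n s B)"
  shows "locdiv v u e F"
  using assms unfolding locdiv_def by blast

lemma locdiv_add:
  assumes "locdiv v u e F" "locdiv v u e G"
  shows "locdiv v u e (F + G)"
proof -
  obtain a H A where 1: "H \<in> forms n a" "ev v H \<noteq> 0" "A \<in> forms n (a + e)"
    "H * F - u * A \<in> ideal_gen n (crv n s B)" using assms(1) unfolding locdiv_def by blast
  obtain b K C where 2: "K \<in> forms n b" "ev v K \<noteq> 0" "C \<in> forms n (b + e)"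
    "K * G - u * C \<in> ideal_gen n (crv n s B)" using assms(2) unfolding locdiv_def by blast
  have "(H * K) * (F + G) - u * (K * A + H * C) = K * (H * F - u * A) + H * (K * G - u * C)"
    by (simp add: algebra_simps)
  also have "\<dots> \<in> ideal_gen n (crv n s B)"
    using 1 2 by (intro ideal_gen_add ideal_gen_mult) (auto dest: forms_mpol_ring)
  finally have "(H * K) * (F + G) - u * (K * A + H * C) \<in> ideal_gen n (crv n s B)" .
  moreover have "K * A + H * C \<in> forms n (a + b + e)"
    using forms_mult[OF 2(1) 1(3)] forms_mult[OF 1(1) 2(3)] by (auto simp: add_ac intro: forms_add)
  ultimately show ?thesis
    unfolding locdiv_def using forms_mult[OF 1(1) 2(1)] 1(2) 2(2)
    by (intro exI[of _ "a + b"] bexI[of _ "H * K"]) auto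
qed

lemma locdiv_mult:
  assumes "locdiv v u e F" "M \<in> forms n k"
  shows "locdiv v u (e + k) (M * F)"
proof -
  obtain a H A where 1: "H \<in> forms n a" "ev v H \<noteq> 0" "A \<in> forms n (a + e)"
    "H * F - u * A \<in> ideal_gen n (crv n s B)" using assms(1) unfolding locdiv_def by blast
  have "H * (M * F) - u * (M * A) = M * (H * F - u * A)" by (simp add: algebra_simps)
  also have "\<dots> \<in> ideal_gen n (crv n s B)"
    using 1 assms(2) by (intro ideal_gen_mult) (auto dest: forms_mpol_ring)
  finally have "H * (M * F) - u * (M * A) \<in> ideal_gen n (crv n s B)" .
  moreover have "M * A \<in> forms n (a + (e + k))"
    using forms_mult[OF assms(2) 1(3)] by (simp add: add_ac)
  ultimately show ?thesis unfolding locdiv_def using 1 by blast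
qed

lemma locdiv_0: "locdiv v u e 0"
  unfolding locdiv_def by (intro exI[of _ 0] bexI[of _ 1] conjI bexI[of _ 0]) (auto simp: forms_1)

lemma locdiv_scale:
  assumes "locdiv v u e (msingle 0 c * F)" "c \<noteq> 0"
  shows "locdiv v u e F"
proof -
  have "locdiv v u (e + 0) (msingle 0 (1 / c) * (msingle 0 c * F))"
    by (rule locdiv_mult[OF assms(1)]) (simp add: forms_single)
  then show ?thesis using assms(2) by (simp add: mult_single flip: mult.assoc)
qed

text \<open>The variables of m are replaced by \<open>Y_j\<close> one at a time; each replacement
  costs a multiple of some \<open>Lf v j i\<close>.\<close>

lemma locdiv_monomial:
  assumes L: "\<And>i. i \<le> n \<Longrightarrow> locdiv v u 0 (Lf v j i)" and j: "j \<le> n"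
  shows "mkeys m \<subseteq> {..n} \<Longrightarrow> mdeg m = Suc e \<Longrightarrow>
    locdiv v u e (msingle m (v j ^ Suc e) - msingle (msingle j (Suc e)) (mon_eval v m))"
proof (induction e arbitrary: m)
  case 0
  then obtain i where m: "m = msingle i 1" using mdeg_eq_1D[of m] by auto
  then have "i \<le> n" using 0 by auto
  then show ?case using L[of i] by (simp add: m Lf_def)
next
  case (Suc e)
  then have "m \<noteq> 0" by auto
  then obtain i where i: "i \<in> mkeys m" by (metis equals0I keys_eq_empty)
  define m' where "m' = m - msingle i 1"
  have m: "m = m' + msingle i 1"
    using i by (intro poly_mapping_eqI) (auto simp: m'_def lookup_add lookup_minus lookup_single when_def in_keys_iff)
  have k: "mkeys m' \<subseteq> {..n}" "i \<le> n" and d: "mdeg m' = Suc e"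
    using Suc.prems by (auto simp: m keys_add_nat)
  have "msingle m (v j ^ Suc (Suc e)) - msingle (msingle j (Suc (Suc e))) (mon_eval v m) =
    msingle (msingle i 1) (v j) * (msingle m' (v j ^ Suc e) - msingle (msingle j (Suc e)) (mon_eval v m'))
    + msingle (msingle j (Suc e)) (mon_eval v m') * Lf v j i"
  proof -
    have "msingle j (Suc e) + msingle i 1 = msingle i 1 + msingle j (Suc e)" by (rule add.commute)
    moreover have "msingle j (Suc e) + msingle j 1 = (msingle j (Suc (Suc e)) :: nat \<Rightarrow>\<^sub>0 nat)"
      by (simp flip: single_add)
    ultimately show ?thesis
      unfolding Lf_def m by (simp add: right_diff_distrib mult_single add.commute mult.commute)
  qed
  also have "locdiv v u (Suc e) \<dots>"
  proof (rule locdiv_add)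
    have "locdiv v u (e + 1) (msingle (msingle i 1) (v j) * (msingle m' (v j ^ Suc e) - msingle (msingle j (Suc e)) (mon_eval v m')))"
      using k by (intro locdiv_mult Suc.IH d forms_single) auto
    then show "locdiv v u (Suc e) (msingle (msingle i 1) (v j) * (msingle m' (v j ^ Suc e) - msingle (msingle j (Suc e)) (mon_eval v m')))"
      by simp
    have "locdiv v u (0 + Suc e) (msingle (msingle j (Suc e)) (mon_eval v m') * Lf v j i)"
      using k j by (intro locdiv_mult L forms_single) auto
    then show "locdiv v u (Suc e) (msingle (msingle j (Suc e)) (mon_eval v m') * Lf v j i)" by simp
  qed
  finally show ?case .
qed

lemma locdiv_form:
  assumes L: "\<And>i. i \<le> n \<Longrightarrow> locdiv v u 0 (Lf v j i)" and j: "j \<le> n" "v j \<noteq> 0"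
    and F: "F \<in> forms n (Suc e)" "ev v F = 0"
  shows "locdiv v u e F"
proof (rule locdiv_scale)
  have "locdiv v u e (msingle 0 (v j ^ Suc e) * F - msingle (msingle j (Suc e)) (ev v F))"
    using F(1)
  proof (induction rule: forms_induct)
    case zero
    show ?case by (simp add: locdiv_0)
  next
    case (add m a p)
    have "msingle 0 (v j ^ Suc e) * (msingle m a + p) - msingle (msingle j (Suc e)) (ev v (msingle m a + p)) =
      msingle 0 a * (msingle m (v j ^ Suc e) - msingle (msingle j (Suc e)) (mon_eval v m)) +
      (msingle 0 (v j ^ Suc e) * p - msingle (msingle j (Suc e)) (ev v p))"
    proof -
      have 1: "msingle 0 (v j ^ Suc e) * msingle m a = msingle 0 a * msingle m (v j ^ Suc e)"
        by (simp add: mult_single mult.commute)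
      have 2: "msingle (msingle j (Suc e)) (ev v (msingle m a + p)) =
        msingle 0 a * msingle (msingle j (Suc e)) (mon_eval v m) + msingle (msingle j (Suc e)) (ev v p)"
        by (simp add: mult_single single_add)
      show ?thesis unfolding distrib_left 1 2 right_diff_distrib by simp
    qed
    moreover have "locdiv v u (e + 0) (msingle 0 a * (msingle m (v j ^ Suc e) - msingle (msingle j (Suc e)) (mon_eval v m)))"
      by (intro locdiv_mult locdiv_monomial[OF L j(1)] add.hyps forms_single) auto
    ultimately show ?case using locdiv_add[OF _ add.IH] by simp
  qed
  then show "locdiv v u e (msingle 0 (v j ^ Suc e) * F)" using F(2) by simp
qed (use j in simp)

text \<open>The maximal ideal at v is locally generated by one linear form u. If no
  \<open>v i\<close> with i \<ge> 2 vanishes, u is the form in \<open>Y_0\<close>,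
  \<open>Y_1\<close> through v and the relation between the \<open>Ef\<close> makes every
  \<open>Lf v j i\<close> a local multiple of u. If \<open>v k = 0\<close>, then u =
  \<open>Y_k\<close>: the form \<open>Ef v j k\<close> is a multiple of \<open>Y_k^s\<close>, the
  k-th relation passes divisibility by u to \<open>Ef v j j'\<close>, and the remaining relations
  pass it to the others.\<close>

lemma uniformizer:
  assumes v: "v \<in> coord_vectors n" "sol n s B v" and y: "good n s B v y"
  shows "\<exists>u\<in>forms n 1. ev v u = 0 \<and> subdegree (fev y u) = 1 \<and>
    (\<forall>e F. F \<in> forms n (Suc e) \<longrightarrow> ev v F = 0 \<longrightarrow> locdiv v u e F)"
proof -
  obtain j j' :: nat where j: "(j = 0 \<and> j' = 1) \<or> (j = 1 \<and> j' = 0)" "v j \<noteq> (0::'a)"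
    using pt_nz[OF v] by auto
  have jn: "j \<le> n" "j' \<le> n" "j \<noteq> j'" using j n2 by auto
  have Bne: "B i \<noteq> B k" if "i \<le> n" "k \<le> n" "i \<noteq> k" for i k
    using inj_B that by (auto dest: inj_onD)
  \<comment> \<open>j' is the other index of {0, 1}; \<open>cf i\<close> is the coefficient of
    \<open>Ef v j j'\<close> in the i-th relation, where the term of \<open>Ef v j j\<close> drops
    out because that form is zero.\<close>
  define cf where "cf i = (if j' = 0 then B i - B 1 else B 0 - B i)" for i
  have cf: "cf i \<noteq> 0" if "i \<in> {2..n}" for i
    using Bne[of i 1] Bne[of 0 i] that by (auto simp: cf_def)
  have Ejj: "Ef v j j = 0" by (simp add: Ef_def)
  have rel: "msingle 0 (cf i) * Ef v j j' + msingle 0 (B 1 - B 0) * Ef v j i \<in> ideal_gen n (crv n s B)"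
    if "i \<in> {2..n}" for i
    using Ef_relation[OF v(2) that jn(1)] j(1) Ejj by (auto simp: cf_def)
  have Mnz: "ev v (Mf v j i) \<noteq> 0" if "v i \<noteq> 0" for i
    unfolding Mf_eval using that j(2) s0 by simp
  have Ljj: "Lf v j j = 0" by (simp add: Lf_def)
  have cases_i: "i = j \<or> i = j' \<or> i \<in> {2..n}" if "i \<le> n" for i using j(1) that by auto
  have C0: "B 1 - B 0 \<noteq> 0" using B10 by simp
  show ?thesis
  proof (cases "\<forall>i\<in>{2..n}. v i \<noteq> 0")
    case True
    define u where "u = Lf v j j'"
    have uf: "u \<in> forms n 1" unfolding u_def using jn by (intro Lf_forms)
    have "fev y u = fps_const (v j) * y j' - fps_const (v j') * y j" by (simp add: u_def Lf_def)
    then have "fev y u = fps_const (v 1) * y 0 - fps_const (v 0) * y 1 \<or>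
      fev y u = - (fps_const (v 1) * y 0 - fps_const (v 0) * y 1)"
      using j(1) by (elim disjE) simp_all
    moreover have "subdegree (fps_const (v 1) * y 0 - fps_const (v 0) * y 1) = 1"
      using y True by (auto simp: good_def)
    ultimately have sd: "subdegree (fev y u) = 1" by (metis subdegree_uminus)
    have L: "locdiv v u 0 (Lf v j i)" if i: "i \<le> n" for i
    proof -
      consider "i = j" | "i = j'" | "i \<in> {2..n}" using cases_i[OF i] by blast
      then show ?thesis
      proof cases
        case 1 then show ?thesis by (simp add: Ljj locdiv_0)
      next
        case 2
        then show ?thesis unfolding locdiv_def u_def
          by (intro exI[of _ 0] bexI[of _ 1] conjI bexI[of _ 1]) (auto simp: forms_1)
      next
        case 3
        define A where "A = - (msingle 0 (cf i / (B 1 - B 0)) * Mf v j j')"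
        have "msingle 0 (1 / (B 1 - B 0)) * (msingle 0 (cf i) * Ef v j j' + msingle 0 (B 1 - B 0) * Ef v j i)
            \<in> ideal_gen n (crv n s B)"
          by (rule ideal_gen_mult[OF rel[OF 3]]) (simp add: mpol_ring_single)
        also have "msingle 0 (1 / (B 1 - B 0)) * (msingle 0 (cf i) * Ef v j j' + msingle 0 (B 1 - B 0) * Ef v j i)
          = msingle 0 (cf i / (B 1 - B 0)) * Ef v j j' + Ef v j i"
          using C0 by (simp add: distrib_left mult_single flip: mult.assoc)
        also have "\<dots> = Mf v j i * Lf v j i - u * A"
          by (simp add: Ef_factor A_def u_def mult_ac)
        finally have I: "Mf v j i * Lf v j i - u * A \<in> ideal_gen n (crv n s B)" .
        have "A \<in> forms n (s - 1 + 0)"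
          unfolding A_def add_0_right using jn by (intro forms_uminus forms_scale Mf_forms)
        moreover have "v i \<noteq> 0" using True 3 by auto
        ultimately show ?thesis
          by (intro locdivI[OF Mf_forms[OF i jn(1)] Mnz _ I])
      qed
    qed
    have "ev v u = 0" by (simp add: u_def Lf_def)
    then show ?thesis using uf sd locdiv_form[OF L jn(1) j(2)] by blast
  next
    case False
    then obtain k where k: "k \<in> {2..n}" "v k = 0" by auto
    have kn: "k \<le> n" using k by auto
    have nz: "v i \<noteq> 0" if "i \<le> n" "i \<noteq> k" for i
      using sol_two_zeros[OF v(2) inj_B _ s0, of i k j] that k j jn n2 by auto
    define u where "u = (msingle (msingle k 1) 1 :: 'a mpol)"
    have uf: "u \<in> forms n 1" unfolding u_def by (intro forms_single) (use kn in auto)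
    have "\<exists>c. c \<noteq> 0 \<and> y k = fps_const c * fps_X" using y k unfolding good_def by blast
    then obtain c where c: "c \<noteq> 0" "y k = fps_const c * fps_X" by blast
    have "fev y u = fps_const c * fps_X" by (simp add: u_def c)
    then have sd: "subdegree (fev y u) = 1" using subdegree_const_X[OF c(1)] by simp
    \<comment> \<open>As \<open>v k = 0\<close>, only the term in \<open>Y_k^s\<close> remains in
      \<open>Ef v j k\<close>, and \<open>A0\<close> is its quotient by u.\<close>
    define A0 where "A0 = msingle (msingle k (s - 1)) (v j ^ s)"
    have A0f: "A0 \<in> forms n (s - 1)" unfolding A0_def by (intro forms_single) (use kn in \<open>auto split: if_splits\<close>)
    have "msingle k (Suc 0) + msingle k (s - Suc 0) = (msingle k s :: nat \<Rightarrow>\<^sub>0 nat)"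
      using s0 by (simp flip: single_add)
    then have Ek: "Ef v j k = u * A0"
      using k s0 by (simp add: Ef_def A0_def u_def mult_single zero_power)
    define D where "D = - (msingle 0 ((B 1 - B 0) / cf k) * A0)"
    have Df: "D \<in> forms n (s - 1)" unfolding D_def by (intro forms_uminus forms_scale A0f)
    have Ej': "Ef v j j' - u * D \<in> ideal_gen n (crv n s B)"
    proof -
      have "msingle 0 (1 / cf k) * (msingle 0 (cf k) * Ef v j j' + msingle 0 (B 1 - B 0) * Ef v j k)
            \<in> ideal_gen n (crv n s B)"
        by (rule ideal_gen_mult[OF rel[OF k(1)]]) (simp add: mpol_ring_single)
      also have "msingle 0 (1 / cf k) * (msingle 0 (cf k) * Ef v j j' + msingle 0 (B 1 - B 0) * Ef v j k)
          = Ef v j j' + msingle 0 ((B 1 - B 0) / cf k) * Ef v j k"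
        using cf[OF k(1)] by (simp add: distrib_left mult_single flip: mult.assoc)
      also have "\<dots> = Ef v j j' - u * D"
        by (simp add: Ek D_def mult_ac)
      finally show ?thesis .
    qed
    have L: "locdiv v u 0 (Lf v j i)" if i: "i \<le> n" for i
    proof -
      consider "i = j" | "i = j'" | "i = k" | "i \<in> {2..n}" "i \<noteq> k" using cases_i[OF i] by blast
      then show ?thesis
      proof cases
        case 1 then show ?thesis by (simp add: Ljj locdiv_0)
      next
        case 2
        have "j' \<noteq> k" using j(1) k by auto
        then have "v j' \<noteq> 0" using nz jn by auto
        moreover have "Mf v j j' * Lf v j j' - u * D \<in> ideal_gen n (crv n s B)"
          using Ej' by (simp add: Ef_factor mult.commute)
        moreover have "D \<in> forms n (s - 1 + 0)" using Df by simp
        ultimately show ?thesis unfolding 2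
          by (intro locdivI[OF Mf_forms[OF jn(2,1)] Mnz])
      next
        case 3
        have "Lf v j k = u * msingle 0 (v j)" using k by (simp add: Lf_def u_def mult_single)
        then show ?thesis unfolding 3
          by (intro locdivI[OF forms_1, of _ "msingle 0 (v j)"]) (auto simp: forms_single)
      next
        case 4
        define A where "A = - (msingle 0 (cf i / (B 1 - B 0)) * D)"
        have ring: "r * (p * e + q * f) + t * (e - g) = (r * q) * f + (r * p + t) * e - t * g"
          for r p q e f t g :: "'a mpol" by (simp add: algebra_simps)
        have "msingle 0 (1 / (B 1 - B 0)) * (msingle 0 (cf i) * Ef v j j' + msingle 0 (B 1 - B 0) * Ef v j i)
            + (- msingle 0 (cf i / (B 1 - B 0))) * (Ef v j j' - u * D) \<in> ideal_gen n (crv n s B)"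
          by (intro ideal_gen_add ideal_gen_mult[OF rel[OF 4(1)]] ideal_gen_mult[OF Ej']
                mpol_ring_uminus mpol_ring_single) auto
        also have "msingle 0 (1 / (B 1 - B 0)) * (msingle 0 (cf i) * Ef v j j' + msingle 0 (B 1 - B 0) * Ef v j i)
            + (- msingle 0 (cf i / (B 1 - B 0))) * (Ef v j j' - u * D) = Ef v j i - u * A"
          unfolding ring A_def using C0 by (simp add: mult_single mult_ac)
        finally have I: "Mf v j i * Lf v j i - u * A \<in> ideal_gen n (crv n s B)"
          by (simp add: Ef_factor mult.commute)
        have "A \<in> forms n (s - 1 + 0)"
          unfolding A_def add_0_right by (intro forms_uminus forms_scale Df)
        then show ?thesis
          by (intro locdivI[OF Mf_forms[OF i jn(1)] Mnz[OF nz[OF i 4(2)]] _ I])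
      qed
    qed
    have "ev v u = 0" by (simp add: u_def k)
    then show ?thesis using uf sd locdiv_form[OF L jn(1) j(2)] by blast
  qed
qed

section \<open>The vanishing order is the order along a good arc\<close>

lemma ideal_power_0: "F \<in> mpol_ring n \<Longrightarrow> F \<in> ideal_power n M 0"
  using ideal_gen_generator[of 1 "{1}" F n] by (simp add: ideal_power_def)

lemma ideal_power_Suc:
  assumes "u \<in> M" "u \<in> mpol_ring n" "g \<in> ideal_power n M m"
  shows "u * g \<in> ideal_power n M (Suc m)"
  using assms(3) unfolding ideal_power_def
proof (induction rule: ideal_gen_induct)
  case (add q f h)
  let ?I = "ideal_gen n {prod_list fs | fs. length fs = Suc m \<and> set fs \<subseteq> M}"
  obtain fs where fs: "f = prod_list fs" "length fs = m" "set fs \<subseteq> M" using add by auto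
  have "u * f \<in> {prod_list fs | fs. length fs = Suc m \<and> set fs \<subseteq> M}"
    using fs assms(1) by (intro CollectI exI[of _ "u # fs"]) auto
  then have "q * (u * f) \<in> ?I" using add by (intro ideal_gen_generator) auto
  then have "q * (u * f) + u * h \<in> ?I" using add by (intro ideal_gen_add) auto
  moreover have "u * (q * f + h) = q * (u * f) + u * h" by (simp add: algebra_simps)
  ultimately show ?case by simp
qed simp

text \<open>One unit of order along the arc is traded for one factor u of the point ideal: locally F
  is u A with A of order one less, and the induction continues with A. The local denominators are
  collected in H.\<close>

lemma vanishing_order_witness:
  assumes v: "v \<in> coord_vectors n" "sol n s B v" and y: "good n s B v y"
  shows "F \<in> forms n d \<Longrightarrow> fev y F \<noteq> 0 \<Longrightarrow> m \<le> subdegree (fev y F) \<Longrightarrow>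
    \<exists>H \<in> (\<Union>e. forms n e) - point_ideal n (pclass n v).
       \<exists>g \<in> ideal_power n (point_ideal n (pclass n v)) m. \<exists>h \<in> ideal_gen n (crv n s B). H * F = g + h"
proof (induction m arbitrary: F d)
  case 0
  have "1 \<notin> point_ideal n (pclass n v)" using point_ideal_form[OF forms_1 v(1)] by simp
  then show ?case
    using forms_1 ideal_power_0[OF forms_mpol_ring[OF 0(1)]]
    by (intro bexI[of _ 1] bexI[of _ F] bexI[of _ 0]) auto
next
  case (Suc m)
  have arc: "arc n s B y" and y0: "\<And>i. i \<le> n \<Longrightarrow> y i $ 0 = v i" using y by (auto simp: good_def)
  then have sol: "sol n s cB y" by (simp add: arc_def)
  have Fv: "ev v F = 0"
    using fev_nth_0[OF forms_mpol_ring[OF Suc.prems(1)] y0] Suc.prems(3)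
      nth_less_subdegree_zero[of 0 "fev y F"] by simp
  have "d \<noteq> 0"
  proof
    assume "d = 0"
    have "F = msingle 0 (mlookup F 0)"
    proof (rule poly_mapping_eqI)
      fix k
      have "k = 0" if "k \<in> mkeys F"
      proof -
        have "mdeg k = 0" using Suc.prems(1) that \<open>d = 0\<close> by (auto simp: forms_iff)
        then show "k = 0" by (intro poly_mapping_eqI) (metis mdeg_def finite_keys in_keys_iff lookup_zero sum_eq_0_iff)
      qed
      then show "mlookup F k = mlookup (msingle 0 (mlookup F 0)) k"
        by (auto simp: lookup_single when_def in_keys_iff)
    qed
    then have "F = msingle 0 c" if "c = mlookup F 0" for c using that by simp
    then obtain c where c: "F = msingle 0 c" by blast
    then show False using Fv Suc.prems(2) by simp
  qed
  then obtain e where e: "d = Suc e" by (cases d) auto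
  obtain u where u: "u \<in> forms n 1" "ev v u = 0" "subdegree (fev y u) = 1"
    "\<And>e F. F \<in> forms n (Suc e) \<Longrightarrow> ev v F = 0 \<Longrightarrow> locdiv v u e F"
    using uniformizer[OF v y] by blast
  obtain a H A where H: "H \<in> forms n a" "ev v H \<noteq> 0" "A \<in> forms n (a + e)"
    "H * F - u * A \<in> ideal_gen n (crv n s B)"
    using u(4)[OF Suc.prems(1)[unfolded e] Fv] unfolding locdiv_def by blast
  have eq: "fev y H * fev y F = fev y u * fev y A"
    using fev_ideal[OF sol H(4)] by simp
  have H0: "fev y H $ 0 \<noteq> 0" using fev_nth_0[OF forms_mpol_ring[OF H(1)] y0] H(2) by simp
  then have Hnz: "fev y H \<noteq> 0" "subdegree (fev y H) = 0" by auto
  have Anz: "fev y A \<noteq> 0" using eq Hnz Suc.prems(2) by auto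
  have unz: "fev y u \<noteq> 0" using u(3) by auto
  have "subdegree (fev y F) = 1 + subdegree (fev y A)"
    using arg_cong[OF eq, of subdegree] Hnz Anz unz Suc.prems(2) u(3) by simp
  then have "m \<le> subdegree (fev y A)" using Suc.prems(3) by simp
  then obtain K g h where K: "K \<in> (\<Union>e. forms n e) - point_ideal n (pclass n v)"
    "g \<in> ideal_power n (point_ideal n (pclass n v)) m" "h \<in> ideal_gen n (crv n s B)" "K * A = g + h"
    using Suc.IH[OF H(3) Anz] by blast
  obtain b where b: "K \<in> forms n b" using K(1) by auto
  have KH: "K * H \<in> forms n (b + a)" by (rule forms_mult[OF b H(1)])
  have "ev v K \<noteq> 0" using K(1) point_ideal_form[OF b v(1)] by simp
  then have "K * H \<notin> point_ideal n (pclass n v)" using point_ideal_form[OF KH v(1)] H(2) by simp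
  moreover have "K * H * F = u * g + (u * h + K * (H * F - u * A))"
  proof -
    have "u * g + (u * h + K * (H * F - u * A)) = u * (g + h) + K * (H * F - u * A)"
      by (simp add: algebra_simps)
    also have "\<dots> = K * H * F" unfolding K(4)[symmetric] by (simp add: algebra_simps)
    finally show ?thesis by simp
  qed
  moreover have "u * g \<in> ideal_power n (point_ideal n (pclass n v)) (Suc m)"
    using u(2) point_ideal_form[OF u(1) v(1)]
    by (intro ideal_power_Suc K(2) forms_mpol_ring[OF u(1)]) auto
  moreover have "u * h + K * (H * F - u * A) \<in> ideal_gen n (crv n s B)"
    using K(3) H(4) u(1) b by (intro ideal_gen_add ideal_gen_mult) (auto dest: forms_mpol_ring)
  ultimately show ?case using KH by blast
qed

lemma ideal_power_subdegree:
  assumes v: "v \<in> coord_vectors n" and y0: "\<And>i. i \<le> n \<Longrightarrow> y i $ 0 = v i"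
    and g: "g \<in> ideal_power n (point_ideal n (pclass n v)) m"
  shows "fps_X ^ m dvd fev y g"
  using g unfolding ideal_power_def
proof (induction rule: ideal_gen_induct)
  case (add q f h)
  then obtain fs where fs: "f = prod_list fs" "length fs = m" "set fs \<subseteq> point_ideal n (pclass n v)" by auto
  have "fps_X ^ length fs dvd prod_list (map (fev y) fs)" using fs(3)
  proof (induction fs)
    case (Cons f fs)
    then have "ev v f = 0" "f \<in> mpol_ring n" using point_ideal_eval[OF _ v] by (auto simp: point_ideal_def)
    then have "fev y f $ 0 = 0" using fev_nth_0[of f n y v] y0 by simp
    then have "fps_X dvd fev y f"
      by (cases "fev y f = 0") (auto simp: fps_dvd_iff Suc_le_eq subdegree_eq_0_iff intro!: gr0I)
    then show ?case using Cons by (auto intro: mult_dvd_mono)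
  qed simp
  then have "fps_X ^ m dvd fev y f" by (simp add: fs)
  then show ?case using add.IH by (auto intro: dvd_add dvd_mult)
qed simp

text \<open>The bound from above: elements of the m-th power of the point ideal pull back to
  multiples of X^m, the equations pull back to 0, and denominators pull back to units. Together with
  \<open>vanishing_order_witness\<close> the maximum exists and is the subdegree.\<close>

theorem vanishing_order_good:
  assumes v: "v \<in> coord_vectors n" "sol n s B v" and y: "good n s B v y"
    and F: "F \<in> forms n d" "fev y F \<noteq> 0"
  shows "vanishing_order n (crv n s B) F (pclass n v) = subdegree (fev y F)"
  unfolding vanishing_order_def
proof (rule Greatest_equality)
  show "\<exists>H \<in> (\<Union>e. forms n e) - point_ideal n (pclass n v).
       \<exists>g \<in> ideal_power n (point_ideal n (pclass n v)) (subdegree (fev y F)).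
       \<exists>h \<in> ideal_gen n (crv n s B). H * F = g + h"
    by (rule vanishing_order_witness[OF v y F]) simp
next
  fix m assume "\<exists>H \<in> (\<Union>e. forms n e) - point_ideal n (pclass n v).
       \<exists>g \<in> ideal_power n (point_ideal n (pclass n v)) m. \<exists>h \<in> ideal_gen n (crv n s B). H * F = g + h"
  then obtain H g h e where H: "H \<in> forms n e" "H \<notin> point_ideal n (pclass n v)"
    "g \<in> ideal_power n (point_ideal n (pclass n v)) m" "h \<in> ideal_gen n (crv n s B)" "H * F = g + h"
    by blast
  have sol: "sol n s cB y" and y0: "\<And>i. i \<le> n \<Longrightarrow> y i $ 0 = v i"
    using y by (auto simp: good_def arc_def)
  have "fev y H $ 0 = ev v H" by (rule fev_nth_0[OF forms_mpol_ring[OF H(1)] y0])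
  then have H0: "fev y H $ 0 \<noteq> 0" using H(2) point_ideal_form[OF H(1) v(1)] by simp
  have "fev y (H * F) = fev y g" unfolding H(5) using fev_ideal[OF sol H(4)] by simp
  then have "fps_X ^ m dvd fev y H * fev y F"
    using ideal_power_subdegree[OF v(1) y0 H(3)] by simp
  moreover have "fev y H * fev y F \<noteq> 0" using H0 F(2) by auto
  ultimately have "m \<le> subdegree (fev y H * fev y F)"
    using dvd_imp_subdegree_le[of "fps_X ^ m" "fev y H * fev y F"] by simp
  also have "\<dots> = subdegree (fev y F)" using H0 F(2) by (subst subdegree_mult) auto
  finally show "m \<le> subdegree (fev y F)" .
qed

end

section \<open>Irreducibility and smoothness\<close>

context curve
begin

text \<open>By \<open>arc_vanishing\<close>, nonvanishing of a form along one arc means nonvanishing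
  along every arc, and by \<open>nonvan_iff\<close> it means that the form does not vanish on the
  whole curve.\<close>

definition nonvan :: "'a mpol \<Rightarrow> bool" where
  "nonvan F \<longleftrightarrow> (\<exists>y. arc n s B y \<and> fev y F \<noteq> 0)"

lemma nonvanD: "nonvan F \<Longrightarrow> F \<in> forms n d \<Longrightarrow> arc n s B y \<Longrightarrow> fev y F \<noteq> 0"
  using arc_vanishing[of n F d y] n2 unfolding nonvan_def by fastforce

lemma goodD:
  assumes "good n s B v y"
  shows "arc n s B y" "sol n s cB y" "\<And>i. i \<le> n \<Longrightarrow> y i $ 0 = v i"
  using assms by (auto simp: good_def arc_def)

lemma pt_zero_unique:
  assumes "v \<in> coord_vectors n" "sol n s B v" "i \<le> n" "k \<le> n" "i \<noteq> k" "v k = 0"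
  shows "v i \<noteq> 0"
proof
  assume "v i = 0"
  then have "v j = 0" if "j \<le> n" for j
    using sol_two_zeros[OF assms(2) inj_B _ s0 assms(3,4,5) _ assms(6) that] n2 by simp
  then show False using pt_nz[OF assms(1,2)] n2 by auto
qed

lemma trunc_point:
  assumes "sol n s B v" "v 0 \<noteq> 0 \<or> v 1 \<noteq> 0"
  defines "w \<equiv> \<lambda>i. if i \<le> n then v i else 0"
  shows "w \<in> coord_vectors n" "sol n s B w" "F \<in> mpol_ring n \<Longrightarrow> ev w F = ev v F"
    "w 0 = v 0" "w 1 = v 1"
proof -
  show w01: "w 0 = v 0" "w 1 = v 1" using n2 by (auto simp: w_def)
  show "w \<in> coord_vectors n"
  proof -
    have "w 0 \<noteq> 0 \<or> w 1 \<noteq> 0" using assms(2) w01 by metis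
    then show ?thesis by (auto simp: coord_vectors_def) (auto simp: w_def)
  qed
  show "sol n s B w" using assms(1) n2 by (simp add: sol_def w_def)
  show "F \<in> mpol_ring n \<Longrightarrow> ev w F = ev v F" by (rule gev_cong_ring) (auto simp: w_def)
qed

lemma nonvan_if_point:
  assumes "F \<in> forms n d" "v \<in> coord_vectors n" "sol n s B v" "ev v F \<noteq> 0"
  shows "nonvan F"
proof -
  obtain y where y: "good n s B v y" using good_at_point[OF assms(2,3)] by blast
  have "fev y F $ 0 = ev v F" by (rule fev_nth_0[OF forms_mpol_ring[OF assms(1)] goodD(3)[OF y]])
  then have "fev y F \<noteq> 0" using assms(4) by auto
  then show ?thesis using goodD(1)[OF y] by (auto simp: nonvan_def)
qed

lemma nonvan_point:
  assumes "F \<in> forms n d" "nonvan F"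
  shows "\<exists>v\<in>coord_vectors n. sol n s B v \<and> ev v F \<noteq> 0"
proof -
  obtain v where v: "sol n s B v" "v 1 = 1" "ev v F \<noteq> 0"
    using nonvanishing_point[OF assms(1)] assms(2) unfolding nonvan_def by blast
  then show ?thesis using trunc_point[of v] forms_mpol_ring[OF assms(1)] by fastforce
qed

lemma nonvan_iff:
  assumes "F \<in> forms n d"
  shows "nonvan F \<longleftrightarrow> \<not> pts \<subseteq> zero_locus n {F}"
proof -
  have iff: "pclass n v \<in> zero_locus n {F} \<longleftrightarrow> ev v F = 0" if "v \<in> coord_vectors n" for v
    using zero_locus_iff[of "{F}" n v] assms that by auto
  show ?thesis
  proof
    assume "nonvan F"
    then obtain v where "v \<in> coord_vectors n" "sol n s B v" "ev v F \<noteq> 0"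
      using nonvan_point[OF assms] by blast
    then show "\<not> pts \<subseteq> zero_locus n {F}" using iff zero_locus_crv_iff by blast
  next
    assume "\<not> pts \<subseteq> zero_locus n {F}"
    then obtain P where P: "P \<in> pts" "P \<notin> zero_locus n {F}" by blast
    obtain v where v: "v \<in> coord_vectors n" "sol n s B v" "P = pclass n v"
      using zero_locus_crvE[OF P(1)] .
    then show "nonvan F" using nonvan_if_point[OF assms v(1,2)] P(2) iff[OF v(1)] by simp
  qed
qed

lemma nonvan_mult:
  assumes "F \<in> forms n d" "G \<in> forms n e" "nonvan F" "nonvan G"
  shows "nonvan (F * G)"
proof -
  obtain y where y: "arc n s B y" using assms(3) by (auto simp: nonvan_def)
  then have "fev y (F * G) \<noteq> 0" using nonvanD[OF assms(3,1) y] nonvanD[OF assms(4,2) y] by simp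
  then show ?thesis using y by (auto simp: nonvan_def)
qed

lemma pts_nonempty: "pts \<noteq> {}"
proof -
  obtain v where v: "sol n s B v" "v 0 = 1" using point_over[OF order_refl] by blast
  show ?thesis using trunc_point[OF v(1)] v(2) zero_locus_crv_iff by fastforce
qed

text \<open>A closed set that misses a point of the curve lies in the zeros of a form that is
  \<open>nonvan\<close>. Power series have no zero divisors, so the product of two such forms is
  \<open>nonvan\<close> too and is nonzero at some point of the curve.\<close>

lemma irreducible: "proj_irreducible n pts"
  unfolding proj_irreducible_def
proof (intro conjI allI impI)
  show "pts \<noteq> {}" by (rule pts_nonempty)
next
  fix C D assume a: "proj_closed n C \<and> proj_closed n D \<and> pts \<subseteq> C \<union> D"
  have ex: "\<exists>d. \<exists>F\<in>forms n d. nonvan F \<and> (\<forall>v\<in>coord_vectors n. pclass n v \<in> Z \<longrightarrow> ev v F = 0)"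
    if Z: "proj_closed n Z" "\<not> pts \<subseteq> Z" for Z
  proof -
    obtain E where E: "E \<subseteq> (\<Union>d. forms n d)" "Z = zero_locus n E"
      using Z(1) unfolding proj_closed_def by blast
    obtain P where P: "P \<in> pts" "P \<notin> Z" using Z(2) by blast
    obtain v where v: "v \<in> coord_vectors n" "sol n s B v" "P = pclass n v"
      using zero_locus_crvE[OF P(1)] .
    obtain F where F: "F \<in> E" "ev v F \<noteq> 0"
      using P(2) zero_locus_iff[OF E(1) v(1)] unfolding E(2) v(3) by blast
    obtain d where d: "F \<in> forms n d" using F(1) E(1) by blast
    have "nonvan F" using nonvan_if_point[OF d v(1,2) F(2)] .
    moreover have "\<forall>v\<in>coord_vectors n. pclass n v \<in> Z \<longrightarrow> ev v F = 0"
      using zero_locus_iff[OF E(1)] F(1) unfolding E(2) by blast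
    ultimately show ?thesis using d by blast
  qed
  show "pts \<subseteq> C \<or> pts \<subseteq> D"
  proof (rule ccontr)
    assume neg: "\<not> (pts \<subseteq> C \<or> pts \<subseteq> D)"
    obtain d F where F: "F \<in> forms n d" "nonvan F" "\<And>v. v \<in> coord_vectors n \<Longrightarrow> pclass n v \<in> C \<Longrightarrow> ev v F = 0"
      using ex[of C] a neg by blast
    obtain e G where G: "G \<in> forms n e" "nonvan G" "\<And>v. v \<in> coord_vectors n \<Longrightarrow> pclass n v \<in> D \<Longrightarrow> ev v G = 0"
      using ex[of D] a neg by blast
    obtain v where v: "v \<in> coord_vectors n" "sol n s B v" "ev v (F * G) \<noteq> 0"
      using nonvan_point[OF forms_mult[OF F(1) G(1)] nonvan_mult[OF F(1) G(1) F(2) G(2)]] by blast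
    then have "pclass n v \<in> C \<union> D" using zero_locus_crv_iff a by blast
    then show False using F(3)[OF v(1)] G(3)[OF v(1)] v(3) by auto
  qed
qed

end

section \<open>Derivatives and the Jacobian criterion\<close>

lemma mpol_deriv_add: "mpol_deriv i (p + q) = mpol_deriv i p + mpol_deriv i q"
  unfolding mpol_deriv_def by (rule setsum_keys_plus_distrib) (auto simp: distrib_left single_add)

lemma mpol_deriv_single:
  "mpol_deriv i (msingle m a) = msingle (m - msingle i 1) (of_nat (mlookup m i) * a)"
  by (simp add: mpol_deriv_def)

lemma ev_deriv_power:
  "ev v (mpol_deriv i (msingle (msingle k s) a)) = (if i = k then of_nat s * a * v i ^ (s - 1) else 0)"
proof (cases "i = k")
  case True
  have "msingle k s - msingle k (Suc 0) = (msingle k (s - Suc 0) :: nat \<Rightarrow>\<^sub>0 nat)"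
    by (rule poly_mapping_eqI) (simp add: lookup_minus lookup_single when_def)
  then show ?thesis using True by (simp add: mpol_deriv_single)
next
  case False
  then show ?thesis by (simp add: mpol_deriv_single lookup_single)
qed

lemma mpol_dim_independent:
  fixes r :: "nat \<Rightarrow> 'a::field mpol"
  assumes fin: "finite I" and ind: "\<And>u. (\<Sum>i\<in>I. msingle 0 (u i) * r i) = 0 \<Longrightarrow> \<forall>i\<in>I. u i = 0"
  shows "mpol_dim (r ` I) = card I"
proof -
  have inj: "inj_on r I"
  proof (rule inj_onI, rule ccontr)
    fix i j assume ij: "i \<in> I" "j \<in> I" "r i = r j" "i \<noteq> j"
    define u where "u k = (if k = i then 1 else if k = j then - 1 else 0 :: 'a)" for k
    have "(\<Sum>k\<in>I. msingle 0 (u k) * r k) = (\<Sum>k\<in>{i, j}. msingle 0 (u k) * r k)"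
      by (rule sum.mono_neutral_right) (use fin ij in \<open>auto simp: u_def\<close>)
    also have "\<dots> = 0" using ij by (simp add: u_def single_uminus)
    finally have "u i = 0" using ind ij(1) by blast
    then show False by (simp add: u_def)
  qed
  have "mpol_vs.independent (r ` I)"
  proof
    assume "mpol_vs.dependent (r ` I)"
    then obtain u v where v: "v \<in> r ` I" "u v \<noteq> 0" "(\<Sum>v\<in>r ` I. msingle 0 (u v) * v) = 0"
      using mpol_vs.dependent_finite[of "r ` I"] fin by auto
    then have "(\<Sum>i\<in>I. msingle 0 (u (r i)) * r i) = 0" by (simp add: sum.reindex[OF inj])
    then have "\<forall>i\<in>I. u (r i) = 0" by (rule ind)
    then show False using v by auto
  qed
  then have "mpol_vs.dim (r ` I) = card (r ` I)" by (rule mpol_vs.dim_eq_card[OF refl])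
  then show ?thesis by (simp add: mpol_dim_def card_image[OF inj])
qed

lemma lookup_linform: "mlookup (linform n l) (msingle k 1) = (if k \<le> n then l k else 0)"
proof -
  have "msingle j (1::nat) = msingle k 1 \<longleftrightarrow> j = k" for j
    by (metis keys_single one_neq_zero singleton_inject)
  then show ?thesis by (simp add: linform_def lookup_sum lookup_single when_def)
qed

context curve
begin

text \<open>For k \<ge> 2 column k meets only row k, in an entry that is nonzero if
  \<open>v k\<close> is. At most one such \<open>v k\<close> vanishes; then \<open>v 0\<close> is
  nonzero, and column 0 disposes of the one remaining row.\<close>

lemma jacobian_rank_point:
  assumes v: "v \<in> coord_vectors n" "sol n s B v"
  shows "jacobian_rank n (crv n s B) v + 1 = n"
proof -
  define c where "c i j = (if j = 0 then of_nat s * (B i - B 1) * v 0 ^ (s - 1) else 0)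
    + (if j = 1 then of_nat s * (B 0 - B i) * v 1 ^ (s - 1) else 0)
    + (if j = i then of_nat s * (B 1 - B 0) * v i ^ (s - 1) else 0)" for i j :: nat
  have "mpol_eval v (mpol_deriv j (eqn s B i)) = c i j" for i j
    unfolding mpol_eval_gev eqn_def mpol_deriv_add c_def
    by (simp add: ev_deriv_power)
  then have "jacobian_rank n (crv n s B) v = mpol_dim ((\<lambda>i. linform n (c i)) ` {2..n})"
    by (simp add: jacobian_rank_def crv_def image_image linform_def)
  also have "\<dots> = card {2..n}"
  proof (rule mpol_dim_independent)
    fix u :: "nat \<Rightarrow> 'a" assume 0: "(\<Sum>i\<in>{2..n}. msingle 0 (u i) * linform n (c i)) = 0"
    have coef: "(\<Sum>i\<in>{2..n}. u i * c i k) = 0" if "k \<le> n" for k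
      using arg_cong[OF 0, of "\<lambda>p. mlookup p (msingle k 1)"] that
      by (simp add: lookup_sum lookup_scale lookup_linform[simplified])
    have u0: "u k = 0" if k: "k \<in> {2..n}" "v k \<noteq> 0" for k
    proof -
      have "(\<Sum>i\<in>{2..n}. u i * c i k) = (\<Sum>i\<in>{2..n}. if i = k then u k * c k k else 0)"
        by (rule sum.cong) (use k in \<open>auto simp: c_def\<close>)
      also have "\<dots> = u k * c k k" using k by simp
      finally have "u k * c k k = 0" using coef k by simp
      moreover have "c k k \<noteq> 0" using k s0 B10 by (simp add: c_def)
      ultimately show ?thesis by simp
    qed
    show "\<forall>i\<in>{2..n}. u i = 0"
    proof
      fix k assume k: "k \<in> {2..n}"
      show "u k = 0"
      proof (cases "v k = 0")
        case True
        have o: "v i \<noteq> 0" if "i \<le> n" "i \<noteq> k" for i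
          using pt_zero_unique[OF v that(1) _ that(2) True] k by simp
        have "(\<Sum>i\<in>{2..n}. u i * c i 0) = (\<Sum>i\<in>{2..n}. if i = k then u k * c k 0 else 0)"
          by (rule sum.cong) (use u0 o in auto)
        also have "\<dots> = u k * c k 0" using k by simp
        finally have "u k * c k 0 = 0" using coef by simp
        moreover have "B k \<noteq> B 1" using inj_B k by (auto dest!: inj_onD)
        then have "c k 0 \<noteq> 0" using k s0 o[of 0] by (simp add: c_def)
        ultimately show ?thesis by simp
      qed (use u0 k in simp)
    qed
  qed simp
  finally show ?thesis using n2 by simp
qed

section \<open>Forms divisible by a binary form along the curve\<close>

lemma good_act:
  assumes "good n s B v y" "t \<in> T 1 n"
  shows "good n s B (\<lambda>i. t i * v i) (act t y)"
proof -
  have t01: "t 0 = 1" "t 1 = 1" "t (Suc 0) = 1" using T_low[OF assms(2)] by auto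
  then have a01: "act t y 0 = y 0" "act t y 1 = y 1" "act t y (Suc 0) = y (Suc 0)"
    by (auto simp: act_def)
  have "\<exists>d. d \<noteq> 0 \<and> act t y i = fps_const d * fps_X" if i: "i \<in> {2..n}" "v i = 0" for i
  proof -
    obtain c where "c \<noteq> 0" "y i = fps_const c * fps_X" using assms(1) i unfolding good_def by blast
    moreover from this have "act t y i = fps_const (t i * c) * fps_X"
      unfolding act_def fps_const_mult[symmetric] mult.assoc by (simp only:)
    ultimately show ?thesis using T_nz[OF assms(2), of i]
      by (intro exI[of _ "t i * c"]) simp
  qed
  moreover have "arc n s B (act t y)" using act_arc[OF goodD(1)[OF assms(1)] assms(2)] by simp
  moreover have "\<forall>i\<le>n. act t y i $ 0 = t i * v i" using goodD(3)[OF assms(1)] by (simp add: act_def)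
  ultimately show ?thesis
    using assms(1) T_nz[OF assms(2)] unfolding good_def a01 t01 by (auto simp: t01)
qed

lemma act_point:
  assumes "v \<in> coord_vectors n" "sol n s B v" "t \<in> T 1 n"
  shows "(\<lambda>i. t i * v i) \<in> coord_vectors n" "sol n s B (\<lambda>i. t i * v i)"
proof -
  show "(\<lambda>i. t i * v i) \<in> coord_vectors n"
    using assms(1) T_nz[OF assms(3)] by (auto simp: coord_vectors_def)
  have "(t i * v i) ^ s = v i ^ s" for i using T_pow[OF assms(3)] by (simp add: power_mult_distrib)
  then show "sol n s B (\<lambda>i. t i * v i)" using assms(2) by (simp add: sol_def)
qed

lemma lam_subdegree:
  assumes "good n s B v y"
  shows "subdegree (fev y (lam (v 0, v 1))) = (if \<exists>k\<in>{2..n}. v k = 0 then s else 1)"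
  using assms unfolding good_def by (auto simp: fps_const_hom.gev_lam)

lemma good_nonunit:
  assumes "good n s B v y" "i \<in> {2..n}"
  shows "y i \<noteq> 0" "subdegree (y i) = (if v i = 0 then 1 else 0)"
proof -
  have "y i \<noteq> 0 \<and> subdegree (y i) = (if v i = 0 then 1 else 0)"
  proof (cases "v i = 0")
    case True
    then obtain c where "c \<noteq> 0" "y i = fps_const c * fps_X" using assms unfolding good_def by blast
    then show ?thesis using True subdegree_const_X[of c] by auto
  next
    case False
    then have "y i $ 0 \<noteq> 0" using goodD(3)[OF assms(1)] assms(2) by simp
    then show ?thesis using False by auto
  qed
  then show "y i \<noteq> 0" "subdegree (y i) = (if v i = 0 then 1 else 0)" by auto
qed

text \<open>Only one of the coordinates $Y_i$, $i \ge 2$, can vanish at a point, and its exponent in a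
  reduced monomial is less than the ramification index s; so a reduced monomial is never divisible by
  the linear form in $Y_0, Y_1$ through that point.\<close>

lemma chm_subdegree:
  assumes v: "v \<in> coord_vectors n" "sol n s B v" and y: "good n s B v y" and \<chi>: "\<chi> \<in> Ch 1 n"
  shows "chm 1 n \<chi> y \<noteq> 0" "subdegree (chm 1 n \<chi> y) < subdegree (fev y (lam (v 0, v 1)))"
proof -
  have I: "{Suc 1..n} = {2..n}" by auto
  show "chm 1 n \<chi> y \<noteq> 0"
    unfolding chm_def using good_nonunit(1)[OF y] by (auto simp: prod_zero_iff I)
  have "subdegree (chm 1 n \<chi> y) = (\<Sum>i\<in>{2..n}. \<chi> i * (if v i = 0 then 1 else 0))"
    unfolding chm_def I using good_nonunit[OF y] by (subst subdegree_prod) auto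
  also have "\<dots> < subdegree (fev y (lam (v 0, v 1)))"
  proof (cases "\<exists>k\<in>{2..n}. v k = 0")
    case True
    then obtain k where k: "k \<in> {2..n}" "v k = 0" by auto
    have "(\<Sum>i\<in>{2..n}. \<chi> i * (if v i = 0 then 1 else 0)) = (\<Sum>i\<in>{2..n}. if i = k then \<chi> k else 0)"
      by (rule sum.cong) (use k pt_zero_unique[OF v] in auto)
    also have "\<dots> = \<chi> k" using k by simp
    also have "\<dots> < s" using \<chi> k by (auto simp: Ch_def)
    finally show ?thesis using True lam_subdegree[OF y] by simp
  next
    case False
    then have "(\<Sum>i\<in>{2..n}. \<chi> i * (if v i = 0 then 1 else 0)) = 0" by auto
    then show ?thesis using False lam_subdegree[OF y] by simp
  qed
  finally show "subdegree (chm 1 n \<chi> y) < subdegree (fev y (lam (v 0, v 1)))" .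
qed

lemma forms_deg_0:
  assumes "F \<in> forms m 0"
  shows "\<exists>c. F = msingle 0 c"
proof -
  have "F = msingle 0 (mlookup F 0)"
  proof (rule poly_mapping_eqI)
    fix k
    have "k = 0" if "k \<in> mkeys F"
    proof -
      have "mdeg k = 0" using assms that by (auto simp: forms_iff)
      then show "k = 0"
        by (intro poly_mapping_eqI) (metis mdeg_def finite_keys in_keys_iff lookup_zero sum_eq_0_iff)
    qed
    then show "mlookup F k = mlookup (msingle 0 (mlookup F 0)) k"
      by (auto simp: lookup_single when_def in_keys_iff)
  qed
  then show ?thesis by blast
qed

text \<open>Local divisibility at all points over \<open>ab\<close> becomes divisibility by a form
  modulo the equations. All conjugates of an arc have the same \<open>Y_0\<close>,
  \<open>Y_1\<close>, so the isotypic projections inherit divisibility by \<open>lam ab\<close>;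
  comparing orders forces each binary form \<open>H \<chi>\<close> to vanish at
  \<open>ab\<close>.\<close>

lemma lam_factor:
  assumes F: "F \<in> forms n (Suc d)" and ab: "ab \<in> P1N"
    and dvd: "\<And>v y. v \<in> coord_vectors n \<Longrightarrow> sol n s B v \<Longrightarrow> good n s B v y \<Longrightarrow> fev y (lam ab) dvd fev y F"
  shows "\<exists>G\<in>forms n d. \<forall>y. sol n s cB y \<longrightarrow> fev y F = fev y (lam ab) * fev y G"
proof -
  have n1: "1 \<le> n" using n2 by simp
  obtain H where H: "decomp 1 n (Suc d) F H" using decomp_exists[OF F order_refl n1] by auto
  obtain v0 where v0: "sol n s B v0" "v0 0 = fst ab" "v0 1 = snd ab" using point_over[OF order_refl] by blast
  have "v0 0 \<noteq> 0 \<or> v0 1 \<noteq> 0" using v0 P1N_nz[OF ab] by (metis prod.collapse)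
  note tr = trunc_point[OF v0(1) this]
  obtain v where v: "v \<in> coord_vectors n" "sol n s B v" "v 0 = fst ab" "v 1 = snd ab"
    using that[OF tr(1,2)] tr(4,5) v0(2,3) by simp
  have ab_eq: "ab = (v 0, v 1)" using v by simp
  obtain y where y: "good n s B v y" using good_at_point[OF v(1,2)] by blast
  have soly: "sol n s cB y" using goodD(2)[OF y] .
  have "\<exists>K\<in>forms 1 (d - wt 1 n \<chi>). H \<chi> = lam ab * K \<and> (d < wt 1 n \<chi> \<longrightarrow> K = 0)" if \<chi>: "\<chi> \<in> Ch 1 n" for \<chi>
  proof -
    have H\<chi>: "H \<chi> \<in> forms 1 (Suc d - wt 1 n \<chi>)" "Suc d < wt 1 n \<chi> \<Longrightarrow> H \<chi> = 0"
      using H \<chi> by (auto simp: decomp_def)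
    have "fev y (lam ab) dvd (\<Sum>t\<in>T 1 n. fps_const (\<Prod>i\<in>{Suc 1..n}. t i ^ (s - \<chi> i)) * fev (act t y) F)"
    proof (intro dvd_sum dvd_mult)
      fix t assume t: "t \<in> T 1 n"
      have "fev (act t y) (lam ab) dvd fev (act t y) F"
        using dvd[OF act_point[OF v(1,2) t] good_act[OF y t]] .
      moreover have "fev (act t y) (lam ab) = fev y (lam ab)"
        by (rule fev_act_low[OF lam_forms t]) simp
      ultimately show "fev y (lam ab) dvd fev (act t y) F" by simp
    qed
    then have "fev y (lam ab) dvd fps_const (of_nat (card (T 1 n))) * (chm 1 n \<chi> y * fev y (H \<chi>))"
      unfolding decomp_extract[OF H \<chi> soly order_refl] .
    moreover have "is_unit (fps_const (of_nat (card (T 1 n))) :: 'a fps)"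
      using card_T_nz[of 1 n] by (simp add: fps_is_unit_iff)
    ultimately have d1: "fev y (lam ab) dvd chm 1 n \<chi> y * fev y (H \<chi>)"
      using dvd_mult_unit_iff' by blast
    \<comment> \<open>Otherwise \<open>H \<chi>\<close> is a unit along y and the monomial of \<chi>
      alone would be divisible by \<open>lam ab\<close>, against
      \<open>chm_subdegree\<close>.\<close>
    have root: "ev v (H \<chi>) = 0"
    proof (rule ccontr)
      assume nz: "ev v (H \<chi>) \<noteq> 0"
      have "fev y (H \<chi>) $ 0 = ev v (H \<chi>)"
        using fev_nth_0[OF forms_mpol_ring[OF H\<chi>(1)], of y v] goodD(3)[OF y] n1 by simp
      then have u: "fev y (H \<chi>) $ 0 \<noteq> 0" using nz by simp
      then have u': "fev y (H \<chi>) \<noteq> 0" "subdegree (fev y (H \<chi>)) = 0" by auto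
      have "subdegree (fev y (lam ab)) \<le> subdegree (chm 1 n \<chi> y * fev y (H \<chi>))"
        using d1 chm_subdegree(1)[OF v(1,2) y \<chi>] u' by (intro dvd_imp_subdegree_le) auto
      also have "\<dots> = subdegree (chm 1 n \<chi> y)"
        using chm_subdegree(1)[OF v(1,2) y \<chi>] u' by simp
      finally show False using chm_subdegree(2)[OF v(1,2) y \<chi>] ab_eq by simp
    qed
    consider "Suc d < wt 1 n \<chi>" | "wt 1 n \<chi> = Suc d" | "wt 1 n \<chi> \<le> d" by linarith
    then show ?thesis
    proof cases
      case 1 then show ?thesis using H\<chi>(2) by (intro bexI[of _ 0]) auto
    next
      \<comment> \<open>The component has degree 0, so it is a constant with a zero.\<close>
      case 2
      then obtain c where "H \<chi> = msingle 0 c" using forms_deg_0[of "H \<chi>" 1] H\<chi>(1) by auto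
      then have "H \<chi> = 0" using root by simp
      then show ?thesis by (intro bexI[of _ 0]) auto
    next
      case 3
      then have "H \<chi> \<in> forms 1 (Suc (d - wt 1 n \<chi>))" using H\<chi>(1) by (simp add: Suc_diff_le)
      from lam_dvd_form[OF this ab root v(3,4)] show ?thesis using 3 by auto
    qed
  qed
  then obtain K where K: "\<And>\<chi>. \<chi> \<in> Ch 1 n \<Longrightarrow> K \<chi> \<in> forms 1 (d - wt 1 n \<chi>)"
    "\<And>\<chi>. \<chi> \<in> Ch 1 n \<Longrightarrow> H \<chi> = lam ab * K \<chi>" "\<And>\<chi>. \<chi> \<in> Ch 1 n \<Longrightarrow> d < wt 1 n \<chi> \<Longrightarrow> K \<chi> = 0"
    by metis
  define G where "G = (\<Sum>\<chi>\<in>Ch 1 n. chm 1 n \<chi> (\<lambda>i. msingle (msingle i 1) 1) * K \<chi>)"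
  have "G \<in> forms n d"
    unfolding G_def
  proof (rule forms_sum)
    fix \<chi> assume \<chi>: "\<chi> \<in> Ch 1 n"
    show "chm 1 n \<chi> (\<lambda>i. msingle (msingle i 1) 1) * K \<chi> \<in> forms n d"
    proof (cases "d < wt 1 n \<chi>")
      case True then show ?thesis using K(3)[OF \<chi>] by simp
    next
      case False
      have "chm 1 n \<chi> (\<lambda>i. msingle (msingle i 1) 1 :: 'a mpol) \<in> forms n (\<Sum>i\<in>{Suc 1..n}. \<chi> i * 1)"
        unfolding chm_def by (intro forms_prod forms_power forms_single) auto
      then have "chm 1 n \<chi> (\<lambda>i. msingle (msingle i 1) 1 :: 'a mpol) \<in> forms n (wt 1 n \<chi>)"
        by (simp add: wt_def)
      from forms_mult[OF this forms_mono[OF K(1)[OF \<chi>] n1]] show ?thesis using False by simp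
    qed
  qed
  moreover have "fev y F = fev y (lam ab) * fev y G" if y: "sol n s cB y" for y
  proof -
    have "fev y (chm 1 n \<chi> (\<lambda>i. msingle (msingle i 1) 1)) = chm 1 n \<chi> y" for \<chi>
      by (simp add: chm_def)
    then have "fev y G = (\<Sum>\<chi>\<in>Ch 1 n. chm 1 n \<chi> y * fev y (K \<chi>))"
      by (simp add: G_def)
    then show ?thesis
      using H y K(2) by (simp add: decomp_def sum_distrib_left mult_ac)
  qed
  ultimately show ?thesis by blast
qed

lemma lam_factors:
  assumes "set ps \<subseteq> P1N" "F \<in> forms n (length ps + d)"
    "\<And>v y. v \<in> coord_vectors n \<Longrightarrow> sol n s B v \<Longrightarrow> good n s B v y \<Longrightarrow> fev y (prod_list (map lam ps)) dvd fev y F"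
  shows "\<exists>G\<in>forms n d. \<forall>y. sol n s cB y \<longrightarrow> fev y F = fev y (prod_list (map lam ps)) * fev y G"
  using assms
proof (induction ps arbitrary: F)
  case Nil
  then show ?case by (intro bexI[of _ F]) auto
next
  case (Cons p ps)
  have p: "p \<in> P1N" using Cons.prems(1) by simp
  have "\<exists>G\<in>forms n (length ps + d). \<forall>y. sol n s cB y \<longrightarrow> fev y F = fev y (lam p) * fev y G"
  proof (rule lam_factor[OF _ p])
    show "F \<in> forms n (Suc (length ps + d))" using Cons.prems(2) by simp
    fix v y assume "v \<in> coord_vectors n" "sol n s B v" "good n s B v y"
    from Cons.prems(3)[OF this] show "fev y (lam p) dvd fev y F" by (auto dest: dvd_mult_left)
  qed
  then obtain G where G: "G \<in> forms n (length ps + d)"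
    "\<And>y. sol n s cB y \<Longrightarrow> fev y F = fev y (lam p) * fev y G" by blast
  have "\<exists>K\<in>forms n d. \<forall>y. sol n s cB y \<longrightarrow> fev y G = fev y (prod_list (map lam ps)) * fev y K"
  proof (rule Cons.IH[OF _ G(1)])
    show "set ps \<subseteq> P1N" using Cons.prems(1) by simp
    fix v y assume v: "v \<in> coord_vectors n" "sol n s B v" "good n s B v y"
    from Cons.prems(3)[OF this] have "fev y (lam p) * fev y (prod_list (map lam ps)) dvd fev y (lam p) * fev y G"
      using G(2)[OF goodD(2)[OF v(3)]] by simp
    moreover have "fev y (lam p) \<noteq> 0" by (rule arc_lam_nz[OF goodD(1)[OF v(3)] P1N_nz[OF p]])
    ultimately show "fev y (prod_list (map lam ps)) dvd fev y G" by simp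
  qed
  then show ?case using G(2) by (auto simp: mult.assoc)
qed

end

section \<open>Orders of vanishing as a valuation\<close>

context curve
begin

definition ordP :: "'a mpol \<Rightarrow> 'a ppoint \<Rightarrow> nat" where
  "ordP F P = vanishing_order n (crv n s B) F P"

lemma ordP_good:
  assumes "v \<in> coord_vectors n" "sol n s B v" "good n s B v y" "F \<in> forms n d" "nonvan F"
  shows "ordP F (pclass n v) = subdegree (fev y F)"
  unfolding ordP_def
  by (rule vanishing_order_good[OF assms(1-4) nonvanD[OF assms(5,4) goodD(1)[OF assms(3)]]])

lemma pt_goodE:
  assumes "P \<in> pts"
  obtains v y where "v \<in> coord_vectors n" "sol n s B v" "good n s B v y" "P = pclass n v"
  using zero_locus_crvE[OF assms] good_at_point by metis

lemma ordP_mult: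
  assumes "F \<in> forms n d" "G \<in> forms n e" "nonvan F" "nonvan G" "P \<in> pts"
  shows "ordP (F * G) P = ordP F P + ordP G P"
proof -
  obtain v y where v: "v \<in> coord_vectors n" "sol n s B v" and y: "good n s B v y" and P: "P = pclass n v"
    using pt_goodE[OF assms(5)] .
  have "fev y F \<noteq> 0" "fev y G \<noteq> 0"
    using nonvanD[OF assms(3,1) goodD(1)[OF y]] nonvanD[OF assms(4,2) goodD(1)[OF y]] by auto
  then show ?thesis
    unfolding P ordP_good[OF v y forms_mult[OF assms(1,2)] nonvan_mult[OF assms(1-4)]]
      ordP_good[OF v y assms(1,3)] ordP_good[OF v y assms(2,4)] by simp
qed

text \<open>No hyperplane contains the curve: multiplying \<open>Y_k\<close> by \<zeta> and
  subtracting isolates the term of \<open>Y_k\<close> for k \<ge> 2, so \<open>l k = 0\<close>. What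
  remains is a linear relation between \<open>Y_0\<close> and \<open>Y_1\<close>, excluded by the
  definition of an arc.\<close>

lemma nonvan_linform:
  assumes "\<exists>i\<le>n. l i \<noteq> 0"
  shows "nonvan (linform n l)"
proof (rule ccontr)
  assume "\<not> nonvan (linform n l)"
  then have zero: "(\<Sum>i\<le>n. fps_const (l i) * y i) = 0" if "arc n s B y" for y
    using that by (auto simp: nonvan_def)
  obtain P where "P \<in> pts" using pts_nonempty by blast
  then obtain v y where y: "good n s B v y" using pt_goodE by metis
  have l2: "l k = 0" if k: "k \<in> {2..n}" for k
  proof -
    define t where "t = (\<lambda>i. if i = k then \<zeta> else 1)"
    have t: "t \<in> T 1 n" using k zeta_power_eq_1[of s] by (auto simp: t_def T_def)
    have "fps_const (l k) * (fps_const (\<zeta> - 1) * y k) =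
      (\<Sum>i\<le>n. if i = k then fps_const (l k) * (fps_const (\<zeta> - 1) * y k) else 0)"
      using k by simp
    also have "\<dots> = (\<Sum>i\<le>n. fps_const (l i) * act t y i - fps_const (l i) * y i)"
    proof (rule sum.cong[OF refl])
      fix i
      have "fps_const (\<zeta> - 1) * y k = fps_const \<zeta> * y k - y k"
        by (simp add: left_diff_distrib flip: fps_const_sub)
      then show "(if i = k then fps_const (l k) * (fps_const (\<zeta> - 1) * y k) else 0) =
        fps_const (l i) * act t y i - fps_const (l i) * y i"
        by (simp add: act_def t_def right_diff_distrib)
    qed
    also have "\<dots> = 0"
      unfolding sum_subtractf zero[OF goodD(1)[OF y]] zero[OF act_arc[OF goodD(1)[OF y] t order_refl]] by simp
    finally have "fps_const (l k) * (fps_const (\<zeta> - 1) * y k) = 0" .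
    moreover have "\<zeta> - 1 \<noteq> 0" using zeta_power_eq_1[of 1] s2 by auto
    ultimately show ?thesis using good_nonunit(1)[OF y k] by (simp del: fps_const_sub)
  qed
  have "(\<Sum>i\<le>n. fps_const (l i) * y i) = (\<Sum>i\<in>{0, 1}. fps_const (l i) * y i)"
    by (rule sum.mono_neutral_right) (use l2 n2 in auto)
  then have "fps_const (l 0) * y 0 = fps_const (- l 1) * y 1"
    unfolding zero[OF goodD(1)[OF y]] by (simp add: eq_neg_iff_add_eq_0 flip: fps_const_neg)
  then have "(- l 1, l 0) = (0, 0)" using goodD(1)[OF y] unfolding arc_def by blast
  then have "l i = 0" if "i \<le> n" for i
    using l2[of i] that by (cases "i = 0"; cases "i = 1") auto
  then show False using assms by blast
qed

text \<open>The normalised image of a point under the projection to the line with coordinates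
  \<open>Y_0\<close>, \<open>Y_1\<close>.\<close>

definition nsl :: "(nat \<Rightarrow> 'a) \<Rightarrow> 'a \<times> 'a" where
  "nsl v = (if v 1 = 0 then (1, 0) else (v 0 / v 1, 1))"

lemma nsl_P1N: "nsl v \<in> P1N"
  by (auto simp: nsl_def P1N_def)

lemma nsl_scale: "c \<noteq> 0 \<Longrightarrow> nsl (\<lambda>i. c * v i) = nsl v"
  by (simp add: nsl_def)

lemma nsl_normal: "(v 0, v 1) \<in> P1N \<Longrightarrow> nsl v = (v 0, v 1)"
  by (auto simp: nsl_def P1N_def)

lemma nsl_pclass_eq:
  assumes "v \<in> coord_vectors n" "w \<in> coord_vectors n" "pclass n v = pclass n w"
  shows "nsl v = nsl w"
  using assms by (auto simp: pclass_eq_iff nsl_scale)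

lemma normal_point:
  assumes "P \<in> pts"
  obtains v where "v \<in> coord_vectors n" "sol n s B v" "(v 0, v 1) \<in> P1N" "P = pclass n v"
proof -
  obtain v where v: "v \<in> coord_vectors n" "sol n s B v" "P = pclass n v" using zero_locus_crvE[OF assms] .
  define c where "c = (if v 1 = 0 then 1 / v 0 else 1 / v 1)"
  have c: "c \<noteq> 0" using pt_nz[OF v(1,2)] by (auto simp: c_def)
  have "(c * v 0, c * v 1) \<in> P1N" using pt_nz[OF v(1,2)] by (auto simp: c_def P1N_def)
  moreover have "pclass n (\<lambda>i. c * v i) = P" "(\<lambda>i. c * v i) \<in> coord_vectors n"
    using pclass_scale[OF v(1) c] v(3) by auto
  moreover from this have "sol n s B (\<lambda>i. c * v i)" using assms zero_locus_crv_iff by blast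
  ultimately show ?thesis using that[of "\<lambda>i. c * v i"] by simp
qed

lemma lam_subdegree_general:
  assumes v: "v \<in> coord_vectors n" "sol n s B v" and y: "good n s B v y" and p: "p \<in> P1N"
  shows "subdegree (fev y (lam p)) = (if p = nsl v then (if \<exists>k\<in>{2..n}. v k = 0 then s else 1) else 0)"
proof (cases "p = nsl v")
  case True
  define c where "c = (if v 1 = 0 then 1 / v 0 else 1 / v 1)"
  have c: "c \<noteq> 0" using pt_nz[OF v] by (auto simp: c_def)
  have p': "p = (c * v 0, c * v 1)" using pt_nz[OF v] True by (auto simp: c_def nsl_def)
  have "fev y (lam p) = fps_const c * fev y (lam (v 0, v 1))"
    unfolding p' by (simp add: fps_const_hom.gev_lam right_diff_distrib mult.assoc flip: fps_const_mult)
  then have "subdegree (fev y (lam p)) = subdegree (fev y (lam (v 0, v 1)))"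
    using subdegree_const_mult[OF c] by simp
  then show ?thesis using True lam_subdegree[OF y] by simp
next
  case False
  have "fev y (lam p) $ 0 = snd p * v 0 - fst p * v 1"
    using goodD(3)[OF y] n2 by (simp add: fps_const_hom.gev_lam)
  moreover have "snd p * v 0 - fst p * v 1 \<noteq> 0"
    using False p pt_nz[OF v] by (auto simp: nsl_def P1N_def split: if_splits)
  ultimately show ?thesis using False by auto
qed

section \<open>No function has a single simple zero and a single simple pole\<close>

lemma T_fix:
  assumes v: "v \<in> coord_vectors n" "sol n s B v" and t: "t \<in> T 1 n"
    and e: "pclass n (\<lambda>i. t i * v i) = pclass n v"
  shows "t i * v i = v i"
proof -
  obtain c where c: "v = (\<lambda>i. c * (t i * v i))"
    using e pclass_eq_iff[OF act_point(1)[OF v t] v(1)] by auto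
  have "t 0 = 1" "t 1 = 1" using T_low[OF t] by auto
  then have "v 0 = c * v 0" "v 1 = c * v 1" using fun_cong[OF c, of 0] fun_cong[OF c, of 1] by auto
  then have "c = 1" using pt_nz[OF v] by auto
  then show ?thesis using fun_cong[OF c, of i] by simp
qed

lemma good_ramified:
  assumes "good n s B v y" "k \<in> {2..n}" "v k = 0"
  obtains c where "c \<noteq> 0" "y k = fps_const c * fps_X"
proof -
  have "\<exists>c. c \<noteq> 0 \<and> y k = fps_const c * fps_X" using assms unfolding good_def by blast
  then show ?thesis using that by blast
qed

text \<open>A hyperplane section containing the fibre over (\<open>w 0\<close> :
  \<open>w 1\<close>), except possibly for one copy of the point w, is cut out by a multiple of the
  form \<open>lam\<close> of that fibre. The fibre has n + 1 points with multiplicity, and n of them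
  impose independent conditions on the n + 1 coefficients. \<open>A1\<close> treats the points other
  than w; \<open>A2\<close> treats w itself, where the factor X makes up for the missing
  order.\<close>

lemma linear_part_zero:
  assumes cs: "n = 2 \<and> s = 3 \<or> n = 3 \<and> s = 2"
    and w: "w \<in> coord_vectors n" "sol n s B w" and y: "good n s B w y"
    and A1: "\<And>t. t \<in> T 1 n \<Longrightarrow> pclass n (\<lambda>i. t i * w i) \<noteq> pclass n w \<Longrightarrow>
      fev y (lam (w 0, w 1)) dvd fev (act t y) (linform n l)"
    and A2: "fev y (lam (w 0, w 1)) dvd fps_X * fev y (linform n l)"
  shows "l 0 * w 0 + l 1 * w 1 = 0 \<and> (\<forall>i\<in>{2..n}. l i = 0)"
proof -
  let ?lam = "fev y (lam (w 0, w 1))"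
  have lnz: "?lam \<noteq> 0" using arc_lam_nz[OF goodD(1)[OF y], of "(w 0, w 1)"] pt_nz[OF w] by auto
  have sdl: "subdegree ?lam = (if \<exists>k\<in>{2..n}. w k = 0 then s else 1)" by (rule lam_subdegree[OF y])
  have nth0: "f $ 0 = 0" if "?lam dvd f" for f
  proof (cases "f = 0")
    case False
    then have "1 \<le> subdegree f" using dvd_imp_subdegree_le[OF that] sdl s2 by (auto split: if_splits)
    then show ?thesis by (intro nth_less_subdegree_zero) linarith
  qed simp
  have nth1: "f $ 1 = 0" if "?lam dvd f" "\<exists>k\<in>{2..n}. w k = 0" for f
  proof (cases "f = 0")
    case False
    then have "2 \<le> subdegree f" using dvd_imp_subdegree_le[OF that(1)] sdl s2 that(2) by auto
    then show ?thesis by (intro nth_less_subdegree_zero) linarith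
  qed simp
  define L0 where "L0 = fps_const (l 0) * y 0 + fps_const (l 1) * y 1"
  have L00: "L0 $ 0 = l 0 * w 0 + l 1 * w 1" using goodD(3)[OF y] n2 by (simp add: L0_def)
  have L0_dvd: "?lam dvd L0" if E0: "l 0 * w 0 + l 1 * w 1 = 0"
  proof -
    obtain \<kappa> where k: "l 0 = \<kappa> * w 1" "l 1 = - \<kappa> * w 0"
    proof (cases "w 1 = 0")
      case True
      then have "w 0 \<noteq> 0" "l 0 = 0" using pt_nz[OF w] E0 by auto
      then show ?thesis using True that[of "- l 1 / w 0"] by simp
    next
      case False
      have "l 1 * w 1 = - (l 0 * w 0)" using E0 by (simp add: eq_neg_iff_add_eq_0 add.commute)
      then have "l 1 = - (l 0 / w 1) * w 0" using False by (simp add: field_simps)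
      then show ?thesis using False that[of "l 0 / w 1"] by simp
    qed
    have "L0 = fps_const \<kappa> * ?lam"
      unfolding L0_def k fps_const_hom.gev_lam fst_conv snd_conv right_diff_distrib
        mult.assoc[symmetric] fps_const_mult by (simp flip: fps_const_neg)
    then show ?thesis by simp
  qed
  from cs show ?thesis
  proof
    assume "n = 2 \<and> s = 3"
    then have n: "n = 2" and s: "s = 3" by auto
    define t where "t z = (\<lambda>i::nat. if i = 2 then z else 1::'a)" for z
    have t: "t z \<in> T 1 n" if "z ^ 3 = 1" for z using that unfolding T_def t_def by (auto simp: n s)
    have A: "fev (act (t z) y) (linform n l) = L0 + fps_const (l 2 * z) * y 2" for z
    proof -
      have I: "{..n} = {0, 1, 2}" by (auto simp: n)
      show ?thesis
        unfolding fps_const_hom.gev_linform I fps_const_mult[symmetric] mult.assoc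
        by (simp add: act_def t_def L0_def)
    qed
    have z3: "\<zeta> ^ 3 = 1" "(\<zeta> ^ 2) ^ 3 = 1" using zeta_power_eq_1 by (auto simp: s simp flip: power_mult)
    have z1: "\<zeta> \<noteq> 1" "\<zeta> ^ 2 \<noteq> 1" using zeta_power_eq_1[of 1] zeta_power_eq_1[of 2] by (auto simp: s)
    have t1: "act (t 1) y = y" by (simp add: act_def t_def)
    have A2': "?lam dvd fps_X * (L0 + fps_const (l 2) * y 2)" using A2 A[of 1] unfolding t1 by simp
    have y20: "y 2 $ 0 = w 2" using goodD(3)[OF y] n by simp
    show ?thesis
    proof (cases "w 2 = 0")
      case False
      have d: "?lam dvd L0 + fps_const (l 2 * z) * y 2" if z: "z ^ 3 = 1" "z \<noteq> 1" for z
      proof -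
        have "pclass n (\<lambda>i. t z i * w i) \<noteq> pclass n w"
          using T_fix[OF w t[OF z(1)], of 2] False z(2) by (auto simp: t_def)
        from A1[OF t[OF z(1)] this] show ?thesis unfolding A .
      qed
      have e: "(l 0 * w 0 + l 1 * w 1) + l 2 * z * w 2 = 0" if "z ^ 3 = 1" "z \<noteq> 1" for z
        using nth0[OF d[OF that]] y20 L00 by simp
      \<comment> \<open>The conditions at the two other points of the fibre differ only in \<zeta>
        against \<zeta>^2, so their difference isolates \<open>l 2\<close>.\<close>
      have "(l 0 * w 0 + l 1 * w 1) + l 2 * \<zeta> * w 2 - ((l 0 * w 0 + l 1 * w 1) + l 2 * \<zeta> ^ 2 * w 2) = 0"
        unfolding e[OF z3(1) z1(1)] e[OF z3(2) z1(2)] by simp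
      then have "l 2 * \<zeta> * (1 - \<zeta>) * w 2 = 0" by (simp add: algebra_simps power2_eq_square)
      then have "l 2 = 0" using False zeta_nz z1 by auto
      then show ?thesis using e[OF z3(1) z1(1)] n by auto
    next
      case True
      then have ram: "\<exists>k\<in>{2..n}. w k = 0" using n by auto
      obtain c where c: "c \<noteq> 0" "y 2 = fps_const c * fps_X"
        using good_ramified[OF y _ True] n by auto
      \<comment> \<open>The whole fibre is w with multiplicity 3, so \<open>A2\<close> makes the
        linear form vanish to order 2 only. The constant coefficient gives the condition on
        \<open>l 0\<close>, \<open>l 1\<close>; after that \<open>L0\<close> is divisible by
        \<open>?lam\<close>, and the next coefficient gives \<open>l 2\<close>.\<close>
      have "(fps_X * (L0 + fps_const (l 2) * y 2)) $ 1 = 0" by (rule nth1[OF A2' ram])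
      then have E: "l 0 * w 0 + l 1 * w 1 = 0" using L00 y20 True by simp
      have "3 \<le> subdegree (fps_X * (L0 + fps_const (l 2) * y 2)) \<or> fps_X * (L0 + fps_const (l 2) * y 2) = 0"
        using dvd_imp_subdegree_le[OF A2'] sdl ram s by auto
      then have "(fps_X * (L0 + fps_const (l 2) * y 2)) $ 2 = 0"
      proof
        assume "3 \<le> subdegree (fps_X * (L0 + fps_const (l 2) * y 2))"
        then show ?thesis by (intro nth_less_subdegree_zero) linarith
      qed (simp only: fps_zero_nth)
      then have "L0 $ 1 + l 2 * c = 0" by (simp add: c fps_X_mult_nth)
      then have "l 2 = 0" using nth1[OF L0_dvd[OF E] ram] c by simp
      then show ?thesis using E n by auto
    qed
  next
    assume "n = 3 \<and> s = 2"
    then have n: "n = 3" and s: "s = 2" by auto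
    define t where "t z x = (\<lambda>i::nat. if i = 2 then z else if i = 3 then x else 1::'a)" for z x
    have t: "t z x \<in> T 1 n" if "z ^ 2 = 1" "x ^ 2 = 1" for z x using that unfolding T_def t_def by (auto simp: n s)
    have A: "fev (act (t z x) y) (linform n l) = L0 + fps_const (l 2 * z) * y 2 + fps_const (l 3 * x) * y 3" for z x
    proof -
      have I: "{..n} = {0, 1, 2, 3}" by (auto simp: n)
      show ?thesis
        unfolding fps_const_hom.gev_linform I fps_const_mult[symmetric] mult.assoc
        by (simp add: act_def t_def L0_def)
    qed
    have t1: "act (t 1 1) y = y" by (simp add: act_def t_def fun_eq_iff)
    have A2': "?lam dvd fps_X * (L0 + fps_const (l 2) * y 2 + fps_const (l 3) * y 3)"
      using A2 A[of 1 1] unfolding t1 by simp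
    have y20: "y 2 $ 0 = w 2" "y 3 $ 0 = w 3" using goodD(3)[OF y] n by simp_all
    define E where "E = l 0 * w 0 + l 1 * w 1"
    have d: "?lam dvd L0 + fps_const (l 2 * z) * y 2 + fps_const (l 3 * x) * y 3"
      if z: "z ^ 2 = 1" "x ^ 2 = 1" "z \<noteq> 1 \<and> w 2 \<noteq> 0 \<or> x \<noteq> 1 \<and> w 3 \<noteq> 0" for z x
    proof -
      have "pclass n (\<lambda>i. t z x i * w i) \<noteq> pclass n w"
        using T_fix[OF w t[OF z(1,2)], of 2] T_fix[OF w t[OF z(1,2)], of 3] z(3) by (auto simp: t_def)
      from A1[OF t[OF z(1,2)] this] show ?thesis unfolding A .
    qed
    have e: "E + l 2 * z * w 2 + l 3 * x * w 3 = 0"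
      if "z ^ 2 = 1" "x ^ 2 = 1" "z \<noteq> 1 \<and> w 2 \<noteq> 0 \<or> x \<noteq> 1 \<and> w 3 \<noteq> 0" for z x
      using nth0[OF d[OF that]] y20 L00 by (simp add: E_def)
    have m1: "(- 1 :: 'a) \<noteq> 1" by simp
    show ?thesis
    proof (cases "\<exists>k\<in>{2..n}. w k = 0")
      case False
      then have nz: "w 2 \<noteq> 0" "w 3 \<noteq> 0" using n by auto
      have e1: "E - l 2 * w 2 + l 3 * w 3 = 0" using e[of "- 1" 1] nz m1 by simp
      have e2: "E + l 2 * w 2 - l 3 * w 3 = 0" using e[of 1 "- 1"] nz m1 by simp
      have e3: "E - l 2 * w 2 - l 3 * w 3 = 0" using e[of "- 1" "- 1"] nz m1 by simp
      have "2 * E = (E - l 2 * w 2 + l 3 * w 3) + (E + l 2 * w 2 - l 3 * w 3)" by simp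
      then have "E = 0" unfolding e1 e2 by simp
      moreover have "2 * (l 2 * w 2) = (E + l 2 * w 2 - l 3 * w 3) - (E - l 2 * w 2 - l 3 * w 3)" by simp
      then have "l 2 * w 2 = 0" unfolding e2 e3 by simp
      moreover have "2 * (l 3 * w 3) = (E - l 2 * w 2 + l 3 * w 3) - (E - l 2 * w 2 - l 3 * w 3)" by simp
      then have "l 3 * w 3 = 0" unfolding e1 e3 by simp
      moreover have I: "{2..n} = {2, 3}" using n by auto
      ultimately show ?thesis using nz unfolding I by (auto simp: E_def)
    next
      case ram: True
      then obtain k where k: "k \<in> {2..n}" "w k = 0" by auto
      \<comment> \<open>The other element of {2, 3}.\<close>
      define k' where "k' = 5 - k"
      have kk: "k = 2 \<and> k' = 3 \<or> k = 3 \<and> k' = 2" using k n by (auto simp: k'_def)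
      have k'nz: "w k' \<noteq> 0" using pt_zero_unique[OF w, of k' k] k kk n by auto
      obtain c where c: "c \<noteq> 0" "y k = fps_const c * fps_X" using good_ramified[OF y k] .
      have sum: "fps_const (l 2 * z) * y 2 + fps_const (l 3 * x) * y 3 =
        fps_const (l k * (if k = 2 then z else x)) * y k + fps_const (l k' * (if k = 2 then x else z)) * y k'" for z x
        using kk by auto
      have d1: "?lam dvd L0 + (fps_const (l k) * y k + fps_const (l k' * (- 1)) * y k')"
        using d[of "if k = 2 then 1 else - 1" "if k = 2 then - 1 else 1"] k'nz m1 kk
        unfolding add.assoc sum by (auto split: if_splits)
      have yk: "y k $ 0 = 0" "y k' $ 0 = w k'" using goodD(3)[OF y] k kk n by auto
      have e1: "E - l k' * w k' = 0" using nth0[OF d1] L00 yk by (simp add: E_def)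
      have S: "fps_const (l 2) * y 2 + fps_const (l 3) * y 3 = fps_const (l k) * y k + fps_const (l k') * y k'"
        using kk by auto
      have "(fps_X * (L0 + (fps_const (l k) * y k + fps_const (l k') * y k'))) $ 1 = 0"
        using nth1[OF A2' ram] unfolding add.assoc S .
      then have e2: "E + l k' * w k' = 0" using L00 yk by (simp add: E_def)
      have "2 * E = (E - l k' * w k') + (E + l k' * w k')" by simp
      then have E: "E = 0" unfolding e1 e2 by simp
      then have lk': "l k' = 0" using e2 k'nz by simp
      have "(L0 + (fps_const (l k) * y k + fps_const (l k' * (- 1)) * y k')) $ 1 = 0" by (rule nth1[OF d1 ram])
      then have "L0 $ 1 + l k * c = 0" using lk' by (simp add: c)
      then have "l k = 0" using nth1[OF L0_dvd ram] E c by (simp add: E_def)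
      moreover have I: "{2..n} = {k, k'}" using n kk by auto
      ultimately show ?thesis using E lk' unfolding I by (auto simp: E_def)
    qed
  qed
qed

text \<open>The factor \<open>lam\<close> of the fibre of R' absorbs the simple pole, and
  multiplication by the other conjugates of G turns the denominator into its norm, a binary form
  that can be divided out factor by factor. What is left is a linear form A with divisor
  \<open>lam\<close> + R - R'. By \<open>linear_part_zero\<close> it is a multiple of
  \<open>lam\<close>, so R = R'.\<close>

theorem single_zero_single_pole:
  assumes cs: "n = 2 \<and> s = 3 \<or> n = 3 \<and> s = 2"
    and F: "F \<in> forms n d" "nonvan F" and G: "G \<in> forms n d" "nonvan G"
    and R: "R \<in> pts" "R' \<in> pts"
    and div: "\<And>P. P \<in> pts \<Longrightarrow> int (ordP F P) - int (ordP G P) = (if P = R then 1 else 0) - (if P = R' then 1 else 0)"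
  shows "R = R'"
proof (rule ccontr)
  assume ne: "R \<noteq> R'"
  have n1: "1 \<le> n" using n2 by simp
  obtain w where w: "w \<in> coord_vectors n" "sol n s B w" "(w 0, w 1) \<in> P1N" "R' = pclass n w"
    using normal_point[OF R(2)] .
  let ?lam = "lam (w 0, w 1)"
  have lamf: "?lam \<in> forms n 1" by (rule lam_forms[OF n1])
  have lamnv: "nonvan ?lam"
  proof -
    obtain y where "good n s B w y" using good_at_point[OF w(1,2)] by blast
    then have "arc n s B y" by (rule goodD(1))
    then show ?thesis using arc_lam_nz[OF _ P1N_nz[OF w(3)]] unfolding nonvan_def by blast
  qed
  obtain N where N: "N \<in> forms 1 (card (T 1 n) * d)"
    "\<And>y. sol n s cB y \<Longrightarrow> fev y N = (\<Prod>t\<in>T 1 n. fev (act t y) G)"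
    using norm_exists[OF G(1) order_refl n1] by auto
  \<comment> \<open>The product of the nontrivial conjugates of G, so that G times \<open>G'\<close>
    is the norm along solutions.\<close>
  define G' where "G' = (\<Prod>t\<in>T 1 n - {\<lambda>_. 1}. scal t G)"
  have cT: "card (T 1 n) = Suc (card (T 1 n - {\<lambda>_. 1}))"
    by (rule card.remove[OF finite_T T_1])
  have "G' \<in> forms n (\<Sum>t\<in>T 1 n - {\<lambda>_. 1}. d)" unfolding G'_def by (intro forms_prod scal_forms G)
  then have G'f: "G' \<in> forms n (card (T 1 n - {\<lambda>_. 1}) * d)" by simp
  have act1: "act (\<lambda>_. 1) y = y" for y by (simp add: act_def)
  have NG: "fev y N = fev y G * fev y G'" if "sol n s cB y" for y
    unfolding N(2)[OF that] G'_def fps_const_hom.gev_prod fev_scal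
    by (subst prod.remove[OF finite_T T_1]) (simp add: act1)
  have Nnz: "fev y N \<noteq> 0" if y: "arc n s B y" for y
  proof -
    have "fev (act t y) G \<noteq> 0" if "t \<in> T 1 n" for t
      by (rule nonvanD[OF G(2,1) act_arc[OF y that order_refl]])
    then show ?thesis using N(2)[of y] y finite_T by (simp add: arc_def)
  qed
  obtain y0 where y0: "good n s B w y0" using good_at_point[OF w(1,2)] by blast
  have "N \<noteq> 0" using Nnz[OF goodD(1)[OF y0]] by auto
  then obtain c ps where c: "c \<noteq> 0" "length ps = card (T 1 n) * d" "set ps \<subseteq> P1N" "N = msingle 0 c * prod_list (map lam ps)"
    using binary_factor[OF N(1)] by auto
  define F2 where "F2 = ?lam * (F * G')"
  have len: "length ps + 1 = 1 + (d + card (T 1 n - {\<lambda>_. 1}) * d)" unfolding c(2) cT by simp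
  have F2f: "F2 \<in> forms n (length ps + 1)"
    unfolding len F2_def by (intro forms_mult lamf F(1) G'f)
  have GF: "fev y G dvd fev y ?lam * fev y F"
    if v: "v \<in> coord_vectors n" "sol n s B v" and y: "good n s B v y" for v y
  proof -
    have nz: "fev y G \<noteq> 0" "fev y F \<noteq> 0" "fev y ?lam \<noteq> 0"
      using nonvanD[OF G(2,1) goodD(1)[OF y]] nonvanD[OF F(2,1) goodD(1)[OF y]]
        nonvanD[OF lamnv lamf goodD(1)[OF y]] by auto
    have P: "pclass n v \<in> pts" using zero_locus_crv_iff[OF v(1)] v(2) by simp
    have "subdegree (fev y G) \<le> subdegree (fev y ?lam) + subdegree (fev y F)"
    proof (cases "pclass n v = R'")
      case True
      then have "nsl v = (w 0, w 1)" using nsl_pclass_eq[OF v(1) w(1)] w(3,4) nsl_normal by auto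
      then have "1 \<le> subdegree (fev y ?lam)"
        using lam_subdegree_general[OF v y w(3)] s2 by auto
      then show ?thesis
        using div[OF P] True ne ordP_good[OF v y F] ordP_good[OF v y G] by auto
    next
      case False
      then show ?thesis
        using div[OF P] ordP_good[OF v y F] ordP_good[OF v y G] by (auto split: if_splits)
    qed
    then show ?thesis using nz by (subst fps_dvd_iff) auto
  qed
  have "\<exists>A\<in>forms n 1. \<forall>y. sol n s cB y \<longrightarrow> fev y F2 = fev y (prod_list (map lam ps)) * fev y A"
  proof (rule lam_factors[OF c(3) F2f])
    fix v y assume v: "v \<in> coord_vectors n" "sol n s B v" and y: "good n s B v y"
    have "fev y N dvd fev y F2"
      unfolding NG[OF goodD(2)[OF y]] F2_def fps_const_hom.gev_mult mult.assoc[symmetric]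
      by (intro mult_dvd_mono GF[OF v y] dvd_refl)
    then show "fev y (prod_list (map lam ps)) dvd fev y F2"
      unfolding c(4) fps_const_hom.gev_mult by (rule dvd_mult_right)
  qed
  then obtain A where A: "A \<in> forms n 1"
    "\<And>y. sol n s cB y \<Longrightarrow> fev y F2 = fev y (prod_list (map lam ps)) * fev y A" by blast
  have rel: "fps_const c * (fev y ?lam * fev y F) = fev y G * fev y A" if y: "arc n s B y" for y
  proof -
    have sy: "sol n s cB y" using y by (simp add: arc_def)
    have "fps_const c * fev y F2 = fev y N * fev y A" unfolding A(2)[OF sy] c(4) by (simp add: mult.assoc)
    then have "fev y G' * (fps_const c * (fev y ?lam * fev y F)) = fev y G' * (fev y G * fev y A)"
      unfolding NG[OF sy] F2_def by (simp add: mult_ac)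
    moreover have "fev y G' \<noteq> 0" using Nnz[OF y] NG[OF sy] by auto
    ultimately show ?thesis by simp
  qed
  have Anv: "nonvan A"
  proof -
    have "fps_const c * (fev y0 ?lam * fev y0 F) \<noteq> 0"
      using c(1) nonvanD[OF F(2,1) goodD(1)[OF y0]] nonvanD[OF lamnv lamf goodD(1)[OF y0]] by simp
    then have "fev y0 A \<noteq> 0" using rel[OF goodD(1)[OF y0]] by auto
    then show ?thesis using goodD(1)[OF y0] by (auto simp: nonvan_def)
  qed
  have ordA: "int (ordP A P) = int (ordP ?lam P) + (if P = R then 1 else 0) - (if P = R' then 1 else 0)"
    if P: "P \<in> pts" for P
  proof -
    obtain v y where v: "v \<in> coord_vectors n" "sol n s B v" and y: "good n s B v y" and Pv: "P = pclass n v"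
      using pt_goodE[OF P] .
    have nz: "fev y G \<noteq> 0" "fev y F \<noteq> 0" "fev y ?lam \<noteq> 0" "fev y A \<noteq> 0"
      using nonvanD[OF G(2,1) goodD(1)[OF y]] nonvanD[OF F(2,1) goodD(1)[OF y]]
        nonvanD[OF lamnv lamf goodD(1)[OF y]] nonvanD[OF Anv A(1) goodD(1)[OF y]] by auto
    have "subdegree (fps_const c * (fev y ?lam * fev y F)) = subdegree (fev y G * fev y A)"
      using rel[OF goodD(1)[OF y]] by simp
    then have "subdegree (fev y ?lam) + subdegree (fev y F) = subdegree (fev y G) + subdegree (fev y A)"
      using nz c(1) by (simp add: subdegree_const_mult)
    then have "ordP ?lam P + ordP F P = ordP G P + ordP A P"
      unfolding Pv ordP_good[OF v y F] ordP_good[OF v y G] ordP_good[OF v y lamf lamnv] ordP_good[OF v y A(1) Anv] .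
    then show ?thesis using div[OF P] by linarith
  qed
  obtain l where l: "A = linform n l" using forms_1_linform[OF A(1)] .
  have zero: "l 0 * w 0 + l 1 * w 1 = 0 \<and> (\<forall>i\<in>{2..n}. l i = 0)"
  proof (rule linear_part_zero[OF cs w(1,2) y0])
    fix t assume t: "t \<in> T 1 n" and tw: "pclass n (\<lambda>i. t i * w i) \<noteq> pclass n w"
    note tv = act_point[OF w(1,2) t] and ty = good_act[OF y0 t]
    have P: "pclass n (\<lambda>i. t i * w i) \<in> pts" using zero_locus_crv_iff tv by blast
    have nz: "fev (act t y0) ?lam \<noteq> 0" "fev (act t y0) A \<noteq> 0"
      using nonvanD[OF lamnv lamf goodD(1)[OF ty]] nonvanD[OF Anv A(1) goodD(1)[OF ty]] by auto
    have "ordP ?lam (pclass n (\<lambda>i. t i * w i)) \<le> ordP A (pclass n (\<lambda>i. t i * w i))"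
      using ordA[OF P] tw w(4) by (auto split: if_splits)
    then have "subdegree (fev (act t y0) ?lam) \<le> subdegree (fev (act t y0) A)"
      unfolding ordP_good[OF tv ty lamf lamnv] ordP_good[OF tv ty A(1) Anv] .
    then have "fev (act t y0) ?lam dvd fev (act t y0) A" using nz by (subst fps_dvd_iff) auto
    moreover have "fev (act t y0) ?lam = fev y0 ?lam" by (rule fev_act_low[OF lam_forms t]) simp
    ultimately show "fev y0 ?lam dvd fev (act t y0) (linform n l)" by (simp only: l)
  next
    have P: "pclass n w \<in> pts" using R(2) w(4) by simp
    have nz: "fev y0 ?lam \<noteq> 0" "fev y0 A \<noteq> 0"
      using nonvanD[OF lamnv lamf goodD(1)[OF y0]] nonvanD[OF Anv A(1) goodD(1)[OF y0]] by auto
    have "ordP ?lam (pclass n w) \<le> 1 + ordP A (pclass n w)"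
      using ordA[OF P] w(4) ne by auto
    then have "subdegree (fev y0 ?lam) \<le> 1 + subdegree (fev y0 A)"
      unfolding ordP_good[OF w(1,2) y0 lamf lamnv] ordP_good[OF w(1,2) y0 A(1) Anv] .
    then have "fev y0 ?lam dvd fps_X * fev y0 A" using nz by (subst fps_dvd_iff) auto
    then show "fev y0 ?lam dvd fps_X * fev y0 (linform n l)" by (simp only: l)
  qed
  have evA: "fev y A = fps_const (l 0) * y 0 + fps_const (l 1) * y 1" for y
  proof -
    have "(\<Sum>i\<le>n. fps_const (l i) * y i) = (\<Sum>i\<in>{0, 1}. fps_const (l i) * y i)"
      by (rule sum.mono_neutral_right) (use zero n2 in auto)
    then show ?thesis by (simp add: l)
  qed
  have "ordP A R = ordP ?lam R"
  proof -
    obtain v y where v: "v \<in> coord_vectors n" "sol n s B v" and y: "good n s B v y" and Pv: "R = pclass n v"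
      using pt_goodE[OF R(1)] .
    have c1: "fps_const (w 1) * fps_const (l 1) = - (fps_const (l 0) * fps_const (w 0))"
    proof -
      have "w 1 * l 1 = - (l 0 * w 0)" using zero by (simp add: eq_neg_iff_add_eq_0 add.commute mult.commute)
      then show ?thesis by simp
    qed
    have ring: "a * (b * x + c * z) = b * (a * x - d * z)" if "a * c = - (b * d)" for a b c d x z :: "'a fps"
    proof -
      have "a * (b * x + c * z) = b * (a * x) + (a * c) * z" by (simp add: algebra_simps)
      then show ?thesis unfolding that by (simp add: algebra_simps)
    qed
    have "fps_const (w 1) * fev y A = fps_const (l 0) * fev y ?lam"
      unfolding evA fps_const_hom.gev_lam fst_conv snd_conv by (rule ring[OF c1])
    moreover have "fps_const (w 0) * fev y A = fps_const (- l 1) * fev y ?lam"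
    proof -
      have "fps_const (w 0) * fps_const (l 0) = - (fps_const (l 1) * fps_const (w 1))"
        using c1 by (simp add: mult.commute)
      from ring[OF this, of "y 1" "y 0"]
      have "fps_const (w 0) * (fps_const (l 0) * y 0 + fps_const (l 1) * y 1)
        = fps_const (l 1) * (fps_const (w 0) * y 1 - fps_const (w 1) * y 0)" by (simp only: add.commute)
      then show ?thesis
        unfolding evA fps_const_hom.gev_lam fst_conv snd_conv fps_const_neg[symmetric]
        by (simp only: right_diff_distrib mult_minus_left) simp
    qed
    moreover have "w 1 \<noteq> 0 \<or> w 0 \<noteq> 0" using pt_nz[OF w(1,2)] by auto
    moreover have "fev y A \<noteq> 0" by (rule nonvanD[OF Anv A(1) goodD(1)[OF y]])
    ultimately have "\<exists>a b. a \<noteq> 0 \<and> b \<noteq> 0 \<and> fps_const a * fev y A = fps_const b * fev y ?lam"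
      by (metis fps_const_0_eq_0 mult_eq_0_iff mult_zero_left fps_const_eq_0_iff)
    then obtain a b where ab: "a \<noteq> 0" "b \<noteq> 0" "fps_const a * fev y A = fps_const b * fev y ?lam" by blast
    have "subdegree (fev y A) = subdegree (fev y ?lam)"
      using arg_cong[OF ab(3), of subdegree] ab(1,2) by (simp add: subdegree_const_mult)
    then show ?thesis unfolding Pv ordP_good[OF v y lamf lamnv] ordP_good[OF v y A(1) Anv] .
  qed
  then show False using ordA[OF R(1)] ne by simp
qed

end

section \<open>The residual point of a hyperplane section\<close>

lemma subdegree_prod_list:
  "(\<And>x. x \<in> set xs \<Longrightarrow> f x \<noteq> 0) \<Longrightarrow>
    subdegree (prod_list (map f xs)) = sum_list (map (\<lambda>x. subdegree (f x :: 'a::field fps)) xs)"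
proof (induction xs)
  case (Cons x xs)
  then have "prod_list (map f xs) \<noteq> 0" by (auto simp: prod_list_zero_iff)
  then show ?case using Cons by simp
qed simp

lemma sum_list_indicator: "(\<Sum>p\<leftarrow>ps. if p = q then e else 0) = e * count_list ps (q::'b)" for e :: nat
  by (induction ps) auto

context curve
begin

definition ram :: "(nat \<Rightarrow> 'a) \<Rightarrow> nat" where
  "ram v = (if \<exists>k\<in>{2..n}. v k = 0 then s else 1)"

lemma ram_pos: "0 < ram v"
  using s0 by (simp add: ram_def)

text \<open>Points over the same point of the line form one orbit. The stabiliser is trivial, or, at
  a point with \<open>v k = 0\<close>, consists of the s roots of unity acting on the coordinate
  k.\<close>

lemma stabilizer_card:
  assumes v: "v \<in> coord_vectors n" "sol n s B v" "(v 0, v 1) \<in> P1N"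
    and w: "w \<in> coord_vectors n" "sol n s B w" "(w 0, w 1) \<in> P1N"
  shows "card {t \<in> T 1 n. pclass n (\<lambda>i. t i * v i) = pclass n w} = (if nsl v = nsl w then ram v else 0)"
proof (cases "nsl v = nsl w")
  case False
  have "pclass n (\<lambda>i. t i * v i) \<noteq> pclass n w" if t: "t \<in> T 1 n" for t
  proof
    assume "pclass n (\<lambda>i. t i * v i) = pclass n w"
    then have "nsl (\<lambda>i. t i * v i) = nsl w"
      by (rule nsl_pclass_eq[OF act_point(1)[OF v(1,2) t] w(1)])
    moreover have "t 0 = 1" "t 1 = 1" using T_low[OF t] by auto
    then have "nsl (\<lambda>i. t i * v i) = nsl v" by (simp only: nsl_def mult_1_left)
    ultimately show False using False by simp
  qed
  then have "{t \<in> T 1 n. pclass n (\<lambda>i. t i * v i) = pclass n w} = {}" by blast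
  then show ?thesis using False by (simp only: card.empty if_False)
next
  case True
  then have vw: "v 0 = w 0" "v 1 = w 1" using nsl_normal[of v] nsl_normal[of w] v(3) w(3) by auto
  have iff: "pclass n (\<lambda>i. t i * v i) = pclass n w \<longleftrightarrow> (\<forall>i\<in>{2..n}. t i * v i = w i)" if t: "t \<in> T 1 n" for t
  proof
    assume "pclass n (\<lambda>i. t i * v i) = pclass n w"
    then obtain c where c: "w = (\<lambda>i. c * (t i * v i))"
      using pclass_eq_iff[OF act_point(1)[OF v(1,2) t] w(1)] by auto
    have "t 0 = 1" "t 1 = 1" using T_low[OF t] by auto
    then have "v 0 = c * v 0" "v 1 = c * v 1" using fun_cong[OF c, of 0] fun_cong[OF c, of 1] vw by auto
    then have "c = 1" using pt_nz[OF v(1,2)] by auto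
    then show "\<forall>i\<in>{2..n}. t i * v i = w i" using c by simp
  next
    assume a: "\<forall>i\<in>{2..n}. t i * v i = w i"
    have "t i * v i = w i" for i
    proof -
      consider "i = 0" | "i = 1" | "i \<in> {2..n}" | "n < i" by fastforce
      then show ?thesis
      proof cases
        case 4 then show ?thesis using v(1) w(1) by (simp add: coord_vectors_def)
      qed (use a vw T_low[OF t, of 0] T_low[OF t, of 1] in auto)
    qed
    then show "pclass n (\<lambda>i. t i * v i) = pclass n w" by simp
  qed
  have pw: "v i ^ s = w i ^ s" if "i \<in> {2..n}" for i
  proof -
    have "(B i - B 1) * v 0 ^ s + (B 0 - B i) * v 1 ^ s + (B 1 - B 0) * v i ^ s = 0"
      "(B i - B 1) * v 0 ^ s + (B 0 - B i) * v 1 ^ s + (B 1 - B 0) * w i ^ s = 0"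
      using v(2) w(2) that vw by (simp_all add: sol_def)
    then have "(B 1 - B 0) * v i ^ s = (B 1 - B 0) * w i ^ s" by (metis add_left_imp_eq)
    then show ?thesis using B10 by simp
  qed
  have dv: "(w i / v i) ^ s = 1" if "i \<in> {2..n}" "v i \<noteq> 0" for i
    using that by (simp add: power_divide pw[OF that(1), symmetric])
  define t0 where "t0 = (\<lambda>i. if i \<in> {2..n} then w i / v i else 1)"
  show ?thesis
  proof (cases "\<exists>k\<in>{2..n}. v k = 0")
    case False
    have "t0 \<in> T 1 n"
      using False dv unfolding T_def t0_def by auto
    moreover have "t = t0" if "t \<in> T 1 n" "\<forall>i\<in>{2..n}. t i * v i = w i" for t
    proof
      fix i show "t i = t0 i"
        using that False T_low[OF that(1), of i] T_high[OF that(1), of i]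
        by (cases "i \<in> {2..n}") (auto simp: t0_def field_simps)
    qed
    moreover have "\<forall>i\<in>{2..n}. t0 i * v i = w i" using False by (auto simp: t0_def)
    ultimately have "{t \<in> T 1 n. pclass n (\<lambda>i. t i * v i) = pclass n w} = {t0}"
      using iff by blast
    then show ?thesis using True False by (simp add: ram_def)
  next
    case ex: True
    then obtain k where k: "k \<in> {2..n}" "v k = 0" by blast
    have wk: "w k = 0" using pw[OF k(1)] k(2) s0 by (simp add: zero_power)
    have nz: "v i \<noteq> 0" if "i \<in> {2..n}" "i \<noteq> k" for i
      using pt_zero_unique[OF v(1,2), of i k] that k by auto
    have "bij_betw (\<lambda>z. t0(k := z)) {z. z ^ s = 1} {t \<in> T 1 n. \<forall>i\<in>{2..n}. t i * v i = w i}"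
    proof (rule bij_betw_byWitness[where f' = "\<lambda>t. t k"])
      show "(\<lambda>z. t0(k := z)) ` {z. z ^ s = 1} \<subseteq> {t \<in> T 1 n. \<forall>i\<in>{2..n}. t i * v i = w i}"
        using k wk nz dv unfolding T_def t0_def by auto
      show "(\<lambda>t. t k) ` {t \<in> T 1 n. \<forall>i\<in>{2..n}. t i * v i = w i} \<subseteq> {z. z ^ s = 1}"
        using T_pow by auto
      show "\<forall>t\<in>{t \<in> T 1 n. \<forall>i\<in>{2..n}. t i * v i = w i}. t0(k := t k) = t"
      proof safe
        fix t assume t: "t \<in> T 1 n" "\<forall>i\<in>{2..n}. t i * v i = w i"
        show "t0(k := t k) = t"
        proof
          fix i show "(t0(k := t k)) i = t i"
            using t nz[of i] T_low[OF t(1), of i] T_high[OF t(1), of i]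
            by (cases "i \<in> {2..n}") (auto simp: t0_def field_simps)
        qed
      qed
    qed auto
    from bij_betw_same_card[OF this] have "card {t \<in> T 1 n. \<forall>i\<in>{2..n}. t i * v i = w i} = s"
      by (simp add: card_roots_of_unity)
    moreover have "{t \<in> T 1 n. pclass n (\<lambda>i. t i * v i) = pclass n w} = {t \<in> T 1 n. \<forall>i\<in>{2..n}. t i * v i = w i}"
      using iff by blast
    ultimately show ?thesis using True ex by (simp add: ram_def)
  qed
qed

text \<open>The projection to the line on classes; \<open>nsl\<close> is invariant under scaling, so
  the chosen representative does not matter.\<close>

definition slope :: "'a ppoint \<Rightarrow> 'a \<times> 'a" where
  "slope P = nsl (SOME v. v \<in> P)"

lemma slope_pclass: "v \<in> coord_vectors n \<Longrightarrow> slope (pclass n v) = nsl v"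
proof -
  assume v: "v \<in> coord_vectors n"
  have "(SOME w. w \<in> pclass n v) \<in> pclass n v" by (rule someI[of "\<lambda>w. w \<in> pclass n v", OF pclass_self[OF v]])
  then show ?thesis unfolding slope_def by (auto simp: pclass_iff[OF v] nsl_scale)
qed

lemma act_in_pts:
  assumes "v \<in> coord_vectors n" "sol n s B v" "t \<in> T 1 n"
  shows "pclass n (\<lambda>i. t i * v i) \<in> pts"
  using zero_locus_crv_iff act_point[OF assms] by blast

text \<open>Summing over the group instead of over the fibre counts each point of the fibre once for
  every element of its stabiliser, that is, \<open>ram v\<close> times.\<close>

lemma sum_count_orbit:
  assumes v: "v \<in> coord_vectors n" "sol n s B v" "(v 0, v 1) \<in> P1N" and D: "set D \<subseteq> pts"
  shows "(\<Sum>t\<in>T 1 n. count_list D (pclass n (\<lambda>i. t i * v i))) = ram v * count_list (map slope D) (nsl v)"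
  using D
proof (induction D)
  case (Cons Q D)
  obtain w where w: "w \<in> coord_vectors n" "sol n s B w" "(w 0, w 1) \<in> P1N" "Q = pclass n w"
    using normal_point[of Q] Cons.prems by auto
  have "(\<Sum>t\<in>T 1 n. if Q = pclass n (\<lambda>i. t i * v i) then 1 else 0 :: nat)
      = card {t \<in> T 1 n. pclass n (\<lambda>i. t i * v i) = pclass n w}"
    using finite_T by (simp add: sum.If_cases w(4) Int_def eq_commute)
  also have "\<dots> = (if nsl v = nsl w then ram v else 0)" by (rule stabilizer_card[OF v w(1-3)])
  finally have e: "(\<Sum>t\<in>T 1 n. if Q = pclass n (\<lambda>i. t i * v i) then 1 else 0 :: nat) = (if nsl v = nsl w then ram v else 0)" .
  have "(\<Sum>t\<in>T 1 n. count_list (Q # D) (pclass n (\<lambda>i. t i * v i))) =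
    (\<Sum>t\<in>T 1 n. (if Q = pclass n (\<lambda>i. t i * v i) then 1 else 0) + count_list D (pclass n (\<lambda>i. t i * v i)))"
    by (rule sum.cong) auto
  also have "\<dots> = (if nsl v = nsl w then ram v else 0) + ram v * count_list (map slope D) (nsl v)"
    unfolding sum.distrib e using Cons by simp
  finally show ?case using slope_pclass[OF w(1)] w(4) by auto
qed simp

lemma P1N_point:
  assumes "p \<in> P1N"
  obtains v where "v \<in> coord_vectors n" "sol n s B v" "(v 0, v 1) = p" "nsl v = p"
proof -
  obtain v0 where v0: "sol n s B v0" "v0 0 = fst p" "v0 1 = snd p" using point_over[OF order_refl] by blast
  have "v0 0 \<noteq> 0 \<or> v0 1 \<noteq> 0" using v0 P1N_nz[OF assms] by (metis prod.collapse)
  note tr = trunc_point[OF v0(1) this]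
  let ?v = "\<lambda>i. if i \<le> n then v0 i else 0"
  have e: "(?v 0, ?v 1) = p" using tr(4,5) v0(2,3) by (metis prod.collapse)
  then have "nsl ?v = p" using nsl_normal[of ?v] assms by metis
  then show ?thesis using that[OF tr(1,2) e] by blast
qed

text \<open>The degree of a hyperplane section without intersection theory: the norm of L is a
  binary form of degree n + 1, so its list of zeros has n + 1 entries. The slopes of the n points of
  D account for all but one of them, and over that one exactly one further point of the section
  lies. The formula for the norm is kept in the conclusion because it locates the slope of Q over
  the ground field.\<close>

theorem residual:
  assumes cT: "card (T 1 n) = n + 1"
    and L: "L \<in> forms n 1" "nonvan L"
    and D: "set D \<subseteq> pts" "length D = n" "\<And>P. P \<in> pts \<Longrightarrow> count_list D P \<le> ordP L P"
  shows "\<exists>Q\<in>pts. (\<forall>P\<in>pts. ordP L P = count_list D P + (if P = Q then 1 else 0)) \<and>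
    (\<exists>c N. c \<noteq> 0 \<and> (\<forall>y. sol n s cB y \<longrightarrow> fev y N = (\<Prod>t\<in>T 1 n. fev (act t y) L)) \<and>
       N = msingle 0 c * prod_list (map (\<lambda>P. lam (slope P)) D) * lam (slope Q))"
proof -
  have n1: "1 \<le> n" using n2 by simp
  obtain N where N: "N \<in> forms 1 (card (T 1 n) * 1)"
    "\<And>y. sol n s cB y \<Longrightarrow> fev y N = (\<Prod>t\<in>T 1 n. fev (act t y) L)"
    using norm_exists[OF L(1) order_refl n1] by auto
  have fnz: "fev (act t y) L \<noteq> 0" if "t \<in> T 1 n" "arc n s B y" for t y
    by (rule nonvanD[OF L(2,1) act_arc[OF that(2,1) order_refl]])
  obtain y0 where "arc n s B y0" using L(2) by (auto simp: nonvan_def)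
  then have "fev y0 N \<noteq> 0" using N(2)[of y0] fnz finite_T by (simp add: arc_def)
  then have "N \<noteq> 0" by auto
  then obtain c ps where c: "c \<noteq> 0" "length ps = card (T 1 n) * 1" "set ps \<subseteq> P1N" "N = msingle 0 c * prod_list (map lam ps)"
    using binary_factor[OF N(1)] by auto
  have len: "length ps = n + 1" using c(2) cT by simp
  have ordsum: "(\<Sum>t\<in>T 1 n. ordP L (pclass n (\<lambda>i. t i * v i))) = ram v * count_list ps (nsl v)"
    if v: "v \<in> coord_vectors n" "sol n s B v" for v
  proof -
    obtain y where y: "good n s B v y" using good_at_point[OF v] by blast
    have "(\<Sum>t\<in>T 1 n. ordP L (pclass n (\<lambda>i. t i * v i))) = (\<Sum>t\<in>T 1 n. subdegree (fev (act t y) L))"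
      by (rule sum.cong[OF refl]) (rule ordP_good[OF act_point[OF v] good_act[OF y] L])
    also have "\<dots> = subdegree (fev y N)"
      unfolding N(2)[OF goodD(2)[OF y]] using fnz goodD(1)[OF y] by (subst subdegree_prod) auto
    also have "\<dots> = subdegree (prod_list (map (\<lambda>p. fev y (lam p)) ps))"
      unfolding c(4) using subdegree_const_mult[OF c(1)] by (simp add: o_def)
    also have "\<dots> = (\<Sum>p\<leftarrow>ps. subdegree (fev y (lam p)))"
      using arc_lam_nz[OF goodD(1)[OF y] P1N_nz] c(3) by (intro subdegree_prod_list) blast
    also have "\<dots> = (\<Sum>p\<leftarrow>ps. if p = nsl v then ram v else 0)"
    proof (intro arg_cong[of _ _ sum_list] map_cong refl)
      fix p assume "p \<in> set ps"
      then show "subdegree (fev y (lam p)) = (if p = nsl v then ram v else 0)"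
        unfolding ram_def using lam_subdegree_general[OF v y] c(3) by blast
    qed
    finally show ?thesis by (simp add: sum_list_indicator)
  qed
  \<comment> \<open>The bound on D is summed over the fibre above q; both sums carry the factor
    \<open>ram v\<close>, which cancels.\<close>
  have le: "count_list (map slope D) q \<le> count_list ps q" for q
  proof (cases "q \<in> P1N")
    case True
    obtain v where v: "v \<in> coord_vectors n" "sol n s B v" "(v 0, v 1) = q" "nsl v = q" using P1N_point[OF True] .
    have "ram v * count_list (map slope D) (nsl v) = (\<Sum>t\<in>T 1 n. count_list D (pclass n (\<lambda>i. t i * v i)))"
      using sum_count_orbit[OF v(1,2) _ D(1)] v(3) True by simp
    also have "\<dots> \<le> (\<Sum>t\<in>T 1 n. ordP L (pclass n (\<lambda>i. t i * v i)))"
      by (intro sum_mono D(3) act_in_pts[OF v(1,2)])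
    finally show ?thesis using ordsum[OF v(1,2)] ram_pos[of v] v(4) by simp
  next
    case False
    then have "q \<notin> set (map slope D)" using nsl_P1N by (auto simp: slope_def)
    then show ?thesis by (simp add: count_notin)
  qed
  then have sub: "mset (map slope D) \<subseteq># mset ps" by (intro mset_subset_eqI) (simp only: count_mset)
  have "size (mset ps - mset (map slope D)) = 1" using size_Diff_submset[OF sub] len D(2) by simp
  then obtain \<rho> where rho: "mset ps - mset (map slope D) = {#\<rho>#}" using size_1_singleton_mset by blast
  then have ms: "mset ps = add_mset \<rho> (mset (map slope D))"
    using subset_mset.diff_add[OF sub] by (metis add_mset_add_single add.commute)
  have rhoP: "\<rho> \<in> P1N" using c(3) ms by (metis set_mset_mset union_single_eq_member subsetD)
  have cnt: "count_list ps q = count_list (map slope D) q + (if q = \<rho> then 1 else 0)" for q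
    using arg_cong[OF ms, of "\<lambda>M. count M q"] by (simp only: count_mset count_add_mset) simp
  define ex where "ex P = ordP L P - count_list D P" for P
  have ordex: "ordP L P = count_list D P + ex P" if "P \<in> pts" for P
    using D(3)[OF that] by (simp add: ex_def)
  have exsum: "(\<Sum>t\<in>T 1 n. ex (pclass n (\<lambda>i. t i * v i))) = (if nsl v = \<rho> then ram v else 0)"
    if v: "v \<in> coord_vectors n" "sol n s B v" "(v 0, v 1) \<in> P1N" for v
  proof -
    have "(\<Sum>t\<in>T 1 n. ordP L (pclass n (\<lambda>i. t i * v i))) =
      (\<Sum>t\<in>T 1 n. count_list D (pclass n (\<lambda>i. t i * v i)) + ex (pclass n (\<lambda>i. t i * v i)))"
      by (rule sum.cong[OF refl]) (rule ordex[OF act_in_pts[OF v(1,2)]])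
    then show ?thesis
      unfolding ordsum[OF v(1,2)] sum.distrib sum_count_orbit[OF v D(1)] cnt
      by (cases "nsl v = \<rho>") (auto simp: distrib_left)
  qed
  obtain v where v: "v \<in> coord_vectors n" "sol n s B v" "(v 0, v 1) = \<rho>" "nsl v = \<rho>" using P1N_point[OF rhoP] .
  have vN: "(v 0, v 1) \<in> P1N" using v(3) rhoP by simp
  have "(\<Sum>t\<in>T 1 n. ex (pclass n (\<lambda>i. t i * v i))) \<noteq> 0" using exsum[OF v(1,2) vN] ram_pos[of v] v(4) by simp
  then obtain t0 where t0: "t0 \<in> T 1 n" "ex (pclass n (\<lambda>i. t0 i * v i)) \<noteq> 0"
    by (meson sum.neutral)
  define u where "u = (\<lambda>i. t0 i * v i)"
  have u: "u \<in> coord_vectors n" "sol n s B u" using act_point[OF v(1,2) t0(1)] by (auto simp: u_def)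
  have u01: "u 0 = v 0" "u 1 = v 1" using T_low[OF t0(1)] by (auto simp: u_def)
  have uN: "(u 0, u 1) \<in> P1N" "nsl u = \<rho>" using vN u01 v(4) by (auto simp: nsl_def)
  define Q where "Q = pclass n u"
  have Q: "Q \<in> pts" using zero_locus_crv_iff u unfolding Q_def by blast
  have exQ: "1 \<le> ex Q" using t0(2) by (simp add: Q_def u_def)
  \<comment> \<open>\<open>ex\<close> is at least the indicator of Q on the orbit, and both have sum
    \<open>ram u\<close>, the indicator by the order of the stabiliser. So they agree term by
    term.\<close>
  have key: "\<forall>t\<in>T 1 n. ex (pclass n (\<lambda>i. t i * u i)) = (if pclass n (\<lambda>i. t i * u i) = Q then 1 else 0)"
  proof -
    let ?f = "\<lambda>t. if pclass n (\<lambda>i. t i * u i) = Q then 1 else 0 :: nat"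
    have "(\<Sum>t\<in>T 1 n. ?f t) = card {t \<in> T 1 n. pclass n (\<lambda>i. t i * u i) = pclass n u}"
      using finite_T by (simp add: sum.If_cases Q_def Int_def)
    also have "\<dots> = ram u" using stabilizer_card[OF u uN(1) u uN(1)] by simp
    also have "\<dots> = (\<Sum>t\<in>T 1 n. ex (pclass n (\<lambda>i. t i * u i)))" using exsum[OF u uN(1)] uN(2) by simp
    finally have eq: "(\<Sum>t\<in>T 1 n. ?f t) = (\<Sum>t\<in>T 1 n. ex (pclass n (\<lambda>i. t i * u i)))" .
    have lef: "?f t \<le> ex (pclass n (\<lambda>i. t i * u i))" for t using exQ by simp
    show ?thesis
    proof (rule ballI, rule ccontr)
      fix t assume t: "t \<in> T 1 n" "ex (pclass n (\<lambda>i. t i * u i)) \<noteq> ?f t"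
      have "(\<Sum>t\<in>T 1 n. ?f t) < (\<Sum>t\<in>T 1 n. ex (pclass n (\<lambda>i. t i * u i)))"
      proof (rule sum_strict_mono_ex1[OF finite_T])
        show "\<forall>t\<in>T 1 n. ?f t \<le> ex (pclass n (\<lambda>i. t i * u i))" using lef by blast
        have "?f t < ex (pclass n (\<lambda>i. t i * u i))"
          by (rule le_neq_implies_less[OF lef]) (use t(2) in simp)
        then show "\<exists>t\<in>T 1 n. ?f t < ex (pclass n (\<lambda>i. t i * u i))" using t(1) by blast
      qed
      then show False using eq by simp
    qed
  qed
  have exP: "ex P = (if P = Q then 1 else 0)" if P: "P \<in> pts" for P
  proof -
    obtain w where w: "w \<in> coord_vectors n" "sol n s B w" "(w 0, w 1) \<in> P1N" "P = pclass n w"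
      using normal_point[OF P] .
    show ?thesis
    proof (cases "nsl w = \<rho>")
      case True
      then have "card {t \<in> T 1 n. pclass n (\<lambda>i. t i * u i) = pclass n w} \<noteq> 0"
        using stabilizer_card[OF u uN(1) w(1-3)] uN(2) ram_pos[of u] by simp
      then have "{t \<in> T 1 n. pclass n (\<lambda>i. t i * u i) = pclass n w} \<noteq> {}" by (metis card.empty)
      then obtain t where "t \<in> T 1 n" "pclass n (\<lambda>i. t i * u i) = P" using w(4) by blast
      then show ?thesis using key by metis
    next
      case False
      then have "(\<Sum>t\<in>T 1 n. ex (pclass n (\<lambda>i. t i * w i))) = 0" using exsum[OF w(1-3)] by simp
      then have "\<forall>t\<in>T 1 n. ex (pclass n (\<lambda>i. t i * w i)) = 0" using finite_T by simp
      from bspec[OF this T_1] have "ex (pclass n (\<lambda>i. (1::'a) * w i)) = 0" .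
      moreover have "P \<noteq> Q" using False nsl_pclass_eq[OF w(1) u(1)] uN(2) w(4) by (auto simp: Q_def)
      ultimately show ?thesis by (simp add: w(4))
    qed
  qed
  have "prod_list (map lam ps) = prod_mset (image_mset lam (mset ps))"
    by (metis mset_map prod_mset_prod_list)
  also have "\<dots> = lam \<rho> * prod_mset (image_mset lam (mset (map slope D)))" unfolding ms by simp
  also have "prod_mset (image_mset lam (mset (map slope D))) = prod_list (map lam (map slope D))"
    by (metis mset_map prod_mset_prod_list)
  finally have "N = msingle 0 c * prod_list (map (\<lambda>P. lam (slope P)) D) * lam (slope Q)"
    unfolding c(4) using slope_pclass[OF u(1)] uN(2) by (simp add: Q_def o_def mult_ac)
  then show ?thesis
    using Q ordex exP N(2) c(1) by (intro bexI[OF _ Q] conjI exI[of _ c] exI[of _ N]) auto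
qed

end

section \<open>Rational points\<close>

lemma underdetermined_aux:
  fixes f :: "nat \<Rightarrow> nat \<Rightarrow> 'b::field"
  shows "finite S \<Longrightarrow> m < card S \<Longrightarrow>
    \<exists>l. (\<exists>i\<in>S. l i \<noteq> 0) \<and> (\<forall>j<m. (\<Sum>i\<in>S. l i * f j i) = 0)"
proof (induction m arbitrary: S f)
  case 0
  then obtain i where "i \<in> S" by fastforce
  then show ?case by (intro exI[of _ "\<lambda>_. 1"]) auto
next
  case (Suc m)
  show ?case
  proof (cases "\<forall>i\<in>S. f m i = 0")
    case True
    obtain l where l: "\<exists>i\<in>S. l i \<noteq> 0" "\<forall>j<m. (\<Sum>i\<in>S. l i * f j i) = 0"
      using Suc.IH[of S f] Suc.prems by auto
    moreover have "(\<Sum>i\<in>S. l i * f m i) = 0" using True by (intro sum.neutral) auto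
    ultimately show ?thesis by (intro exI[of _ l]) (auto simp: less_Suc_eq)
  next
    case False
    then obtain i0 where i0: "i0 \<in> S" "f m i0 \<noteq> 0" by auto
    define f' where "f' j i = f j i - f j i0 * f m i / f m i0" for j i
    have "m < card (S - {i0})" using Suc.prems i0(1) by simp
    then obtain l where l: "\<exists>i\<in>S - {i0}. l i \<noteq> 0" "\<forall>j<m. (\<Sum>i\<in>S - {i0}. l i * f' j i) = 0"
      using Suc.IH[of "S - {i0}" f'] Suc.prems(1) by auto
    define a where "a = - (\<Sum>i\<in>S - {i0}. l i * f m i) / f m i0"
    define l' where "l' = l(i0 := a)"
    have split: "(\<Sum>i\<in>S. l' i * f j i) = a * f j i0 + (\<Sum>i\<in>S - {i0}. l i * f j i)" for j
    proof -
      have "(\<Sum>i\<in>S - {i0}. l' i * f j i) = (\<Sum>i\<in>S - {i0}. l i * f j i)"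
        by (rule sum.cong) (auto simp: l'_def)
      then show ?thesis by (subst sum.remove[OF Suc.prems(1) i0(1)]) (simp add: l'_def)
    qed
    have "(\<Sum>i\<in>S. l' i * f j i) = 0" if j: "j < Suc m" for j
    proof (cases "j = m")
      case True then show ?thesis using i0(2) unfolding split by (simp add: a_def)
    next
      case False
      then have "(\<Sum>i\<in>S - {i0}. l i * f' j i) = 0" using l(2) j by simp
      also have "(\<Sum>i\<in>S - {i0}. l i * f' j i) =
        (\<Sum>i\<in>S - {i0}. l i * f j i) - (\<Sum>i\<in>S - {i0}. (l i * f m i) * (f j i0 / f m i0))"
        unfolding sum_subtractf[symmetric] by (rule sum.cong) (auto simp: f'_def right_diff_distrib)
      also have "(\<Sum>i\<in>S - {i0}. (l i * f m i) * (f j i0 / f m i0)) = - (a * f j i0)"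
        unfolding sum_distrib_right[symmetric] by (simp add: a_def)
      finally show ?thesis unfolding split by (simp add: add.commute)
    qed
    moreover have "\<exists>i\<in>S. l' i \<noteq> 0" using l(1) by (auto simp: l'_def)
    ultimately show ?thesis by blast
  qed
qed

lemma underdetermined:
  fixes f :: "nat \<Rightarrow> nat \<Rightarrow> 'b::field"
  obtains l where "\<exists>i\<le>n. l i \<noteq> 0" "\<And>j. j < n \<Longrightarrow> (\<Sum>i\<le>n. l i * f j i) = 0"
proof -
  have "\<exists>l. (\<exists>i\<in>{..n}. l i \<noteq> 0) \<and> (\<forall>j<n. (\<Sum>i\<le>n. l i * f j i) = 0)"
    by (rule underdetermined_aux) auto
  then show ?thesis using that by blast
qed

lemma count_list_take:
  "k < count_list D P \<Longrightarrow> \<exists>j<length D. D ! j = P \<and> count_list (take j D) P = k"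
proof (induction D arbitrary: k)
  case (Cons x D)
  show ?case
  proof (cases "x = P \<and> k = 0")
    case True then show ?thesis by (intro exI[of _ 0]) auto
  next
    case False
    then have "(if x = P then k - 1 else k) < count_list D P" using Cons.prems by auto
    then obtain j where "j < length D" "D ! j = P" "count_list (take j D) P = (if x = P then k - 1 else k)"
      using Cons.IH by blast
    then show ?thesis using False by (intro exI[of _ "Suc j"]) auto
  qed
qed simp

section \<open>Elements, points and arcs defined over the ground field\<close>

abbreviation inK :: "'k::field alg_closure \<Rightarrow> bool" where
  "inK x \<equiv> x \<in> range to_ac"

lemma inK_to_ac [simp, intro]: "inK (to_ac a)" by simp

lemma inK_0 [simp]: "inK 0" and inK_1 [simp]: "inK 1"
  using inK_to_ac[of 0] inK_to_ac[of 1] by simp_all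

lemma inK_add: "inK x \<Longrightarrow> inK y \<Longrightarrow> inK (x + y)"
  by (elim rangeE) (hypsubst, rule range_eqI[where f = to_ac, OF to_ac_add[symmetric]])

lemma inK_minus: "inK x \<Longrightarrow> inK (- x)"
  by (elim rangeE) (hypsubst, rule range_eqI[where f = to_ac, OF to_ac_minus[symmetric]])

lemma inK_diff: "inK x \<Longrightarrow> inK y \<Longrightarrow> inK (x - y)"
  by (elim rangeE) (hypsubst, rule range_eqI[where f = to_ac, OF to_ac_diff[symmetric]])

lemma inK_mult: "inK x \<Longrightarrow> inK y \<Longrightarrow> inK (x * y)"
  by (elim rangeE) (hypsubst, rule range_eqI[where f = to_ac, OF to_ac_mult[symmetric]])

lemma inK_divide: "inK x \<Longrightarrow> inK y \<Longrightarrow> inK (x / y)"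
  by (elim rangeE) (hypsubst, rule range_eqI[where f = to_ac, OF to_ac_divide[symmetric]])

lemma inK_power: "inK x \<Longrightarrow> inK (x ^ k)"
  by (elim rangeE) (hypsubst, rule range_eqI[where f = to_ac, OF to_ac_power[symmetric]])

lemma inK_numeral: "inK (numeral k)"
  using inK_to_ac[of "numeral k"] by simp

lemmas inK_intros = inK_to_ac inK_0 inK_1 inK_add inK_minus inK_diff inK_mult inK_divide inK_power inK_numeral

lemma inK_prod_list: "(\<And>x. x \<in> set xs \<Longrightarrow> inK (f x)) \<Longrightarrow> inK (prod_list (map f xs))"
  by (induction xs) (auto intro: inK_mult)

abbreviation lift :: "(nat \<Rightarrow> 'k::field) \<Rightarrow> nat \<Rightarrow> 'k alg_closure" where
  "lift v \<equiv> \<lambda>i. to_ac (v i)"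

lemma lift_coord: "v \<in> coord_vectors n \<Longrightarrow> lift v \<in> coord_vectors n"
  by (auto simp: coord_vectors_def)

lemma lift_sol: "sol n s (lift A) (lift v) \<longleftrightarrow> sol n s A v"
proof -
  have "(to_ac (A i) - to_ac (A 1)) * to_ac (v 0) ^ s + (to_ac (A 0) - to_ac (A i)) * to_ac (v 1) ^ s
      + (to_ac (A 1) - to_ac (A 0)) * to_ac (v i) ^ s =
    to_ac ((A i - A 1) * v 0 ^ s + (A 0 - A i) * v 1 ^ s + (A 1 - A 0) * v i ^ s)" for i
    by simp
  then show ?thesis unfolding sol_def by (simp only: to_ac_eq_0_iff)
qed

lemma geometric_point_pclass:
  assumes v: "v \<in> coord_vectors n"
  shows "geometric_point (pclass n v) = pclass n (lift v)"
proof (intro equalityI subsetI)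
  fix w assume "w \<in> geometric_point (pclass n v)"
  then obtain u c where u: "u \<in> pclass n v" "c \<noteq> 0" "w = (\<lambda>i. c * to_ac (u i))"
    by (auto simp: geometric_point_def)
  then obtain d where "d \<noteq> 0" "u = (\<lambda>i. d * v i)" by (auto simp: pclass_iff[OF v])
  then show "w \<in> pclass n (lift v)"
    unfolding pclass_iff[OF lift_coord[OF v]] using u
    by (intro exI[of _ "c * to_ac d"]) (auto simp: mult.assoc)
next
  fix w assume "w \<in> pclass n (lift v)"
  then obtain c where "c \<noteq> 0" "w = (\<lambda>i. c * to_ac (v i))" by (auto simp: pclass_iff[OF lift_coord[OF v]])
  then show "w \<in> geometric_point (pclass n v)"
    unfolding geometric_point_def using pclass_self[OF v] by blast
qed

lemma geometric_point_inj:
  assumes v: "v \<in> coord_vectors n" and w: "w \<in> coord_vectors n"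
    and eq: "geometric_point (pclass n v) = geometric_point (pclass n w)"
  shows "pclass n v = pclass n w"
proof -
  obtain c where c: "c \<noteq> 0" "lift w = (\<lambda>i. c * to_ac (v i))"
    using eq unfolding geometric_point_pclass[OF v] geometric_point_pclass[OF w]
      pclass_eq_iff[OF lift_coord[OF v] lift_coord[OF w]] by blast
  obtain i where i: "v i \<noteq> 0" using v by (auto simp: coord_vectors_def)
  define d where "d = w i / v i"
  have cd: "c = to_ac d" using fun_cong[OF c(2), of i] i by (simp add: d_def)
  have "w j = d * v j" for j
  proof -
    have "to_ac (w j) = to_ac (d * v j)" using fun_cong[OF c(2), of j] cd by simp
    then show ?thesis by (simp only: to_ac_eq_iff)
  qed
  moreover have "d \<noteq> 0" using cd c(1) by auto
  ultimately show ?thesis unfolding pclass_eq_iff[OF v w] by (auto simp: fun_eq_iff)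
qed

definition fmap :: "'k::field fps \<Rightarrow> 'k alg_closure fps" where
  "fmap f = Abs_fps (\<lambda>m. to_ac (f $ m))"

lemma fmap_nth [simp]: "fmap f $ m = to_ac (f $ m)"
  by (simp add: fmap_def)

lemma coeff_hom_fmap: "coeff_hom fmap"
proof
  show "fmap 1 = 1" by (rule fps_ext) auto
  show "fmap (a + b) = fmap a + fmap b" for a b :: "'a fps" by (rule fps_ext) simp
  show "fmap (a * b) = fmap a * fmap b" for a b :: "'a fps"
    by (rule fps_ext) (simp add: fps_mult_nth to_ac_sum)
qed

interpretation fmap: coeff_hom fmap by (rule coeff_hom_fmap)

lemma fmap_const [simp]: "fmap (fps_const a) = fps_const (to_ac a)"
  by (rule fps_ext) simp

lemma fmap_X [simp]: "fmap fps_X = fps_X"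
  by (rule fps_ext) (simp add: fps_X_def)

lemma subdegree_fmap: "subdegree (fmap f) = subdegree f"
proof (cases "f = 0")
  case False
  show ?thesis
  proof (rule subdegreeI)
    show "fmap f $ subdegree f \<noteq> 0" using False by simp
    show "fmap f $ i = 0" if "i < subdegree f" for i by (simp add: nth_less_subdegree_zero[OF that])
  qed
qed simp

lemma good_fmap:
  assumes g: "good n s A v y" and v: "v 0 \<noteq> 0 \<or> v 1 \<noteq> 0" and n: "1 \<le> n" and s: "0 < s"
  shows "good n s (lift A) (lift v) (\<lambda>i. fmap (y i))"
proof -
  have y0: "\<And>i. i \<le> n \<Longrightarrow> y i $ 0 = v i" and arc: "arc n s A y" using g by (auto simp: good_def)
  define f where "f = fps_const (v 1) * y 0 - fps_const (v 0) * y 1"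
  have fm: "fps_const (to_ac (v 1)) * fmap (y 0) - fps_const (to_ac (v 0)) * fmap (y 1) = fmap f"
    by (simp add: f_def)
  have "fps_const (v 1) * y 0 \<noteq> fps_const (v 0) * y 1"
    using arc v unfolding arc_def by (metis prod.inject)
  then have "f \<noteq> 0" by (simp add: f_def)
  then have fnz: "fmap f \<noteq> 0" using subdegree_fmap[of f] by (auto simp: fps_eq_iff)
  have sol: "sol n s (\<lambda>i. fps_const (to_ac (A i))) (\<lambda>i. fmap (y i))"
    using sol_hom[OF coeff_hom_fmap, of n s "\<lambda>i. fps_const (A i)" y] arc by (simp add: arc_def)
  \<comment> \<open>The constants a, b now lie in the closure. The constant terms force (a, b) to be
    proportional to (\<open>v 0\<close>, \<open>v 1\<close>), so such a relation would annihilate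
    \<open>fmap f\<close>, which is nonzero because f is.\<close>
  have "a = 0 \<and> b = 0" if e: "fps_const b * fmap (y 0) = fps_const a * fmap (y 1)" for a b
  proof -
    have e0: "b * to_ac (v 0) = a * to_ac (v 1)"
      using arg_cong[OF e, of "\<lambda>f. f $ 0"] y0 n by simp
    have ring1: "b' * (v1 * x0 - v0 * x1) = v1 * (b' * x0 - a' * x1) - (b' * v0 - a' * v1) * x1"
      and ring2: "a' * (v1 * x0 - v0 * x1) = v0 * (b' * x0 - a' * x1) - (b' * v0 - a' * v1) * x0"
      for a' b' v0 v1 x0 x1 :: "'a alg_closure fps" by (simp_all add: algebra_simps)
    have z1: "fps_const b * fmap (y 0) - fps_const a * fmap (y 1) = 0" using e by simp
    have z2: "fps_const b * fps_const (to_ac (v 0)) - fps_const a * fps_const (to_ac (v 1)) = 0"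
      using e0 by simp
    have "fps_const b * fmap f =
        fps_const (to_ac (v 1)) * (fps_const b * fmap (y 0) - fps_const a * fmap (y 1))
        - (fps_const b * fps_const (to_ac (v 0)) - fps_const a * fps_const (to_ac (v 1))) * fmap (y 1)"
      unfolding fm[symmetric] by (rule ring1)
    moreover have "fps_const a * fmap f =
        fps_const (to_ac (v 0)) * (fps_const b * fmap (y 0) - fps_const a * fmap (y 1))
        - (fps_const b * fps_const (to_ac (v 0)) - fps_const a * fps_const (to_ac (v 1))) * fmap (y 0)"
      unfolding fm[symmetric] by (rule ring2)
    ultimately have "fps_const b * fmap f = 0" "fps_const a * fmap f = 0"
      unfolding z1 z2 by simp_all
    then show ?thesis using fnz by simp
  qed
  then have "arc n s (lift A) (\<lambda>i. fmap (y i))" using sol unfolding arc_def by blast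
  moreover have "\<exists>c. c \<noteq> 0 \<and> fmap (y i) = fps_const c * fps_X" if i: "i \<in> {2..n}" "v i = 0" for i
  proof -
    have "\<exists>c. c \<noteq> 0 \<and> y i = fps_const c * fps_X" using g i unfolding good_def by blast
    then obtain c where "c \<noteq> 0" "y i = fps_const c * fps_X" by blast
    then show ?thesis by (intro exI[of _ "to_ac c"]) simp
  qed
  ultimately show ?thesis
    using g y0 unfolding good_def fm subdegree_fmap f_def by simp
qed

text \<open>The root of unity lies in the ground field, so the s-th roots of unity do, and the group
  acts on k-rational points.\<close>

locale kcurve =
  fixes n s :: nat and A :: "nat \<Rightarrow> 'k::field_char_0" and z0 :: 'k
  assumes nk: "2 \<le> n" and sk: "2 \<le> s" and inj_A: "inj_on A {..n}"
    and primk: "primitive_root_of_unity s z0"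
begin

sublocale curve n s "lift A" "to_ac z0"
proof
  show "2 \<le> n" "2 \<le> s" by (rule nk sk)+
  show "inj_on (lift A) {..n}" using inj_A by (simp add: inj_on_def)
  have "to_ac z0 ^ j = 1 \<longleftrightarrow> z0 ^ j = 1" for j
    by (metis to_ac_1 to_ac_eq_iff to_ac_power)
  then show "primitive_root_of_unity s (to_ac z0)" using primk by (simp add: primitive_root_of_unity_def)
qed

abbreviation "RP \<equiv> rational_points n (crv n s A)"

lemma geometric_pts: "geometric_points n (crv n s A) = pts"
  by (simp add: geometric_points_def base_change_crv)

lemma smooth:
  assumes "proj_dimension n (crv n s A) = 1"
  shows "smooth_curve n (crv n s A)"
  unfolding smooth_curve_def geometric_pts
proof (intro conjI ballI irreducible assms)
  show "crv n s A \<subseteq> (\<Union>d. forms n d)" using crv_forms by blast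
  fix P v assume P: "P \<in> pts" and v: "v \<in> P"
  obtain w where w: "w \<in> coord_vectors n" "sol n s (lift A) w" "P = pclass n w" using zero_locus_crvE[OF P] .
  have vc: "v \<in> coord_vectors n" using v w(3) pclass_subset by blast
  obtain c where "c \<noteq> 0" "v = (\<lambda>i. c * w i)" using v w(3) pclass_iff[OF w(1)] by auto
  then have "P = pclass n v" using pclass_scale[OF w(1)] w(3) by simp
  then have "sol n s (lift A) v" using P zero_locus_crv_iff[OF vc] by blast
  then show "jacobian_rank n (base_change ` crv n s A) v + 1 = n"
    unfolding base_change_crv by (rule jacobian_rank_point[OF vc])
qed

lemma RP_E:
  assumes "P \<in> RP"
  obtains v where "v \<in> coord_vectors n" "sol n s A v" "P = pclass n v" "geometric_point P = pclass n (lift v)"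
    "lift v \<in> coord_vectors n" "sol n s (lift A) (lift v)"
proof -
  obtain v where v: "v \<in> coord_vectors n" "sol n s A v" "P = pclass n v"
    using assms zero_locus_crvE unfolding rational_points_def by metis
  then show ?thesis using that geometric_point_pclass[OF v(1)] lift_coord[OF v(1)] lift_sol by blast
qed

lemma RP_I: "v \<in> coord_vectors n \<Longrightarrow> sol n s A v \<Longrightarrow> pclass n v \<in> RP"
  unfolding rational_points_def using zero_locus_crv_iff by blast

lemma geometric_point_pts: "P \<in> RP \<Longrightarrow> geometric_point P \<in> pts"
  using RP_E zero_locus_crv_iff by metis

lemma geometric_point_eq_iff: "P \<in> RP \<Longrightarrow> Q \<in> RP \<Longrightarrow> geometric_point P = geometric_point Q \<longleftrightarrow> P = Q"
  using RP_E geometric_point_inj by metis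

lemma rational_good:
  assumes "P \<in> RP"
  shows "\<exists>v y. v \<in> coord_vectors n \<and> sol n s A v \<and> P = pclass n v \<and> good n s (lift A) (lift v) (\<lambda>i. fmap (y i))"
proof -
  obtain v where v: "v \<in> coord_vectors n" "sol n s A v" "P = pclass n v" "lift v \<in> coord_vectors n" "sol n s (lift A) (lift v)"
    using RP_E[OF assms] by metis
  have v01: "v 0 \<noteq> 0 \<or> v 1 \<noteq> 0" using pt_nz[OF v(4,5)] by simp
  obtain y where "good n s A v y" using good_exists[OF v(2) inj_A s0 _ v01] nk by auto
  from good_fmap[OF this v01 _ s0] have "good n s (lift A) (lift v) (\<lambda>i. fmap (y i))" using nk by simp
  then show ?thesis using v(1-3) by blast
qed

lemma ord_pos_iff:
  assumes "F \<in> forms n d" "nonvan F" "v \<in> coord_vectors n" "sol n s (lift A) v"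
  shows "1 \<le> ordP F (pclass n v) \<longleftrightarrow> ev v F = 0"
proof -
  obtain y where y: "good n s (lift A) v y" using good_at_point[OF assms(3,4)] by blast
  have nz: "fev y F \<noteq> 0" by (rule nonvanD[OF assms(2,1) goodD(1)[OF y]])
  have "fev y F $ 0 = ev v F" by (rule fev_nth_0[OF forms_mpol_ring[OF assms(1)] goodD(3)[OF y]])
  then show ?thesis unfolding ordP_good[OF assms(3,4) y assms(1,2)]
    using nz by (metis One_nat_def Suc_leI gr0I not_one_le_zero nth_subdegree_nonzero nth_less_subdegree_zero)
qed

text \<open>The j-th entry of D asks that the coefficient of X^m vanish along its arc, where m
  counts the earlier copies of the same point. With arcs over k this is a system of n linear
  equations over k in n + 1 unknowns, so it has a nonzero solution over k.\<close>

lemma interpolating_form: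
  assumes D: "set D \<subseteq> RP" "length D = n"
  obtains l where "\<exists>i\<le>n. l i \<noteq> (0::'k)"
    "\<And>P. P \<in> pts \<Longrightarrow> count_list (map geometric_point D) P \<le> ordP (linform n (lift l)) P"
proof -
  have "\<forall>P\<in>RP. \<exists>v y. v \<in> coord_vectors n \<and> sol n s A v \<and> P = pclass n v \<and> good n s (lift A) (lift v) (\<lambda>i. fmap (y i))"
    using rational_good by blast
  then obtain vv yy where vy: "\<And>P. P \<in> RP \<Longrightarrow> vv P \<in> coord_vectors n \<and> sol n s A (vv P) \<and> P = pclass n (vv P)
      \<and> good n s (lift A) (lift (vv P)) (\<lambda>i. fmap (yy P i))" by metis
  obtain l where l: "\<exists>i\<le>n. l i \<noteq> 0"
    "\<And>j. j < n \<Longrightarrow> (\<Sum>i\<le>n. l i * (yy (D ! j) i $ count_list (take j D) (D ! j))) = 0"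
    using underdetermined[of n "\<lambda>j i. yy (D ! j) i $ count_list (take j D) (D ! j)"] by blast
  have lf: "linform n (lift l) \<in> forms n 1" by (rule linform_forms)
  have nv: "nonvan (linform n (lift l))" by (rule nonvan_linform) (use l(1) in auto)
  have "count_list (map geometric_point D) P \<le> ordP (linform n (lift l)) P" if P: "P \<in> pts" for P
  proof (cases "P \<in> set (map geometric_point D)")
    case True
    then obtain P0 where P0: "P0 \<in> set D" "P = geometric_point P0" by auto
    have R: "P0 \<in> RP" using P0 D(1) by auto
    have "count_list (map geometric_point D') P = count_list D' P0" if "set D' \<subseteq> RP" for D'
      using that by (induction D') (auto simp: P0(2) geometric_point_eq_iff R)
    then have cnt: "count_list (map geometric_point D) P = count_list D P0" using D(1) .
    let ?y = "\<lambda>i. fmap (yy P0 i)"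
    have v: "lift (vv P0) \<in> coord_vectors n" "sol n s (lift A) (lift (vv P0))" and y: "good n s (lift A) (lift (vv P0)) ?y"
      and Pe: "P = pclass n (lift (vv P0))"
      using vy[OF R] lift_coord lift_sol[of n s A "vv P0"] geometric_point_pclass[of "vv P0" n] P0(2) by auto
    have nz: "fev ?y (linform n (lift l)) \<noteq> 0" by (rule nonvanD[OF nv lf goodD(1)[OF y]])
    have "fev ?y (linform n (lift l)) $ m = 0" if m: "m < count_list D P0" for m
    proof -
      obtain j where j: "j < length D" "D ! j = P0" "count_list (take j D) P0 = m"
        using count_list_take[OF m] by blast
      have "(\<Sum>i\<le>n. l i * (yy P0 i $ m)) = 0" using l(2)[of j] j D(2) by simp
      moreover have "fev ?y (linform n (lift l)) $ m = to_ac (\<Sum>i\<le>n. l i * (yy P0 i $ m))"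
        by (simp add: fps_sum_nth to_ac_sum)
      ultimately show ?thesis by simp
    qed
    then have "count_list D P0 \<le> subdegree (fev ?y (linform n (lift l)))"
      using nz by (intro subdegree_geI) auto
    then show ?thesis unfolding cnt using ordP_good[OF v y lf nv] Pe by simp
  next
    case False then show ?thesis by (simp add: count_notin)
  qed
  then show ?thesis using that l(1) by blast
qed

lemma inK_pow_coord:
  assumes "sol n s (lift A) v" "inK (v 0)" "inK (v 1)" "i \<in> {2..n}"
  shows "inK (v i ^ s)"
proof -
  have "(to_ac (A i) - to_ac (A 1)) * v 0 ^ s + (to_ac (A 0) - to_ac (A i)) * v 1 ^ s
      + (to_ac (A 1) - to_ac (A 0)) * v i ^ s = 0"
    using assms(1,4) by (auto simp: sol_def)
  then have "(to_ac (A 1) - to_ac (A 0)) * v i ^ s =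
     - ((to_ac (A i) - to_ac (A 1)) * v 0 ^ s + (to_ac (A 0) - to_ac (A i)) * v 1 ^ s)"
    by (simp only: eq_neg_iff_add_eq_0) (simp add: add.commute)
  then have "v i ^ s = - ((to_ac (A i) - to_ac (A 1)) * v 0 ^ s + (to_ac (A 0) - to_ac (A i)) * v 1 ^ s)
      / (to_ac (A 1) - to_ac (A 0))"
    using B10 by (metis nonzero_mult_div_cancel_left right_minus_eq)
  also have "inK \<dots>" using assms(2,3) by (intro inK_intros)
  finally show ?thesis .
qed

definition t2 :: "'k alg_closure \<Rightarrow> nat \<Rightarrow> 'k alg_closure" where
  "t2 z = (\<lambda>i. if i = 2 then z else 1)"

definition t3 :: "'k alg_closure \<Rightarrow> 'k alg_closure \<Rightarrow> nat \<Rightarrow> 'k alg_closure" where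
  "t3 z x = (\<lambda>i. if i = 2 then z else if i = 3 then x else 1)"

lemma T_2_3:
  assumes "n = 2" "s = 3"
  shows "T 1 n = {t2 1, t2 (to_ac z0), t2 (to_ac z0 ^ 2)}" "distinct [t2 1, t2 (to_ac z0), t2 (to_ac z0 ^ 2)]"
proof -
  let ?z = "to_ac z0"
  have z: "?z \<noteq> 1" "?z ^ 2 \<noteq> 1" "?z ^ 3 = 1"
    using zeta_power_eq_1[of 1] zeta_power_eq_1[of 2] zeta_power_eq_1[of 3] assms(2) by auto
  have zz: "?z \<noteq> ?z ^ 2" using z zeta_nz by (auto simp: power2_eq_square)
  have d: "t2 a = t2 b \<longleftrightarrow> a = b" for a b by (auto simp: t2_def fun_eq_iff)
  show D: "distinct [t2 1, t2 ?z, t2 (?z ^ 2)]" using z zz by (auto simp: d)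
  have mem: "t2 a \<in> T 1 n" if "a ^ 3 = 1" for a
    unfolding T_def using that assms by (auto simp: t2_def)
  have "(?z ^ 2) ^ 3 = 1" using z(3) by (metis mult.commute power_mult power_one)
  then have sub: "{t2 1, t2 ?z, t2 (?z ^ 2)} \<subseteq> T 1 n" using mem z(3) by simp
  have "card {t2 1, t2 ?z, t2 (?z ^ 2)} = 3" using D by simp
  moreover have "card (T 1 n) = 3" using assms unfolding card_T by simp
  ultimately show "T 1 n = {t2 1, t2 ?z, t2 (?z ^ 2)}"
    using card_subset_eq[OF finite_T sub] by simp
qed

lemma T_3_2:
  assumes "n = 3" "s = 2"
  shows "T 1 n = {t3 1 1, t3 1 (- 1), t3 (- 1) 1, t3 (- 1) (- 1)}"
    "distinct [t3 1 1, t3 1 (- 1), t3 (- 1) 1, t3 (- 1) (- 1)]"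
proof -
  have d: "t3 a b = t3 a' b' \<longleftrightarrow> a = a' \<and> b = b'" for a b a' b'
  proof
    assume e: "t3 a b = t3 a' b'"
    show "a = a' \<and> b = b'" using fun_cong[OF e, of 2] fun_cong[OF e, of 3] by (simp add: t3_def)
  qed simp
  have m1: "(- 1 :: 'k alg_closure) \<noteq> 1" "(1 :: 'k alg_closure) \<noteq> - 1" by simp_all
  show D: "distinct [t3 1 1, t3 1 (- 1), t3 (- 1) 1, t3 (- 1) (- 1)]" using m1 by (simp add: d)
  have mem: "t3 a b \<in> T 1 n" if "a ^ 2 = 1" "b ^ 2 = 1" for a b
    unfolding T_def using that assms by (auto simp: t3_def)
  have sub: "{t3 1 1, t3 1 (- 1), t3 (- 1) 1, t3 (- 1) (- 1)} \<subseteq> T 1 n" using mem by simp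
  have "card {t3 1 1, t3 1 (- 1), t3 (- 1) 1, t3 (- 1) (- 1)} = 4" using D m1 by simp
  moreover have "card (T 1 n) = 4" using assms unfolding card_T by simp
  ultimately show "T 1 n = {t3 1 1, t3 1 (- 1), t3 (- 1) 1, t3 (- 1) (- 1)}"
    using card_subset_eq[OF finite_T sub] by simp
qed

lemma ev_linform_2: "n = 2 \<Longrightarrow> ev v (linform n l) = l 0 * v 0 + l 1 * v 1 + l 2 * v 2"
proof -
  assume "n = 2"
  then have I: "{..n} = {0, 1, 2}" by auto
  show ?thesis unfolding coeff_hom.gev_linform[OF coeff_hom_id] I by simp
qed

lemma ev_linform_3: "n = 3 \<Longrightarrow> ev v (linform n l) = l 0 * v 0 + l 1 * v 1 + l 2 * v 2 + l 3 * v 3"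
proof -
  assume "n = 3"
  then have I: "{..n} = {0, 1, 2, 3}" by auto
  show ?thesis unfolding coeff_hom.gev_linform[OF coeff_hom_id] I by simp
qed

text \<open>Expanding the norm shows that it contains \<open>v 2\<close> and \<open>v 3\<close> only
  through their s-th powers, which lie in k by the equations: it is x^3 + y^3 in the cubic case and
  (x^2 + y^2 - z^2)^2 - 4 x^2 y^2 in the quartic one.\<close>

lemma norm_value_rational:
  assumes cs: "n = 2 \<and> s = 3 \<or> n = 3 \<and> s = 2"
    and v: "sol n s (lift A) v" "inK (v 0)" "inK (v 1)"
  shows "inK (\<Prod>t\<in>T 1 n. ev (\<lambda>i. t i * v i) (linform n (lift l)))"
  using cs
proof
  assume c: "n = 2 \<and> s = 3"
  let ?z = "to_ac z0"
  define x where "x = to_ac (l 0) * v 0 + to_ac (l 1) * v 1"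
  define y where "y = to_ac (l 2) * v 2"
  have e: "ev (\<lambda>i. t2 z i * v i) (linform n (lift l)) = x + z * y" for z
    using ev_linform_2[of "\<lambda>i. t2 z i * v i" "lift l"] c by (simp add: t2_def x_def y_def)
  have z: "?z \<noteq> 1" "?z ^ 3 = 1" using zeta_power_eq_1[of 1] zeta_power_eq_1[of 3] c by auto
  have "(?z - 1) * (1 + ?z + ?z ^ 2) = ?z ^ 3 - 1" by (simp add: algebra_simps power2_eq_square power3_eq_cube)
  then have z3: "1 + ?z + ?z ^ 2 = 0" using z by simp
  have "(\<Prod>t\<in>T 1 n. ev (\<lambda>i. t i * v i) (linform n (lift l))) = (x + y) * ((x + ?z * y) * (x + ?z ^ 2 * y))"
    using T_2_3(2)[OF conjunct1[OF c] conjunct2[OF c]]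
    unfolding T_2_3(1)[OF conjunct1[OF c] conjunct2[OF c]] by (simp add: e)
  also have "\<dots> = x ^ 3 + (1 + ?z + ?z ^ 2) * x ^ 2 * y + ?z * (1 + ?z + ?z ^ 2) * x * y ^ 2 + ?z ^ 3 * y ^ 3"
    by (simp add: algebra_simps power2_eq_square power3_eq_cube)
  also have "\<dots> = x ^ 3 + y ^ 3" unfolding z3 z(2) by simp
  also have "inK \<dots>"
  proof -
    have "inK (v 2 ^ 3)" using inK_pow_coord[OF v, of 2] c by simp
    moreover have "inK (x ^ 3 + to_ac (l 2) ^ 3 * w)" if "inK w" for w
      unfolding x_def using v that by (intro inK_intros)
    ultimately show ?thesis unfolding y_def power_mult_distrib by blast
  qed
  finally show ?thesis .
next
  assume c: "n = 3 \<and> s = 2"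
  define x where "x = to_ac (l 0) * v 0 + to_ac (l 1) * v 1"
  define y where "y = to_ac (l 2) * v 2"
  define z where "z = to_ac (l 3) * v 3"
  have e: "ev (\<lambda>i. t3 a b i * v i) (linform n (lift l)) = x + a * y + b * z" for a b
    using ev_linform_3[of "\<lambda>i. t3 a b i * v i" "lift l"] c by (simp add: t3_def x_def y_def z_def)
  have "(\<Prod>t\<in>T 1 n. ev (\<lambda>i. t i * v i) (linform n (lift l)))
      = (x + y + z) * ((x + y - z) * ((x - y + z) * (x - y - z)))"
    using T_3_2(2)[OF conjunct1[OF c] conjunct2[OF c]]
    unfolding T_3_2(1)[OF conjunct1[OF c] conjunct2[OF c]] by (simp add: e)
  also have "\<dots> = (x ^ 2 + y ^ 2 - z ^ 2) ^ 2 - 4 * x ^ 2 * y ^ 2"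
    by (simp add: algebra_simps power2_eq_square)
  also have "inK \<dots>"
  proof -
    have "inK (v 2 ^ 2)" "inK (v 3 ^ 2)" using inK_pow_coord[OF v, of 2] inK_pow_coord[OF v, of 3] c by simp_all
    moreover have "inK ((x ^ 2 + to_ac (l 2) ^ 2 * p - to_ac (l 3) ^ 2 * q) ^ 2 - 4 * x ^ 2 * (to_ac (l 2) ^ 2 * p))"
      if "inK p" "inK q" for p q
      unfolding x_def using v that by (intro inK_intros)
    ultimately show ?thesis unfolding y_def z_def power_mult_distrib by blast
  qed
  finally show ?thesis .
qed

text \<open>The group fixes \<open>Y_0\<close> and \<open>Y_1\<close>, one of which is nonzero at v,
  so the scalar between the conjugate of v and a k-rational representative of P is a quotient of
  elements of k.\<close>

lemma inK_transport:
  assumes v: "v \<in> coord_vectors n" "sol n s (lift A) v" "inK (v 0)" "inK (v 1)"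
    and t: "t \<in> T 1 n" "\<And>i. inK (t i)"
    and P: "P \<in> RP" "pclass n (\<lambda>i. t i * v i) = geometric_point P"
  shows "inK (v i)"
proof -
  obtain u where u: "u \<in> coord_vectors n" "geometric_point P = pclass n (lift u)" "lift u \<in> coord_vectors n" "sol n s (lift A) (lift u)"
    using RP_E[OF P(1)] by metis
  obtain c where c: "c \<noteq> 0" "(\<lambda>i. t i * v i) = (\<lambda>i. c * to_ac (u i))"
    using P(2) pclass_eq_iff[OF u(3) act_point(1)[OF v(1,2) t(1)]] unfolding u(2) by metis
  have t01: "t 0 = 1" "t 1 = 1" using T_low[OF t(1)] by auto
  obtain j where j: "j \<in> {0, 1}" "v j \<noteq> 0" using pt_nz[OF v(1,2)] by auto
  have "v j = c * to_ac (u j)" using fun_cong[OF c(2), of j] j(1) t01 by auto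
  then have "to_ac (u j) \<noteq> 0" "c = v j / to_ac (u j)" using j(2) by auto
  then have "inK c" using j(1) v(3,4) by (auto intro!: inK_divide)
  moreover have "v i = c * to_ac (u i) / t i" using fun_cong[OF c(2), of i] T_nz[OF t(1), of i] by (simp add: field_simps)
  ultimately show ?thesis using t(2)[of i] by (auto intro!: inK_intros)
qed

text \<open>The slope of the residual point Q is read off the norm of L, whose values at k-rational
  points of the line lie in k, as do the factors belonging to D. This yields a representative of Q
  with \<open>Y_0\<close> and \<open>Y_1\<close> in k. The other coordinates follow from the
  equation of the hyperplane; where it fails to determine them, a different conjugate of Q lies on
  the hyperplane too, hence belongs to D and is k-rational.\<close>

theorem rational_residual:
  assumes cs: "n = 2 \<and> s = 3 \<or> n = 3 \<and> s = 2"
    and D: "set D \<subseteq> RP" "length D = n"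
  shows "\<exists>R\<in>RP. \<exists>l. (\<exists>i\<le>n. l i \<noteq> 0) \<and>
    (\<forall>P\<in>pts. ordP (linform n (lift l)) P = count_list (map geometric_point D) P + (if P = geometric_point R then 1 else 0))"
proof -
  have cT: "card (T 1 n) = n + 1" using cs unfolding card_T by auto
  obtain l where l: "\<exists>i\<le>n. l i \<noteq> 0"
    "\<And>P. P \<in> pts \<Longrightarrow> count_list (map geometric_point D) P \<le> ordP (linform n (lift l)) P"
    using interpolating_form[OF D] by blast
  let ?L = "linform n (lift l)" and ?D = "map geometric_point D"
  have lf: "?L \<in> forms n 1" by (rule linform_forms)
  have nv: "nonvan ?L" by (rule nonvan_linform) (use l(1) in auto)
  have Dp: "set ?D \<subseteq> pts" "length ?D = n" using D geometric_point_pts by auto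
  obtain Q c N where Q: "Q \<in> pts" "\<And>P. P \<in> pts \<Longrightarrow> ordP ?L P = count_list ?D P + (if P = Q then 1 else 0)"
    "c \<noteq> 0" "\<And>y. sol n s cB y \<Longrightarrow> fev y N = (\<Prod>t\<in>T 1 n. fev (act t y) ?L)"
    "N = msingle 0 c * prod_list (map (\<lambda>P. lam (slope P)) ?D) * lam (slope Q)"
    using residual[OF cT lf nv Dp l(2)] by blast
  define a b where "a = fst (slope Q)" and "b = snd (slope Q)"
  have slopeK: "inK (fst (slope P)) \<and> inK (snd (slope P)) \<and> slope P \<in> P1N" if P: "P \<in> set ?D" for P
  proof -
    obtain P0 where P0: "P0 \<in> RP" "P = geometric_point P0" using P D(1) by auto
    obtain u where u: "lift u \<in> coord_vectors n" "P = pclass n (lift u)" using RP_E[OF P0(1)] P0(2) by metis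
    have "slope P = nsl (lift u)" unfolding u(2) by (rule slope_pclass[OF u(1)])
    then show ?thesis using nsl_P1N[of "lift u"] by (auto simp: nsl_def intro!: inK_divide)
  qed
  \<comment> \<open>The value of the norm at (x : 1), divided by the nonzero factors of D. It is
    affine in x, so two such x determine c b and c a.\<close>
  have val: "inK (c * (b * to_ac x - a))" if x: "to_ac x \<notin> (\<lambda>P. fst (slope P)) ` set ?D" for x
  proof -
    obtain v where v: "sol n s (lift A) v" "v 0 = to_ac x" "v 1 = 1" using point_over[OF order_refl] by blast
    let ?v = "\<lambda>i. fps_const (v i)"
    have "sol n s cB ?v" using sol_hom[OF fps_const_hom.coeff_hom_axioms v(1)] by simp
    then have "fev ?v N = (\<Prod>t\<in>T 1 n. fev (act t ?v) ?L)" by (rule Q(4))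
    also have "\<dots> = (\<Prod>t\<in>T 1 n. fps_const (ev (\<lambda>i. t i * v i) ?L))"
      by (rule prod.cong) (simp_all add: act_def fps_const_hom.c_gev)
    finally have "fps_const (ev v N) = fps_const (\<Prod>t\<in>T 1 n. ev (\<lambda>i. t i * v i) ?L)"
      unfolding fps_const_hom.c_gev fps_const_hom.c_prod .
    from arg_cong[OF this, of "\<lambda>f. f $ 0"]
    have "ev v N = (\<Prod>t\<in>T 1 n. ev (\<lambda>i. t i * v i) ?L)" by simp
    then have "inK (ev v N)" using norm_value_rational[OF cs v(1)] v(2,3) by simp
    moreover define q where "q = prod_list (map (\<lambda>P. snd (slope P) * to_ac x - fst (slope P)) ?D)"
    have "ev v N = (c * (b * to_ac x - a)) * q"
      unfolding Q(5) q_def a_def b_def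
      by (simp add: coeff_hom.gev_prod_list[OF coeff_hom_id] coeff_hom.gev_lam[OF coeff_hom_id] v(2,3)[simplified] o_def)
    moreover have "inK q" unfolding q_def using slopeK by (intro inK_prod_list inK_intros) auto
    moreover have "q \<noteq> 0"
    proof -
      have "snd (slope P) * to_ac x - fst (slope P) \<noteq> 0" if P: "P \<in> set ?D" for P
        using slopeK[OF P] x P by (auto simp: P1N_def image_iff)
      then show ?thesis unfolding q_def by (auto simp: prod_list_zero_iff)
    qed
    ultimately have "ev v N / q = c * (b * to_ac x - a)" "inK (ev v N)" "inK q" by simp_all
    then show ?thesis using inK_divide[of "ev v N" q] by metis
  qed
  have fin: "finite {x. to_ac x \<in> (\<lambda>P. fst (slope P)) ` set ?D}"
    using finite_vimageI[OF _ inj_to_ac, of "(\<lambda>P. fst (slope P)) ` set ?D"] by (simp add: vimage_def)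
  obtain x1 where x1: "to_ac x1 \<notin> (\<lambda>P. fst (slope P)) ` set ?D"
    using ex_new_if_finite[OF infinite_UNIV_char_0 fin] by blast
  obtain x2 where x2: "to_ac x2 \<notin> (\<lambda>P. fst (slope P)) ` set ?D" "x2 \<noteq> x1"
    using ex_new_if_finite[OF infinite_UNIV_char_0 finite.insertI[OF fin, of x1]] by blast
  have "inK ((c * (b * to_ac x1 - a) - c * (b * to_ac x2 - a)) / (to_ac x1 - to_ac x2))"
    by (intro inK_intros val x1 x2)
  moreover have "(c * (b * to_ac x1 - a) - c * (b * to_ac x2 - a)) / (to_ac x1 - to_ac x2) = c * b"
  proof -
    have "c * (b * to_ac x1 - a) - c * (b * to_ac x2 - a) = c * b * (to_ac x1 - to_ac x2)" by (simp add: algebra_simps)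
    moreover have "to_ac x1 - to_ac x2 \<noteq> 0" using x2(2) by simp
    ultimately show ?thesis by simp
  qed
  ultimately have cb: "inK (c * b)" by simp
  have "inK (c * b * to_ac x1 - c * (b * to_ac x1 - a))" by (intro inK_intros val x1 cb)
  then have ca: "inK (c * a)" by (simp add: algebra_simps)
  obtain w where w: "w \<in> coord_vectors n" "sol n s (lift A) w" "(w 0, w 1) \<in> P1N" "Q = pclass n w"
    using normal_point[OF Q(1)] .
  have ab: "slope Q = (w 0, w 1)" unfolding w(4) slope_pclass[OF w(1)] by (rule nsl_normal[OF w(3)])
  define v where "v = (\<lambda>i. c * w i)"
  have v: "v \<in> coord_vectors n" "Q = pclass n v" using pclass_scale[OF w(1) Q(3)] w(4) by (auto simp: v_def)
  have vs: "sol n s (lift A) v" using Q(1) zero_locus_crv_iff[OF v(1)] v(2) by blast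
  have v01: "inK (v 0)" "inK (v 1)" using ca cb ab by (auto simp: v_def a_def b_def)
  have "1 \<le> ordP ?L Q" using Q(2)[OF Q(1)] by simp
  then have Lv: "ev v ?L = 0" using ord_pos_iff[OF lf nv v(1) vs] v(2) by simp
  \<comment> \<open>A conjugate of Q that differs from Q and lies on the hyperplane must occur in D,
    so it is k-rational, and \<open>inK_transport\<close> carries this back to v.\<close>
  have move: "inK (v i)" if t: "t \<in> T 1 n" "\<And>i. inK (t i)" "ev (\<lambda>i. t i * v i) ?L = 0" "\<exists>i. t i * v i \<noteq> v i" for t i
  proof -
    note tp = act_point[OF v(1) vs t(1)]
    have ne: "pclass n (\<lambda>i. t i * v i) \<noteq> Q" using T_fix[OF v(1) vs t(1)] t(4) v(2) by auto
    have "pclass n (\<lambda>i. t i * v i) \<in> pts" using zero_locus_crv_iff tp by blast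
    from Q(2)[OF this] have "1 \<le> count_list ?D (pclass n (\<lambda>i. t i * v i))"
      using ord_pos_iff[OF lf nv tp] t(3) ne by simp
    then have "pclass n (\<lambda>i. t i * v i) \<in> set ?D" using count_notin by fastforce
    then obtain P0 where "P0 \<in> RP" "pclass n (\<lambda>i. t i * v i) = geometric_point P0" using D(1) by auto
    then show ?thesis using inK_transport[OF v(1) vs v01 t(1,2)] by blast
  qed
  define x where "x = to_ac (l 0) * v 0 + to_ac (l 1) * v 1"
  have xK: "inK x" unfolding x_def by (intro inK_intros v01)
  have high: "v i = 0" if "i > n" for i using v(1) that by (auto simp: coord_vectors_def)
  have allK: "inK (v i)" for i
    using cs
  proof
    assume c: "n = 2 \<and> s = 3"
    have e: "ev (\<lambda>i. t2 z i * v i) ?L = x + z * (to_ac (l 2) * v 2)" for z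
      using ev_linform_2[of "\<lambda>i. t2 z i * v i" "lift l"] c by (simp add: t2_def x_def)
    have L0: "x + to_ac (l 2) * v 2 = 0" using Lv ev_linform_2[of v "lift l"] c by (simp add: x_def)
    have v2: "inK (v 2)"
    proof (cases "l 2 = 0")
      case False
      then have "v 2 = - x / to_ac (l 2)" using L0 by (simp add: field_simps eq_neg_iff_add_eq_0 add.commute)
      then show ?thesis using xK by (auto intro!: inK_intros)
    next
      case l2: True
      show ?thesis
      proof (cases "v 2 = 0")
        case False
        have "to_ac z0 \<noteq> 1" using zeta_power_eq_1[of 1] c by auto
        then have "\<exists>i. t2 (to_ac z0) i * v i \<noteq> v i" using False by (intro exI[of _ 2]) (simp add: t2_def)
        moreover have "ev (\<lambda>i. t2 (to_ac z0) i * v i) ?L = 0" using L0 l2 unfolding e by simp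
        moreover have "t2 (to_ac z0) \<in> T 1 n" using T_2_3 c by simp
        moreover have "inK (t2 (to_ac z0) i)" for i by (simp add: t2_def)
        ultimately show ?thesis using move by blast
      qed simp
    qed
    consider "i = 0" | "i = 1" | "i = 2" | "i > n" using c by linarith
    then show ?thesis using v2 v01 high by cases auto
  next
    assume c: "n = 3 \<and> s = 2"
    define y where "y = to_ac (l 2) * v 2"
    define z where "z = to_ac (l 3) * v 3"
    have e: "ev (\<lambda>i. t3 p q i * v i) ?L = x + p * y + q * z" for p q
      using ev_linform_3[of "\<lambda>i. t3 p q i * v i" "lift l"] c by (simp add: t3_def x_def y_def z_def)
    have L0: "x + y + z = 0" using Lv ev_linform_3[of v "lift l"] c by (simp add: x_def y_def z_def)
    have flip: "inK (v i)" if pq: "p \<in> {1, - 1}" "q \<in> {1, - 1}" "x + p * y + q * z = 0" "p * v 2 \<noteq> v 2 \<or> q * v 3 \<noteq> v 3" for p q i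
    proof (rule move)
      show "t3 p q \<in> T 1 n" using T_3_2 c pq by auto
      show "inK (t3 p q i)" for i using pq inK_minus[OF inK_1] by (auto simp: t3_def)
      show "ev (\<lambda>i. t3 p q i * v i) ?L = 0" using pq(3) e by simp
      show "\<exists>i. t3 p q i * v i \<noteq> v i"
        using pq(4) by (elim disjE) (rule exI[of _ 2], simp add: t3_def, rule exI[of _ 3], simp add: t3_def)
    qed
    have m: "- u = u \<longleftrightarrow> u = 0" for u :: "'k alg_closure"
    proof
      assume "- u = u"
      then have "2 * u = 0" unfolding mult_2 by (simp only: neg_eq_iff_add_eq_0)
      then show "u = 0" by simp
    qed simp
    show ?thesis
    proof (cases "y = 0 \<and> v 2 \<noteq> 0")
      case True then show ?thesis using flip[of "- 1" 1] L0 by (simp add: m)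
    next
      case y0: False
      show ?thesis
      proof (cases "z = 0 \<and> v 3 \<noteq> 0")
        case True then show ?thesis using flip[of 1 "- 1"] L0 by (simp add: m)
      next
        case z0: False
        show ?thesis
        proof (cases "x = 0")
          case True
          have "v 2 \<noteq> 0 \<or> v 3 \<noteq> 0" using pt_zero_unique[OF v(1) vs, of 2 3] c by auto
          moreover have "x + - 1 * y + - 1 * z = 0" using L0 True by (simp add: eq_neg_iff_add_eq_0[symmetric])
          ultimately show ?thesis using flip[of "- 1" "- 1"] by (simp add: m)
        next
          case False
          \<comment> \<open>The sum y + z is known from the hyperplane and y^2 - z^2 from the
            equations of the curve. As x is nonzero, their quotient y - z lies in k, hence so do y
            and z.\<close>
          have yz: "y + z = - x" using L0 by (simp add: eq_neg_iff_add_eq_0 add_ac)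
          have "inK (v 2 ^ 2)" "inK (v 3 ^ 2)" using inK_pow_coord[OF vs v01, of 2] inK_pow_coord[OF vs v01, of 3] c by simp_all
          moreover have "inK (to_ac (l 2) ^ 2 * p - to_ac (l 3) ^ 2 * q)" if "inK p" "inK q" for p q
            using that by (intro inK_intros)
          ultimately have sq: "inK (y ^ 2 - z ^ 2)" unfolding y_def z_def power_mult_distrib by blast
          have "y ^ 2 - z ^ 2 = (y - z) * (y + z)" by (simp add: algebra_simps power2_eq_square)
          then have "y - z = (y ^ 2 - z ^ 2) / - x" using False yz by simp
          moreover have "inK ((y ^ 2 - z ^ 2) / - x)" by (intro inK_divide inK_minus sq xK)
          ultimately have d: "inK (y - z)" by metis
          have "y = ((y - z) - x) / 2" using yz by (simp add: field_simps eq_neg_iff_add_eq_0)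
          moreover have "inK (((y - z) - x) / 2)" by (intro inK_divide inK_diff[OF d xK] inK_numeral)
          ultimately have yK: "inK y" by metis
          have "z = - x - y" using yz by (simp add: algebra_simps)
          moreover have "inK (- x - y)" by (intro inK_diff inK_minus yK xK)
          ultimately have zK: "inK z" by metis
          have v2: "inK (v 2)"
          proof (cases "l 2 = 0")
            case True then have "v 2 = 0" using y0 by (simp add: y_def)
            then show ?thesis by simp
          next
            case False
            then have "v 2 = y / to_ac (l 2)" by (simp add: y_def)
            then show ?thesis using yK by (auto intro!: inK_intros)
          qed
          have v3: "inK (v 3)"
          proof (cases "l 3 = 0")
            case True then have "v 3 = 0" using z0 by (simp add: z_def)
            then show ?thesis by simp
          next
            case False
            then have "v 3 = z / to_ac (l 3)" by (simp add: z_def)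
            then show ?thesis using zK by (auto intro!: inK_intros)
          qed
          consider "i = 0" | "i = 1" | "i = 2" | "i = 3" | "i > n" using c by linarith
          then show ?thesis using v2 v3 v01 high by cases auto
        qed
      qed
    qed
  qed
  define u where "u = (\<lambda>i. of_ac (v i))"
  have lu: "lift u = v" using allK by (auto simp: u_def fun_eq_iff to_ac_of_ac)
  have "v i \<noteq> 0 \<longleftrightarrow> u i \<noteq> 0" for i using fun_cong[OF lu, of i] by auto
  then have uc: "u \<in> coord_vectors n" using v(1) by (auto simp: coord_vectors_def)
  have us: "sol n s A u" using vs lift_sol[of n s A u] lu by simp
  have "Q = geometric_point (pclass n u)" using geometric_point_pclass[OF uc] lu v(2) by simp
  then show ?thesis using RP_I[OF uc us] l(1) Q(2) by blast
qed

end

section \<open>Tangents and inflection\<close>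

context curve
begin

lemma power_coeff_1: "(f ^ s) $ 1 = of_nat s * (f $ 0) ^ (s - 1) * (f $ 1 :: 'a)"
proof -
  have "fps_deriv (f ^ s) $ 0 = (f ^ s) $ 1" by simp
  moreover have "fps_deriv (f ^ s) $ 0 = of_nat s * (f $ 0) ^ (s - 1) * f $ 1"
    by (simp add: fps_deriv_power fps_power_zeroth)
  ultimately show ?thesis by simp
qed

lemma arc_nz: "arc n s B y \<Longrightarrow> y 0 \<noteq> 0"
proof
  assume "arc n s B y" "y 0 = 0"
  moreover from this(1) have "fps_const 1 * y 0 \<noteq> fps_const 0 * y 1"
    unfolding arc_def by (metis prod.inject zero_neq_one)
  ultimately show False by simp
qed

text \<open>The powers \<open>y i ^ s\<close> are an affine function of \<open>B i\<close>, so every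
  vector m orthogonal to the all-ones vector and to B annihilates them.\<close>

lemma sol_relation:
  assumes y: "sol n s cB y" and m: "(\<Sum>i\<le>n. m i) = 0" "(\<Sum>i\<le>n. m i * B i) = 0"
  shows "(\<Sum>i\<le>n. fps_const (m i) * y i ^ s) = 0"
proof -
  have r: "fps_const (B 1 - B 0) * y i ^ s = fps_const (B 1 - B i) * y 0 ^ s + fps_const (B i - B 0) * y 1 ^ s"
    if "i \<le> n" for i
  proof (cases "i \<in> {2..n}")
    case True
    then have e: "(fps_const (B i) - fps_const (B 1)) * y 0 ^ s + (fps_const (B 0) - fps_const (B i)) * y 1 ^ s
      + (fps_const (B 1) - fps_const (B 0)) * y i ^ s = 0"
      using y by (simp add: sol_def)
    have "(b - c) * r = (b - a) * p + (a - c) * q" if "(a - b) * p + (c - a) * q + (b - c) * r = 0"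
      for a b c p q r :: "'a fps"
    proof -
      have "(b - c) * r = - ((a - b) * p + (c - a) * q)" unfolding eq_neg_iff_add_eq_0 using that by (simp only: add_ac)
      then show ?thesis by (simp add: algebra_simps)
    qed
    from this[OF e] show ?thesis by simp
  next
    case False
    then have "i = 0 \<or> i = 1" using that by auto
    then show ?thesis by (auto simp del: fps_const_sub)
  qed
  have "fps_const (B 1 - B 0) * (\<Sum>i\<le>n. fps_const (m i) * y i ^ s)
      = (\<Sum>i\<le>n. fps_const (m i) * (fps_const (B 1 - B 0) * y i ^ s))"
    by (simp only: sum_distrib_left mult_ac)
  also have "\<dots> = (\<Sum>i\<le>n. fps_const (m i * (B 1 - B i)) * y 0 ^ s + fps_const (m i * (B i - B 0)) * y 1 ^ s)"
    by (intro sum.cong refl) (simp only: r atMost_iff distrib_left fps_const_mult[symmetric] mult.assoc)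
  also have "\<dots> = fps_const (\<Sum>i\<le>n. m i * (B 1 - B i)) * y 0 ^ s + fps_const (\<Sum>i\<le>n. m i * (B i - B 0)) * y 1 ^ s"
    by (simp add: sum.distrib sum_distrib_right fps_const_hom.c_sum)
  also have "\<dots> = 0"
  proof -
    have "(\<Sum>i\<le>n. m i * (B 1 - B i)) = 0" "(\<Sum>i\<le>n. m i * (B i - B 0)) = 0"
      using m by (simp_all add: right_diff_distrib sum_subtractf flip: sum_distrib_right)
    then show ?thesis by (simp only:) simp
  qed
  finally have "fps_const (B 1 - B 0) * (\<Sum>i\<le>n. fps_const (m i) * y i ^ s) = 0" by simp
  then show ?thesis using B10 by (simp del: fps_const_sub)
qed

text \<open>The relation in s-th powers holds identically along the arc. Its constant term says that
  the hyperplane passes through v, and its derivative, s times the sum of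
  \<open>m i * v i ^ (s - 1) * y i $ 1\<close>, that it is tangent there.\<close>

lemma tangent_ord:
  assumes v: "v \<in> coord_vectors n" "sol n s B v"
    and m: "(\<Sum>i\<le>n. m i) = 0" "(\<Sum>i\<le>n. m i * B i) = 0"
    and l: "\<And>i. i \<le> n \<Longrightarrow> l i = m i * v i ^ (s - 1)" "\<exists>i\<le>n. l i \<noteq> 0"
  shows "2 \<le> ordP (linform n l) (pclass n v)"
proof -
  obtain y where y: "good n s B v y" using good_at_point[OF v] by blast
  note yv = goodD(3)[OF y]
  have L: "fev y (linform n l) \<noteq> 0" using nonvanD[OF nonvan_linform[OF l(2)] linform_forms goodD(1)[OF y]] .
  have R: "(\<Sum>i\<le>n. fps_const (m i) * y i ^ s) = 0" using sol_relation[OF goodD(2)[OF y] m] .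
  have "(\<Sum>i\<le>n. m i * v i ^ s) = (\<Sum>i\<le>n. fps_const (m i) * y i ^ s) $ 0"
    by (simp add: fps_sum_nth fps_power_zeroth yv)
  then have "(\<Sum>i\<le>n. m i * v i ^ s) = 0" by (simp add: R)
  moreover have "fev y (linform n l) $ 0 = (\<Sum>i\<le>n. m i * v i ^ s)"
    using s0 by (simp add: fps_sum_nth yv l(1) mult.assoc power_eq_if[of _ s] mult.commute[of "v _"])
  ultimately have c0: "fev y (linform n l) $ 0 = 0" by simp
  have "of_nat s * (\<Sum>i\<le>n. l i * y i $ 1) = (\<Sum>i\<le>n. fps_const (m i) * y i ^ s) $ 1"
    by (simp only: fps_sum_nth fps_mult_left_const_nth power_coeff_1 sum_distrib_left)
      (intro sum.cong refl, simp add: l(1) yv)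
  then have "(\<Sum>i\<le>n. l i * y i $ 1) = 0" using s0 by (simp add: R)
  then have c1: "fev y (linform n l) $ 1 = 0" by (simp add: fps_sum_nth)
  have "fev y (linform n l) $ i = 0" if "i < 2" for i
    using that c0 c1 by (cases i) (auto simp: less_Suc_eq numeral_2_eq_2)
  then have "2 \<le> subdegree (fev y (linform n l))" using L by (intro subdegree_geI) auto
  then show ?thesis using ordP_good[OF v y linform_forms nonvan_linform[OF l(2)]] by simp
qed

text \<open>In the coordinates z_i = \<open>Y_i\<close> / \<open>\<tau> i\<close> the equations
  become z_i^s - z_1^s = const \<open>Y_0^s\<close>, and every z_i is 1 at the point \<tau>. Contact
  at \<tau> can then be measured in powers of \<open>Y_0\<close>.\<close>

lemma scaled_relation:
  assumes y: "sol n s cB y" and B: "\<And>i. i \<le> n \<Longrightarrow> B i = \<mu> * \<tau> i ^ s" and \<tau>: "\<tau> 0 = 0"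
    and i: "1 \<le> i" "i \<le> n" "\<tau> i \<noteq> 0" "\<tau> 1 \<noteq> 0"
  shows "(fps_const (1 / \<tau> i) * y i) ^ s - (fps_const (1 / \<tau> 1) * y 1) ^ s
    = fps_const (1 / \<tau> i ^ s - 1 / \<tau> 1 ^ s) * y 0 ^ s"
proof -
  have m0: "\<mu> \<noteq> 0" using B10 B[of 0] B[of 1] n2 by auto
  show ?thesis
  proof (cases "i = 1")
    case False
    then have e: "(fps_const (B i) - fps_const (B 1)) * y 0 ^ s + (fps_const (B 0) - fps_const (B i)) * y 1 ^ s
      + (fps_const (B 1) - fps_const (B 0)) * y i ^ s = 0"
      using y i by (simp add: sol_def)
    define a where "a = fps_const (1 / (\<mu> * \<tau> i ^ s * \<tau> 1 ^ s))"
    have a1: "a * (fps_const (B i) - fps_const (B 1)) = fps_const (1 / \<tau> 1 ^ s - 1 / \<tau> i ^ s)"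
      and a2: "a * (fps_const (B 0) - fps_const (B i)) = fps_const (- 1 / \<tau> 1 ^ s)"
      and a3: "a * (fps_const (B 1) - fps_const (B 0)) = fps_const (1 / \<tau> i ^ s)"
      using i n2 m0 s0 by (simp_all add: a_def B \<tau> field_simps)
    have "a * (fps_const (B i) - fps_const (B 1)) * y 0 ^ s + a * (fps_const (B 0) - fps_const (B i)) * y 1 ^ s
      + a * (fps_const (B 1) - fps_const (B 0)) * y i ^ s = 0"
      using arg_cong[OF e, of "\<lambda>x. a * x"] by (simp only: distrib_left mult.assoc mult_zero_right)
    then have e': "fps_const (1 / \<tau> 1 ^ s - 1 / \<tau> i ^ s) * y 0 ^ s + fps_const (- 1 / \<tau> 1 ^ s) * y 1 ^ s
      + fps_const (1 / \<tau> i ^ s) * y i ^ s = 0" by (simp only: a1 a2 a3)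
    have pw: "(fps_const (1 / \<tau> j) * y j) ^ s = fps_const (1 / \<tau> j ^ s) * y j ^ s" for j
      unfolding power_mult_distrib fps_const_power power_one_over ..
    define a' c' where ac: "a' = fps_const (1 / \<tau> 1 ^ s)" "c' = fps_const (1 / \<tau> i ^ s)"
    have s: "fps_const (- 1 / \<tau> 1 ^ s) = - a'" "fps_const (1 / \<tau> 1 ^ s - 1 / \<tau> i ^ s) = a' - c'"
      "fps_const (1 / \<tau> i ^ s - 1 / \<tau> 1 ^ s) = c' - a'" by (simp_all add: ac)
    have "c' * y i ^ s - a' * y 1 ^ s - (c' - a') * y 0 ^ s = (a' - c') * y 0 ^ s + - a' * y 1 ^ s + c' * y i ^ s"
      by (simp add: algebra_simps)
    also have "\<dots> = 0" using e' unfolding s ac(2)[symmetric] .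
    finally show ?thesis unfolding pw s ac[symmetric] by simp
  qed simp
qed

text \<open>The flex line is z_2 = z_1. The difference z_2^3 - z_1^3 is a nonzero multiple of
  \<open>Y_0^3\<close>, and its cofactor over z_2 - z_1 is a unit at \<tau>, so the contact is at
  least 3.\<close>

lemma hyperflex_cubic:
  assumes c: "n = 2" "s = 3" and B: "\<And>i. i \<le> n \<Longrightarrow> B i = \<mu> * \<tau> i ^ s"
    and \<tau>: "\<tau> \<in> coord_vectors n" "\<tau> 0 = 0" "\<tau> 1 \<noteq> 0" "\<tau> 2 \<noteq> 0" "sol n s B \<tau>"
  shows "\<exists>l. (\<exists>i\<le>n. l i \<noteq> 0) \<and> n + 1 \<le> ordP (linform n l) (pclass n \<tau>)"
proof -
  define l where "l i = (if i = 1 then - 1 / \<tau> 1 else if i = 2 then 1 / \<tau> 2 else 0)" for i :: nat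
  have l: "\<exists>i\<le>n. l i \<noteq> 0" using \<tau> n2 by (intro exI[of _ 2]) (simp add: l_def)
  obtain y where y: "good n s B \<tau> y" using good_at_point[OF \<tau>(1,5)] by blast
  note yv = goodD(3)[OF y]
  let ?z = "\<lambda>i. fps_const (1 / \<tau> i) * y i"
  have L: "fev y (linform n l) \<noteq> 0" using nonvanD[OF nonvan_linform[OF l] linform_forms goodD(1)[OF y]] .
  have y0: "y 0 \<noteq> 0" using arc_nz[OF goodD(1)[OF y]] .
  then have e: "1 \<le> subdegree (y 0)" using yv[of 0] \<tau>(2) by (intro subdegree_geI) simp_all
  have rel: "?z 2 ^ s - ?z 1 ^ s = fps_const (1 / \<tau> 2 ^ s - 1 / \<tau> 1 ^ s) * y 0 ^ s"
    using scaled_relation[OF goodD(2)[OF y] B \<tau>(2), of 2] \<tau> n2 by simp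
  have z0: "?z 2 $ 0 = ?z 1 $ 0" "?z 2 $ 0 \<noteq> 0" using yv \<tau> n2 by simp_all
  obtain h where h: "?z 2 ^ s - ?z 1 ^ s = (?z 2 - ?z 1) * h" "h $ 0 \<noteq> 0"
    using fps_power_diff_factor[OF z0 s0] by blast
  have Lz: "fev y (linform n l) = ?z 2 - ?z 1"
    using c by (simp add: l_def numeral_2_eq_2 fps_const_neg[symmetric] del: fps_const_neg)
  have b: "B 2 \<noteq> B 1" using inj_B n2 by (auto dest: inj_onD)
  have k: "1 / \<tau> 2 ^ s - 1 / \<tau> 1 ^ s \<noteq> 0"
  proof
    assume "1 / \<tau> 2 ^ s - 1 / \<tau> 1 ^ s = 0"
    then have "\<tau> 1 ^ s = \<tau> 2 ^ s" by simp
    then show False using b B[of 1] B[of 2] n2 by simp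
  qed
  have h0: "h \<noteq> 0" "subdegree h = 0" using h(2) by auto
  have "subdegree (fev y (linform n l)) + subdegree h = subdegree (fps_const (1 / \<tau> 2 ^ s - 1 / \<tau> 1 ^ s) * y 0 ^ s)"
    using L h0(1) h(1) rel unfolding Lz by (metis subdegree_mult)
  also have "\<dots> = s * subdegree (y 0)" using k by (simp add: subdegree_const_mult subdegree_power)
  finally have "n + 1 \<le> subdegree (fev y (linform n l))" using e h0 c by simp
  then show ?thesis using l ordP_good[OF \<tau>(1,5) y linform_forms nonvan_linform[OF l]] by metis
qed

text \<open>After multiplication by \<open>Y_0^2\<close> the coefficients \<open>e j - e i\<close>
  turn into differences of the squares of p, q, r, and the linear form into the Vandermonde
  determinant of p, q, r up to sign. Multiplied further by the local unit (p + q)(p + r)(q + r) it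
  is the product of the differences of squares, a nonzero multiple of \<open>Y_0^6\<close>. So the
  contact is at least 4.\<close>

lemma hyperflex_quartic:
  assumes c: "n = 3" "s = 2" and B: "\<And>i. i \<le> n \<Longrightarrow> B i = \<mu> * \<tau> i ^ s"
    and \<tau>: "\<tau> \<in> coord_vectors n" "\<tau> 0 = 0" "\<tau> 1 \<noteq> 0" "\<tau> 2 \<noteq> 0" "\<tau> 3 \<noteq> 0" "sol n s B \<tau>"
  shows "\<exists>l. (\<exists>i\<le>n. l i \<noteq> 0) \<and> n + 1 \<le> ordP (linform n l) (pclass n \<tau>)"
proof -
  define e where "e i = 1 / \<tau> i ^ s" for i
  define l where "l i = (if i = 1 then (e 2 - e 3) / \<tau> 1 else if i = 2 then (e 3 - e 1) / \<tau> 2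
    else if i = 3 then (e 1 - e 2) / \<tau> 3 else 0)" for i :: nat
  have ne: "e i - e j \<noteq> 0" if "i \<in> {1, 2, 3}" "j \<in> {1, 2, 3}" "i \<noteq> j" for i j
  proof
    assume "e i - e j = 0"
    then have "\<tau> i ^ s = \<tau> j ^ s" by (simp add: e_def)
    then have "B i = B j" using B[of i] B[of j] that c by auto
    then show False using inj_B that c by (auto dest: inj_onD)
  qed
  have l: "\<exists>i\<le>n. l i \<noteq> 0" using \<tau> n2 ne[of 3 1] by (intro exI[of _ 2]) (simp add: l_def)
  obtain y where y: "good n s B \<tau> y" using good_at_point[OF \<tau>(1,6)] by blast
  note yv = goodD(3)[OF y]
  let ?z = "\<lambda>i. fps_const (1 / \<tau> i) * y i"
  have L: "fev y (linform n l) \<noteq> 0" using nonvanD[OF nonvan_linform[OF l] linform_forms goodD(1)[OF y]] .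
  have y0: "y 0 \<noteq> 0" using arc_nz[OF goodD(1)[OF y]] .
  then have e1: "1 \<le> subdegree (y 0)" using yv[of 0] \<tau>(2) by (intro subdegree_geI) simp_all
  have rel1: "?z i ^ 2 - ?z 1 ^ 2 = fps_const (e i - e 1) * y 0 ^ 2" if "i \<in> {2, 3}" for i
    using scaled_relation[OF goodD(2)[OF y] B \<tau>(2), of i] \<tau> that c unfolding e_def by auto
  define p q r where pqr: "p = ?z 1" "q = ?z 2" "r = ?z 3"
  have k: "q ^ 2 - p ^ 2 = fps_const (e 2 - e 1) * y 0 ^ 2" "r ^ 2 - p ^ 2 = fps_const (e 3 - e 1) * y 0 ^ 2"
    using rel1[of 2] rel1[of 3] by (simp_all add: pqr)
  have k3: "q ^ 2 - r ^ 2 = fps_const (e 2 - e 3) * y 0 ^ 2"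
  proof -
    have "q ^ 2 - r ^ 2 = (q ^ 2 - p ^ 2) - (r ^ 2 - p ^ 2)" by simp
    also have "\<dots> = (fps_const (e 2 - e 1) - fps_const (e 3 - e 1)) * y 0 ^ 2" unfolding k by (simp only: left_diff_distrib)
    finally show ?thesis by simp
  qed
  have Lz: "fev y (linform n l) = fps_const (e 2 - e 3) * p + fps_const (e 3 - e 1) * q - fps_const (e 2 - e 1) * r"
  proof -
    have m: "fps_const (l 1) * y 1 = fps_const (e 2 - e 3) * p" "fps_const (l 2) * y 2 = fps_const (e 3 - e 1) * q"
      "fps_const (l 3) * y 3 = fps_const (e 1 - e 2) * r"
      unfolding l_def pqr mult.assoc[symmetric] fps_const_mult by simp_all
    have "{..n} = {0, 1, 2, 3}" using c by auto
    then have "fev y (linform n l) = fps_const (l 1) * y 1 + fps_const (l 2) * y 2 + fps_const (l 3) * y 3"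
      by (simp add: l_def)
    also have "\<dots> = fps_const (e 2 - e 3) * p + fps_const (e 3 - e 1) * q + fps_const (e 1 - e 2) * r"
      by (simp only: m)
    also have "fps_const (e 1 - e 2) * r = - (fps_const (e 2 - e 1) * r)"
      by (simp only: mult_minus_left[symmetric] fps_const_neg minus_diff_eq)
    finally show ?thesis by (simp only: add_uminus_conv_diff)
  qed
  define u where "u = (p + q) * (p + r) * (q + r)"
  define w where "w = fps_const ((e 2 - e 1) * (e 3 - e 1) * (e 3 - e 2))"
  have u0: "u $ 0 \<noteq> 0" using yv \<tau> c by (simp add: u_def pqr)
  have k4: "r ^ 2 - q ^ 2 = fps_const (e 3 - e 2) * y 0 ^ 2"
    using k3 by (simp only: minus_diff_eq[of "q ^ 2" "r ^ 2", symmetric] mult_minus_left[symmetric] fps_const_neg minus_diff_eq)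
  have "y 0 ^ 2 * (fev y (linform n l) * u) = y 0 ^ 2 * (w * y 0 ^ 4)"
  proof -
    have w: "w = fps_const (e 2 - e 1) * fps_const (e 3 - e 1) * fps_const (e 3 - e 2)" by (simp add: w_def)
    have g1: "z * ((a * p + b * q - c * r) * u) = ((a * z) * p + (b * z) * q - (c * z) * r) * u" for a b c z :: "'a fps"
      by (simp add: algebra_simps)
    have g2: "(a * z ^ 2) * (b * z ^ 2) * (c * z ^ 2) = z ^ 2 * (a * b * c * z ^ 4)" for a b c z :: "'a fps"
      by (simp add: power2_eq_square power4_eq_xxxx mult_ac)
    have "y 0 ^ 2 * (fev y (linform n l) * u) = ((q ^ 2 - r ^ 2) * p + (r ^ 2 - p ^ 2) * q - (q ^ 2 - p ^ 2) * r) * u"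
      unfolding Lz g1 k k3 ..
    also have "\<dots> = (q ^ 2 - p ^ 2) * (r ^ 2 - p ^ 2) * (r ^ 2 - q ^ 2)"
      unfolding u_def by (simp add: algebra_simps power2_eq_square)
    also have "\<dots> = y 0 ^ 2 * (w * y 0 ^ 4)" unfolding k k4 w g2 ..
    finally show ?thesis .
  qed
  then have E: "fev y (linform n l) * u = w * y 0 ^ 4" using y0 by simp
  have un: "u \<noteq> 0" "subdegree u = 0" using u0 by auto
  have "subdegree (fev y (linform n l)) + subdegree u = subdegree (w * y 0 ^ 4)"
    using E L un(1) by (metis subdegree_mult)
  also have "\<dots> = 4 * subdegree (y 0)"
    unfolding w_def using ne[of 2 1] ne[of 3 1] ne[of 3 2] by (subst subdegree_const_mult) (simp_all add: subdegree_power)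
  finally have "n + 1 \<le> subdegree (fev y (linform n l))" using e1 un c by simp
  then show ?thesis using l ordP_good[OF \<tau>(1,6) y linform_forms nonvan_linform[OF l]] by metis
qed

end

section \<open>The group of rational points\<close>

context kcurve
begin

text \<open>Principal divisors, in terms of \<open>nonvan\<close> and \<open>ordP\<close>; the
  values of f are constrained only at the points of the curve.\<close>

definition prin :: "('k alg_closure ppoint \<Rightarrow> int) \<Rightarrow> bool" where
  "prin f \<longleftrightarrow> (\<exists>d. \<exists>F\<in>forms n d. \<exists>G\<in>forms n d. nonvan F \<and> nonvan G \<and>
    (\<forall>P\<in>pts. f P = int (ordP F P) - int (ordP G P)))"

lemma lin_equiv_iff: "lin_equiv n (crv n s A) D D' \<longleftrightarrow> prin (\<lambda>P. D P - D' P)"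
  unfolding lin_equiv_def prin_def geometric_pts base_change_crv ordP_def[symmetric]
  by (intro iff_exI bex_cong refl conj_cong) (simp_all add: nonvan_iff)

lemma prin_diff:
  assumes "F \<in> forms n d" "G \<in> forms n d" "nonvan F" "nonvan G"
    "\<And>P. P \<in> pts \<Longrightarrow> f P = int (ordP F P) - int (ordP G P)"
  shows "prin f"
  unfolding prin_def using assms by blast

lemma prin_add:
  assumes "prin f" "prin g"
  shows "prin (\<lambda>P. f P + g P)"
proof -
  obtain d F G where 1: "F \<in> forms n d" "G \<in> forms n d" "nonvan F" "nonvan G"
    "\<And>P. P \<in> pts \<Longrightarrow> f P = int (ordP F P) - int (ordP G P)" using assms(1) unfolding prin_def by blast
  obtain e F' G' where 2: "F' \<in> forms n e" "G' \<in> forms n e" "nonvan F'" "nonvan G'"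
    "\<And>P. P \<in> pts \<Longrightarrow> g P = int (ordP F' P) - int (ordP G' P)" using assms(2) unfolding prin_def by blast
  show ?thesis
    by (rule prin_diff[OF forms_mult[OF 1(1) 2(1)] forms_mult[OF 1(2) 2(2)]
          nonvan_mult[OF 1(1) 2(1) 1(3) 2(3)] nonvan_mult[OF 1(2) 2(2) 1(4) 2(4)]])
      (simp add: 1(5) 2(5) ordP_mult[OF 1(1) 2(1) 1(3) 2(3)] ordP_mult[OF 1(2) 2(2) 1(4) 2(4)])
qed

lemma prin_minus:
  assumes "prin f"
  shows "prin (\<lambda>P. - f P)"
proof -
  obtain d F G where 1: "F \<in> forms n d" "G \<in> forms n d" "nonvan F" "nonvan G"
    "\<And>P. P \<in> pts \<Longrightarrow> f P = int (ordP F P) - int (ordP G P)" using assms(1) unfolding prin_def by blast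
  show ?thesis by (rule prin_diff[OF 1(2,1,4,3)]) (simp add: 1(5))
qed

lemma prin_0: "prin (\<lambda>P. 0)"
  by (rule prin_diff[OF linform_forms linform_forms, of "\<lambda>_. 1" "\<lambda>_. 1"]) (auto intro!: nonvan_linform)

lemma prin_int_mult:
  assumes "prin f"
  shows "prin (\<lambda>P. c * f P)"
proof -
  have N: "prin (\<lambda>P. int k * f P)" for k
  proof (induction k)
    case (Suc k)
    then show ?case using prin_add[OF assms Suc] by (simp add: distrib_right)
  qed (simp add: prin_0)
  show ?thesis
  proof (cases "0 \<le> c")
    case True
    then show ?thesis using N[of "nat c"] by simp
  next
    case False
    then show ?thesis using prin_minus[OF N[of "nat (- c)"]] by simp
  qed
qed

lemma prin_combine:
  assumes "prin f" "prin g" "\<And>P. h P = a * f P + b * g P"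
  shows "prin h"
proof -
  have "h = (\<lambda>P. a * f P + b * g P)" using assms(3) by blast
  then show ?thesis using prin_add[OF prin_int_mult[OF assms(1)] prin_int_mult[OF assms(2)]] by simp
qed

abbreviation "pd R \<equiv> point_divisor (geometric_point R)"

lemma count_list_pd: "int (count_list (map geometric_point D) P) = (\<Sum>R\<leftarrow>D. pd R P)"
  by (induction D) (auto simp: point_divisor_def)

lemma line_divisors_equiv:
  assumes "\<exists>i\<le>n. l i \<noteq> 0" "\<And>P. P \<in> pts \<Longrightarrow> int (ordP (linform n l) P) = f P"
    and "\<exists>i\<le>n. l' i \<noteq> 0" "\<And>P. P \<in> pts \<Longrightarrow> int (ordP (linform n l') P) = g P"
  shows "prin (\<lambda>P. f P - g P)"
  by (rule prin_diff[OF linform_forms linform_forms nonvan_linform[OF assms(1)] nonvan_linform[OF assms(3)]])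
    (simp add: assms(2,4))

end

locale origin_curve = kcurve n s A z0 for n s and A :: "nat \<Rightarrow> 'k::field_char_0" and z0 +
  fixes base :: "'k ppoint"
  assumes cs: "n = 2 \<and> s = 3 \<or> n = 3 \<and> s = 2" and base: "base \<in> RP"
begin

abbreviation "MW \<equiv> mordell_weil_group n (crv n s A) base"

lemma single_equiv_eq:
  assumes "R \<in> RP" "R' \<in> RP" "prin (\<lambda>P. pd R P - pd R' P)"
  shows "R = R'"
proof -
  obtain d F G where 1: "F \<in> forms n d" "G \<in> forms n d" "nonvan F" "nonvan G"
    "\<And>P. P \<in> pts \<Longrightarrow> pd R P - pd R' P = int (ordP F P) - int (ordP G P)" using assms(3) unfolding prin_def by blast
  have "geometric_point R = geometric_point R'"
    by (rule single_zero_single_pole[OF cs 1(1,3) 1(2,4)])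
      (use assms(1,2) 1(5) in \<open>auto intro: geometric_point_pts simp: point_divisor_def[abs_def] split: if_splits\<close>)
  then show ?thesis using geometric_point_eq_iff assms by blast
qed

lemma residual_point:
  assumes "set D \<subseteq> RP" "length D = n"
  obtains R l where "R \<in> RP" "\<exists>i\<le>n. l i \<noteq> 0"
    "\<And>P. P \<in> pts \<Longrightarrow> int (ordP (linform n l) P) = (\<Sum>Q\<leftarrow>D. pd Q P) + pd R P"
proof -
  obtain R l where R: "R \<in> RP" "\<exists>i\<le>n. l i \<noteq> 0"
    "\<forall>P\<in>pts. ordP (linform n (lift l)) P = count_list (map geometric_point D) P + (if P = geometric_point R then 1 else 0)"
    using rational_residual[OF cs assms] by blast
  have "\<exists>i\<le>n. lift l i \<noteq> 0" using R(2) by auto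
  moreover have "int (ordP (linform n (lift l)) P) = (\<Sum>Q\<leftarrow>D. pd Q P) + pd R P" if "P \<in> pts" for P
    using R(3) that by (simp add: count_list_pd[symmetric]) (simp add: point_divisor_def)
  ultimately show ?thesis by (rule that[OF R(1)])
qed

text \<open>Any two hyperplane sections are linearly equivalent. The point R depends on D alone, so
  the second list D' may itself contain R; this is how R gets cancelled below.\<close>

lemma residual_combine:
  assumes "set D \<subseteq> RP" "length D = n"
  shows "\<exists>R\<in>RP. \<forall>D'. set D' \<subseteq> RP \<longrightarrow> length D' = n \<longrightarrow>
    (\<exists>R'\<in>RP. prin (\<lambda>P. (\<Sum>Q\<leftarrow>D. pd Q P) + pd R P - ((\<Sum>Q\<leftarrow>D'. pd Q P) + pd R' P)))"
proof -
  obtain R l where R: "R \<in> RP" "\<exists>i\<le>n. l i \<noteq> 0"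
    "\<And>P. P \<in> pts \<Longrightarrow> int (ordP (linform n l) P) = (\<Sum>Q\<leftarrow>D. pd Q P) + pd R P"
    using residual_point[OF assms] by metis
  have "\<exists>R'\<in>RP. prin (\<lambda>P. (\<Sum>Q\<leftarrow>D. pd Q P) + pd R P - ((\<Sum>Q\<leftarrow>D'. pd Q P) + pd R' P))"
    if D': "set D' \<subseteq> RP" "length D' = n" for D'
  proof -
    obtain R' l' where R': "R' \<in> RP" "\<exists>i\<le>n. l' i \<noteq> 0"
      "\<And>P. P \<in> pts \<Longrightarrow> int (ordP (linform n l') P) = (\<Sum>Q\<leftarrow>D'. pd Q P) + pd R' P"
      using residual_point[OF D'] by metis
    show ?thesis using line_divisors_equiv[OF R(2,3) R'(2,3)] R'(1) by blast
  qed
  then show ?thesis using R(1) by blast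
qed

lemma sum_list_replicate_pd: "(\<Sum>Q\<leftarrow>replicate k R. pd Q P) = int k * pd R P"
  by (induction k) (simp_all add: distrib_right)

text \<open>The chord construction with origin O: P + Q + (n - 2) O + R and R + O + (n - 2) O + R'
  are hyperplane sections, hence P + Q is equivalent to R' + O.\<close>

lemma sum_exists:
  assumes "P \<in> RP" "Q \<in> RP"
  shows "\<exists>R\<in>RP. prin (\<lambda>Z. pd P Z + pd Q Z - (pd R Z + pd base Z))"
proof -
  have D: "set (P # Q # replicate (n - 2) base) \<subseteq> RP" "length (P # Q # replicate (n - 2) base) = n"
    using assms base nk by auto
  obtain R where R: "R \<in> RP" "\<forall>D'. set D' \<subseteq> RP \<longrightarrow> length D' = n \<longrightarrow>
    (\<exists>R'\<in>RP. prin (\<lambda>Z. (\<Sum>Q\<leftarrow>P # Q # replicate (n - 2) base. pd Q Z) + pd R Z - ((\<Sum>Q\<leftarrow>D'. pd Q Z) + pd R' Z)))"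
    using residual_combine[OF D] by blast
  have "set (R # base # replicate (n - 2) base) \<subseteq> RP" "length (R # base # replicate (n - 2) base) = n"
    using R(1) base nk by auto
  from R(2)[rule_format, OF this] obtain R' where R': "R' \<in> RP"
    "prin (\<lambda>Z. (\<Sum>Q\<leftarrow>P # Q # replicate (n - 2) base. pd Q Z) + pd R Z
      - ((\<Sum>Q\<leftarrow>R # base # replicate (n - 2) base. pd Q Z) + pd R' Z))" by blast
  show ?thesis
    by (rule bexI[OF _ R'(1)], rule prin_combine[OF R'(2) prin_0, of _ 1 0]) simp
qed

text \<open>With O the origin, n O + R and P + R + (n - 2) O + R' are hyperplane sections, hence P +
  R' is equivalent to 2 O.\<close>

lemma inverse_exists:
  assumes "P \<in> RP"
  shows "\<exists>R\<in>RP. prin (\<lambda>Z. pd P Z + pd R Z - 2 * pd base Z)"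
proof -
  have D: "set (replicate n base) \<subseteq> RP" "length (replicate n base) = n" using base nk by auto
  obtain R where R: "R \<in> RP" "\<forall>D'. set D' \<subseteq> RP \<longrightarrow> length D' = n \<longrightarrow>
    (\<exists>R'\<in>RP. prin (\<lambda>Z. (\<Sum>Q\<leftarrow>replicate n base. pd Q Z) + pd R Z - ((\<Sum>Q\<leftarrow>D'. pd Q Z) + pd R' Z)))"
    using residual_combine[OF D] by blast
  have "set (P # R # replicate (n - 2) base) \<subseteq> RP" "length (P # R # replicate (n - 2) base) = n"
    using R(1) assms base nk by auto
  from R(2)[rule_format, OF this] obtain R' where R': "R' \<in> RP"
    "prin (\<lambda>Z. (\<Sum>Q\<leftarrow>replicate n base. pd Q Z) + pd R Z
      - ((\<Sum>Q\<leftarrow>P # R # replicate (n - 2) base. pd Q Z) + pd R' Z))" by blast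
  have n: "int n = int (n - 2) + 2" using nk by simp
  show ?thesis
    by (rule bexI[OF _ R'(1)], rule prin_combine[OF R'(2) prin_0, of _ "- 1" 0])
      (simp only: sum_list_replicate_pd list.map sum_list.Cons n, simp add: algebra_simps)
qed

lemma MW_simps [simp]: "carrier MW = RP" "\<one>\<^bsub>MW\<^esub> = base"
  by (simp_all add: mordell_weil_group_def)

lemma mult_eq:
  assumes "R \<in> RP" "prin (\<lambda>Z. pd P Z + pd Q Z - (pd R Z + pd base Z))"
  shows "P \<otimes>\<^bsub>MW\<^esub> Q = R"
proof -
  have "(THE R. R \<in> RP \<and> prin (\<lambda>Z. pd P Z + pd Q Z - (pd R Z + pd base Z))) = R"
  proof (rule the_equality)
    fix R' assume R': "R' \<in> RP \<and> prin (\<lambda>Z. pd P Z + pd Q Z - (pd R' Z + pd base Z))"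
    have "prin (\<lambda>Z. pd R' Z - pd R Z)"
      by (rule prin_combine[OF assms(2) conjunct2[OF R'], of _ 1 "- 1"]) simp
    then show "R' = R" using single_equiv_eq R' assms(1) by blast
  qed (use assms in blast)
  then show ?thesis by (simp add: mordell_weil_group_def lin_equiv_iff)
qed

lemma mult_spec:
  assumes "P \<in> RP" "Q \<in> RP"
  shows "P \<otimes>\<^bsub>MW\<^esub> Q \<in> RP" "prin (\<lambda>Z. pd P Z + pd Q Z - (pd (P \<otimes>\<^bsub>MW\<^esub> Q) Z + pd base Z))"
proof -
  obtain R where R: "R \<in> RP" "prin (\<lambda>Z. pd P Z + pd Q Z - (pd R Z + pd base Z))"
    using sum_exists[OF assms] by blast
  show "P \<otimes>\<^bsub>MW\<^esub> Q \<in> RP" "prin (\<lambda>Z. pd P Z + pd Q Z - (pd (P \<otimes>\<^bsub>MW\<^esub> Q) Z + pd base Z))"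
    using R unfolding mult_eq[OF R] by simp_all
qed

lemma mult_base:
  assumes "P \<in> RP"
  shows "P \<otimes>\<^bsub>MW\<^esub> base = P"
  by (rule mult_eq[OF assms]) (simp add: prin_0)

lemma inv_spec:
  assumes "P \<in> RP"
  shows "inv\<^bsub>MW\<^esub> P \<in> RP \<and> prin (\<lambda>Z. pd P Z + pd (inv\<^bsub>MW\<^esub> P) Z - 2 * pd base Z)"
proof -
  obtain R where R: "R \<in> RP" "prin (\<lambda>Z. pd P Z + pd R Z - 2 * pd base Z)"
    using inverse_exists[OF assms] by blast
  have 1: "P \<otimes>\<^bsub>MW\<^esub> R = base" "R \<otimes>\<^bsub>MW\<^esub> P = base"
    by (rule mult_eq[OF base], rule prin_combine[OF R(2) prin_0, of _ 1 0], simp)+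
  have "inv\<^bsub>MW\<^esub> P = R" unfolding m_inv_def
  proof (rule the_equality)
    fix y assume y: "y \<in> carrier MW \<and> P \<otimes>\<^bsub>MW\<^esub> y = \<one>\<^bsub>MW\<^esub> \<and> y \<otimes>\<^bsub>MW\<^esub> P = \<one>\<^bsub>MW\<^esub>"
    then have yR: "y \<in> RP" and yb: "P \<otimes>\<^bsub>MW\<^esub> y = base" by simp_all
    have "prin (\<lambda>Z. pd y Z - pd R Z)"
      by (rule prin_combine[OF mult_spec(2)[OF assms yR] R(2), of _ 1 "- 1"]) (simp add: yb)
    then show "y = R" using single_equiv_eq yR R(1) by blast
  qed (use R 1 in simp)
  then show ?thesis using R by simp
qed

text \<open>The recursion is the one to which powers in \<open>MW\<close> unfold. It is followed
  through divisor classes: each step adds the class of x - O, with O the origin.\<close>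

lemma nat_pow_spec:
  assumes x: "x \<in> RP"
  shows "rec_nat base (\<lambda>u b. b \<otimes>\<^bsub>MW\<^esub> x) m \<in> RP \<and>
    prin (\<lambda>Z. pd (rec_nat base (\<lambda>u b. b \<otimes>\<^bsub>MW\<^esub> x) m) Z - pd base Z - int m * (pd x Z - pd base Z))"
proof (induction m)
  case (Suc m)
  let ?y = "rec_nat base (\<lambda>u b. b \<otimes>\<^bsub>MW\<^esub> x) m"
  have y: "?y \<in> RP" using Suc by blast
  have "prin (\<lambda>Z. pd (?y \<otimes>\<^bsub>MW\<^esub> x) Z - pd base Z - int (Suc m) * (pd x Z - pd base Z))"
    by (rule prin_combine[OF mult_spec(2)[OF y x] conjunct2[OF Suc], of _ "- 1" 1]) (simp add: algebra_simps)
  then show ?case using mult_spec(1)[OF y x] by simp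
qed (simp add: base prin_0)

lemma int_pow_spec:
  assumes x: "x \<in> RP"
  shows "x [^]\<^bsub>MW\<^esub> (c :: int) \<in> RP \<and>
    prin (\<lambda>Z. pd (x [^]\<^bsub>MW\<^esub> c) Z - pd base Z - c * (pd x Z - pd base Z))"
proof (cases "c < 0")
  case True
  let ?y = "rec_nat base (\<lambda>u b. b \<otimes>\<^bsub>MW\<^esub> x) (nat (- c))"
  have y: "?y \<in> RP" "prin (\<lambda>Z. pd ?y Z - pd base Z - int (nat (- c)) * (pd x Z - pd base Z))"
    using nat_pow_spec[OF x] by blast+
  have e: "x [^]\<^bsub>MW\<^esub> c = inv\<^bsub>MW\<^esub> ?y" using True by (simp add: int_pow_def)
  have "prin (\<lambda>Z. pd (inv\<^bsub>MW\<^esub> ?y) Z - pd base Z - c * (pd x Z - pd base Z))"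
    by (rule prin_combine[OF conjunct2[OF inv_spec[OF y(1)]] y(2), of _ 1 "- 1"])
      (use True in \<open>simp add: algebra_simps\<close>)
  then show ?thesis unfolding e using inv_spec[OF y(1)] by blast
next
  case False
  have e: "x [^]\<^bsub>MW\<^esub> c = rec_nat base (\<lambda>u b. b \<otimes>\<^bsub>MW\<^esub> x) (nat c)" using False by (simp add: int_pow_def)
  show ?thesis unfolding e using nat_pow_spec[OF x, of "nat c"] False by simp
qed

text \<open>\<open>finprod\<close> is unfolded to its inductive fold, whose only derivation for a
  singleton multiplies \<open>f x\<close> onto the unit.\<close>

lemma finprod_single:
  assumes "f x \<in> RP"
  shows "finprod MW f {x} = f x"
proof -
  have e: "(THE z. ({x}, z) \<in> foldSetD RP ((\<otimes>\<^bsub>MW\<^esub>) \<circ> f) base) = f x"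
  proof (rule the_equality)
    have "({}, base) \<in> foldSetD RP ((\<otimes>\<^bsub>MW\<^esub>) \<circ> f) base" using base by (rule foldSetD.emptyI)
    moreover have "((\<otimes>\<^bsub>MW\<^esub>) \<circ> f) x base = f x" by (simp add: mult_base assms)
    ultimately show "({x}, f x) \<in> foldSetD RP ((\<otimes>\<^bsub>MW\<^esub>) \<circ> f) base"
      using foldSetD.insertI[of x "{}" "(\<otimes>\<^bsub>MW\<^esub>) \<circ> f" base RP base] assms by simp
  next
    fix z assume "({x}, z) \<in> foldSetD RP ((\<otimes>\<^bsub>MW\<^esub>) \<circ> f) base"
    then show "z = f x"
    proof cases
      case (insertI x' B' y')
      then have "x' = x" "B' = {}" by auto
      then have "y' = base" using insertI by (auto elim: empty_foldSetDE)
      then show ?thesis using insertI \<open>x' = x\<close> by (simp add: mult_base assms)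
    qed simp
  qed
  then show ?thesis by (simp add: finprod_def foldD_def)
qed

text \<open>By \<open>step\<close> the class of Q_k - O is (-2)^k times that of Q_0 - O. If c
  annihilated Q_0 with c nonzero, two powers of -2 would agree modulo c, and the corresponding
  points Q_k would be equal.\<close>

theorem rank_ge_1:
  assumes Q: "\<And>k. Q k \<in> RP" "inj Q"
    and step: "\<And>k. prin (\<lambda>Z. 2 * pd (Q k) Z + pd (Q (Suc k)) Z - 3 * pd base Z)"
  shows "1 \<le> mordell_weil_rank n (crv n s A) base"
proof -
  have pow: "prin (\<lambda>Z. pd (Q k) Z - pd base Z - (- 2) ^ k * (pd (Q 0) Z - pd base Z))" for k
  proof (induction k)
    case (Suc k)
    show ?case by (rule prin_combine[OF step[of k] Suc, of _ 1 "- 2"]) (simp add: algebra_simps)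
  qed (simp add: prin_0)
  have "c = 0" if c: "Q 0 [^]\<^bsub>MW\<^esub> c = base" for c :: int
  proof (rule ccontr)
    assume c0: "c \<noteq> 0"
    have p0: "prin (\<lambda>Z. c * (pd (Q 0) Z - pd base Z))"
      by (rule prin_combine[OF conjunct2[OF int_pow_spec[OF Q(1)[of 0], of c]] prin_0, of _ "- 1" 0]) (simp add: c)
    have "range (\<lambda>k::nat. (- 2) ^ k mod \<bar>c\<bar> :: int) \<subseteq> {0..<\<bar>c\<bar>}" using c0 by auto
    then have "finite (range (\<lambda>k::nat. (- 2) ^ k mod \<bar>c\<bar> :: int))" by (rule finite_subset) simp
    then have "\<not> inj (\<lambda>k::nat. (- 2) ^ k mod \<bar>c\<bar> :: int)"
      using finite_imageD infinite_UNIV_nat by blast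
    then obtain k l :: nat where kl: "k \<noteq> l" "(- 2) ^ k mod \<bar>c\<bar> = ((- 2) ^ l mod \<bar>c\<bar> :: int)"
      unfolding inj_def by blast
    then have "c dvd (- 2) ^ k - (- 2) ^ l" by (simp add: mod_eq_dvd_iff)
    then obtain e where e: "(- 2) ^ k - (- 2) ^ l = c * e" by (elim dvdE)
    then have e': "(- 2) ^ k = (- 2) ^ l + c * e" by simp
    have "prin (\<lambda>Z. (pd (Q k) Z - pd base Z - (- 2) ^ k * (pd (Q 0) Z - pd base Z))
      - (pd (Q l) Z - pd base Z - (- 2) ^ l * (pd (Q 0) Z - pd base Z)))"
      by (rule prin_combine[OF pow[of k] pow[of l], of _ 1 "- 1"]) simp
    then have "prin (\<lambda>Z. pd (Q k) Z - pd (Q l) Z)"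
      by (rule prin_combine[OF _ p0, of _ _ 1 e]) (simp add: e' algebra_simps)
    then have "Q k = Q l" using single_equiv_eq Q(1) by blast
    then show False using kl Q(2) by (auto dest: injD)
  qed
  then have "int_independent MW {Q 0}"
    unfolding int_independent_def using int_pow_spec[OF Q(1)] by (simp add: finprod_single)
  then have "{Q 0} \<in> {S. finite S \<and> S \<subseteq> carrier MW \<and> int_independent MW S}" using Q(1) by simp
  then show ?thesis unfolding mordell_weil_rank_def abelian_rank_def
    by (rule SUP_upper2) (simp add: one_enat_def)
qed

text \<open>By \<open>residual\<close> a hyperplane section consists of n given points and one more.
  If n + 1 points with multiplicity are known to lie on it, the extra point must be the remaining
  one.\<close>

lemma full_divisor:
  assumes D: "set D \<subseteq> RP" "length D = n + 1" and l: "\<exists>i\<le>n. l i \<noteq> 0"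
    and ord: "\<And>P. P \<in> RP \<Longrightarrow> count_list D P \<le> ordP (linform n l) (geometric_point P)"
    and P: "P \<in> pts"
  shows "int (ordP (linform n l) P) = (\<Sum>R\<leftarrow>D. pd R P)"
proof -
  obtain R E where D': "D = R # E" using D(2) by (cases D) auto
  have cT: "card (T 1 n) = n + 1" using cs by (auto simp: card_T)
  have ord': "count_list (map geometric_point D) P \<le> ordP (linform n l) P" for P
  proof (cases "P \<in> geometric_point ` set D")
    case True
    then obtain Q where Q: "Q \<in> set D" "P = geometric_point Q" by blast
    have "count_list (map geometric_point D) P = count_list D Q"
    proof -
      have "count_list (map geometric_point D') P = count_list D' Q" if "set D' \<subseteq> RP" for D'
        using that Q D(1) by (induction D') (auto simp: geometric_point_eq_iff subset_iff)
      then show ?thesis using D(1) by blast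
    qed
    then show ?thesis using ord Q D(1) by auto
  next
    case False
    then have "count_list (map geometric_point D) P = 0" by (simp add: count_list_0_iff)
    then show ?thesis by simp
  qed
  have E: "set (map geometric_point E) \<subseteq> pts" "length (map geometric_point E) = n"
    using D geometric_point_pts by (auto simp: D')
  have "count_list (map geometric_point E) P \<le> ordP (linform n l) P" for P
    using ord'[of P] by (auto simp: D' split: if_splits)
  from residual[OF cT linform_forms nonvan_linform[OF l] E this] obtain Q where Q: "Q \<in> pts"
    "\<And>P. P \<in> pts \<Longrightarrow> ordP (linform n l) P = count_list (map geometric_point E) P + (if P = Q then 1 else 0)"
    by blast
  have "geometric_point R \<in> pts" using D(1) geometric_point_pts by (auto simp: D')
  then have "geometric_point R = Q" using Q(2)[of "geometric_point R"] ord'[of "geometric_point R"]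
    by (auto simp: D' split: if_splits)
  then have "ordP (linform n l) P = count_list (map geometric_point D) P" using Q(2)[OF P] by (auto simp: D')
  then show ?thesis by (simp add: count_list_pd)
qed

text \<open>The hyperflex gives the section (n + 1) O, the form \<open>l k\<close> gives 2 Q_k +
  Q_(k+1) + (n - 2) O. Their difference is the relation that \<open>rank_ge_1\<close> asks
  for.\<close>

theorem tangent_sequence_rank:
  assumes flex: "\<exists>i\<le>n. l0 i \<noteq> 0" "n + 1 \<le> ordP (linform n l0) (geometric_point base)"
    and Q: "\<And>k. Q k \<in> RP" "inj Q" "\<And>k. Q k \<noteq> base"
    and l: "\<And>k. \<exists>i\<le>n. l k i \<noteq> 0"
    and ord: "\<And>k. 2 \<le> ordP (linform n (l k)) (geometric_point (Q k))"
      "\<And>k. 1 \<le> ordP (linform n (l k)) (geometric_point (Q (Suc k)))"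
      "\<And>k. n = 3 \<Longrightarrow> 1 \<le> ordP (linform n (l k)) (geometric_point base)"
  shows "1 \<le> mordell_weil_rank n (crv n s A) base"
proof (rule rank_ge_1[OF Q(1,2)])
  fix k
  let ?E = "replicate (n + 1) base" and ?D = "Q k # Q k # Q (Suc k) # replicate (n - 2) base"
  have cr: "count_list (replicate m a) b = (if a = b then m else 0)" for m and a b :: "'k ppoint"
    by (induction m) auto
  have ne: "Q k \<noteq> Q (Suc k)" using Q(2) by (auto dest: injD)
  have 0: "int (ordP (linform n l0) P) = (\<Sum>R\<leftarrow>?E. pd R P)" if "P \<in> pts" for P
    by (rule full_divisor[OF _ _ flex(1) _ that]) (use base flex in \<open>auto simp: cr split: if_splits\<close>)
  have 1: "int (ordP (linform n (l k)) P) = (\<Sum>R\<leftarrow>?D. pd R P)" if "P \<in> pts" for P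
  proof (rule full_divisor[OF _ _ l _ that])
    fix P assume "P \<in> RP"
    consider "P = Q k" | "P = Q (Suc k)" | "P = base" "P \<noteq> Q k" "P \<noteq> Q (Suc k)"
      | "P \<noteq> Q k" "P \<noteq> Q (Suc k)" "P \<noteq> base" by blast
    then show "count_list ?D P \<le> ordP (linform n (l k)) (geometric_point P)"
    proof cases
      case 1
      then have "count_list ?D P = 2" using ne Q(3)[of k] by (auto simp: cr)
      then show ?thesis using ord(1)[of k] 1 by simp
    next
      case 2
      then have "count_list ?D P = 1" using ne Q(3)[of "Suc k"] by (auto simp: cr)
      then show ?thesis using ord(2)[of k] 2 by simp
    next
      case 3
      then have "count_list ?D P = n - 2" by (auto simp: cr)
      then show ?thesis using ord(3)[of k] 3 cs by auto
    qed (simp add: cr)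
  qed (use Q base nk in auto)
  have n: "int (n + 1) = int (n - 2) + 3" using nk by simp
  have "prin (\<lambda>P. (\<Sum>R\<leftarrow>?D. pd R P) - (\<Sum>R\<leftarrow>?E. pd R P))"
    by (rule line_divisors_equiv[OF l 1 flex(1) 0])
  then show "prin (\<lambda>Z. 2 * pd (Q k) Z + pd (Q (Suc k)) Z - 3 * pd base Z)"
    by (rule prin_combine[OF _ prin_0, of _ _ 1 0])
      (simp only: sum_list_replicate_pd list.map sum_list.Cons n, simp add: algebra_simps)
qed

end

section \<open>Points of infinite order\<close>

context kcurve
begin

lemma flex_point_sol:
  assumes "\<And>i. i \<le> n \<Longrightarrow> A i = \<mu> * \<tau> i ^ s" "\<tau> 0 = 0"
  shows "sol n s A \<tau>"
proof -
  have "(A i - A 1) * \<tau> 0 ^ s + (A 0 - A i) * \<tau> 1 ^ s + (A 1 - A 0) * \<tau> i ^ s = 0" if "i \<in> {2..n}" for i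
  proof -
    have "A i = \<mu> * \<tau> i ^ s" "A 1 = \<mu> * \<tau> 1 ^ s" "A 0 = 0" using that nk assms(1)[of i] assms(1)[of 1] assms(1)[of 0] assms(2) s0 by auto
    then show ?thesis using assms(2) s0 by simp
  qed
  then show ?thesis unfolding sol_def by blast
qed

text \<open>Translation into coordinates. The vectors \<open>m k\<close> are those of
  \<open>tangent_ord\<close>, so the hyperplane with coefficients
  \<open>m k i * v k i ^ (s - 1)\<close> is tangent at \<open>v k\<close>; \<open>meet\<close> says
  that it passes through the next point and, for n = 3, through the origin \<tau>. Different ratios
  of \<open>Y_1\<close> to \<open>Y_0\<close> keep the points apart, and \<open>Y_0\<close>
  separates them from \<tau>.\<close>

lemma vector_sequence_rank:
  assumes cs: "n = 2 \<and> s = 3 \<or> n = 3 \<and> s = 2"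
    and A: "\<And>i. i \<le> n \<Longrightarrow> A i = \<mu> * \<tau> i ^ s"
    and \<tau>: "\<tau> \<in> coord_vectors n" "\<tau> 0 = 0" "\<And>i. 1 \<le> i \<Longrightarrow> i \<le> n \<Longrightarrow> \<tau> i \<noteq> 0"
    and v: "\<And>k. v k \<in> coord_vectors n" "\<And>k. sol n s A (v k)" "\<And>k. v k 0 \<noteq> 0"
      "\<And>k k'. v k 0 * v k' 1 = v k' 0 * v k 1 \<Longrightarrow> k = k'"
    and m: "\<And>k. (\<Sum>i\<le>n. m k i) = 0" "\<And>k. (\<Sum>i\<le>n. m k i * A i) = 0"
      "\<And>k. \<exists>i\<le>n. m k i * v k i ^ (s - 1) \<noteq> 0"
    and meet: "\<And>k. (\<Sum>i\<le>n. m k i * v k i ^ (s - 1) * v (Suc k) i) = 0"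
      "\<And>k. n = 3 \<Longrightarrow> (\<Sum>i\<le>n. m k i * v k i ^ (s - 1) * \<tau> i) = 0"
  shows "\<exists>B0\<in>RP. 1 \<le> mordell_weil_rank n (crv n s A) B0"
proof -
  note st = flex_point_sol[OF A \<tau>(2)]
  have base: "pclass n \<tau> \<in> RP" using RP_I[OF \<tau>(1) st] .
  interpret origin_curve n s A z0 "pclass n \<tau>" by unfold_locales (use cs base in auto)
  note lt = lift_coord[OF \<tau>(1)] iffD2[OF lift_sol st]
  have lv: "lift (v k) \<in> coord_vectors n" "sol n s (lift A) (lift (v k))" for k
    using lift_coord[OF v(1)] v(2)[of k] lift_sol[of n s A "v k"] by blast+
  have B: "lift A i = to_ac \<mu> * lift \<tau> i ^ s" if "i \<le> n" for i using A[OF that] by simp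
  have "\<exists>l. (\<exists>i\<le>n. l i \<noteq> 0) \<and> n + 1 \<le> ordP (linform n l) (pclass n (lift \<tau>))"
    using cs
  proof
    assume c: "n = 2 \<and> s = 3"
    show ?thesis by (rule hyperflex_cubic[OF conjunct1[OF c] conjunct2[OF c] B lt(1) _ _ _ lt(2)])
      (use \<tau> c in simp_all)
  next
    assume c: "n = 3 \<and> s = 2"
    show ?thesis by (rule hyperflex_quartic[OF conjunct1[OF c] conjunct2[OF c] B lt(1) _ _ _ _ lt(2)])
      (use \<tau> c in simp_all)
  qed
  then obtain l0 where l0: "\<exists>i\<le>n. l0 i \<noteq> 0" "n + 1 \<le> ordP (linform n l0) (geometric_point (pclass n \<tau>))"
    unfolding geometric_point_pclass[OF \<tau>(1)] by blast
  define l where "l k i = m k i * v k i ^ (s - 1)" for k i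
  have ln: "\<exists>i\<le>n. lift (l k) i \<noteq> 0" for k using m(3)[of k] by (simp add: l_def)
  have hom: "to_ac (\<Sum>i\<le>n. f i) = (\<Sum>i\<le>n. to_ac (f i))" for f :: "nat \<Rightarrow> 'k" by (rule to_ac_hom.c_sum)
  have on: "1 \<le> ordP (linform n (lift (l k))) (geometric_point (pclass n w))"
    if w: "w \<in> coord_vectors n" "sol n s A w" "(\<Sum>i\<le>n. l k i * w i) = 0" for k w
  proof -
    have "ev (lift w) (linform n (lift (l k))) = to_ac (\<Sum>i\<le>n. l k i * w i)"
      by (simp add: coeff_hom.gev_linform[OF coeff_hom_id] hom)
    then show ?thesis unfolding geometric_point_pclass[OF w(1)]
      using ord_pos_iff[OF linform_forms nonvan_linform[OF ln] lift_coord[OF w(1)] iffD2[OF lift_sol w(2)]] w(3) by simp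
  qed
  have eq: "k = k'" if e: "pclass n (v k) = pclass n (v k')" for k k'
  proof -
    obtain c where "v k' = (\<lambda>i. c * v k i)" using e unfolding pclass_eq_iff[OF v(1) v(1)] by blast
    then have "v k 0 * v k' 1 = v k' 0 * v k 1" by simp
    then show ?thesis by (rule v(4))
  qed
  have "1 \<le> mordell_weil_rank n (crv n s A) (pclass n \<tau>)"
  proof (rule tangent_sequence_rank[OF l0, where Q = "\<lambda>k. pclass n (v k)" and l = "\<lambda>k. lift (l k)"])
    show "inj (\<lambda>k. pclass n (v k))" by (rule injI) (rule eq)
    fix k
    show "pclass n (v k) \<in> RP" using RP_I[OF v(1,2)] .
    show "pclass n (v k) \<noteq> pclass n \<tau>"
      unfolding pclass_eq_iff[OF v(1) \<tau>(1)] using \<tau>(2) v(3)[of k] by (auto dest: fun_cong[of _ _ 0])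
    show "\<exists>i\<le>n. lift (l k) i \<noteq> 0" by (rule ln)
    show "2 \<le> ordP (linform n (lift (l k))) (geometric_point (pclass n (v k)))"
      unfolding geometric_point_pclass[OF v(1)]
    proof (rule tangent_ord[OF lv, where m = "lift (m k)"])
      show "(\<Sum>i\<le>n. lift (m k) i) = 0" using m(1)[of k] hom[of "m k"] by simp
      show "(\<Sum>i\<le>n. lift (m k) i * lift A i) = 0" using m(2)[of k] hom[of "\<lambda>i. m k i * A i"] by simp
      show "lift (l k) i = lift (m k) i * lift (v k) i ^ (s - 1)" for i by (simp add: l_def)
      show "\<exists>i\<le>n. lift (l k) i \<noteq> 0" by (rule ln)
    qed
    show "1 \<le> ordP (linform n (lift (l k))) (geometric_point (pclass n (v (Suc k))))"
      by (rule on[OF v(1,2)]) (use meet(1)[of k] in \<open>simp add: l_def\<close>)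
    show "1 \<le> ordP (linform n (lift (l k))) (geometric_point (pclass n \<tau>))" if "n = 3"
    proof (rule on[OF \<tau>(1) st])
      show "(\<Sum>i\<le>n. l k i * \<tau> i) = 0" using meet(2)[OF that, of k] unfolding l_def .
    qed
  qed
  then show ?thesis by (rule bexI[OF _ base])
qed

end

section \<open>Integer sequences with growing 2-adic valuation\<close>

lemma two_adic_unique:
  fixes a b c d :: int
  assumes "a * (2 ^ k * c) = b * (2 ^ l * d)" "odd a" "odd b" "odd c" "odd d"
  shows "k = l"
proof -
  have "False" if "a * (2 ^ k * c) = b * (2 ^ l * d)" "odd a" "odd c" "k < l" for a b c d :: int and k l
  proof -
    have "(2::int) ^ l = 2 ^ k * 2 ^ (l - k)" using that(4) by (simp flip: power_add)
    then have "2 ^ k * (a * c) = 2 ^ k * (b * (2 ^ (l - k) * d))" using that(1) by (simp add: ac_simps)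
    then have "a * c = b * (2 ^ (l - k) * d)" by simp
    moreover have "even (b * (2 ^ (l - k) * d))" using that(4) by simp
    ultimately show False using that(2,3) by (metis even_mult_iff)
  qed
  from this[OF assms(1,2,4)] this[OF assms(1)[symmetric] assms(3,5)] show ?thesis by (meson linorder_neqE_nat)
qed

text \<open>Each point of the sequence is the residual intersection of the tangent at its predecessor. Since
  y' = y (r - p) and p + q + r = 0 with q divisible by 4 and r odd, y gains exactly one factor 2.\<close>

lemma cubic_sequence:
  fixes T :: int
  assumes T: "even T"
  obtains w :: "nat \<Rightarrow> nat \<Rightarrow> int" where
    "\<And>k. odd (w k 0)" "\<And>k. odd (w k 2)" "\<And>k. \<exists>d. odd d \<and> w k 1 = 2 ^ k * d"
    "\<And>k. (T ^ 3 - 1) * w k 0 ^ 3 - T ^ 3 * w k 1 ^ 3 + w k 2 ^ 3 = 0"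
    "\<And>k. (T ^ 3 - 1) * w k 0 ^ 2 * w (Suc k) 0 - T ^ 3 * w k 1 ^ 2 * w (Suc k) 1 + w k 2 ^ 2 * w (Suc k) 2 = 0"
proof -
  define P where "P k w \<longleftrightarrow> odd (w 0) \<and> odd (w 2) \<and> (\<exists>d. odd d \<and> w 1 = 2 ^ k * d) \<and>
    (T ^ 3 - 1) * w 0 ^ 3 - T ^ 3 * w 1 ^ 3 + w 2 ^ 3 = 0" for k :: nat and w :: "nat \<Rightarrow> int"
  define R where "R w w' \<longleftrightarrow> (T ^ 3 - 1) * w 0 ^ 2 * w' 0 - T ^ 3 * w 1 ^ 2 * w' 1 + w 2 ^ 2 * w' 2 = 0"
    for w w' :: "nat \<Rightarrow> int"
  have 0: "\<exists>w. P 0 w" by (intro exI[of _ "\<lambda>_. 1"]) (simp add: P_def)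
  have S: "\<exists>w'. P (Suc k) w' \<and> R w w'" if w: "P k w" for k w
  proof -
    define x y z where xyz: "x = w 0" "y = w 1" "z = w 2"
    obtain d where d: "odd d" "y = 2 ^ k * d" and o: "odd x" "odd z"
      and e: "(T ^ 3 - 1) * x ^ 3 - T ^ 3 * y ^ 3 + z ^ 3 = 0"
      using w unfolding P_def xyz by blast
    define p q r where pqr: "p = (T ^ 3 - 1) * x ^ 3" "q = - (T ^ 3 * y ^ 3)" "r = z ^ 3"
    have s: "p + q + r = 0" using e by (simp add: pqr)
    \<comment> \<open>The classical formula for the residual point of the tangent at (x : y : z) to
      a diagonal cubic whose three terms are p, q and r.\<close>
    define w' where "w' i = (if i = 0 then x * (q - r) else if i = 1 then y * (r - p) else z * (p - q))" for i :: nat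
    have q4: "4 dvd q"
    proof -
      have "2 ^ 3 dvd T ^ 3" using T by (rule dvd_power_same)
      then have "4 dvd T ^ 3" by (rule dvd_trans[rotated]) simp
      then show ?thesis by (simp add: pqr)
    qed
    then have q2: "even q" by (rule dvd_trans[rotated]) simp
    have r: "odd r" using o by (simp add: pqr)
    obtain t where t: "q = 4 * t" using q4 by (elim dvdE)
    have "p = - r - q" using s by simp
    then have rp: "r - p = 2 * (r + 2 * t)" by (simp add: t)
    have "odd p" using \<open>p = - r - q\<close> r q2 by simp
    then have "odd (x * (q - r))" "odd (z * (p - q))" using o r q2 by simp_all
    moreover have "odd (d * (r + 2 * t)) \<and> y * (r - p) = 2 ^ Suc k * (d * (r + 2 * t))"
      using d r by (simp add: rp)
    moreover have "(T ^ 3 - 1) * (x * (q - r)) ^ 3 - T ^ 3 * (y * (r - p)) ^ 3 + (z * (p - q)) ^ 3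
      = p * (q - r) ^ 3 + q * (r - p) ^ 3 + r * (p - q) ^ 3"
      by (simp only: power_mult_distrib) (simp add: pqr)
    \<comment> \<open>The left side is (p + q + r)(p - q)(q - r)(r - p).\<close>
    moreover have "p * (q - r) ^ 3 + q * (r - p) ^ 3 + r * (p - q) ^ 3 = 0" using s by Groebner_Basis.algebra
    ultimately have "P (Suc k) w'" unfolding P_def w'_def by auto
    moreover have "R w w'"
    proof -
      have "(T ^ 3 - 1) * x ^ 2 * (x * (q - r)) - T ^ 3 * y ^ 2 * (y * (r - p)) + z ^ 2 * (z * (p - q))
        = p * (q - r) + q * (r - p) + r * (p - q)"
        by (simp add: pqr power2_eq_square power3_eq_cube)
      also have "\<dots> = 0" by Groebner_Basis.algebra
      finally show ?thesis by (simp add: R_def w'_def xyz)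
    qed
    ultimately show ?thesis by blast
  qed
  obtain w where "\<forall>k. P k (w k) \<and> R (w k) (w (Suc k))"
    using dependent_nat_choice[of P "\<lambda>_. R", OF 0 S] by blast
  then show ?thesis using that[of w] unfolding P_def R_def by blast
qed

text \<open>The next point is the residual intersection of the plane spanned by the tangent and the origin, in
  the coordinates $y = Y_0 / M$ and $z_i = Y_i / \tau_i$, where $M = \tau_1 \tau_2 \tau_3$ and (a, b, c) is
  $(M / \tau_1, M / \tau_2, M / \tau_3)$.\<close>

lemma quartic_sequence:
  fixes a b c :: int
  assumes o: "odd a" "odd b" "odd c"
  obtains w :: "nat \<Rightarrow> nat \<Rightarrow> int" where
    "\<And>k. \<exists>d. odd d \<and> w k 0 = 2 ^ k * d" "\<And>k. odd (w k 1)" "\<And>k. odd (w k 2)" "\<And>k. odd (w k 3)"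
    "\<And>k. w k 1 ^ 2 - w k 2 ^ 2 = (a ^ 2 - b ^ 2) * w k 0 ^ 2"
    "\<And>k. w k 1 ^ 2 - w k 3 ^ 2 = (a ^ 2 - c ^ 2) * w k 0 ^ 2"
    "\<And>k. (w k 2 - w k 3) * w k 1 * w (Suc k) 1 + (w k 3 - w k 1) * w k 2 * w (Suc k) 2
      + (w k 1 - w k 2) * w k 3 * w (Suc k) 3
      = ((w k 2 - w k 3) * a ^ 2 + (w k 3 - w k 1) * b ^ 2 + (w k 1 - w k 2) * c ^ 2) * w k 0 * w (Suc k) 0"
proof -
  define P where "P k w \<longleftrightarrow> (\<exists>d. odd d \<and> w 0 = 2 ^ k * d) \<and> odd (w 1) \<and> odd (w 2) \<and> odd (w 3) \<and>
    w 1 ^ 2 - w 2 ^ 2 = (a ^ 2 - b ^ 2) * w 0 ^ 2 \<and> w 1 ^ 2 - w 3 ^ 2 = (a ^ 2 - c ^ 2) * w 0 ^ 2"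
    for k :: nat and w :: "nat \<Rightarrow> int"
  define R where "R w w' \<longleftrightarrow> (w 2 - w 3) * w 1 * w' 1 + (w 3 - w 1) * w 2 * w' 2 + (w 1 - w 2) * w 3 * w' 3
      = ((w 2 - w 3) * a ^ 2 + (w 3 - w 1) * b ^ 2 + (w 1 - w 2) * c ^ 2) * w 0 * w' 0"
    for w w' :: "nat \<Rightarrow> int"
  \<comment> \<open>In the original coordinates the start y = 1, z = (a, b, c) is the point (1 : 1 :
    1 : 1).\<close>
  have 0: "\<exists>w. P 0 w"
    by (intro exI[of _ "\<lambda>i. if i = 0 then 1 else if i = 1 then a else if i = 2 then b else c"])
      (use o in \<open>simp add: P_def\<close>)
  have S: "\<exists>w'. P (Suc k) w' \<and> R w w'" if w: "P k w" for k w
  proof -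
    define y z1 z2 z3 where z: "y = w 0" "z1 = w 1" "z2 = w 2" "z3 = w 3"
    obtain d where d: "odd d" "y = 2 ^ k * d" and o: "odd z1" "odd z2" "odd z3"
      and e: "z1 ^ 2 - z2 ^ 2 = (a ^ 2 - b ^ 2) * y ^ 2" "z1 ^ 2 - z3 ^ 2 = (a ^ 2 - c ^ 2) * y ^ 2"
      using w unfolding P_def z by blast
    \<comment> \<open>With x - e_i = (z_i / y)^2 on the cubic w^2 = (x - e_1)(x - e_2)(x - e_3), the
      duplication formula gives (Z_i / Y')^2 as the new x - e_i. The denominator supplies the factor
      2, and its sign is the one that fits the plane condition \<open>R\<close>.\<close>
    define Y' where "Y' = - 2 * y * z1 * z2 * z3"
    define Z1 where "Z1 = z1 ^ 2 * z2 ^ 2 + z1 ^ 2 * z3 ^ 2 - z2 ^ 2 * z3 ^ 2"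
    define Z2 where "Z2 = z2 ^ 2 * z1 ^ 2 + z2 ^ 2 * z3 ^ 2 - z1 ^ 2 * z3 ^ 2"
    define Z3 where "Z3 = z3 ^ 2 * z1 ^ 2 + z3 ^ 2 * z2 ^ 2 - z1 ^ 2 * z2 ^ 2"
    define w' where "w' i = (if i = 0 then Y' else if i = 1 then Z1 else if i = 2 then Z2 else Z3)" for i :: nat
    have w': "w' 0 = Y'" "w' 1 = Z1" "w' 2 = Z2" "w' 3 = Z3" by (simp_all add: w'_def)
    have "odd (- (d * z1 * z2 * z3)) \<and> Y' = 2 ^ Suc k * - (d * z1 * z2 * z3)" using d o by (simp add: Y'_def)
    moreover have "odd Z1" "odd Z2" "odd Z3" using o by (simp_all add: Z1_def Z2_def Z3_def)
    moreover have "Z1 ^ 2 - Z2 ^ 2 = (a ^ 2 - b ^ 2) * Y' ^ 2"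
    proof -
      have "Z1 ^ 2 - Z2 ^ 2 = 4 * z1 ^ 2 * z2 ^ 2 * z3 ^ 2 * (z1 ^ 2 - z2 ^ 2)" unfolding Z1_def Z2_def by Groebner_Basis.algebra
      then show ?thesis unfolding e Y'_def by Groebner_Basis.algebra
    qed
    moreover have "Z1 ^ 2 - Z3 ^ 2 = (a ^ 2 - c ^ 2) * Y' ^ 2"
    proof -
      have "Z1 ^ 2 - Z3 ^ 2 = 4 * z1 ^ 2 * z2 ^ 2 * z3 ^ 2 * (z1 ^ 2 - z3 ^ 2)" unfolding Z1_def Z3_def by Groebner_Basis.algebra
      then show ?thesis unfolding e Y'_def by Groebner_Basis.algebra
    qed
    ultimately have "P (Suc k) w'" unfolding P_def w' by blast
    moreover have "R w w'"
    proof -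
      have "((z2 - z3) * a ^ 2 + (z3 - z1) * b ^ 2 + (z1 - z2) * c ^ 2) * y ^ 2 =
        (z2 - z3) * (z1 ^ 2 - z3 ^ 2) + (z3 - z1) * (z2 ^ 2 - z3 ^ 2)"
      proof -
        have e3: "z2 ^ 2 - z3 ^ 2 = (b ^ 2 - c ^ 2) * y ^ 2" using e by (simp add: algebra_simps)
        show ?thesis unfolding e(2) e3 by (simp add: algebra_simps)
      qed
      moreover have "((z2 - z3) * a ^ 2 + (z3 - z1) * b ^ 2 + (z1 - z2) * c ^ 2) * y * Y' =
        ((z2 - z3) * a ^ 2 + (z3 - z1) * b ^ 2 + (z1 - z2) * c ^ 2) * y ^ 2 * (- 2 * z1 * z2 * z3)"
        unfolding Y'_def by Groebner_Basis.algebra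
      moreover have "(z2 - z3) * z1 * Z1 + (z3 - z1) * z2 * Z2 + (z1 - z2) * z3 * Z3 =
        ((z2 - z3) * (z1 ^ 2 - z3 ^ 2) + (z3 - z1) * (z2 ^ 2 - z3 ^ 2)) * (- 2 * z1 * z2 * z3)"
        unfolding Z1_def Z2_def Z3_def by Groebner_Basis.algebra
      ultimately have "(z2 - z3) * z1 * Z1 + (z3 - z1) * z2 * Z2 + (z1 - z2) * z3 * Z3 =
        ((z2 - z3) * a ^ 2 + (z3 - z1) * b ^ 2 + (z1 - z2) * c ^ 2) * y * Y'" by (simp only:)
      then show ?thesis unfolding R_def w' z .
    qed
    ultimately show ?thesis by blast
  qed
  obtain w where "\<forall>k. P k (w k) \<and> R (w k) (w (Suc k))"
    using dependent_nat_choice[of P "\<lambda>_. R", OF 0 S] by blast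
  then show ?thesis using that[of w] unfolding P_def R_def by blast
qed

section \<open>From integer sequences to positive rank\<close>

lemma sum_atMost_2: "(\<Sum>i\<le>2. f i) = f 0 + f 1 + f (2::nat)" for f :: "nat \<Rightarrow> 'b::comm_monoid_add"
  by (simp add: numeral_2_eq_2)

lemma sum_atMost_3: "(\<Sum>i\<le>3. f i) = f 0 + f 1 + f 2 + f (3::nat)" for f :: "nat \<Rightarrow> 'b::comm_monoid_add"
  by (simp add: numeral_3_eq_3 numeral_2_eq_2)

lemma cubic_rank:
  fixes A :: "nat \<Rightarrow> 'k::field_char_0" and T :: int
  assumes A: "A 0 = 0" "A 1 = \<mu>" "A 2 = \<mu> * of_int T ^ 3" "inj_on A {..2}"
    and T: "even T" "T \<noteq> 0" and z0: "primitive_root_of_unity 3 (z0 :: 'k)"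
  shows "\<exists>B0\<in>rational_points 2 (crv 2 3 A). 1 \<le> mordell_weil_rank 2 (crv 2 3 A) B0"
proof (rule cubic_sequence[OF T(1)])
  fix w :: "nat \<Rightarrow> nat \<Rightarrow> int"
  interpret kcurve 2 3 A z0 by unfold_locales (use A z0 in auto)
  assume w: "\<And>k. odd (w k 0)" "\<And>k. odd (w k 2)" "\<And>k. \<exists>d. odd d \<and> w k 1 = 2 ^ k * d"
    "\<And>k. (T ^ 3 - 1) * w k 0 ^ 3 - T ^ 3 * w k 1 ^ 3 + w k 2 ^ 3 = 0"
    "\<And>k. (T ^ 3 - 1) * w k 0 ^ 2 * w (Suc k) 0 - T ^ 3 * w k 1 ^ 2 * w (Suc k) 1 + w k 2 ^ 2 * w (Suc k) 2 = 0"
  have w0: "w k 0 \<noteq> 0" "w k 2 \<noteq> 0" for k using w(1,2)[of k] by auto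
  define v where "v k i = (if i \<le> 2 then of_int (w k i) else 0 :: 'k)" for k i :: nat
  define \<tau> where "\<tau> i = (if i = 1 then 1 else if i = 2 then of_int T else 0 :: 'k)" for i :: nat
  \<comment> \<open>The vectors orthogonal to (1, 1, 1) and to (0, 1, T^3) form a line, so one m
    serves all points of the sequence.\<close>
  define m where "m i = (if i = 0 then of_int (T ^ 3 - 1) else if i = 1 then - of_int (T ^ 3) else 1 :: 'k)" for i :: nat
  have eq: "(of_int T ^ 3 - 1) * of_int (w k 0) ^ 3 - of_int T ^ 3 * of_int (w k 1) ^ 3 + of_int (w k 2) ^ 3 = (0 :: 'k)" for k
    using arg_cong[OF w(4)[of k], of "of_int :: int \<Rightarrow> 'k"] by simp
  show ?thesis
  proof (rule vector_sequence_rank[of \<mu> \<tau> v "\<lambda>_. m"])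
    show "A i = \<mu> * \<tau> i ^ 3" if "i \<le> 2" for i
    proof -
      have "i = 0 \<or> i = 1 \<or> i = 2" using that by linarith
      then show ?thesis using A by (auto simp: \<tau>_def)
    qed
    show "\<tau> \<in> coord_vectors 2" unfolding coord_vectors_def by (auto simp: \<tau>_def intro: exI[of _ 1])
    show "\<tau> i \<noteq> 0" if "1 \<le> i" "i \<le> 2" for i using that T by (auto simp: \<tau>_def)
    fix k
    show "v k \<in> coord_vectors 2" unfolding coord_vectors_def using w0 by (auto simp: v_def intro: exI[of _ 0])
    have "(\<mu> * of_int T ^ 3 - \<mu>) * of_int (w k 0) ^ 3 - \<mu> * of_int T ^ 3 * of_int (w k 1) ^ 3 + \<mu> * of_int (w k 2) ^ 3
      = \<mu> * ((of_int T ^ 3 - 1) * of_int (w k 0) ^ 3 - of_int T ^ 3 * of_int (w k 1) ^ 3 + of_int (w k 2) ^ 3)"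
      by (simp add: algebra_simps)
    then show "sol 2 3 A (v k)" unfolding sol_def using A eq[of k] by (simp add: v_def)
    show "v k 0 \<noteq> 0" using w0 by (simp add: v_def)
    show "k = k'" if "v k 0 * v k' 1 = v k' 0 * v k 1" for k'
    proof -
      obtain d d' where d: "odd d" "w k 1 = 2 ^ k * d" "odd d'" "w k' 1 = 2 ^ k' * d'" using w(3) by meson
      have "of_int (w k 0 * w k' 1) = (of_int (w k' 0 * w k 1) :: 'k)" using that by (simp add: v_def)
      then have "w k 0 * w k' 1 = w k' 0 * w k 1" by (simp only: of_int_eq_iff)
      then show ?thesis using two_adic_unique[of "w k' 0" k d "w k 0" k' d'] d w(1) by simp
    qed
    show "(\<Sum>i\<le>2. m i) = 0" by (simp add: sum_atMost_2 m_def)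
    show "(\<Sum>i\<le>2. m i * A i) = 0" unfolding sum_atMost_2 using A by (simp add: m_def)
    show "\<exists>i\<le>2. m i * v k i ^ (3 - 1) \<noteq> 0" using w0 by (intro exI[of _ 2]) (simp add: m_def v_def)
    show "(\<Sum>i\<le>2. m i * v k i ^ (3 - 1) * v (Suc k) i) = 0"
      using arg_cong[OF w(5)[of k], of "of_int :: int \<Rightarrow> 'k"] unfolding sum_atMost_2 by (simp add: m_def v_def)
  qed (auto simp: \<tau>_def)
qed

lemma quartic_rank:
  fixes A :: "nat \<Rightarrow> 'k::field_char_0" and p q :: int
  assumes A: "A 0 = 0" "A 1 = \<mu>" "A 2 = \<mu> * of_int p ^ 2" "A 3 = \<mu> * of_int q ^ 2" "inj_on A {..3}"
    and pq: "odd p" "odd q" and z0: "primitive_root_of_unity 2 (z0 :: 'k)"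
  shows "\<exists>B0\<in>rational_points 3 (crv 3 2 A). 1 \<le> mordell_weil_rank 3 (crv 3 2 A) B0"
proof -
  have opq: "odd (p * q)" using pq by simp
  show ?thesis
  proof (rule quartic_sequence[OF opq pq(2,1)])
  fix w :: "nat \<Rightarrow> nat \<Rightarrow> int"
  interpret kcurve 3 2 A z0 by unfold_locales (use A z0 in auto)
  assume w: "\<And>k. \<exists>d. odd d \<and> w k 0 = 2 ^ k * d" "\<And>k. odd (w k 1)" "\<And>k. odd (w k 2)" "\<And>k. odd (w k 3)"
    "\<And>k. w k 1 ^ 2 - w k 2 ^ 2 = ((p * q) ^ 2 - q ^ 2) * w k 0 ^ 2"
    "\<And>k. w k 1 ^ 2 - w k 3 ^ 2 = ((p * q) ^ 2 - p ^ 2) * w k 0 ^ 2"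
    "\<And>k. (w k 2 - w k 3) * w k 1 * w (Suc k) 1 + (w k 3 - w k 1) * w k 2 * w (Suc k) 2
      + (w k 1 - w k 2) * w k 3 * w (Suc k) 3
      = ((w k 2 - w k 3) * (p * q) ^ 2 + (w k 3 - w k 1) * q ^ 2 + (w k 1 - w k 2) * p ^ 2) * w k 0 * w (Suc k) 0"
  have pq0: "p \<noteq> 0" "q \<noteq> 0" using pq by auto
  have p2: "p ^ 2 \<noteq> q ^ 2"
  proof
    assume "p ^ 2 = q ^ 2"
    then have "A 2 = A 3" using A by (metis of_int_power)
    then show False using A(5) by (auto dest: inj_onD)
  qed
  have w0: "w k 0 \<noteq> 0" "w k 1 \<noteq> 0" for k using w(1)[of k] w(2)[of k] by auto
  have w23: "w k 2 - w k 3 \<noteq> 0" for k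
  proof
    assume "w k 2 - w k 3 = 0"
    then have "((p * q) ^ 2 - q ^ 2) * w k 0 ^ 2 = ((p * q) ^ 2 - p ^ 2) * w k 0 ^ 2"
      using w(5)[of k] w(6)[of k] by simp
    then show False using p2 w0[of k] by simp
  qed
  \<comment> \<open>Back from the coordinates of \<open>quartic_sequence\<close> to
    \<open>Y_0\<close>, ..., \<open>Y_3\<close>, with \<tau> = (0, 1, p, q), so that the product of
    its last three entries is p q.\<close>
  define W where "W k i = (if i = 0 then p * q * w k 0 else if i = 1 then w k 1
    else if i = 2 then p * w k 2 else q * w k 3)" for k i :: nat
  \<comment> \<open>Orthogonality to A and passage through \<tau> do not involve the entry at 0, and
    the differences of the \<open>w k i\<close> solve both at once, by (z_2 - z_3) + (z_3 - z_1) +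
    (z_1 - z_2) = 0 and its analogue weighted by z_1, z_2, z_3. The entry at 0 then makes the sum of
    all entries zero.\<close>
  define M where "M k i = (if i = 0 then - ((w k 2 - w k 3) * (p * q) ^ 2 + (w k 3 - w k 1) * q ^ 2 + (w k 1 - w k 2) * p ^ 2)
    else if i = 1 then (w k 2 - w k 3) * (p * q) ^ 2 else if i = 2 then (w k 3 - w k 1) * q ^ 2
    else (w k 1 - w k 2) * p ^ 2)" for k i :: nat
  define v where "v k i = (if i \<le> 3 then of_int (W k i) else 0 :: 'k)" for k i :: nat
  define t where "t i = (if i = 1 then 1 else if i = 2 then p else if i = 3 then q else 0)" for i :: nat
  have cases3: "i = 0 \<or> i = 1 \<or> i = 2 \<or> i = 3" if "i \<le> 3" for i :: nat using that by linarith
  show ?thesis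
  proof (rule vector_sequence_rank[of \<mu> "\<lambda>i. of_int (t i)" v "\<lambda>k i. of_int (M k i)"])
    show At: "A i = \<mu> * of_int (t i) ^ 2" if "i \<le> 3" for i
      using cases3[OF that] A by (auto simp: t_def)
    show "(\<lambda>i. of_int (t i) :: 'k) \<in> coord_vectors 3" unfolding coord_vectors_def by (auto simp: t_def intro: exI[of _ 1])
    show "of_int (t i) \<noteq> (0::'k)" if "1 \<le> i" "i \<le> 3" for i using that pq0 by (auto simp: t_def)
    fix k
    have W0: "W k 0 \<noteq> 0" using w0[of k] pq0 by (simp add: W_def)
    show "v k \<in> coord_vectors 3" unfolding coord_vectors_def using W0 by (auto simp: v_def intro: exI[of _ 0])
    show "sol 3 2 A (v k)" unfolding sol_def
    proof
      fix i :: nat assume i: "i \<in> {2..3}"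
      have "(t i ^ 2 - 1) * W k 0 ^ 2 - t i ^ 2 * W k 1 ^ 2 + W k i ^ 2 = 0"
      proof (cases "i = 2")
        case True
        have "(p ^ 2 - 1) * (p * q * w k 0) ^ 2 - p ^ 2 * w k 1 ^ 2 + (p * w k 2) ^ 2 = 0" using w(5)[of k] by Groebner_Basis.algebra
        then show ?thesis using True by (simp add: t_def W_def)
      next
        case False
        have "(q ^ 2 - 1) * (p * q * w k 0) ^ 2 - q ^ 2 * w k 1 ^ 2 + (q * w k 3) ^ 2 = 0" using w(6)[of k] by Groebner_Basis.algebra
        moreover have "i = 3" using False i by auto
        ultimately show ?thesis by (simp add: t_def W_def)
      qed
      from arg_cong[OF this, of "of_int :: int \<Rightarrow> 'k"]
      have "(of_int (t i) ^ 2 - 1) * of_int (W k 0) ^ 2 - of_int (t i) ^ 2 * of_int (W k 1) ^ 2 + of_int (W k i) ^ 2 = (0 :: 'k)"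
        by simp
      then have "\<mu> * ((of_int (t i) ^ 2 - 1) * of_int (W k 0) ^ 2 - of_int (t i) ^ 2 * of_int (W k 1) ^ 2 + of_int (W k i) ^ 2) = (0 :: 'k)"
        by simp
      moreover have "A i = \<mu> * of_int (t i) ^ 2" "v k i = of_int (W k i)" "v k 0 = of_int (W k 0)" "v k 1 = of_int (W k 1)"
        using At[of i] i by (simp_all add: v_def)
      ultimately show "(A i - A 1) * v k 0 ^ 2 + (A 0 - A i) * v k 1 ^ 2 + (A 1 - A 0) * v k i ^ 2 = 0"
        using A(1,2) by (simp add: algebra_simps)
    qed
    show "v k 0 \<noteq> 0" using W0 by (simp add: v_def)
    show "k = k'" if "v k 0 * v k' 1 = v k' 0 * v k 1" for k'
    proof -
      obtain d d' where d: "odd d" "w k 0 = 2 ^ k * d" "odd d'" "w k' 0 = 2 ^ k' * d'" using w(1) by meson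
      have "of_int (W k 0 * W k' 1) = (of_int (W k' 0 * W k 1) :: 'k)" using that by (simp add: v_def)
      then have "W k 0 * W k' 1 = W k' 0 * W k 1" by (simp only: of_int_eq_iff)
      then have "w k' 1 * w k 0 = w k 1 * w k' 0" using pq0 by (simp add: W_def ac_simps)
      then show ?thesis using two_adic_unique[of "w k' 1" k d "w k 1" k' d'] d w(2) by simp
    qed
    show "(\<Sum>i\<le>3. of_int (M k i) :: 'k) = 0" unfolding of_int_sum[symmetric] sum_atMost_3 by (simp add: M_def)
    have "(\<Sum>i\<le>3. M k i * t i ^ 2) = 0" unfolding sum_atMost_3 by (simp add: M_def t_def algebra_simps)
    then have "\<mu> * of_int (\<Sum>i\<le>3. M k i * t i ^ 2) = 0" by simp
    then show "(\<Sum>i\<le>3. of_int (M k i) * A i) = 0"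
      by (simp add: At sum_distrib_left mult.left_commute)
    have "M k 1 * W k 1 \<noteq> 0" using w23[of k] w0[of k] pq0 by (simp add: M_def W_def)
    then have "of_int (M k 1) * of_int (W k 1) \<noteq> (0::'k)" by (simp flip: of_int_mult)
    then show "\<exists>i\<le>3. of_int (M k i) * v k i ^ (2 - 1) \<noteq> 0" by (intro exI[of _ 1]) (simp add: v_def)
    have "(\<Sum>i\<le>3. M k i * W k i * W (Suc k) i) = 0" unfolding sum_atMost_3 
    proof -
      have "- (((w k 2 - w k 3) * (p * q) ^ 2 + (w k 3 - w k 1) * q ^ 2 + (w k 1 - w k 2) * p ^ 2)) * (p * q * w k 0) * (p * q * w (Suc k) 0)
        + (w k 2 - w k 3) * (p * q) ^ 2 * w k 1 * w (Suc k) 1 + (w k 3 - w k 1) * q ^ 2 * (p * w k 2) * (p * w (Suc k) 2)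
        + (w k 1 - w k 2) * p ^ 2 * (q * w k 3) * (q * w (Suc k) 3) = 0"
        using w(7)[of k] by Groebner_Basis.algebra
      then show "M k 0 * W k 0 * W (Suc k) 0 + M k 1 * W k 1 * W (Suc k) 1 + M k 2 * W k 2 * W (Suc k) 2
        + M k 3 * W k 3 * W (Suc k) 3 = 0" by (simp add: M_def W_def)
    qed
    then have "of_int (\<Sum>i\<le>3. M k i * W k i * W (Suc k) i) = (0::'k)" by (simp only: of_int_0)
    then show "(\<Sum>i\<le>3. of_int (M k i) * v k i ^ (2 - 1) * v (Suc k) i) = 0" by (simp add: v_def)
    have "(\<Sum>i\<le>3. M k i * W k i * t i) = 0" unfolding sum_atMost_3
      by (simp add: M_def W_def t_def algebra_simps power2_eq_square)
    then have "of_int (\<Sum>i\<le>3. M k i * W k i * t i) = (0::'k)" by (simp only: of_int_0)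
    then show "(\<Sum>i\<le>3. of_int (M k i) * v k i ^ (2 - 1) * of_int (t i)) = 0" by (simp add: v_def)
  qed (auto simp: t_def)
  qed
qed

section \<open>The families of curves\<close>

lemma U_set_iff:
  "\<alpha> \<in> U_set r n \<longleftrightarrow> \<alpha> \<in> {..n} \<rightarrow>\<^sub>E UNIV \<and> inj_on (\<lambda>i. \<alpha> i ^ r :: 'k::field) {..n}"
proof -
  have "(\<Prod>j\<le>n. \<Prod>i<j. \<alpha> i ^ r - \<alpha> j ^ r) \<noteq> 0 \<longleftrightarrow> inj_on (\<lambda>i. \<alpha> i ^ r) {..n}"
    by (rule iffI, rule linorder_inj_onI) (auto simp: prod_zero_iff dest: inj_onD)
  then show ?thesis by (simp add: U_set_def)
qed

lemma (in kcurve) genus_one: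
  assumes "n = 2 \<and> s = 3 \<or> n = 3 \<and> s = 2"
  shows "genus_one_curve n (crv n s A)"
proof -
  have "A 1 \<noteq> A 0" using inj_A nk by (auto dest: inj_onD)
  then obtain c where c: "hilbert_polynomial n (crv n s A) = [:0, c:]" "c \<noteq> 0"
    using assms hilbert_polynomial_2_3[of A] hilbert_polynomial_3_2[of A] by auto
  then have "proj_dimension n (crv n s A) = 1" by (simp add: proj_dimension_def)
  then show ?thesis using smooth c by (simp add: genus_one_curve_def genus_def)
qed

text \<open>Recovers \<alpha> from the point [1 : \<alpha>]. Summed over a multiset of points it
  gives the sum of the \<alpha>_i, an invariant of the unordered tuple that tells different
  multiples of one tuple apart.\<close>

definition affine_coord :: "'a::field ppoint \<Rightarrow> 'a" where
  "affine_coord P = (SOME v. v \<in> P) 1 / (SOME v. v \<in> P) 0"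

lemma sym_point_sum: "sum_mset (image_mset affine_coord (sym_point n \<alpha>)) = (\<Sum>i\<le>n. \<alpha> i)"
proof -
  have "affine_coord (pclass 1 u) = a"
    if u: "u = (\<lambda>j. if j = 0 then 1 else if j = 1 then a else 0)" for u :: "nat \<Rightarrow> 'a" and a
  proof -
    have "u \<in> coord_vectors 1" unfolding coord_vectors_def u by (auto intro: exI[of _ 0])
    then have "(SOME v. v \<in> pclass 1 u) \<in> pclass 1 u" using pclass_self by (metis someI)
    then obtain c where c: "c \<noteq> 0" "(SOME v. v \<in> pclass 1 u) = (\<lambda>i. c * u i)"
      unfolding pclass_iff[OF \<open>u \<in> coord_vectors 1\<close>] by blast
    show ?thesis unfolding affine_coord_def c(2) using c(1) by (simp add: u)
  qed
  then show ?thesis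
    by (simp add: sym_point_def pclass_def[symmetric] image_mset.compositionality comp_def sum_unfold_sum_mset)
qed

lemma infinite_sym_points:
  fixes c :: "nat \<Rightarrow> nat" and S :: "(nat \<Rightarrow> 'k::field_char_0) set"
  assumes S: "\<And>L. 1 \<le> L \<Longrightarrow> restrict (\<lambda>i. of_nat (L * c i)) {..n} \<in> S" and c: "(\<Sum>i\<le>n. c i) \<noteq> 0"
  shows "infinite (sym_point n ` S)"
proof -
  define a where "a L = (restrict (\<lambda>i. of_nat (L * c i)) {..n} :: nat \<Rightarrow> 'k)" for L
  have "inj (\<lambda>L. sym_point n (a L))"
  proof (rule injI)
    fix L M assume e: "sym_point n (a L) = sym_point n (a M)"
    have "(\<Sum>i\<le>n. a K i) = of_nat (K * (\<Sum>i\<le>n. c i))" for K by (simp add: a_def sum_distrib_left)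
    then have "of_nat (L * (\<Sum>i\<le>n. c i)) = (of_nat (M * (\<Sum>i\<le>n. c i)) :: 'k)"
      using arg_cong[OF e, of "\<lambda>D. sum_mset (image_mset affine_coord D)"] unfolding sym_point_sum by simp
    then show "L = M" using c by (simp only: of_nat_eq_iff) simp
  qed
  then have "inj_on (\<lambda>L. sym_point n (a L)) {1..}" by (rule inj_on_subset) simp
  then have "infinite ((\<lambda>L. sym_point n (a L)) ` {1..})" by (simp add: finite_image_iff infinite_Ici)
  moreover have "(\<lambda>L. sym_point n (a L)) ` {1..} \<subseteq> sym_point n ` S" using S by (auto simp: a_def)
  ultimately show ?thesis by (metis finite_subset)
qed

lemma inj_on_scaled_powers:
  assumes "inj_on c {..n}" "0 < r" "1 \<le> L"
  shows "inj_on (\<lambda>i. restrict (\<lambda>i. of_nat (L * c i)) {..n} i ^ r :: 'k::field_char_0) {..n}"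
proof (rule inj_onI)
  fix i j assume ij: "i \<in> {..n}" "j \<in> {..n}"
    and e: "restrict (\<lambda>i. of_nat (L * c i)) {..n} i ^ r = (restrict (\<lambda>i. of_nat (L * c i)) {..n} j ^ r :: 'k)"
  then have "of_nat ((L * c i) ^ r) = (of_nat ((L * c j) ^ r) :: 'k)" by simp
  then have "(L * c i) ^ r = (L * c j) ^ r" by (simp only: of_nat_eq_iff)
  then have "c i = c j" using assms(2,3) by (simp add: power_eq_iff_eq_base)
  then show "i = j" using assms(1) ij by (auto dest: inj_onD)
qed

section \<open>Rational points on the conic\<close>

lemma conic_points_infinite:
  fixes A :: "nat \<Rightarrow> 'k::field_char_0"
  assumes A: "inj_on A {..2}"
  shows "infinite (rational_points 2 (crv 2 2 A))"
proof -
  define a b where ab: "a = A 2 - A 1" "b = A 0 - A 2"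
  have b0: "b \<noteq> 0" using A by (auto simp: ab dest: inj_onD)
  have c: "A 1 - A 0 = - a - b" by (simp add: ab)
  define \<beta> where "\<beta> u = a + b * of_nat u" for u
  define q where "q u = a + b * of_nat u ^ 2" for u
  \<comment> \<open>The second intersection of the conic with the line through (1,1,1) in direction (1,u,0).\<close>
  define v where "v u i = (if i = 0 then q u - 2 * \<beta> u else if i = 1 then q u - 2 * \<beta> u * of_nat u
    else if i = 2 then q u else 0)" for u and i :: nat
  \<comment> \<open>For \<open>\<beta> u = 0\<close> the line is tangent at (1, 1, 1) and all
    coordinates of \<open>v u\<close> coincide; such u are left out.\<close>
  define S where "S = {u. \<beta> u \<noteq> 0}"
  have "inj \<beta>" by (rule injI) (simp add: \<beta>_def b0)
  then have "finite (\<beta> -` {0})" by (intro finite_vimageI) simp_all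
  moreover have "- S = \<beta> -` {0}" by (auto simp: S_def)
  ultimately have "finite (- S)" by simp
  then have S: "infinite S" by (metis finite_compl infinite_UNIV_nat)
  have vc: "v u \<in> coord_vectors 2" if "u \<in> S" for u
  proof -
    have "v u 0 \<noteq> 0 \<or> v u 2 \<noteq> 0" using that by (auto simp: v_def S_def)
    moreover have "\<forall>i>2. v u i = 0" by (simp add: v_def)
    ultimately show ?thesis unfolding coord_vectors_def by blast
  qed
  have vs: "sol 2 2 A (v u)" for u
  proof -
    have "a * (q - 2 * \<beta>) ^ 2 + b * (q - 2 * \<beta> * t) ^ 2 + (- a - b) * q ^ 2 = 0"
      if "q = a + b * t ^ 2" "\<beta> = a + b * t" for q \<beta> t :: 'k
      using that by Groebner_Basis.algebra
    from this[OF q_def[of u] \<beta>_def[of u]]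
    have "a * v u 0 ^ 2 + b * v u 1 ^ 2 + (- a - b) * v u 2 ^ 2 = 0" by (simp add: v_def)
    then have e: "(A 2 - A 1) * v u 0 ^ 2 + (A 0 - A 2) * v u 1 ^ 2 + (A 1 - A 0) * v u 2 ^ 2 = 0"
      unfolding c[symmetric] unfolding ab .
    show ?thesis unfolding sol_def
    proof
      fix i :: nat assume "i \<in> {2..2}"
      then have "i = 2" by simp
      then show "(A i - A 1) * v u 0 ^ 2 + (A 0 - A i) * v u 1 ^ 2 + (A 1 - A 0) * v u i ^ 2 = 0"
        using e by (simp only:)
    qed
  qed
  have inj: "inj_on (\<lambda>u. pclass 2 (v u)) S"
  proof (rule inj_onI)
    fix u u' assume u: "u \<in> S" "u' \<in> S" and e: "pclass 2 (v u) = pclass 2 (v u')"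
    obtain k where k: "v u' = (\<lambda>i. k * v u i)" using e unfolding pclass_eq_iff[OF vc[OF u(1)] vc[OF u(2)]] by blast
    \<comment> \<open>The direction u is recovered as the quotient of these two differences.\<close>
    have d: "v u 2 - v u 1 = 2 * \<beta> u * of_nat u" "v u 2 - v u 0 = 2 * \<beta> u" for u by (simp_all add: v_def)
    have "(v u' 2 - v u' 1) * (v u 2 - v u 0) = (v u 2 - v u 1) * (v u' 2 - v u' 0)"
      unfolding k by (simp add: algebra_simps)
    then show "u = u'" unfolding d using u by (simp add: S_def)
  qed
  have "(\<lambda>u. pclass 2 (v u)) ` S \<subseteq> rational_points 2 (crv 2 2 A)"
    unfolding rational_points_def using zero_locus_crv_iff vc vs by blast
  moreover have "infinite ((\<lambda>u. pclass 2 (v u)) ` S)" using S inj by (simp add: finite_image_iff)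
  ultimately show ?thesis by (metis finite_subset)
qed

lemma conic:
  fixes A :: "nat \<Rightarrow> 'k::field_char_0"
  assumes A: "inj_on A {..2}" and z: "primitive_root_of_unity 2 (z0 :: 'k)"
  shows "smooth_conic 2 (crv 2 2 A)"
proof -
  interpret kcurve 2 2 A z0 by unfold_locales (use A z in auto)
  have A10: "A 1 \<noteq> A 0" using A by (auto dest: inj_onD)
  have "smooth_curve 2 (crv 2 2 A)" by (rule smooth) (simp add: proj_dimension_def hilbert_polynomial_2_2[OF A10])
  moreover have "crv 2 2 A = {eqn 2 A 2}" by (simp add: crv_def)
  moreover have "eqn 2 A 2 \<noteq> 0"
  proof
    assume "eqn 2 A 2 = 0"
    then have "ev (\<lambda>i. if i = 2 then 1 else 0) (eqn 2 A 2) = 0" by simp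
    then show False using A10 by (simp add: gev_eqn[OF coeff_hom_id])
  qed
  ultimately show ?thesis unfolding smooth_conic_def using eqn_forms[of 2 2 2 A] by auto
qed

theorem theorem4p5:
  fixes r s :: nat
  assumes "number_field TYPE('k::field_char_0)"
    and "\<exists>\<zeta>::'k. primitive_root_of_unity s \<zeta>"
    and "2 \<le> r"
  shows "(s = 2 \<longrightarrow>
            (\<forall>\<alpha> \<in> (U_set r 2 :: (nat \<Rightarrow> 'k) set).
               smooth_conic 2 (X_curve r s 2 \<alpha>) \<and>
               rational_points 2 (X_curve r s 2 \<alpha>) \<noteq> {} \<and>
               infinite (rational_points 2 (X_curve r s 2 \<alpha>)))) \<and>
         (s = 2 \<longrightarrow>
            (\<forall>\<alpha> \<in> (U_set r 3 :: (nat \<Rightarrow> 'k) set). genus_one_curve 3 (X_curve r s 3 \<alpha>)) \<and>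
            infinite (sym_point 3 ` {\<alpha> \<in> (U_set r 3 :: (nat \<Rightarrow> 'k) set).
              \<exists>B0. elliptic_curve 3 (X_curve r s 3 \<alpha>) B0 \<and>
                   1 \<le> mordell_weil_rank 3 (X_curve r s 3 \<alpha>) B0})) \<and>
         (s = 3 \<longrightarrow>
            (\<forall>\<alpha> \<in> (U_set r 2 :: (nat \<Rightarrow> 'k) set). genus_one_curve 2 (X_curve r s 2 \<alpha>)) \<and>
            infinite (sym_point 2 ` {\<alpha> \<in> (U_set r 2 :: (nat \<Rightarrow> 'k) set).
              \<exists>B0. elliptic_curve 2 (X_curve r s 2 \<alpha>) B0 \<and>
                   1 \<le> mordell_weil_rank 2 (X_curve r s 2 \<alpha>) B0}))"
proof -
  obtain z0 :: 'k where z0: "primitive_root_of_unity s z0" using assms(2) by blast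
  have genus: "genus_one_curve n (X_curve r s n \<alpha>)"
    if "n = 2 \<and> s = 3 \<or> n = 3 \<and> s = 2" "\<alpha> \<in> U_set r n" for n and \<alpha> :: "nat \<Rightarrow> 'k"
  proof -
    interpret kcurve n s "\<lambda>i. \<alpha> i ^ r" z0
      by unfold_locales (use that z0 in \<open>auto simp: U_set_iff\<close>)
    show ?thesis unfolding X_curve_crv by (rule genus_one[OF that(1)])
  qed
  \<comment> \<open>The tuples are \<alpha> = L c for L \<ge> 1, so \<alpha>_i^r = \<mu> c_i^r with
    \<mu> = L^r; the rank statement \<open>R\<close> is uniform in \<mu>.\<close>
  have inf: "infinite (sym_point n ` {\<alpha> \<in> (U_set r n :: (nat \<Rightarrow> 'k) set).
      \<exists>B0. elliptic_curve n (X_curve r s n \<alpha>) B0 \<and> 1 \<le> mordell_weil_rank n (X_curve r s n \<alpha>) B0})"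
    if n: "n = 2 \<and> s = 3 \<or> n = 3 \<and> s = 2" and c: "inj_on c {..n}" "c n \<noteq> (0::nat)"
      and R: "\<And>\<alpha> :: nat \<Rightarrow> 'k. \<And>\<mu>. inj_on (\<lambda>i. \<alpha> i ^ r) {..n} \<Longrightarrow> (\<And>i. i \<le> n \<Longrightarrow> \<alpha> i ^ r = \<mu> * of_nat (c i) ^ r) \<Longrightarrow>
        \<exists>B0\<in>rational_points n (crv n s (\<lambda>i. \<alpha> i ^ r)). 1 \<le> mordell_weil_rank n (crv n s (\<lambda>i. \<alpha> i ^ r)) B0"
    for n c
  proof (rule infinite_sym_points[of c])
    show "(\<Sum>i\<le>n. c i) \<noteq> 0" using c(2) by auto
    fix L :: nat assume L: "1 \<le> L"
    define \<alpha> where "\<alpha> = (restrict (\<lambda>i. of_nat (L * c i)) {..n} :: nat \<Rightarrow> 'k)"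
    have inj: "inj_on (\<lambda>i. \<alpha> i ^ r) {..n}" unfolding \<alpha>_def by (rule inj_on_scaled_powers) (use c L assms(3) in auto)
    then have U: "\<alpha> \<in> U_set r n" by (simp add: U_set_iff \<alpha>_def)
    have "\<exists>B0\<in>rational_points n (crv n s (\<lambda>i. \<alpha> i ^ r)). 1 \<le> mordell_weil_rank n (crv n s (\<lambda>i. \<alpha> i ^ r)) B0"
      by (rule R[OF inj, of "of_nat L ^ r"]) (simp add: \<alpha>_def power_mult_distrib)
    then show "restrict (\<lambda>i. of_nat (L * c i)) {..n} \<in> {\<alpha> \<in> (U_set r n :: (nat \<Rightarrow> 'k) set).
      \<exists>B0. elliptic_curve n (X_curve r s n \<alpha>) B0 \<and> 1 \<le> mordell_weil_rank n (X_curve r s n \<alpha>) B0}"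
      using U genus[OF n U] unfolding \<alpha>_def[symmetric] elliptic_curve_def X_curve_crv by blast
  qed
  have swap: "(x ^ i) ^ j = (x ^ j) ^ i" for x :: 'k and i j by (metis power_mult mult.commute)
  have r0: "0 < r" using assms(3) by simp
  show ?thesis
  proof (intro conjI impI ballI)
    fix \<alpha> :: "nat \<Rightarrow> 'k" assume s: "s = 2" and \<alpha>: "\<alpha> \<in> U_set r 2"
    have A: "inj_on (\<lambda>i. \<alpha> i ^ r) {..2}" using \<alpha> by (simp add: U_set_iff)
    show "smooth_conic 2 (X_curve r s 2 \<alpha>)" unfolding X_curve_crv s by (rule conic[OF A z0[unfolded s]])
    show i: "infinite (rational_points 2 (X_curve r s 2 \<alpha>))"
      unfolding X_curve_crv s by (rule conic_points_infinite[OF A])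
    show "rational_points 2 (X_curve r s 2 \<alpha>) \<noteq> {}" using i by (metis finite.emptyI)
  next
    assume s: "s = 2"
    let ?c = "\<lambda>i::nat. if i = 0 then 0 else if i = 1 then 1 else if i = 2 then 9 else 25 :: nat"
    show "infinite (sym_point 3 ` {\<alpha> \<in> (U_set r 3 :: (nat \<Rightarrow> 'k) set).
      \<exists>B0. elliptic_curve 3 (X_curve r s 3 \<alpha>) B0 \<and> 1 \<le> mordell_weil_rank 3 (X_curve r s 3 \<alpha>) B0})"
    proof (rule inf[of 3 ?c])
      show "inj_on ?c {..3}"
      proof (rule inj_onI)
        fix i j assume a: "i \<in> {..3::nat}" "j \<in> {..3::nat}" and e: "?c i = ?c j"
        from a have "i = 0 \<or> i = 1 \<or> i = 2 \<or> i = 3" "j = 0 \<or> j = 1 \<or> j = 2 \<or> j = 3" by auto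
        then show "i = j" using e by (elim disjE) simp_all
      qed
      fix \<alpha> :: "nat \<Rightarrow> 'k" and \<mu>
      assume inj: "inj_on (\<lambda>i. \<alpha> i ^ r) {..3}" and a: "\<And>i. i \<le> 3 \<Longrightarrow> \<alpha> i ^ r = \<mu> * of_nat (?c i) ^ r"
      have sq: "(3 :: 'k) ^ 2 = 9" "(5 :: 'k) ^ 2 = 25" by simp_all
      have pow: "of_int (3 ^ r) ^ 2 = (9 :: 'k) ^ r" "of_int (5 ^ r) ^ 2 = (25 :: 'k) ^ r"
        by (simp_all only: of_int_power of_int_numeral swap[of _ r 2] sq)
      have "\<alpha> 0 ^ r = 0" "\<alpha> 1 ^ r = \<mu>" using a[of 0] a[of 1] r0 by simp_all
      moreover have "\<alpha> 2 ^ r = \<mu> * of_int (3 ^ r) ^ 2" unfolding pow using a[of 2] by simp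
      moreover have "\<alpha> 3 ^ r = \<mu> * of_int (5 ^ r) ^ 2" unfolding pow using a[of 3] by simp
      ultimately show "\<exists>B0\<in>rational_points 3 (crv 3 s (\<lambda>i. \<alpha> i ^ r)). 1 \<le> mordell_weil_rank 3 (crv 3 s (\<lambda>i. \<alpha> i ^ r)) B0"
        unfolding s by (rule quartic_rank[OF _ _ _ _ inj _ _ z0[unfolded s]]) simp_all
    qed (use s in simp_all)
  next
    assume s: "s = 3"
    let ?c = "\<lambda>i::nat. if i = 0 then 0 else if i = 1 then 1 else 8 :: nat"
    show "infinite (sym_point 2 ` {\<alpha> \<in> (U_set r 2 :: (nat \<Rightarrow> 'k) set).
      \<exists>B0. elliptic_curve 2 (X_curve r s 2 \<alpha>) B0 \<and> 1 \<le> mordell_weil_rank 2 (X_curve r s 2 \<alpha>) B0})"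
    proof (rule inf[of 2 ?c])
      show "inj_on ?c {..2}"
      proof (rule inj_onI)
        fix i j assume a: "i \<in> {..2::nat}" "j \<in> {..2::nat}" and e: "?c i = ?c j"
        from a have "i = 0 \<or> i = 1 \<or> i = 2" "j = 0 \<or> j = 1 \<or> j = 2" by auto
        then show "i = j" using e by (elim disjE) simp_all
      qed
      fix \<alpha> :: "nat \<Rightarrow> 'k" and \<mu>
      assume inj: "inj_on (\<lambda>i. \<alpha> i ^ r) {..2}" and a: "\<And>i. i \<le> 2 \<Longrightarrow> \<alpha> i ^ r = \<mu> * of_nat (?c i) ^ r"
      have cube: "(2 :: 'k) ^ 3 = 8" by simp
      have pow: "of_int (2 ^ r) ^ 3 = (8 :: 'k) ^ r"
        by (simp only: of_int_power of_int_numeral swap[of _ r 3] cube)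
      have "\<alpha> 0 ^ r = 0" "\<alpha> 1 ^ r = \<mu>" using a[of 0] a[of 1] r0 by simp_all
      moreover have "\<alpha> 2 ^ r = \<mu> * of_int (2 ^ r) ^ 3" unfolding pow using a[of 2] by simp
      ultimately show "\<exists>B0\<in>rational_points 2 (crv 2 s (\<lambda>i. \<alpha> i ^ r)). 1 \<le> mordell_weil_rank 2 (crv 2 s (\<lambda>i. \<alpha> i ^ r)) B0"
        unfolding s by (rule cubic_rank[OF _ _ _ inj _ _ z0[unfolded s]]) (use r0 in simp_all)
    qed (use s in simp_all)
  qed (use genus in auto)
qed

end
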